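(* Let $z_0>0$, let $\mathcal{P}$ be the regular octagon translation surface, let $\mathcal{I}=[0,2z_0]$ be treated as a torus (the endpoints $0$ and $2z_0$ are identified), and let $\mathcal{M}=\mathcal{P}\times\mathcal{I}$ be the corresponding rational octagonal right prism translation $3$-manifold. Then for almost every pair consisting of a direction $\mathbf{v}$ (a unit vector in $\mathbb{R}^3$) and a starting point $S_0\in\mathcal{M}$, the half-infinite geodesic in $\mathcal{M}$ with starting point $S_0$ and direction $\mathbf{v}$ is uniformly distributed in $\mathcal{M}$.
   Context: The regular octagon translation surface $\mathcal{P}$ is the flat surface obtained from a regular octagon (with its interior) in the plane by identifying each pair of parallel edges via translation. Its only singularity is the point coming from the vertices of the octagon. For a unit vector $\mathbf{v}=(v_1,v_2,v_3)$ and a point $S_0=(s_1,s_2,s_3)\in\mathcal{M}$, with $(s_1,s_2)\in\mathcal{P}$ and $s_3\in\mathcal{I}$, the half-infinite geodesic with starting point $S_0$ and direction $\mathbf{v}$ is the path $$\mathcal{L}_{S_0,\mathbf{v}}(t)=(s_1+v_1t,\,s_2+v_2t,\,s_3+v_3t),\quad t\ge0,$$ where the first two coordinates are taken modulo $\mathcal{P}$ (that is, they follow the straight-line flow on $\mathcal{P}$ through the edge identifications by translation) and the third coordinate is taken modulo $\mathcal{I}$ (that is, modulo $2z_0$). The geodesic is not continued if its projection to $\mathcal{P}$ hits the singularity of $\mathcal{P}$; for almost every pair $(\mathbf{v},S_0)$ it is defined for all $t\ge0$. "Almost every pair" is with respect to the product of the surface measure on the unit sphere of directions in $\mathbb{R}^3$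 and the $3$-dimensional Lebesgue measure on $\mathcal{M}$. A half-infinite geodesic $\mathcal{L}(t)$, $t\ge0$, is uniformly distributed in $\mathcal{M}$ (in the classical Weyl sense) if for every Jordan measurable set $A\subset\mathcal{M}$, $$\lim_{T\to\infty}\frac{1}{T}\operatorname{meas}\{t\in[0,T]:\mathcal{L}(t)\in A\}=\frac{\operatorname{vol}(A)}{\operatorname{vol}(\mathcal{M})},$$ where $\operatorname{meas}$ is $1$-dimensional Lebesgue measure and $\operatorname{vol}$ is $3$-dimensional Lebesgue measure. *)

theory Defs
  imports "HOL-Analysis.Analysis"
begin

text \<open>
  The plane is \<^typ>\<open>complex\<close> and three-dimensional Euclidean space is \<^typ>\<open>complex \<times> real\<close>,
  whose norm, inner product and Lebesgue measure are the Euclidean ones.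
\<close>

section \<open>The regular octagon translation surface\<close>

text \<open>
  An arbitrary regular octagon is given by its centre \<open>c\<close> and the vector \<open>w \<noteq> 0\<close> from the centre
  to one of the vertices. Vertices and edges are indexed by natural numbers modulo 8.
\<close>

definition octagon_vertex :: "complex \<Rightarrow> complex \<Rightarrow> nat \<Rightarrow> complex" where
  "octagon_vertex c w k = c + w * cis (real k * pi / 4)"

definition octagon :: "complex \<Rightarrow> complex \<Rightarrow> complex set" where
  "octagon c w = convex hull (octagon_vertex c w ` {..<8})"

definition octagon_edge :: "complex \<Rightarrow> complex \<Rightarrow> nat \<Rightarrow> complex set" where
  "octagon_edge c w k = closed_segment (octagon_vertex c w k) (octagon_vertex c w (k + 1))"

text \<open>
  The translation taking edge \<open>k\<close> to the parallel edge \<open>k + 4\<close> sends vertex \<open>k\<close> to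
  vertex \<open>k + 5\<close> and vertex \<open>k + 1\<close> to vertex \<open>k + 4\<close>.
\<close>

definition octagon_glue :: "complex \<Rightarrow> complex \<Rightarrow> (complex \<times> complex) set" where
  "octagon_glue c w =
     {(x, y). \<exists>k<8. x \<in> octagon_edge c w k \<and>
                    y = x + (octagon_vertex c w (k + 5) - octagon_vertex c w k)}"

definition octagon_rel :: "complex \<Rightarrow> complex \<Rightarrow> (complex \<times> complex) set" where
  "octagon_rel c w = (octagon_glue c w)\<^sup>* \<inter> octagon c w \<times> octagon c w"

definition octagon_surface :: "complex \<Rightarrow> complex \<Rightarrow> complex set set" where
  "octagon_surface c w = octagon c w // octagon_rel c w"

text \<open>All eight vertices are identified with each other.\<close>

definition octagon_singularity :: "complex \<Rightarrow> complex \<Rightarrow> complex set" where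
  "octagon_singularity c w = octagon_rel c w `` {octagon_vertex c w 0}"

lemma octagon_vertex_add_4: "octagon_vertex c w (k + 4) = 2 * c - octagon_vertex c w k"
proof -
  have "cis (real (k + 4) * pi / 4) = cis (real k * pi / 4) * cis pi"
    unfolding cis_mult by (simp add: field_simps)
  then show ?thesis by (simp add: octagon_vertex_def)
qed

lemma octagon_vertex_add_8: "octagon_vertex c w (k + 8) = octagon_vertex c w k"
  using octagon_vertex_add_4[of c w "k + 4"] octagon_vertex_add_4[of c w k] by (simp add: add.commute)

lemma octagon_edge_add_8: "octagon_edge c w (k + 8) = octagon_edge c w k"
  using octagon_vertex_add_8[of c w k] octagon_vertex_add_8[of c w "k + 1"]
  by (simp add: octagon_edge_def)

lemma octagon_edge_translate:
  "(\<lambda>x. x + (octagon_vertex c w (k + 5) - octagon_vertex c w k)) ` octagon_edge c w k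
     = octagon_edge c w (k + 4)"
proof -
  let ?v = "octagon_vertex c w"
  let ?d = "?v (k + 5) - ?v k"
  have v5: "?v (k + 5) = 2 * c - ?v (k + 1)"
    using octagon_vertex_add_4[of c w "k + 1"] by (simp add: add.commute)
  have "k + 4 + 1 = k + 5" by simp
  then have "?d + ?v k = ?v (k + 4 + 1)" by (simp only: diff_add_cancel)
  moreover have "?d + ?v (k + 1) = ?v (k + 4)"
    unfolding v5 octagon_vertex_add_4 by simp
  moreover have "(\<lambda>x. x + ?d) ` octagon_edge c w k = closed_segment (?d + ?v k) (?d + ?v (k + 1))"
    unfolding octagon_edge_def closed_segment_translation by (rule image_cong[OF refl add.commute])
  ultimately show ?thesis
    by (simp only: octagon_edge_def closed_segment_commute)
qed

lemma sym_octagon_glue: "sym (octagon_glue c w)"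
proof (rule symI)
  fix x y assume "(x, y) \<in> octagon_glue c w"
  then obtain k where k: "k < 8" and x: "x \<in> octagon_edge c w k"
    and y: "y = x + (octagon_vertex c w (k + 5) - octagon_vertex c w k)"
    by (auto simp: octagon_glue_def)
  define j where "j = (if k < 4 then k + 4 else k - 4)"
  have jk: "j + 8 = k + 4 \<or> j = k + 4" "j < 8" using k by (auto simp: j_def)
  have per: "octagon_vertex c w j = octagon_vertex c w (k + 4)"
    "octagon_edge c w j = octagon_edge c w (k + 4)"
    using jk(1) octagon_vertex_add_8[of c w j] octagon_edge_add_8[of c w j] by metis+
  have "j + 5 + 8 = k + 9 \<or> j + 5 = k + 9" using jk(1) by auto
  then have per5: "octagon_vertex c w (j + 5) = octagon_vertex c w (k + 9)"
    using octagon_vertex_add_8[of c w "j + 5"] by metis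
  have "y \<in> octagon_edge c w j"
    using x y octagon_edge_translate[of c w k] per(2) by blast
  moreover have "octagon_vertex c w (k + 9) = octagon_vertex c w (k + 1)"
    using octagon_vertex_add_8[of c w "k + 1"] by (simp add: add.commute)
  moreover have "octagon_vertex c w (k + 5) = 2 * c - octagon_vertex c w (k + 1)"
    using octagon_vertex_add_4[of c w "k + 1"] by (simp add: add.commute)
  ultimately have "y \<in> octagon_edge c w j \<and>
      x = y + (octagon_vertex c w (j + 5) - octagon_vertex c w j)"
    unfolding y per(1) per5 octagon_vertex_add_4 by simp
  then show "(y, x) \<in> octagon_glue c w"
    using jk(2) unfolding octagon_glue_def by blast
qed

lemma equiv_octagon_rel: "equiv (octagon c w) (octagon_rel c w)"
proof (rule equivI)
  show "octagon_rel c w \<subseteq> octagon c w \<times> octagon c w" "refl_on (octagon c w) (octagon_rel c w)"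
    by (auto simp: octagon_rel_def refl_on_def)
  show "sym (octagon_rel c w)"
    using sym_rtrancl[OF sym_octagon_glue, of c w] by (auto simp: octagon_rel_def sym_def)
  show "trans (octagon_rel c w)"
    unfolding octagon_rel_def by (rule transI) auto
qed


section \<open>The translation 3-manifold\<close>

text \<open>
  The interval \<open>[0, 2 z0]\<close> with its endpoints identified: the class of a real number consists of
  its representatives modulo \<open>2 z0\<close> in the interval.
\<close>

definition circle_class :: "real \<Rightarrow> real \<Rightarrow> real set" where
  "circle_class z0 s = {s' \<in> {0..2 * z0}. \<exists>n::int. s' = s + 2 * z0 * of_int n}"

definition circle :: "real \<Rightarrow> real set set" where
  "circle z0 = circle_class z0 ` {0..2 * z0}"

definition octagon_manifold :: "complex \<Rightarrow> complex \<Rightarrow> real \<Rightarrow> (complex set \<times> real set) set" where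
  "octagon_manifold c w z0 = octagon_surface c w \<times> circle z0"

definition octagon_prism :: "complex \<Rightarrow> complex \<Rightarrow> real \<Rightarrow> (complex \<times> real) set" where
  "octagon_prism c w z0 = octagon c w \<times> {0..2 * z0}"

definition prism_proj ::
  "complex \<Rightarrow> complex \<Rightarrow> real \<Rightarrow> complex \<times> real \<Rightarrow> complex set \<times> real set" where
  "prism_proj c w z0 p = (octagon_rel c w `` {fst p}, circle_class z0 (snd p))"

text \<open>
  All points of the closed prism that represent a point of \<open>A\<close>. Since the boundary of the prism is
  a null set, volume and Jordan measurability in the manifold are those of this set.
\<close>

definition prism_reps ::
  "complex \<Rightarrow> complex \<Rightarrow> real \<Rightarrow> (complex set \<times> real set) set \<Rightarrow> (complex \<times> real) set" where
  "prism_reps c w z0 A = {p \<in> octagon_prism c w z0. prism_proj c w z0 p \<in> A}"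

definition manifold_vol ::
  "complex \<Rightarrow> complex \<Rightarrow> real \<Rightarrow> (complex set \<times> real set) set \<Rightarrow> real" where
  "manifold_vol c w z0 A = measure lebesgue (prism_reps c w z0 A)"

definition jordan_measurable :: "'a::euclidean_space set \<Rightarrow> bool" where
  "jordan_measurable A \<longleftrightarrow> bounded A \<and> negligible (frontier A)"

definition manifold_jordan_measurable ::
  "complex \<Rightarrow> complex \<Rightarrow> real \<Rightarrow> (complex set \<times> real set) set \<Rightarrow> bool" where
  "manifold_jordan_measurable c w z0 A \<longleftrightarrow>
     A \<subseteq> octagon_manifold c w z0 \<and> jordan_measurable (prism_reps c w z0 A)"

lemma prism_proj_image: "prism_proj c w z0 ` octagon_prism c w z0 = octagon_manifold c w z0"
  by (force simp: prism_proj_def octagon_prism_def octagon_manifold_def octagon_surface_def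
      circle_def quotient_def image_iff)

lemma prism_reps_manifold: "prism_reps c w z0 (octagon_manifold c w z0) = octagon_prism c w z0"
  using prism_proj_image by (fastforce simp: prism_reps_def)


section \<open>Geodesics and uniform distribution\<close>

text \<open>
  \<open>g\<close> moves with constant velocity \<open>u\<close>, starting at the point represented by \<open>x\<close> and never meeting
  the singularity: just after and just before each time \<open>t\<close> it is a straight segment in the octagon
  through some representative \<open>y\<close> of \<open>g t\<close>. The two representatives differ when an edge is crossed.
\<close>

definition straight_flow ::
  "complex \<Rightarrow> complex \<Rightarrow> complex \<Rightarrow> complex \<Rightarrow> (real \<Rightarrow> complex set) \<Rightarrow> bool" where
  "straight_flow c w u x g \<longleftrightarrow>
     g 0 = octagon_rel c w `` {x} \<and>
     (\<forall>t\<ge>0. g t \<in> octagon_surface c w \<and> g t \<noteq> octagon_singularity c w \<and>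
        (\<exists>e>0. \<exists>y\<in>g t. \<forall>s. t \<le> s \<and> s < t + e \<longrightarrow> y + (s - t) *\<^sub>R u \<in> g s) \<and>
        (\<exists>e>0. \<exists>y\<in>g t. \<forall>s\<ge>0. t - e < s \<and> s \<le> t \<longrightarrow> y + (s - t) *\<^sub>R u \<in> g s))"

definition half_infinite_geodesic ::
  "complex \<Rightarrow> complex \<Rightarrow> real \<Rightarrow> complex \<times> real \<Rightarrow> complex \<times> real \<Rightarrow>
     (real \<Rightarrow> complex set \<times> real set) \<Rightarrow> bool" where
  "half_infinite_geodesic c w z0 S v L \<longleftrightarrow>
     (\<exists>g. straight_flow c w (fst v) (fst S) g \<and>
          (\<forall>t\<ge>0. L t = (g t, circle_class z0 (snd S + snd v * t))))"

text \<open>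
  Jordan measurable sets need not be Borel, so for some of them the set of visiting times is not
  Lebesgue measurable (a subset of the geodesic itself may be added to \<open>A\<close>). Outer Lebesgue
  measure, which agrees with Lebesgue measure on measurable sets, is therefore used; a plain
  \<^const>\<open>measure\<close> would return 0 on non-measurable sets.
\<close>

definition uniformly_distributed ::
  "complex \<Rightarrow> complex \<Rightarrow> real \<Rightarrow> (real \<Rightarrow> complex set \<times> real set) \<Rightarrow> bool" where
  "uniformly_distributed c w z0 L \<longleftrightarrow>
     (\<forall>A. manifold_jordan_measurable c w z0 A \<longrightarrow>
        ((\<lambda>T. 1 / T * enn2real (outer_measure_of lebesgue {t \<in> {0..T}. L t \<in> A})) \<longlongrightarrow>
           manifold_vol c w z0 A / manifold_vol c w z0 (octagon_manifold c w z0)) at_top)"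


section \<open>Surface measure on the unit sphere\<close>

text \<open>
  The surface measure of \<open>A\<close> is the dimension times the volume of the cone over \<open>A\<close> in the unit
  ball; \<^const>\<open>sgn\<close> is radial projection.
\<close>

definition sphere_measure :: "'a::euclidean_space measure" where
  "sphere_measure = scale_measure (of_nat DIM('a))
     (distr (restrict_space lborel (ball 0 1 - {0})) (restrict_space borel (sphere 0 1)) sgn)"

lemma emeasure_sphere_measure:
  fixes A :: "'a::euclidean_space set"
  assumes "A \<in> sets borel" "A \<subseteq> sphere 0 1"
  shows "emeasure sphere_measure A =
           of_nat DIM('a) * emeasure lborel {x \<in> ball 0 1 - {0}. sgn x \<in> A}"
proof -
  let ?B = "ball 0 1 - {0} :: 'a set"
  have meas: "sgn \<in> restrict_space lborel ?B \<rightarrow>\<^sub>M restrict_space borel (sphere 0 1 :: 'a set)"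
    by (intro measurable_restrict_space2 measurable_restrict_space1)
       (auto simp: space_restrict_space norm_sgn)
  have "A \<in> sets (restrict_space borel (sphere 0 1))"
    using assms by (simp add: sets_restrict_space_iff)
  moreover have "sgn -` A \<inter> ?B = {x \<in> ?B. sgn x \<in> A}" by auto
  moreover have "emeasure (restrict_space lborel ?B) {x \<in> ?B. sgn x \<in> A} =
      emeasure lborel {x \<in> ?B. sgn x \<in> A}"
    by (rule emeasure_restrict_space) auto
  ultimately show ?thesis
    unfolding sphere_measure_def emeasure_scale_measure
    using emeasure_distr[OF meas, of A] by (simp only: space_restrict_space space_lborel space_borel Int_UNIV_right)
qed

end

theory Submission
  imports Defs
begin

text \<open>
  After a similarity the octagon has centre \<open>0\<close> and vertex \<open>1\<close>. Let \<open>v = (u, s)\<close>. The planar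
  component of a geodesic is the flow in direction \<open>u\<close> on the octagon surface, the vertical one is the rotation
  \<open>z + s t\<close> modulo \<open>2 z0\<close>.

  Vertical component: for a mean zero periodic function \<open>\<psi>\<close> the correlations of
  \<open>\<psi> (z + s t)\<close> and \<open>\<psi> (z + s t')\<close> over \<open>(s, z)\<close> are \<open>O(1 / \<bar>t - t'\<bar>)\<close>. Hence, whatever the planar
  orbit is, the average of \<open>h t * \<psi> (z + s t)\<close> tends to \<open>0\<close> for almost all \<open>(s, z)\<close> and each
  bounded \<open>h\<close>. It remains to show that almost every planar direction is ergodic.

  Planar component: the horizontal cylinders of the surface have equal moduli, so the corresponding parabolic
  shear is an affine automorphism, as are the dihedral symmetries of the octagon. For \<open>u\<close> outside a null set
  there are automorphisms whose linear part maps a unit vector \<open>p\<close> to a multiple of \<open>u\<close> and contracts a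
  unit vector \<open>q\<close> arbitrarily much, with the angle between \<open>p\<close> and \<open>q\<close> bounded below. An
  invariant set of the flow, pulled back by them, is almost invariant under all small translations of the octagon and
  therefore null or of full measure (Masur's criterion in its simplest form). The set where the limsup of the averages
  is large is invariant, and a covering argument shows that it is null.

  Half-open dyadic cells pass from product sets to Jordan measurable sets. Typical pairs are invariant under positive scaling
  of \<open>v\<close>, so null sets of directions in \<open>\<real>\<^sup>3\<close> give null sets on the sphere.
\<close>

text \<open>The renormalisation of a direction can stall near two parabolic directions: near the
  horizontal, where the shear has to be repeated, and near the angle \<open>pi / 8\<close>, where
  the shear followed by a rotation is parabolic as well. Each run is finite for an unexceptional
  direction, but single steps may shorten the vector by very little and may align the contracted and
  the expanded direction. For this reason a second vector is carried along and only the ends of runs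
  are recorded. The planar flow and the vertical rotation are never combined into one ergodic
  system. For a fixed planar orbit the visits to a planar cell form a bounded weight, and the null
  set of slopes and heights may depend on that orbit; Fubini and the countability of the cells
  assemble the result. Points of the surface are classes of points of the octagon, and all maps are
  given on representatives. They jump at the edges, but differ from a linear map by countably many
  translations; with injectivity off a null set this yields preservation of area. The explicit
  choice of representatives keeps everything measurable.\<close>

abbreviation oct :: "complex set" where "oct \<equiv> octagon 0 1"
abbreviation rel :: "(complex \<times> complex) set" where "rel \<equiv> octagon_rel 0 1"
abbreviation vtx :: "nat \<Rightarrow> complex" where "vtx \<equiv> octagon_vertex 0 1"

section \<open>The regular octagon in coordinates\<close>

lemma sqrt2: "sqrt 2 * sqrt 2 = (2::real)" "sqrt 2 > (1.414::real)" "sqrt 2 < (1.415::real)"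
  by (simp, (rule real_less_rsqrt real_less_lsqrt; simp add: power2_eq_square)+)

lemma sqrt2_mult: "sqrt 2 * (sqrt 2 * x) = 2 * (x::real)"
  by (simp flip: mult.assoc)

lemma vtx_eq: "vtx k = cis (real k * pi / 4)"
  by (simp add: octagon_vertex_def)

lemma norm_vtx [simp]: "norm (vtx k) = 1"
  by (simp add: vtx_eq)

lemma vtx_values:
  "vtx 0 = Complex 1 0" "vtx 1 = Complex (sqrt 2 / 2) (sqrt 2 / 2)"
  "vtx 2 = Complex 0 1" "vtx 3 = Complex (- sqrt 2 / 2) (sqrt 2 / 2)"
  "vtx 4 = Complex (-1) 0" "vtx 5 = Complex (- sqrt 2 / 2) (- sqrt 2 / 2)"
  "vtx 6 = Complex 0 (-1)" "vtx 7 = Complex (sqrt 2 / 2) (- sqrt 2 / 2)"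
proof -
  show 0: "vtx 0 = Complex 1 0" by (simp add: vtx_eq complex_eq_iff)
  show 1: "vtx 1 = Complex (sqrt 2 / 2) (sqrt 2 / 2)"
    by (simp add: vtx_eq complex_eq_iff cos_45 sin_45)
  have r: "2 * pi / 4 = pi / 2" "3 * pi / 4 = pi - pi / 4" by simp_all
  show 2: "vtx 2 = Complex 0 1" by (simp add: vtx_eq complex_eq_iff r)
  have "cos (3 * pi / 4) = - sqrt 2 / 2" "sin (3 * pi / 4) = sqrt 2 / 2"
    unfolding r cos_pi_minus sin_pi_minus by (simp_all add: cos_45 sin_45)
  then show 3: "vtx 3 = Complex (- sqrt 2 / 2) (sqrt 2 / 2)"
    by (simp add: vtx_eq complex_eq_iff)
  have 4: "vtx (k + 4) = - vtx k" for k using octagon_vertex_add_4[of 0 1 k] by simp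
  show "vtx 4 = Complex (-1) 0" "vtx 5 = Complex (- sqrt 2 / 2) (- sqrt 2 / 2)"
    "vtx 6 = Complex 0 (-1)" "vtx 7 = Complex (sqrt 2 / 2) (- sqrt 2 / 2)"
    using 4[of 0] 4[of 1] 4[of 2] 4[of 3] 0 1 2 3 by (simp_all add: complex_eq_iff)
qed

text \<open>The inequalities cut out a convex set containing the vertices, which gives one
  inclusion. Conversely, in its octant a point is a combination of the origin, one axis vertex and
  one diagonal vertex, and one of the inequalities says that the two weights sum to at most
  1.\<close>

lemma oct_iff: "z \<in> oct \<longleftrightarrow> \<bar>Re z\<bar> + (sqrt 2 - 1) * \<bar>Im z\<bar> \<le> 1 \<and> (sqrt 2 - 1) * \<bar>Re z\<bar> + \<bar>Im z\<bar> \<le> 1"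
proof -
  define K where "K = {z. \<bar>Re z\<bar> + (sqrt 2 - 1) * \<bar>Im z\<bar> \<le> 1 \<and> (sqrt 2 - 1) * \<bar>Re z\<bar> + \<bar>Im z\<bar> \<le> 1}"
  have vs: "vtx ` {..<8} = {vtx 0, vtx 1, vtx 2, vtx 3, vtx 4, vtx 5, vtx 6, vtx 7}"
    by (auto simp: lessThan_nat_numeral lessThan_Suc)
  have ineq: "\<bar>(1 - t) * a + t * b\<bar> + s * \<bar>(1 - t) * a' + t * b'\<bar> \<le> 1"
    if "0 \<le> t" "t \<le> 1" "0 \<le> s" "\<bar>a\<bar> + s * \<bar>a'\<bar> \<le> 1" "\<bar>b\<bar> + s * \<bar>b'\<bar> \<le> 1" for t a b s a' b' :: real
  proof -
    have "\<bar>(1 - t) * a + t * b\<bar> \<le> (1 - t) * \<bar>a\<bar> + t * \<bar>b\<bar>"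
      using that abs_triangle_ineq[of "(1-t)*a" "t*b"] by (simp add: abs_mult)
    moreover have "\<bar>(1 - t) * a' + t * b'\<bar> \<le> (1 - t) * \<bar>a'\<bar> + t * \<bar>b'\<bar>"
      using that abs_triangle_ineq[of "(1-t)*a'" "t*b'"] by (simp add: abs_mult)
    then have "s * \<bar>(1 - t) * a' + t * b'\<bar> \<le> s * ((1 - t) * \<bar>a'\<bar> + t * \<bar>b'\<bar>)"
      using that by (intro mult_left_mono) auto
    moreover have "(1 - t) * (\<bar>a\<bar> + s * \<bar>a'\<bar>) + t * (\<bar>b\<bar> + s * \<bar>b'\<bar>) \<le> (1 - t) * 1 + t * 1"
      using that by (intro add_mono mult_left_mono) auto
    ultimately show ?thesis by (simp add: algebra_simps)
  qed
  have "convex K"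
    unfolding convex_alt K_def using ineq[where s = "sqrt 2 - 1"] sqrt2
    by (simp add: add.commute[of "_ * \<bar>Re _\<bar>"] add.commute[of "_ * \<bar>_ + _ * Re _\<bar>"])
  moreover have "vtx ` {..<8} \<subseteq> K"
    unfolding vs vtx_values K_def using sqrt2 by (auto simp: algebra_simps)
  ultimately have 1: "oct \<subseteq> K" unfolding octagon_def by (intro hull_minimal)
  have "z \<in> oct" if "z \<in> K" for z
  proof -
    have v: "vtx k \<in> oct" if "k < 8" for k
      unfolding octagon_def using that by (intro hull_inc) auto
    have conv: "convex oct" by (simp add: octagon_def)
    have "vtx 4 = - vtx 0" using vtx_values by (simp add: complex_eq_iff)
    then have 0: "0 \<in> oct"
      using convexD[OF conv v[of 0] v[of 4], of "1/2" "1/2"] by simp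
    have comb: "a *\<^sub>R x + b *\<^sub>R y \<in> oct" if "x \<in> oct" "y \<in> oct" "0 \<le> a" "0 \<le> b" "a + b \<le> 1" for a b x y
    proof (cases "a = 0 \<and> b = 0")
      case False
      then have False: "a + b \<noteq> 0" using that by linarith
      have "(a / (a + b)) *\<^sub>R x + (b / (a + b)) *\<^sub>R y \<in> oct"
        using that False by (intro convexD[OF conv]) (auto simp flip: add_divide_distrib)
      from convexD[OF conv this 0, of "a + b" "1 - (a + b)"] that False show ?thesis
        by (simp add: scaleR_add_right)
    qed (use that 0 in auto)
    have *: "\<exists>j<8. vtx j = Complex (s * sqrt 2 / 2) (t * sqrt 2 / 2)" "\<exists>i<8. vtx i = Complex s 0" "\<exists>i<8. vtx i = Complex 0 s"
      if "s = 1 \<or> s = -1" "t = 1 \<or> t = -1" for s t :: real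
    proof -
      have v1: "vtx (Suc 0) = Complex (sqrt 2 / 2) (sqrt 2 / 2)" using vtx_values(2) by simp
      show "\<exists>j<8. vtx j = Complex (s * sqrt 2 / 2) (t * sqrt 2 / 2)"
        using that by (elim disjE; simp) (intro exI[of _ 1] exI[of _ 7] exI[of _ 3] exI[of _ 5]; simp add: vtx_values v1)+
      show "\<exists>i<8. vtx i = Complex s 0"
        using that(1) by (elim disjE; simp) (intro exI[of _ 0] exI[of _ 4]; simp add: vtx_values)+
      show "\<exists>i<8. vtx i = Complex 0 s"
        using that(1) by (elim disjE; simp) (intro exI[of _ 2] exI[of _ 6]; simp add: vtx_values)+
    qed
    define s t where "s = (if Re z \<ge> 0 then 1 else -1 :: real)" and "t = (if Im z \<ge> 0 then 1 else -1 :: real)"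
    have st: "s = 1 \<or> s = -1" "t = 1 \<or> t = -1" by (auto simp: s_def t_def)
    obtain j where j: "j < 8" "vtx j = Complex (s * sqrt 2 / 2) (t * sqrt 2 / 2)" using *(1)[OF st] by blast
    show ?thesis
    proof (cases "\<bar>Im z\<bar> \<le> \<bar>Re z\<bar>")
      case True
      obtain i where i: "i < 8" "vtx i = Complex s 0" using *(2)[OF st] by blast
      have "z = (\<bar>Re z\<bar> - \<bar>Im z\<bar>) *\<^sub>R vtx i + (sqrt 2 * \<bar>Im z\<bar>) *\<^sub>R vtx j"
        unfolding i j by (auto simp: complex_eq_iff s_def t_def algebra_simps sqrt2_mult)
      moreover have "\<dots> \<in> oct" using True \<open>z \<in> K\<close> i j
        by (intro comb v) (auto simp: K_def algebra_simps)
      ultimately show ?thesis by simp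
    next
      case False
      obtain i where i: "i < 8" "vtx i = Complex 0 t" using *(3)[OF st(2) st(2)] by blast
      have "z = (\<bar>Im z\<bar> - \<bar>Re z\<bar>) *\<^sub>R vtx i + (sqrt 2 * \<bar>Re z\<bar>) *\<^sub>R vtx j"
        unfolding i j by (auto simp: complex_eq_iff s_def t_def algebra_simps sqrt2_mult)
      moreover have "\<dots> \<in> oct" using False \<open>z \<in> K\<close> i j
        by (intro comb v) (auto simp: K_def algebra_simps)
      ultimately show ?thesis by simp
    qed
  qed
  with 1 have "oct = K" by auto
  then show ?thesis by (simp add: K_def)
qed

lemma convex_oct: "convex oct" and compact_oct: "compact oct" and closed_oct: "closed oct"
  and bounded_oct: "bounded oct"
proof -
  show "convex oct" by (simp add: octagon_def)
  show "compact oct" unfolding octagon_def by (intro finite_imp_compact_convex_hull) auto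
  then show "closed oct" "bounded oct" by (auto intro: compact_imp_closed compact_imp_bounded)
qed

lemma uminus_oct: "z \<in> oct \<Longrightarrow> - z \<in> oct" and cnj_oct: "z \<in> oct \<Longrightarrow> cnj z \<in> oct"
  by (auto simp: oct_iff)

lemma uminus_oct_iff: "- z \<in> oct \<longleftrightarrow> z \<in> oct"
  using uminus_oct[of z] uminus_oct[of "-z"] by auto

section \<open>The gluing relation\<close>

definition D :: "complex set" where "D = (\<lambda>k. vtx (k + 5) - vtx k) ` {..<8}"

lemma vtx_add_4: "vtx (k + 4) = - vtx k"
  using octagon_vertex_add_4[of 0 1 k] by simp

lemma vtx_add_5: "vtx (k + 5) = - vtx (k + 1)"
  using vtx_add_4[of "k + 1"] by (simp add: add.commute)

lemma D_eq: "D = {d. (\<bar>Re d\<bar> = 1 + sqrt 2 / 2 \<and> \<bar>Im d\<bar> = sqrt 2 / 2) \<or> (\<bar>Re d\<bar> = sqrt 2 / 2 \<and> \<bar>Im d\<bar> = 1 + sqrt 2 / 2)}"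
  (is "_ = ?R")
proof -
  have s: "vtx 8 = vtx 0" "vtx 9 = vtx 1" "vtx 10 = vtx 2" "vtx 11 = vtx 3" "vtx 12 = vtx 4"
    using octagon_vertex_add_8[of 0 1 0] octagon_vertex_add_8[of 0 1 1] octagon_vertex_add_8[of 0 1 2]
      octagon_vertex_add_8[of 0 1 3] octagon_vertex_add_8[of 0 1 4] by simp_all
  have v1: "vtx (Suc 0) = Complex (sqrt 2 / 2) (sqrt 2 / 2)" using vtx_values(2) by simp
  have D: "D = {Complex (- sqrt 2 / 2 - 1) (- sqrt 2 / 2), Complex (- sqrt 2 / 2) (- 1 - sqrt 2 / 2),
    Complex (sqrt 2 / 2) (- 1 - sqrt 2 / 2), Complex (1 + sqrt 2 / 2) (- sqrt 2 / 2),
    Complex (sqrt 2 / 2 + 1) (sqrt 2 / 2), Complex (sqrt 2 / 2) (1 + sqrt 2 / 2),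
    Complex (- sqrt 2 / 2) (1 + sqrt 2 / 2), Complex (- 1 - sqrt 2 / 2) (sqrt 2 / 2)}"
    unfolding D_def by (simp add: lessThan_nat_numeral lessThan_Suc s vtx_values v1 minus_complex.code)
      (auto simp: algebra_simps)
  have "D \<subseteq> ?R"
    using sqrt2(2) unfolding D by (intro subsetI) (elim insertE emptyE; simp)
  moreover have "z \<in> D" if "z \<in> ?R" for z
  proof -
    have *: "\<bar>x\<bar> = c \<Longrightarrow> x = c \<or> x = - c" for x c :: real by linarith
    have "((Re z = 1 + sqrt 2 / 2 \<or> Re z = - (1 + sqrt 2 / 2)) \<and> (Im z = sqrt 2 / 2 \<or> Im z = - (sqrt 2 / 2))) \<or>
      ((Re z = sqrt 2 / 2 \<or> Re z = - (sqrt 2 / 2)) \<and> (Im z = 1 + sqrt 2 / 2 \<or> Im z = - (1 + sqrt 2 / 2)))"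
      using that * by blast
    then show ?thesis unfolding D by (elim disjE conjE) (simp_all add: complex_eq_iff)
  qed
  ultimately show ?thesis by blast
qed

lemma D_iff: "d \<in> D \<longleftrightarrow> (\<bar>Re d\<bar> = 1 + sqrt 2 / 2 \<and> \<bar>Im d\<bar> = sqrt 2 / 2) \<or> (\<bar>Re d\<bar> = sqrt 2 / 2 \<and> \<bar>Im d\<bar> = 1 + sqrt 2 / 2)"
  unfolding D_eq by simp

lemma D_uminus: "d \<in> D \<Longrightarrow> - d \<in> D" and D_uminus_iff: "- d \<in> D \<longleftrightarrow> d \<in> D"
  and D_cnj: "d \<in> D \<Longrightarrow> cnj d \<in> D"
  by (auto simp: D_iff)

text \<open>A gluing translation is twice the apothem, \<open>2 * cos (pi / 8)\<close>, whose square
  is \<open>2 + sqrt 2\<close>.\<close>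

lemma norm_D: "d \<in> D \<Longrightarrow> (norm d)\<^sup>2 = 2 + sqrt 2"
proof -
  assume "d \<in> D"
  then have "(Re d)\<^sup>2 + (Im d)\<^sup>2 = (1 + sqrt 2 / 2)\<^sup>2 + (sqrt 2 / 2)\<^sup>2"
    unfolding D_iff by (metis add.commute power2_abs)
  also have "\<dots> = 2 + sqrt 2" by (simp add: power2_eq_square algebra_simps)
  finally show ?thesis by (simp only: cmod_power2)
qed

lemma edge_subset: "octagon_edge 0 1 k \<subseteq> oct"
proof -
  have "vtx k \<in> oct" for k
  proof -
    have "vtx k = vtx (k mod 8)"
    proof (induction k rule: less_induct)
      case (less k)
      show ?case
      proof (cases "k < 8")
        case False
        then have "vtx k = vtx (k - 8)" using octagon_vertex_add_8[of 0 1 "k - 8"] by simp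
        with less[of "k - 8"] False show ?thesis by (simp add: le_mod_geq)
      qed simp
    qed
    then show ?thesis unfolding octagon_def by (metis hull_inc imageI lessThan_iff mod_less_divisor zero_less_numeral)
  qed
  then show ?thesis unfolding octagon_edge_def by (intro closed_segment_subset convex_oct)
qed

lemma vtx_Suc: "vtx (Suc k) = cis (pi / 4) * vtx k"
  by (simp add: vtx_eq cis_mult field_simps)

lemma rotate_oct: "(\<lambda>z. cis (pi / 4) * z) ` oct = oct"
proof -
  have "(\<lambda>z. cis (pi / 4) * z) ` vtx ` {..<8} = vtx ` Suc ` {..<8}"
    by (simp add: image_image vtx_Suc)
  also have "Suc ` {..<8} = insert (0 + 8) ({..<8} - {0})"
    by (auto simp: image_iff lessThan_nat_numeral lessThan_Suc)
  also have "vtx ` \<dots> = insert (vtx 0) (vtx ` ({..<8} - {0}))"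
    unfolding image_insert octagon_vertex_add_8 ..
  also have "\<dots> = vtx ` {..<8}" by (metis image_insert insert_Diff lessThan_iff zero_less_numeral)
  finally have "convex hull ((\<lambda>z. cis (pi / 4) * z) ` vtx ` {..<8}) = oct"
    by (simp add: octagon_def)
  moreover have "linear (\<lambda>z. cis (pi / 4) * z)"
    by (intro bounded_linear.linear bounded_linear_mult_right)
  ultimately show ?thesis unfolding octagon_def by (simp add: convex_hull_linear_image)
qed

lemma rotate_oct_iff: "cis (pi / 4) * z \<in> oct \<longleftrightarrow> z \<in> oct"
proof -
  have "inj (\<lambda>z. cis (pi / 4) * z)" by (simp add: inj_def)
  then show ?thesis using rotate_oct by (metis (no_types, lifting) inj_image_mem_iff)
qed

text \<open>The octagon and its translate by a gluing vector touch only along the shared edge. For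
  edge 0 this is a computation; the other edges follow by rotation through \<open>pi / 4\<close>. It
  lets \<open>glue_iff\<close> describe the gluing without mentioning edges.\<close>

lemma glue_edge:
  assumes "z \<in> oct" "z + (vtx (k + 5) - vtx k) \<in> oct"
  shows "\<exists>t\<in>{0..1}. z = (1 - t) *\<^sub>R vtx k + t *\<^sub>R vtx (k + 1)"
  using assms
proof (induction k arbitrary: z)
  case 0
  define x y where "x = Re z" and "y = Im z"
  have d: "vtx (0 + 5) - vtx 0 = Complex (- 1 - sqrt 2 / 2) (- sqrt 2 / 2)"
    by (simp add: vtx_values complex_eq_iff)
  have z: "\<bar>x\<bar> + (sqrt 2 - 1) * \<bar>y\<bar> \<le> 1"
    and z': "\<bar>x - 1 - sqrt 2 / 2\<bar> + (sqrt 2 - 1) * \<bar>y - sqrt 2 / 2\<bar> \<le> 1"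
    using 0 unfolding d oct_iff by (simp_all add: x_def y_def algebra_simps)
  have "x + (sqrt 2 - 1) * \<bar>y\<bar> \<le> 1" "(sqrt 2 - 1) * \<bar>y - sqrt 2 / 2\<bar> + sqrt 2 / 2 \<le> x"
    using z z' by linarith+
  \<comment> \<open>The two bounds on \<open>x\<close> squeeze \<open>y\<close> between the heights
    of the end points: its distances from 0 and from \<open>sqrt 2 / 2\<close> sum to at most
    \<open>sqrt 2 / 2\<close>.\<close>
  then have *: "(sqrt 2 - 1) * (\<bar>y\<bar> + \<bar>y - sqrt 2 / 2\<bar>) \<le> (sqrt 2 - 1) * (sqrt 2 / 2)"
    by (simp add: algebra_simps sqrt2_mult)
  then have "\<bar>y\<bar> + \<bar>y - sqrt 2 / 2\<bar> \<le> sqrt 2 / 2" using sqrt2 by (simp add: mult_le_cancel_left)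
  then have y: "0 \<le> y" "y \<le> sqrt 2 / 2" by linarith+
  have "x \<le> 1 - (sqrt 2 - 1) * y" using z y by simp
  moreover have "(sqrt 2 - 1) * (sqrt 2 / 2 - y) + sqrt 2 / 2 \<le> x" using z' y by simp
  then have "1 - (sqrt 2 - 1) * y \<le> x" by (simp add: algebra_simps sqrt2_mult) (simp add: field_simps)
  ultimately have x: "x = 1 - (sqrt 2 - 1) * y" by simp
  have "y * sqrt 2 \<le> sqrt 2 / 2 * sqrt 2" using y by (intro mult_right_mono) auto
  then have "sqrt 2 * y \<in> {0..1}" using y by (simp add: algebra_simps)
  moreover have "z = (1 - sqrt 2 * y) *\<^sub>R vtx 0 + (sqrt 2 * y) *\<^sub>R vtx (0 + 1)"
  proof -
    have v1: "vtx (Suc 0) = Complex (sqrt 2 / 2) (sqrt 2 / 2)" using vtx_values(2) by simp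
    show ?thesis using x by (simp add: vtx_values v1 complex_eq_iff x_def y_def algebra_simps sqrt2_mult)
  qed
  ultimately show ?case by blast
next
  case (Suc k)
  define z' where "z' = cis (- pi / 4) * z"
  have z: "z = cis (pi / 4) * z'" by (simp add: z'_def cis_mult flip: mult.assoc)
  have *: "vtx (Suc k + 5) - vtx (Suc k) = cis (pi / 4) * (vtx (k + 5) - vtx k)"
    using vtx_Suc[of "k + 5"] by (simp add: vtx_Suc algebra_simps)
  have "z' \<in> oct" using Suc.prems(1) unfolding z rotate_oct_iff .
  moreover have "z' + (vtx (k + 5) - vtx k) \<in> oct"
    using Suc.prems(2) unfolding z * by (metis distrib_left rotate_oct_iff)
  ultimately obtain t where "t \<in> {0..1}" "z' = (1 - t) *\<^sub>R vtx k + t *\<^sub>R vtx (k + 1)"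
    using Suc.IH by blast
  then show ?case
    by (intro bexI[of _ t]) (simp_all add: z vtx_Suc distrib_left)
qed

lemma glue_iff: "(z, z') \<in> octagon_glue 0 1 \<longleftrightarrow> z \<in> oct \<and> z' \<in> oct \<and> z' - z \<in> D"
proof
  assume g: "(z, z') \<in> octagon_glue 0 1"
  have "z \<in> oct" if "(z, z') \<in> octagon_glue 0 1" for z z'
    using that edge_subset by (auto simp: octagon_glue_def)
  then show "z \<in> oct \<and> z' \<in> oct \<and> z' - z \<in> D"
    using g symD[OF sym_octagon_glue g] by (auto simp: octagon_glue_def D_def)
next
  assume *: "z \<in> oct \<and> z' \<in> oct \<and> z' - z \<in> D"
  then obtain k where k: "k < 8" "z' = z + (vtx (k + 5) - vtx k)"
    by (auto simp: D_def algebra_simps)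
  with * glue_edge[of z k] have "z \<in> octagon_edge 0 1 k"
    by (auto simp: octagon_edge_def closed_segment_def)
  then show "(z, z') \<in> octagon_glue 0 1" using k by (auto simp: octagon_glue_def)
qed

text \<open>Gluing negates the end points of the edge and swaps their weights \<open>1 - t\<close>
  and \<open>t\<close>; the norm is symmetric in the weights because both end points are unit
  vectors. The distance from the centre is thus an invariant of classes, and it separates the
  singularity from all other points.\<close>

lemma norm_glue:
  assumes "(z, z') \<in> octagon_glue 0 1"
  shows "norm z' = norm z"
proof -
  obtain k where k: "k < 8" "z' = z + (vtx (k + 5) - vtx k)" "z \<in> oct" "z' \<in> oct"
    using assms by (auto simp: glue_iff D_def) (metis add.commute diff_add_cancel)
  then obtain t where t: "z = (1 - t) *\<^sub>R vtx k + t *\<^sub>R vtx (k + 1)" using glue_edge[of z k] by auto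
  have z': "z' = - (t *\<^sub>R vtx k + (1 - t) *\<^sub>R vtx (k + 1))"
    unfolding k t vtx_add_5 by (simp add: algebra_simps)
  have "(norm (a *\<^sub>R x + b *\<^sub>R y))\<^sup>2 = a\<^sup>2 + b\<^sup>2 + 2 * a * b * (x \<bullet> y)" if "norm x = 1" "norm y = 1" for a b and x y :: complex
    using that unfolding power2_norm_eq_inner norm_eq_1
    by (simp add: inner_add_left inner_add_right inner_commute power2_eq_square algebra_simps)
  from this[of "vtx k" "vtx (k+1)" "1-t" t] this[of "vtx k" "vtx (k+1)" t "1-t"]
  have "(norm z')\<^sup>2 = (norm z)\<^sup>2" unfolding t z' norm_minus_cancel by simp
  then show ?thesis by simp
qed

section \<open>Equivalence classes of the gluing\<close>

lemma rel_subset: "(x, y) \<in> rel \<Longrightarrow> x \<in> oct" "(x, y) \<in> rel \<Longrightarrow> y \<in> oct"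
  by (auto simp: octagon_rel_def)

lemma rel_refl: "x \<in> oct \<Longrightarrow> (x, x) \<in> rel"
  by (auto simp: octagon_rel_def)

lemma rel_sym: "(x, y) \<in> rel \<Longrightarrow> (y, x) \<in> rel"
  using equiv_octagon_rel[of 0 1] by (auto simp: equiv_def sym_def)

lemma rel_trans: "(x, y) \<in> rel \<Longrightarrow> (y, z) \<in> rel \<Longrightarrow> (x, z) \<in> rel"
  using equiv_octagon_rel[of 0 1] by (auto simp: equiv_def trans_def)

lemma rel_D: "x \<in> oct \<Longrightarrow> y \<in> oct \<Longrightarrow> y - x \<in> D \<Longrightarrow> (x, y) \<in> rel"
  unfolding octagon_rel_def using glue_iff[of x y] by auto

lemma norm_rel: "(x, y) \<in> rel \<Longrightarrow> norm x = norm y"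
proof -
  assume "(x, y) \<in> rel"
  then have "(x, y) \<in> (octagon_glue 0 1)\<^sup>*" by (auto simp: octagon_rel_def)
  then show ?thesis by induction (simp_all add: norm_glue)
qed

lemma rel_induct [consumes 1, case_names refl step]:
  assumes "(x, y) \<in> rel" "P x" "\<And>y z. (x, y) \<in> rel \<Longrightarrow> P y \<Longrightarrow> y \<in> oct \<Longrightarrow> z \<in> oct \<Longrightarrow> z - y \<in> D \<Longrightarrow> P z"
  shows "P y"
proof -
  have "(x, y) \<in> (octagon_glue 0 1)\<^sup>*" "x \<in> oct" using assms(1) by (auto simp: octagon_rel_def)
  then have "P y \<and> (x, y) \<in> rel"
  proof induction
    case base then show ?case using assms(2) rel_refl by simp
  next
    case (step y z)
    then have "(y, z) \<in> rel" using glue_iff[of y z] rel_D by blast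
    with step assms(3)[of y z] glue_iff[of y z] rel_trans show ?case by blast
  qed
  then show ?thesis ..
qed

text \<open>Since gluing keeps the norm, both translations have inner product
  \<open>- (2 + sqrt 2) / 2\<close> with \<open>z\<close>. Two different members of \<open>D\<close>
  have a sum of norm at most \<open>2 + sqrt 2\<close>, attained for neighbours, so Cauchy-Schwarz
  forces \<open>norm z \<ge> 1\<close>. Hence a class away from the vertices has at most two
  points.\<close>

lemma D_unique:
  assumes "z \<in> oct" "norm z < 1" "d \<in> D" "d' \<in> D" "z + d \<in> oct" "z + d' \<in> oct"
  shows "d = d'"
proof (rule ccontr)
  assume "d \<noteq> d'"
  have i: "2 * (z \<bullet> d) = - (2 + sqrt 2)" if "d \<in> D" "z + d \<in> oct" for d
  proof -
    have "norm (z + d) = norm z" using that assms(1) glue_iff[of z "z + d"] norm_glue[of z "z + d"] by simp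
    then have "(norm (z + d))\<^sup>2 = (norm z)\<^sup>2" by simp
    then show ?thesis using norm_D[OF that(1)]
      by (simp add: power2_norm_eq_inner inner_add_left inner_add_right inner_commute)
  qed
  have "(norm (d + d'))\<^sup>2 \<le> (2 + sqrt 2)\<^sup>2"
  proof -
    have "(norm (d + d'))\<^sup>2 = (Re d + Re d')\<^sup>2 + (Im d + Im d')\<^sup>2" by (simp add: cmod_power2)
    also have "\<dots> \<le> (2 + sqrt 2)\<^sup>2"
    proof -
      have *: "\<bar>x\<bar> = c \<Longrightarrow> x = c \<or> x = - c" for x c :: real by linarith
      have dd: "(Re d = r \<or> Re d = - r) \<and> (Im d = s \<or> Im d = - s)" if "\<bar>Re d\<bar> = r \<and> \<bar>Im d\<bar> = s" for d r s
        using that * by metis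
      have ne: "Re d \<noteq> Re d' \<or> Im d \<noteq> Im d'" using \<open>d \<noteq> d'\<close> by (auto simp: complex_eq_iff)
      have D: "((Re d = r \<or> Re d = - r) \<and> (Im d = s \<or> Im d = - s)) \<or> ((Re d = s \<or> Re d = - s) \<and> (Im d = r \<or> Im d = - r))"
        if "d \<in> D" "r = 1 + sqrt 2 / 2" "s = sqrt 2 / 2" for d r s using that dd unfolding D_iff by metis
      define r s where "r = 1 + sqrt 2 / 2" and "s = sqrt 2 / (2 :: real)"
      have "(2 * r)\<^sup>2 \<le> (2 + sqrt 2)\<^sup>2" "(2 * s)\<^sup>2 \<le> (2 + sqrt 2)\<^sup>2" "(r + s)\<^sup>2 + (r + s)\<^sup>2 \<le> (2 + sqrt 2)\<^sup>2"
        "(r - s)\<^sup>2 + (r - s)\<^sup>2 \<le> (2 + sqrt 2)\<^sup>2" "(r - s)\<^sup>2 + (r + s)\<^sup>2 \<le> (2 + sqrt 2)\<^sup>2" "0 \<le> (2 + sqrt 2)\<^sup>2"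
        using sqrt2(2) by (simp_all add: r_def s_def power2_eq_square algebra_simps)
      with D[OF assms(3) r_def s_def] D[OF assms(4) r_def s_def] ne show ?thesis
        by (elim disjE conjE) (auto simp: power2_commute add.commute power2_eq_square algebra_simps)
    qed
    finally show ?thesis .
  qed
  then have n: "norm (d + d') \<le> 2 + sqrt 2" by (rule power2_le_imp_le) simp
  have "2 + sqrt 2 = - (z \<bullet> (d + d'))" using i[OF assms(3,5)] i[OF assms(4,6)] by (simp add: inner_add_right)
  also have "\<dots> \<le> norm z * norm (d + d')" using Cauchy_Schwarz_ineq2[of z "d + d'"] by linarith
  also have "\<dots> \<le> norm z * (2 + sqrt 2)" by (intro mult_left_mono n) simp
  finally show False using assms(2) by (simp add: add_pos_pos)
qed

lemma rel_cases:
  assumes "(x, y) \<in> rel" "norm x < 1"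
  shows "x = y \<or> y - x \<in> D"
  using assms(1)
proof (induction rule: rel_induct)
  case (step y z)
  then have x: "x \<in> oct" using rel_subset by blast
  have n: "norm y < 1" using step assms(2) norm_rel by metis
  from step.IH show ?case
  proof (elim disjE)
    assume "y - x \<in> D"
    then have "x - y \<in> D" using D_uminus[of "y - x"] by simp
    with D_unique[OF step.hyps(2) n, of "x - y" "z - y"] step x show ?thesis by simp
  qed (use step in simp)
qed simp

lemma norm_oct_le: "z \<in> oct \<Longrightarrow> norm z \<le> 1"
proof -
  have "oct \<subseteq> cball 0 1" unfolding octagon_def by (intro hull_minimal) auto
  then show "z \<in> oct \<Longrightarrow> norm z \<le> 1" by auto
qed

text \<open>If \<open>x\<close> were related to another point \<open>y\<close>, then a point
  slightly behind \<open>x\<close> on the line through \<open>y\<close> would be glued by the same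
  translation. But gluing fixes the inner product with that translation, which changes along the
  line.\<close>

lemma rel_interior_eq:
  assumes "(x, y) \<in> rel" "x \<in> interior oct"
  shows "y = x"
proof (rule ccontr)
  assume "y \<noteq> x"
  have xy: "x \<in> oct" "y \<in> oct" using rel_subset assms(1) by blast+
  obtain e where e: "e > 0" "ball x e \<subseteq> oct" using assms(2) mem_interior by blast
  have n1: "norm x < 1"
  proof -
    have "interior oct \<subseteq> interior (cball 0 1)" using norm_oct_le by (intro interior_mono) auto
    then show ?thesis using assms(2) by auto
  qed
  have d: "y - x \<in> D" using rel_cases[OF assms(1) n1] \<open>y \<noteq> x\<close> by auto
  define t where "t = min (1/2) (e / 4)"
  have t: "0 < t" "t < 1" using e by (auto simp: t_def)
  have nd: "norm (y - x) < 2" using norm_D[OF d] sqrt2 by (intro power2_less_imp_less[of _ 2]) auto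
  define z where "z = x - t *\<^sub>R (y - x)"
  have "t * norm (y - x) \<le> (e / 4) * 2" using nd t e by (intro mult_mono) (auto simp: t_def)
  then have "t * norm (y - x) < e" using e by simp
  then have "z \<in> oct" using e(2) t by (auto simp: z_def dist_norm)
  have eq: "2 * (x \<bullet> (y - x)) = - (2 + sqrt 2)" if "x \<in> oct" "y \<in> oct" "y - x \<in> D" for x y
  proof -
    have "norm y = norm x" using that glue_iff[of x y] norm_glue[of x y] by simp
    then have "(norm (x + (y - x)))\<^sup>2 = (norm x)\<^sup>2" by simp
    then show ?thesis using norm_D[OF that(3)] unfolding power2_norm_eq_inner
      by (simp add: inner_diff_left inner_diff_right inner_commute)
  qed
  have z2: "z + (y - x) \<in> oct"
  proof -
    have "z + (y - x) = t *\<^sub>R x + (1 - t) *\<^sub>R y" by (simp add: z_def algebra_simps)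
    then show ?thesis using convexD[OF convex_oct xy, of t "1 - t"] t by simp
  qed
  have "2 * (z \<bullet> (y - x)) = 2 * (x \<bullet> (y - x))"
    using eq[OF xy d] eq[OF \<open>z \<in> oct\<close> z2] d by simp
  then have "t * ((y - x) \<bullet> (y - x)) = 0" by (simp add: z_def inner_diff_left)
  then show False using t \<open>y \<noteq> x\<close> by auto
qed

lemma interior_norm_less: "z \<in> interior oct \<Longrightarrow> norm z < 1"
proof -
  have "interior oct \<subseteq> interior (cball 0 1)" using norm_oct_le by (intro interior_mono) auto
  then show "z \<in> interior oct \<Longrightarrow> norm z < 1" by auto
qed

lemma norm_1_vtx:
  assumes "z \<in> oct" "norm z = 1"
  shows "\<exists>k<8. z = vtx k"
proof -
  define x y where "x = \<bar>Re z\<bar>" and "y = \<bar>Im z\<bar>"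
  have nn: "0 \<le> x" "0 \<le> y" by (auto simp: x_def y_def)
  have le: "x + (sqrt 2 - 1) * y \<le> 1" "(sqrt 2 - 1) * x + y \<le> 1"
    using assms(1) by (auto simp: oct_iff x_def y_def)
  have "(Re z)\<^sup>2 + (Im z)\<^sup>2 = 1" using assms(2) by (metis cmod_power2 one_power2)
  then have xy: "x * x + y * y = 1" by (simp add: x_def y_def power2_eq_square)
  have key: "y = 0 \<or> (x = sqrt 2 / 2 \<and> y = sqrt 2 / 2)"
    if "0 \<le> x" "0 \<le> y" "x + (sqrt 2 - 1) * y \<le> 1" "x * x + y * y = 1" "y \<le> x" for x y
  proof (rule disjCI)
    assume neg: "\<not> (x = sqrt 2 / 2 \<and> y = sqrt 2 / 2)"
    have "x * x \<le> (1 - (sqrt 2 - 1) * y) * (1 - (sqrt 2 - 1) * y)" using that by (intro mult_mono) auto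
    then have "1 - y * y \<le> (1 - (sqrt 2 - 1) * y) * (1 - (sqrt 2 - 1) * y)" using that by linarith
    then have "(sqrt 2 - 1) * (y * (1 - sqrt 2 * y)) \<le> 0"
      by (simp add: algebra_simps sqrt2_mult)
    then have "y * (1 - sqrt 2 * y) \<le> 0" using sqrt2 by (simp add: mult_le_0_iff)
    then have "y = 0 \<or> 1 \<le> sqrt 2 * y" using that by (auto simp: mult_le_0_iff)
    then consider "y = 0" | "1 \<le> sqrt 2 * y" by blast
    then show "y = 0"
    proof cases
      case 2
      then have "sqrt 2 * 1 \<le> sqrt 2 * (sqrt 2 * y)" by (intro mult_left_mono) auto
      then have y: "sqrt 2 / 2 \<le> y" by (simp add: sqrt2_mult)
      have "(sqrt 2 - 1) * (sqrt 2 / 2) \<le> (sqrt 2 - 1) * y" using y sqrt2 by (intro mult_left_mono) auto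
      moreover have "(sqrt 2 - 1) * (sqrt 2 / 2) = 1 - sqrt 2 / 2" by (simp add: field_simps)
      ultimately have "x \<le> sqrt 2 / 2" using that(3) by linarith
      with y that(5) have "x = sqrt 2 / 2" "y = sqrt 2 / 2" by linarith+
      with neg show ?thesis by simp
    qed
  qed
  have "(x = sqrt 2 / 2 \<and> y = sqrt 2 / 2) \<or> (x = 1 \<and> y = 0) \<or> (x = 0 \<and> y = 1)"
  proof (cases "y \<le> x")
    case True
    from key[OF nn le(1) xy True] xy nn show ?thesis by (auto simp: square_eq_1_iff)
  next
    case False
    then have "x = 0 \<or> (y = sqrt 2 / 2 \<and> x = sqrt 2 / 2)"
      using nn le xy by (intro key) (auto simp: add.commute)
    with xy nn show ?thesis by (auto simp: square_eq_1_iff)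
  qed
  moreover have v1: "vtx (Suc 0) = Complex (sqrt 2 / 2) (sqrt 2 / 2)" using vtx_values(2) by simp
  have "vtx ` {..<8} = {vtx 0, vtx 1, vtx 2, vtx 3, vtx 4, vtx 5, vtx 6, vtx 7}"
    by (auto simp: lessThan_nat_numeral lessThan_Suc)
  ultimately have "z \<in> vtx ` {..<8}" unfolding vtx_values
    by (cases z) (auto simp: x_def y_def abs_if split: if_splits)
  then show ?thesis by auto
qed

text \<open>Norm 1 characterises the vertices, and the norm is constant on classes. The vertices
  form a single class by the chain 0, 5, 2, 7, 4, 1, 6, 3 of gluings.\<close>

lemma singularity_iff:
  assumes "z \<in> oct"
  shows "rel `` {z} = octagon_singularity 0 1 \<longleftrightarrow> norm z = 1"
proof
  have v: "vtx k \<in> oct" if "k < 8" for k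
    unfolding octagon_def using that by (intro hull_inc) auto
  assume "rel `` {z} = octagon_singularity 0 1"
  then have "(vtx 0, z) \<in> rel" using rel_refl[OF assms] by (auto simp: octagon_singularity_def)
  then show "norm z = 1" using norm_rel norm_vtx by metis
next
  assume "norm z = 1"
  then obtain k where k: "k < 8" "z = vtx k" using norm_1_vtx assms by blast
  have v: "vtx k \<in> oct" if "k < 8" for k
    unfolding octagon_def using that by (intro hull_inc) auto
  have s: "vtx 8 = vtx 0" "vtx 9 = vtx 1" "vtx 10 = vtx 2" "vtx 11 = vtx 3" "vtx 12 = vtx 4"
    using octagon_vertex_add_8[of 0 1 0] octagon_vertex_add_8[of 0 1 1] octagon_vertex_add_8[of 0 1 2]
      octagon_vertex_add_8[of 0 1 3] octagon_vertex_add_8[of 0 1 4] by simp_all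
  have st: "(vtx i, vtx j) \<in> rel" if "i < 8" "j < 8" "vtx (i + 5) = vtx j" for i j
  proof (rule rel_D)
    show "vtx j - vtx i \<in> D" unfolding D_def that(3)[symmetric] using that(1) by blast
  qed (use v that in auto)
  have r5: "(vtx 0, vtx 5) \<in> rel" by (rule st) auto
  have r2: "(vtx 0, vtx 2) \<in> rel" by (rule rel_trans[OF r5 st]) (simp_all add: s)
  have r7: "(vtx 0, vtx 7) \<in> rel" by (rule rel_trans[OF r2 st]) (simp_all add: s)
  have r4: "(vtx 0, vtx 4) \<in> rel" by (rule rel_trans[OF r7 st]) (simp_all add: s)
  have r1: "(vtx 0, vtx 1) \<in> rel" by (rule rel_trans[OF r4 st]) (simp_all add: s)
  have r6: "(vtx 0, vtx 6) \<in> rel" by (rule rel_trans[OF r1 st]) (simp_all add: s)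
  have r3: "(vtx 0, vtx 3) \<in> rel" by (rule rel_trans[OF r6 st]) (simp_all add: s)
  have "k = 0 \<or> k = 1 \<or> k = 2 \<or> k = 3 \<or> k = 4 \<or> k = 5 \<or> k = 6 \<or> k = 7" using k by linarith
  then have "(vtx 0, z) \<in> rel" using r1 r2 r3 r4 r5 r6 r7 rel_refl[OF v[of 0]] unfolding k(2) by auto
  then show "rel `` {z} = octagon_singularity 0 1"
    unfolding octagon_singularity_def using equiv_class_eq[OF equiv_octagon_rel] by metis
qed

lemma class_eq_iff: "x \<in> oct \<Longrightarrow> y \<in> oct \<Longrightarrow> rel `` {x} = rel `` {y} \<longleftrightarrow> (x, y) \<in> rel"
  by (rule eq_equiv_class_iff[OF equiv_octagon_rel])

lemma class_in_surface: "x \<in> oct \<Longrightarrow> rel `` {x} \<in> octagon_surface 0 1"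
  by (auto simp: octagon_surface_def quotient_def)

lemma surface_class:
  assumes "X \<in> octagon_surface 0 1" "y \<in> X"
  shows "y \<in> oct" "X = rel `` {y}"
proof -
  obtain x where x: "x \<in> oct" "X = rel `` {x}"
    using assms(1) by (auto simp: octagon_surface_def quotient_def)
  then show "y \<in> oct" using assms(2) rel_subset by auto
  then show "X = rel `` {y}" using x assms(2) class_eq_iff by auto
qed

lemma surface_cases:
  assumes "X \<in> octagon_surface 0 1"
  obtains y where "y \<in> oct" "X = rel `` {y}" "y \<in> X"
  using assms rel_refl by (auto simp: octagon_surface_def quotient_def)

section \<open>Horizontal cylinders\<close>

text \<open>
  The horizontal line through a vertex cuts the surface into two cylinders: the central band
  (\<open>False\<close>), made of the points with \<open>\<bar>Im z\<bar> \<le> sqrt 2 / 2\<close>, and the union of the two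
  outer bands (\<open>True\<close>). The half of the octagon below the real axis is moved up by the side translation
  \<open>(lam, del)\<close>, so that a cylinder has circumference \<open>2 * lam\<close> and heights from \<open>lo\<close> to
  \<open>hi\<close>. Both cylinders have modulus \<open>2 + 2 * sqrt 2\<close>.
\<close>

definition lam :: "bool \<Rightarrow> real" where "lam b = (if b then sqrt 2 / 2 else 1 + sqrt 2 / 2)"
definition del :: "bool \<Rightarrow> real" where "del b = (if b then 1 + sqrt 2 / 2 else sqrt 2 / 2)"
definition lo :: "bool \<Rightarrow> real" where "lo b = (if b then sqrt 2 / 2 else 0)"
definition hi :: "bool \<Rightarrow> real" where "hi b = (if b then 1 else sqrt 2 / 2)"

text \<open>
  Universal cover \<open>(s, y)\<close> of a cylinder: \<open>pt b s y m\<close> is its point seen in the \<open>m\<close>-th copy of the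
  (half) octagon, and \<open>wd b y\<close> is half the width of a copy at height \<open>y\<close>.
\<close>

definition pt :: "bool \<Rightarrow> real \<Rightarrow> real \<Rightarrow> int \<Rightarrow> complex" where
  "pt b s y m = Complex (s - of_int m * lam b) (y - (if odd m then del b else 0))"

definition wd :: "bool \<Rightarrow> real \<Rightarrow> real" where
  "wd b y = (if b then (1 + sqrt 2) * (1 - y) else 1 - (sqrt 2 - 1) * y)"

lemma lam_pos: "lam b > 0" by (simp add: lam_def add_pos_pos)

text \<open>Below height \<open>sqrt 2 / 2\<close> the boundary consists of steep edges, so the
  first inequality of \<open>oct_iff\<close> implies the second; above that height the roles are
  exchanged.\<close>

lemma oct_band_low:
  assumes "0 \<le> v" "v \<le> sqrt 2 / 2"
  shows "\<bar>x\<bar> + (sqrt 2 - 1) * v \<le> 1 \<and> (sqrt 2 - 1) * \<bar>x\<bar> + v \<le> 1 \<longleftrightarrow> \<bar>x\<bar> \<le> 1 - (sqrt 2 - 1) * v"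
proof -
  have "(sqrt 2 - 1) * \<bar>x\<bar> + v \<le> 1" if "\<bar>x\<bar> \<le> 1 - (sqrt 2 - 1) * v"
  proof -
    have "(sqrt 2 - 1) * \<bar>x\<bar> \<le> (sqrt 2 - 1) * (1 - (sqrt 2 - 1) * v)"
      using that sqrt2 by (intro mult_left_mono) auto
    moreover have "(sqrt 2 - 1) * v \<le> (sqrt 2 - 1) * (sqrt 2 / 2)"
      using assms sqrt2 by (intro mult_left_mono) auto
    moreover have "(sqrt 2 - 1) * (sqrt 2 / 2) = 1 - sqrt 2 / 2" by (simp add: field_simps)
    moreover have "(sqrt 2 - 1) * (1 - (sqrt 2 - 1) * v) = sqrt 2 - 1 - v + 2 * ((sqrt 2 - 1) * v)"
      by (simp add: algebra_simps sqrt2_mult)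
    ultimately show ?thesis by linarith
  qed
  then show ?thesis by linarith
qed

lemma oct_band_high:
  assumes "sqrt 2 / 2 \<le> v" "v \<le> 1"
  shows "\<bar>x\<bar> + (sqrt 2 - 1) * v \<le> 1 \<and> (sqrt 2 - 1) * \<bar>x\<bar> + v \<le> 1 \<longleftrightarrow> \<bar>x\<bar> \<le> (1 + sqrt 2) * (1 - v)"
proof -
  have 1: "(sqrt 2 - 1) * \<bar>x\<bar> + v \<le> 1 \<longleftrightarrow> \<bar>x\<bar> \<le> (1 + sqrt 2) * (1 - v)"
  proof -
    have e: "(1 + sqrt 2) * ((sqrt 2 - 1) * \<bar>x\<bar>) = \<bar>x\<bar>" by (simp add: algebra_simps sqrt2_mult)
    have "(sqrt 2 - 1) * \<bar>x\<bar> + v \<le> 1 \<longleftrightarrow> (sqrt 2 - 1) * \<bar>x\<bar> \<le> 1 - v" by linarith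
    also have "\<dots> \<longleftrightarrow> (1 + sqrt 2) * ((sqrt 2 - 1) * \<bar>x\<bar>) \<le> (1 + sqrt 2) * (1 - v)"
      using sqrt2 by (intro mult_le_cancel_left_pos[symmetric]) auto
    finally show ?thesis by (simp only: e)
  qed
  have "\<bar>x\<bar> + (sqrt 2 - 1) * v \<le> 1" if "\<bar>x\<bar> \<le> (1 + sqrt 2) * (1 - v)"
    using that assms by (simp add: algebra_simps)
  with 1 show ?thesis by blast
qed

text \<open>Odd copies are seen upside down, at height \<open>y - del b\<close>, with half width
  \<open>lam b - wd b y\<close>. Consecutive copies have centres \<open>lam b\<close> apart and half
  widths adding up to \<open>lam b\<close>, so they tile the cover.\<close>

lemma pt_oct_iff:
  assumes "lo b \<le> y" "y \<le> hi b"
  shows "pt b s y m \<in> oct \<longleftrightarrow> \<bar>s - of_int m * lam b\<bar> \<le> (if even m then wd b y else lam b - wd b y)"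
proof -
  let ?x = "s - of_int m * lam b"
  have lw: "0 \<le> sqrt 2 / 2 - y" "sqrt 2 / 2 - y \<le> sqrt 2 / 2"
    "1 - (sqrt 2 - 1) * (sqrt 2 / 2 - y) = 1 + sqrt 2 / 2 - (1 - (sqrt 2 - 1) * y)" if "\<not> b"
    using assms that by (auto simp: lo_def hi_def algebra_simps) (simp add: field_simps)?
  have hg: "sqrt 2 / 2 \<le> 1 + sqrt 2 / 2 - y" "1 + sqrt 2 / 2 - y \<le> 1"
    "(1 + sqrt 2) * (1 - (1 + sqrt 2 / 2 - y)) = sqrt 2 / 2 - (1 + sqrt 2) * (1 - y)" if b
    using assms that by (auto simp: lo_def hi_def algebra_simps) (simp add: field_simps)?
  show ?thesis
  proof (cases b; cases "even m")
    assume "b" "even m"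
    then show ?thesis using assms oct_band_high[of y ?x]
      by (simp add: oct_iff pt_def wd_def lo_def hi_def)
        (smt (verit, ccfv_SIG) real_sqrt_ge_0_iff)
  next
    assume "\<not> b" "even m"
    then show ?thesis using assms oct_band_low[of y ?x]
      by (simp add: oct_iff pt_def wd_def lo_def hi_def)
  next
    assume "\<not> b" "odd m"
    then have "\<bar>Im (pt b s y m)\<bar> = sqrt 2 / 2 - y" using assms sqrt2(2) by (simp add: pt_def del_def lo_def hi_def)
    then show ?thesis using oct_band_low[OF lw(1,2), of ?x] lw(3) \<open>\<not> b\<close> \<open>odd m\<close>
      unfolding oct_iff by (simp add: pt_def wd_def lam_def)
  next
    assume "b" "odd m"
    then have "\<bar>Im (pt b s y m)\<bar> = 1 + sqrt 2 / 2 - y" using assms sqrt2(2) by (simp add: pt_def del_def lo_def hi_def)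
    then show ?thesis using oct_band_high[OF hg(1,2), of ?x] hg(3) \<open>b\<close> \<open>odd m\<close>
      unfolding oct_iff by (simp add: pt_def wd_def lam_def)
  qed
qed

lemma wd_bounds:
  assumes "lo b \<le> y" "y \<le> hi b"
  shows "0 \<le> wd b y" "wd b y \<le> lam b"
proof -
  have "0 \<le> wd b y \<and> wd b y \<le> lam b"
  proof (cases b)
    case True
    then have y: "sqrt 2 / 2 \<le> y" "y \<le> 1" using assms by (auto simp: lo_def hi_def)
    have "(1 + sqrt 2) * (1 - y) \<le> (1 + sqrt 2) * (1 - sqrt 2 / 2)"
      using y by (intro mult_left_mono) auto
    moreover have "(1 + sqrt 2) * (1 - sqrt 2 / 2) = sqrt 2 / 2" by (simp add: field_simps)
    ultimately show ?thesis using True y by (simp add: wd_def lam_def)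
  next
    case False
    then have y: "0 \<le> y" "y \<le> sqrt 2 / 2" using assms by (auto simp: lo_def hi_def)
    have "(sqrt 2 - 1) * y \<le> 1 * 1"
      using y sqrt2 by (intro mult_mono) auto
    moreover have "0 \<le> (sqrt 2 - 1) * y" using y by simp
    moreover have "0 \<le> p \<Longrightarrow> p \<le> 1 \<Longrightarrow> 0 \<le> 1 - p \<and> 1 - p \<le> 1 + sqrt 2 / 2" for p :: real
      using sqrt2(2) by auto
    ultimately have "0 \<le> 1 - (sqrt 2 - 1) * y \<and> 1 - (sqrt 2 - 1) * y \<le> 1 + sqrt 2 / 2" by simp
    then show ?thesis using False by (simp add: wd_def lam_def)
  qed
  then show "0 \<le> wd b y" "wd b y \<le> lam b" by auto
qed

lemma pt_Suc_diff: "pt b s y (m + 1) - pt b s y m \<in> D"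
proof -
  have "Re (pt b s y (m + 1) - pt b s y m) = - lam b" by (simp add: pt_def algebra_simps)
  moreover have "Im (pt b s y (m + 1) - pt b s y m) = (if odd m then del b else - del b)" by (simp add: pt_def)
  ultimately show ?thesis
    unfolding D_iff using sqrt2(2) by (cases b) (simp_all add: lam_def del_def)
qed

text \<open>Consecutive copies differ by a gluing translation, so it suffices that every copy
  between two copies containing the point contains it as well.\<close>

lemma pt_rel_le:
  assumes y: "lo b \<le> y" "y \<le> hi b" and "pt b s y m \<in> oct" "pt b s y (m + int n) \<in> oct"
  shows "(pt b s y m, pt b s y (m + int n)) \<in> rel"
  using assms(3,4)
proof (induction n arbitrary: m)
  case 0
  then show ?case by (simp add: rel_refl)
next
  case (Suc n)
  note w = pt_oct_iff[OF y] wd_bounds[OF y] lam_pos[of b]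
  have "pt b s y (m + 1) \<in> oct"
  proof (cases "n = 0")
    case False
    \<comment> \<open>The bounds from the two outer copies meet, so the point lies over the centre
      of copy \<open>m + 1\<close>.\<close>
    have 1: "s \<le> of_int (m + 1) * lam b"
      using Suc.prems(1) w by (auto simp: algebra_simps abs_le_iff split: if_splits)
    have 2: "of_int (m + int (Suc n) - 1) * lam b \<le> s"
      using Suc.prems(2) w by (auto simp: algebra_simps abs_le_iff split: if_splits)
    have "of_int (m + 1) * lam b \<le> of_int (m + int (Suc n) - 1) * lam b"
      using False w by (intro mult_right_mono) auto
    then have "s = of_int (m + 1) * lam b" using 1 2 by linarith
    then show ?thesis using w by simp
  qed (use Suc in \<open>simp add: add.commute\<close>)
  moreover from this have "(pt b s y m, pt b s y (m + 1)) \<in> rel"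
    using Suc.prems pt_Suc_diff by (intro rel_D) auto
  ultimately show ?case using Suc.IH[of "m + 1"] Suc.prems rel_trans by (auto simp: algebra_simps)
qed

lemma pt_rel:
  assumes y: "lo b \<le> y" "y \<le> hi b" and "pt b s y m \<in> oct" "pt b s y m' \<in> oct"
  shows "(pt b s y m, pt b s y m') \<in> rel"
proof (cases "m \<le> m'")
  case True
  then show ?thesis using pt_rel_le[OF y assms(3), of "nat (m' - m)"] assms(4) by simp
next
  case False
  then show ?thesis using pt_rel_le[OF y assms(4), of "nat (m - m')"] assms(3) rel_sym by simp
qed

text \<open>Selects one copy containing the point: the nearest even copy if the point lies within
  its width, otherwise the odd neighbour on the side of the point. The choice is explicit, so maps
  built from it are visibly measurable and piecewise affine.\<close>

definition nf :: "bool \<Rightarrow> real \<Rightarrow> real \<Rightarrow> complex" where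
  "nf b s y = (let e = 2 * \<lfloor>s / (2 * lam b) + 1 / 2\<rfloor> in
     if \<bar>s - of_int e * lam b\<bar> \<le> wd b y then pt b s y e
     else if s > of_int e * lam b then pt b s y (e + 1) else pt b s y (e - 1))"

lemma nf_cases:
  assumes "lo b \<le> y" "y \<le> hi b"
  obtains m where "nf b s y = pt b s y m" "pt b s y m \<in> oct"
proof -
  define e where "e = 2 * \<lfloor>s / (2 * lam b) + 1 / 2\<rfloor>"
  note w = pt_oct_iff[OF assms] wd_bounds[OF assms] lam_pos[of b]
  define f where "f = \<lfloor>s / (2 * lam b) + 1 / 2\<rfloor>"
  have "of_int f * (2 * lam b) \<le> (s / (2 * lam b) + 1 / 2) * (2 * lam b)"
    using w unfolding f_def by (intro mult_right_mono) auto
  moreover have "(s / (2 * lam b) + 1 / 2) * (2 * lam b) < (of_int f + 1) * (2 * lam b)"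
    using w unfolding f_def by (intro mult_strict_right_mono) linarith+
  moreover have "(s / (2 * lam b) + 1 / 2) * (2 * lam b) = s + lam b" using w by (simp add: field_simps)
  ultimately have e: "of_int e * lam b \<le> s + lam b" "s + lam b < of_int e * lam b + 2 * lam b"
    unfolding e_def f_def[symmetric] of_int_mult by (simp_all only: mult.commute mult.left_commute distrib_left)
  have ev: "even e" by (simp add: e_def)
  have "\<exists>m. nf b s y = pt b s y m \<and> pt b s y m \<in> oct"
    unfolding nf_def e_def[symmetric] Let_def
    using w e ev by (auto simp: algebra_simps abs_if split: if_splits)
  then show ?thesis using that by blast
qed

text \<open>The covering projection onto the closed cylinder; by \<open>dev_eq\<close> any copy
  containing the point gives the same class.\<close>

definition dev :: "bool \<Rightarrow> real \<Rightarrow> real \<Rightarrow> complex set" where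
  "dev b s y = rel `` {nf b s y}"

lemma nf_oct: "lo b \<le> y \<Longrightarrow> y \<le> hi b \<Longrightarrow> nf b s y \<in> oct"
  by (metis nf_cases)

lemma dev_eq:
  assumes "lo b \<le> y" "y \<le> hi b" "pt b s y m \<in> oct"
  shows "dev b s y = rel `` {pt b s y m}"
  using nf_cases[OF assms(1,2), of s] assms pt_rel[OF assms(1,2)] class_eq_iff
  unfolding dev_def by metis

lemma pt_shift: "pt b (s + of_int n * (2 * lam b)) y m = pt b s y (m - 2 * n)"
  by (simp add: pt_def algebra_simps)

lemma dev_periodic:
  assumes "lo b \<le> y" "y \<le> hi b"
  shows "dev b (s + of_int n * (2 * lam b)) y = dev b s y"
proof -
  obtain m where "pt b (s + of_int n * (2 * lam b)) y m \<in> oct"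
    using nf_cases[OF assms] by metis
  then show ?thesis using dev_eq[OF assms] pt_shift by metis
qed

text \<open>Closedness of the octagon gives \<open>z\<close> as a limit of sample points, and
  convexity gives the segment from there to one of them.\<close>

lemma ray_oct:
  assumes "infinite N" "\<And>n::nat. n \<in> N \<Longrightarrow> z + (e / (real n + 1)) *\<^sub>R u \<in> oct" "e > 0"
  shows "\<exists>e'>0. \<forall>t. 0 \<le> t \<and> t \<le> e' \<longrightarrow> z + t *\<^sub>R u \<in> oct"
proof -
  have "z \<in> oct"
  proof -
    obtain r :: "nat \<Rightarrow> nat" where r: "strict_mono r" "\<And>n. r n \<in> N"
      using infinite_enumerate[OF assms(1)] by blast
    have "(\<lambda>n. e / (real n + 1)) \<longlonglongrightarrow> 0" by real_asymp
    then have "(\<lambda>n. e / (real (r n) + 1)) \<longlonglongrightarrow> 0"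
      using LIMSEQ_subseq_LIMSEQ[OF _ r(1), of "\<lambda>n. e / (real n + 1)"] by (simp add: o_def)
    then have "(\<lambda>n. z + (e / (real (r n) + 1)) *\<^sub>R u) \<longlonglongrightarrow> z + 0 *\<^sub>R u" by (intro tendsto_intros)
    then show ?thesis using closed_sequentially[OF closed_oct] assms(2) r(2) by fastforce
  qed
  obtain n where "n \<in> N" using assms(1) infinite_imp_nonempty by blast
  define e' where "e' = e / (real n + 1)"
  have e': "e' > 0" "z + e' *\<^sub>R u \<in> oct" using assms \<open>n \<in> N\<close> by (auto simp: e'_def)
  have "z + t *\<^sub>R u \<in> oct" if "0 \<le> t" "t \<le> e'" for t
  proof -
    have "(1 - t / e') *\<^sub>R z + (t / e') *\<^sub>R (z + e' *\<^sub>R u) = z + t *\<^sub>R u"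
      using e' by (simp add: algebra_simps)
    then show ?thesis using convexD[OF convex_oct \<open>z \<in> oct\<close> e'(2), of "1 - t / e'" "t / e'"] that e' by simp
  qed
  with e' show ?thesis by blast
qed

lemma pt_add: "pt b (s + t * Re u) (y + t * Im u) m = pt b s y m + t *\<^sub>R u"
  by (simp add: pt_def complex_eq_iff)

text \<open>A short piece of a line in the cover stays in one copy. The copies containing the points
  at times \<open>e / (n + 1)\<close> have bounded index, so one copy contains infinitely many of
  these points, and \<open>ray_oct\<close> fills in the segment.\<close>

lemma dev_germ:
  assumes "e > 0" "\<And>t. 0 \<le> t \<Longrightarrow> t \<le> e \<Longrightarrow> lo b \<le> y + t * Im u \<and> y + t * Im u \<le> hi b"
  shows "\<exists>e'>0. \<exists>z\<in>dev b s y. \<forall>t. 0 \<le> t \<and> t \<le> e' \<longrightarrow> z + t *\<^sub>R u \<in> dev b (s + t * Re u) (y + t * Im u)"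
proof -
  define t where "t n = e / (real n + 1)" for n :: nat
  have t: "0 \<le> t n" "t n \<le> e" for n using assms(1) by (auto simp: t_def field_simps)
  have "\<exists>m. pt b (s + t n * Re u) (y + t n * Im u) m \<in> oct" for n
    using nf_cases assms(2)[OF t, of n] by metis
  then obtain m where m: "\<And>n. pt b (s + t n * Re u) (y + t n * Im u) (m n) \<in> oct" by metis
  define B where "B = (\<bar>s\<bar> + e * \<bar>Re u\<bar> + lam b) / lam b"
  have "\<bar>of_int (m n)\<bar> \<le> B" for n
  proof -
    have yy: "lo b \<le> y + t n * Im u" "y + t n * Im u \<le> hi b" using assms(2)[OF t] by auto
    have "\<bar>s + t n * Re u - of_int (m n) * lam b\<bar> \<le> lam b"
      using m[of n] pt_oct_iff[OF yy] wd_bounds[OF yy] lam_pos[of b] by (auto split: if_splits)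
    moreover have "\<bar>t n * Re u\<bar> \<le> e * \<bar>Re u\<bar>" using t[of n] by (simp add: abs_mult mult_right_mono)
    ultimately have "\<bar>of_int (m n) * lam b\<bar> \<le> \<bar>s\<bar> + e * \<bar>Re u\<bar> + lam b" by linarith
    then show ?thesis using lam_pos[of b] by (simp add: B_def abs_mult field_simps)
  qed
  then have "m n \<in> {\<lfloor>-B\<rfloor>..\<lceil>B\<rceil>}" for n
    by (smt (verit, ccfv_threshold) atLeastAtMost_iff floor_le_iff le_ceiling_iff)
  then have "finite (range m)" by (meson finite_atLeastAtMost_int finite_subset image_subsetI)
  then obtain k where k: "infinite {n. m n = k}"
    using pigeonhole_infinite[of UNIV m] by auto
  have "\<exists>e'>0. \<forall>t. 0 \<le> t \<and> t \<le> e' \<longrightarrow> pt b s y k + t *\<^sub>R u \<in> oct"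
    by (rule ray_oct[OF k _ assms(1)]) (use m in \<open>auto simp flip: t_def pt_add\<close>)
  then obtain e' where e': "e' > 0" "\<And>t. 0 \<le> t \<Longrightarrow> t \<le> e' \<Longrightarrow> pt b s y k + t *\<^sub>R u \<in> oct" by auto
  have d: "pt b s y k + t *\<^sub>R u \<in> dev b (s + t * Re u) (y + t * Im u)" if "0 \<le> t" "t \<le> min e e'" for t
  proof -
    have "pt b s y k + t *\<^sub>R u \<in> oct" using e'(2) that by simp
    then show ?thesis using dev_eq[of b "y + t * Im u" "s + t * Re u" k] assms(2)[of t] that rel_refl
      by (auto simp: pt_add)
  qed
  show ?thesis
    using d[of 0] assms(1) e'(1) d by (intro exI[of _ "min e e'"] conjI bexI[of _ "pt b s y k"]) auto
qed

section \<open>Shears\<close>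

text \<open>Coordinates of a point in its cylinder, with copy number 0 in the upper and 1 in the
  lower half of the octagon. Points with \<open>\<bar>Im z\<bar> = sqrt 2 / 2\<close> are given to
  the outer cylinder; by \<open>shear_dev\<close> the twist is independent of this choice.\<close>

definition cyl :: "complex \<Rightarrow> bool" where "cyl z \<longleftrightarrow> sqrt 2 / 2 \<le> \<bar>Im z\<bar>"
definition sco :: "complex \<Rightarrow> real" where "sco z = (if Im z \<ge> 0 then Re z else Re z + lam (cyl z))"
definition yco :: "complex \<Rightarrow> real" where "yco z = (if Im z \<ge> 0 then Im z else Im z + del (cyl z))"

text \<open>
  The affine twist which is the identity on the boundaries of both cylinders; the common modulus makes it the
  same linear map \<open>shear_lin\<close> on each of them.
\<close>

definition shear :: "int \<Rightarrow> complex \<Rightarrow> complex" where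
  "shear \<kappa> z = nf (cyl z) (sco z - of_int \<kappa> * (2 + 2 * sqrt 2) * (yco z - lo (cyl z))) (yco z)"

lemma oct_Im_le: "z \<in> oct \<Longrightarrow> \<bar>Im z\<bar> \<le> 1" "z \<in> oct \<Longrightarrow> \<bar>Re z\<bar> \<le> 1"
  using norm_oct_le[of z] abs_Im_le_cmod[of z] abs_Re_le_cmod[of z] by linarith+

lemma coords:
  assumes "z \<in> oct"
  shows "lo (cyl z) \<le> yco z" "yco z \<le> hi (cyl z)" "z = pt (cyl z) (sco z) (yco z) (if Im z \<ge> 0 then 0 else 1)"
  using oct_Im_le[OF assms] sqrt2
  by (auto simp: lo_def hi_def cyl_def yco_def sco_def pt_def del_def complex_eq_iff)

lemma shear_oct: "z \<in> oct \<Longrightarrow> shear \<kappa> z \<in> oct"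
  unfolding shear_def by (intro nf_oct coords)

text \<open>Modulus times height is the circumference: at the top the twist is by a whole number of
  turns, at the bottom it is zero.\<close>

lemma dev_shear_boundary:
  assumes "y = lo b \<or> y = hi b"
  shows "dev b (s - of_int \<kappa> * (2 + 2 * sqrt 2) * (y - lo b)) y = dev b s y"
proof -
  have le: "lo b \<le> hi b" using sqrt2 by (auto simp: lo_def hi_def)
  have "(2 + 2 * sqrt 2) * (hi b - lo b) = 2 * lam b"
    by (auto simp: lo_def hi_def lam_def algebra_simps)
  then have e: "s - of_int \<kappa> * (2 + 2 * sqrt 2) * (hi b - lo b) = s + of_int (- \<kappa>) * (2 * lam b)"
    by (simp add: mult.assoc)
  from assms show ?thesis
  proof
    assume "y = hi b"
    show ?thesis unfolding \<open>y = hi b\<close> e using dev_periodic[of b "hi b" s "- \<kappa>"] le by simp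
  qed simp
qed

text \<open>The twist may be computed in any cover coordinates of \<open>z\<close>. Away from the
  boundaries the cylinder is determined and coordinates differ by periods; on a boundary both
  descriptions are untwisted by \<open>dev_shear_boundary\<close>.\<close>

lemma shear_dev:
  assumes z: "z \<in> oct" "z = pt b s y m" and y: "lo b \<le> y" "y \<le> hi b"
  shows "rel `` {shear \<kappa> z} = dev b (s - of_int \<kappa> * (2 + 2 * sqrt 2) * (y - lo b)) y"
proof -
  define m0 :: int where "m0 = (if Im z \<ge> 0 then 0 else 1)"
  note c = coords[OF z(1), folded m0_def]
  have L: "rel `` {shear \<kappa> z} = dev (cyl z) (sco z - of_int \<kappa> * (2 + 2 * sqrt 2) * (yco z - lo (cyl z))) (yco z)"
    by (simp add: shear_def dev_def)
  have zz: "rel `` {z} = dev (cyl z) (sco z) (yco z)" "rel `` {z} = dev b s y"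
    using dev_eq[OF c(1,2), of "sco z" m0] dev_eq[OF y, of s m] z c(3) by simp_all
  have Imz: "Im z = y - (if odd m then del b else 0)" "Re z = s - of_int m * lam b" by (simp_all add: z(2) pt_def)
  show ?thesis
  proof (cases "y = lo b \<or> y = hi b")
    case True
    then have "yco z = lo (cyl z) \<or> yco z = hi (cyl z)"
      using Imz(1) sqrt2(2,3) by (cases b; cases "even m") (simp_all add: lo_def hi_def cyl_def yco_def del_def, linarith+)
    then show ?thesis unfolding L using True dev_shear_boundary zz by simp
  next
    case False
    then have yy: "lo b < y" "y < hi b" using y by auto
    have b: "cyl z = b" "(Im z \<ge> 0) = even m"
      using Imz(1) yy sqrt2(2,3) by (cases b; cases "even m"; simp add: lo_def hi_def cyl_def del_def; linarith)+
    then have yc: "yco z = y" using Imz by (auto simp: yco_def)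
    have ev: "even (m - m0)" using b(2) by (auto simp: m0_def)
    then obtain n where n: "m - m0 = 2 * n" by (elim evenE)
    have "s = sco z + of_int (m - m0) * lam b" using Imz b by (auto simp: sco_def m0_def algebra_simps)
    then have "s = sco z + of_int n * (2 * lam b)" by (simp add: n)
    then show ?thesis unfolding L b yc
      using dev_periodic[OF y, of "sco z - of_int \<kappa> * (2 + 2 * sqrt 2) * (y - lo b)" n]
      by (simp add: algebra_simps)
  qed
qed

text \<open>Two glued points are one point of the cover of a common cylinder, seen in copy 0 and in
  copy 1 or -1. The horizontal size of the translation tells which cylinder, and the upper point
  gives the height.\<close>

lemma shear_rel_D:
  assumes "z \<in> oct" "z' \<in> oct" "z' - z \<in> D" "Im z' \<le> Im z"
  shows "(shear \<kappa> z, shear \<kappa> z') \<in> rel"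
proof -
  define b where "b \<longleftrightarrow> \<bar>Re (z' - z)\<bar> = sqrt 2 / 2"
  have d: "\<bar>Re (z' - z)\<bar> = lam b" "\<bar>Im (z' - z)\<bar> = del b"
    using assms(3) by (auto simp: D_iff b_def lam_def del_def)
  have dI: "Im z' = Im z - del b" using d(2) assms(4) by simp
  have y: "lo b \<le> Im z" "Im z \<le> hi b"
  proof -
    have "lo b \<le> Im z \<and> Im z \<le> hi b"
    proof (cases b)
      case True
      then show ?thesis using oct_Im_le[OF assms(1)] oct_Im_le[OF assms(2)] dI by (auto simp: lo_def hi_def del_def)
    next
      case False
      \<comment> \<open>Two points so far apart horizontally lie on the steep edges, which confines
        \<open>Im z\<close> to the central band.\<close>
      then have "1 + sqrt 2 / 2 \<le> \<bar>Re z\<bar> + \<bar>Re z'\<bar>" "Im z' = Im z - sqrt 2 / 2"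
        using d dI by (auto simp: lam_def del_def)
      then have "(sqrt 2 - 1) * \<bar>Im z\<bar> + (sqrt 2 - 1) * \<bar>Im z - sqrt 2 / 2\<bar> \<le> 1 - sqrt 2 / 2"
        using assms(1,2) by (auto simp: oct_iff)
      also have "1 - sqrt 2 / 2 = (sqrt 2 - 1) * (sqrt 2 / 2)" by (simp add: field_simps)
      finally have "(sqrt 2 - 1) * (\<bar>Im z\<bar> + \<bar>Im z - sqrt 2 / 2\<bar>) \<le> (sqrt 2 - 1) * (sqrt 2 / 2)"
        by (simp only: distrib_left)
      then have "\<bar>Im z\<bar> + \<bar>Im z - sqrt 2 / 2\<bar> \<le> sqrt 2 / 2" using sqrt2 by (simp add: mult_le_cancel_left)
      then have "0 \<le> Im z" "Im z \<le> sqrt 2 / 2" by linarith+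
      then show ?thesis using False by (auto simp: lo_def hi_def)
    qed
    then show "lo b \<le> Im z" "Im z \<le> hi b" by auto
  qed
  have z: "z = pt b (Re z) (Im z) 0" by (simp add: pt_def)
  have "z' = pt b (Re z) (Im z) 1 \<or> z' = pt b (Re z) (Im z) (-1)"
    using d dI by (auto simp: pt_def complex_eq_iff)
  then have "rel `` {shear \<kappa> z} = rel `` {shear \<kappa> z'}"
    using shear_dev[OF assms(1) z y] shear_dev[OF assms(2) _ y] by metis
  then show ?thesis using class_eq_iff shear_oct assms by metis
qed

lemma shear_rel:
  assumes "(z, z') \<in> rel"
  shows "(shear \<kappa> z, shear \<kappa> z') \<in> rel"
  using assms
proof (induction rule: rel_induct)
  case refl
  then show ?case using assms rel_refl rel_subset shear_oct by blast
next
  case (step y y')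
  have "(shear \<kappa> y, shear \<kappa> y') \<in> rel"
  proof (cases "Im y' \<le> Im y")
    case False
    then show ?thesis using step D_uminus[of "y' - y"] shear_rel_D[of y' y] rel_sym by simp
  qed (use step shear_rel_D in blast)
  then show ?case using step.IH rel_trans by blast
qed

text \<open>The derivative of \<open>shear\<close>. Positive \<open>\<kappa>\<close> moves upper
  points to the left, the direction that shortens vectors of small positive angle.\<close>

definition shear_lin :: "int \<Rightarrow> complex \<Rightarrow> complex" where
  "shear_lin \<kappa> u = Complex (Re u - of_int \<kappa> * (2 + 2 * sqrt 2) * Im u) (Im u)"

lemma linear_shear_lin: "linear (shear_lin \<kappa>)"
  by (rule linearI) (simp_all add: shear_lin_def complex_eq_iff algebra_simps)

lemma small_interval:
  fixes y v c d :: real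
  assumes "c < d"
  assumes "(c < y \<and> y < d) \<or> (y = c \<and> 0 \<le> v) \<or> (y = d \<and> v \<le> 0)"
  shows "\<exists>e>0. \<forall>t. 0 \<le> t \<and> t \<le> e \<longrightarrow> c \<le> y + t * v \<and> y + t * v \<le> d"
proof -
  have l: "((\<lambda>t. y + t * v) \<longlongrightarrow> y + 0 * v) (at_right 0)" by (intro tendsto_intros)
  have "eventually (\<lambda>t. c \<le> y + t * v \<and> y + t * v \<le> d) (at_right 0)"
    using assms(2)
  proof (elim disjE conjE)
    assume "c < y" "y < d"
    then show ?thesis using order_tendstoD(1)[OF l, of c] order_tendstoD(2)[OF l, of d]
      by (auto elim: eventually_elim2)
  next
    assume *: "y = c" "0 \<le> v"
    then have "eventually (\<lambda>t. y + t * v < d) (at_right 0)" using order_tendstoD(2)[OF l, of d] assms(1) by simp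
    moreover have "eventually (\<lambda>t. 0 < t) (at_right (0::real))" by (rule eventually_at_right_less)
    ultimately show ?thesis by eventually_elim (use * in auto)
  next
    assume *: "y = d" "v \<le> 0"
    then have "eventually (\<lambda>t. y + t * v > c) (at_right 0)" using order_tendstoD(1)[OF l, of c] assms(1) by simp
    moreover have "eventually (\<lambda>t. 0 < t) (at_right (0::real))" by (rule eventually_at_right_less)
    ultimately show ?thesis by eventually_elim (use * in \<open>auto simp: mult_nonneg_nonpos\<close>)
  qed
  then obtain e where e: "e > 0" "\<And>t. 0 < t \<Longrightarrow> t < e \<Longrightarrow> c \<le> y + t * v \<and> y + t * v \<le> d"
    by (auto simp: eventually_at_right_field)
  then show ?thesis using assms
    by (intro exI[of _ "e / 2"]) (auto simp: less_eq_real_def[of 0])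
qed

text \<open>A starting point on a boundary line must be given to the cylinder into which
  \<open>u\<close> points. The second point of the octagon on the ray excludes leaving through the
  top or the bottom.\<close>

lemma band_germ:
  assumes "z \<in> oct" "z + t0 *\<^sub>R u \<in> oct" "t0 > 0"
  obtains b s y m e where "z = pt b s y m" "e > 0"
    "\<And>t. 0 \<le> t \<Longrightarrow> t \<le> e \<Longrightarrow> lo b \<le> y + t * Im u \<and> y + t * Im u \<le> hi b"
proof -
  have *: "\<exists>b s y m e. z = pt b s y m \<and> e > 0 \<and> (\<forall>t. 0 \<le> t \<and> t \<le> e \<longrightarrow> lo b \<le> y + t * Im u \<and> y + t * Im u \<le> hi b)"
    if "(lo b < Im z + r * del b \<and> Im z + r * del b < hi b) \<or> (Im z + r * del b = lo b \<and> 0 \<le> Im u) \<or> (Im z + r * del b = hi b \<and> Im u \<le> 0)"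
      "r = 0 \<or> r = 1" for b r
  proof -
    have "lo b < hi b" using sqrt2 by (auto simp: lo_def hi_def)
    from small_interval[OF this that(1)] obtain e where
      "e > 0" "\<forall>t. 0 \<le> t \<and> t \<le> e \<longrightarrow> lo b \<le> Im z + r * del b + t * Im u \<and> Im z + r * del b + t * Im u \<le> hi b" by blast
    moreover have "z = pt b (Re z + r * lam b) (Im z + r * del b) (if r = 0 then 0 else 1)"
      using that(2) by (auto simp: pt_def complex_eq_iff)
    ultimately show ?thesis by blast
  qed
  have tI: "\<bar>Im z + t0 * Im u\<bar> \<le> 1" using oct_Im_le[OF assms(2)] by simp
  have ge: "Im u \<le> 0" if "Im z = 1"
    using tI that mult_pos_pos[OF assms(3), of "Im u"] by (cases "Im u > 0") auto
  have ge': "0 \<le> Im u" if "Im z = - 1"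
    using tI that mult_pos_neg[OF assms(3), of "Im u"] by (cases "Im u < 0") auto
  have I: "\<bar>Im z\<bar> \<le> 1" using oct_Im_le assms(1) by blast
  have s: "0 < sqrt 2 / 2" "sqrt 2 / 2 < (1::real)" using sqrt2 by auto
  have "\<exists>b r. (r = 0 \<or> r = 1) \<and> ((lo b < Im z + r * del b \<and> Im z + r * del b < hi b) \<or> (Im z + r * del b = lo b \<and> 0 \<le> Im u) \<or> (Im z + r * del b = hi b \<and> Im u \<le> 0))"
  proof (cases "Im u \<ge> 0")
    case True
    then consider "Im z < - sqrt 2 / 2" | "- sqrt 2 / 2 \<le> Im z" "Im z < 0" | "0 \<le> Im z" "Im z < sqrt 2 / 2"
      | "sqrt 2 / 2 \<le> Im z" by linarith
    then show ?thesis
    proof cases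
      case 1 then show ?thesis using I True by (intro exI[of _ True] exI[of _ 1]) (auto simp: lo_def hi_def del_def)
    next
      case 2 then show ?thesis using I True by (intro exI[of _ False] exI[of _ 1]) (auto simp: lo_def hi_def del_def)
    next
      case 3 then show ?thesis using I True by (intro exI[of _ False] exI[of _ 0]) (auto simp: lo_def hi_def del_def)
    next
      case 4 then show ?thesis using I True ge by (intro exI[of _ True] exI[of _ 0]) (auto simp: lo_def hi_def del_def)
    qed
  next
    case False
    then consider "Im z \<le> - sqrt 2 / 2" | "- sqrt 2 / 2 < Im z" "Im z \<le> 0" | "0 < Im z" "Im z \<le> sqrt 2 / 2"
      | "sqrt 2 / 2 < Im z" by linarith
    then show ?thesis
    proof cases
      case 1 then show ?thesis using I False ge' by (intro exI[of _ True] exI[of _ 1]) (auto simp: lo_def hi_def del_def)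
    next
      case 2 then show ?thesis using I False by (intro exI[of _ False] exI[of _ 1]) (auto simp: lo_def hi_def del_def)
    next
      case 3 then show ?thesis using I False by (intro exI[of _ False] exI[of _ 0]) (auto simp: lo_def hi_def del_def)
    next
      case 4 then show ?thesis using I False by (intro exI[of _ True] exI[of _ 0]) (auto simp: lo_def hi_def del_def)
    qed
  qed
  then show ?thesis using * that by metis
qed

text \<open>In cover coordinates \<open>shear\<close> is affine, so a short segment goes to a
  segment with direction \<open>shear_lin \<kappa> u\<close>, and \<open>dev_germ\<close> brings it
  back to the octagon.\<close>

lemma shear_germ:
  assumes "e > 0" "\<And>t. 0 \<le> t \<Longrightarrow> t \<le> e \<Longrightarrow> z + t *\<^sub>R u \<in> oct"
  shows "\<exists>e'>0. \<exists>y\<in>rel `` {shear \<kappa> z}. \<forall>t. 0 \<le> t \<and> t \<le> e' \<longrightarrow> y + t *\<^sub>R shear_lin \<kappa> u \<in> rel `` {shear \<kappa> (z + t *\<^sub>R u)}"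
proof -
  have z: "z \<in> oct" using assms(2)[of 0] assms(1) by simp
  have "z + e *\<^sub>R u \<in> oct" using assms by simp
  from band_germ[OF z this assms(1)] obtain b s y m f where f: "z = pt b s y m" "f > 0"
    "\<And>t. 0 \<le> t \<Longrightarrow> t \<le> f \<Longrightarrow> lo b \<le> y + t * Im u \<and> y + t * Im u \<le> hi b" by blast
  let ?a = "of_int \<kappa> * (2 + 2 * sqrt 2) :: real"
  let ?s = "s - ?a * (y - lo b)"
  have i: "Im (shear_lin \<kappa> u) = Im u" "Re (shear_lin \<kappa> u) = Re u - ?a * Im u" by (simp_all add: shear_lin_def)
  have d: "rel `` {shear \<kappa> (z + t *\<^sub>R u)} = dev b (?s + t * Re (shear_lin \<kappa> u)) (y + t * Im (shear_lin \<kappa> u))"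
    if "0 \<le> t" "t \<le> min e f" for t
    using shear_dev[of "z + t *\<^sub>R u" b "s + t * Re u" "y + t * Im u" m \<kappa>] assms(2)[of t] f(3)[of t] that
    unfolding pt_add f(1) i by (simp add: algebra_simps)
  have ii: "lo b \<le> y + t * Im (shear_lin \<kappa> u) \<and> y + t * Im (shear_lin \<kappa> u) \<le> hi b" if "0 \<le> t" "t \<le> f" for t
    using f(3)[of t] that unfolding i by blast
  obtain e' y0 where e': "e' > 0" "y0 \<in> dev b ?s y"
    "\<And>t. 0 \<le> t \<and> t \<le> e' \<Longrightarrow> y0 + t *\<^sub>R shear_lin \<kappa> u \<in> dev b (?s + t * Re (shear_lin \<kappa> u)) (y + t * Im (shear_lin \<kappa> u))"
    using dev_germ[OF f(2), of b y "shear_lin \<kappa> u" ?s] ii by blast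
  show ?thesis
  proof (intro exI[of _ "min e' (min e f)"] conjI bexI[of _ y0] allI impI)
    show "0 < min e' (min e f)" using e' assms(1) f by simp
    show "y0 \<in> rel `` {shear \<kappa> z}" using e'(2) d[of 0] assms(1) f(2) by simp
    fix t assume t: "0 \<le> t \<and> t \<le> min e' (min e f)"
    then show "y0 + t *\<^sub>R shear_lin \<kappa> u \<in> rel `` {shear \<kappa> (z + t *\<^sub>R u)}"
      using e'(3)[of t] d[of t] by simp
  qed
qed

text \<open>Undoing the twist in the same cover coordinates gives back the point, but
  \<open>nf\<close> may select another representative; hence the relation in place of
  equality.\<close>

lemma shear_inverse:
  assumes "z \<in> oct"
  shows "(shear (- \<kappa>) (shear \<kappa> z), z) \<in> rel"
proof -
  note c = coords[OF assms]
  define b s y where "b = cyl z" and "s = sco z" and "y = yco z"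
  note c' = c[folded b_def s_def y_def]
  obtain m where m: "shear \<kappa> z = pt b (s - of_int \<kappa> * (2 + 2 * sqrt 2) * (y - lo b)) y m"
    using nf_cases[OF c'(1,2)] unfolding shear_def b_def s_def y_def by metis
  have "rel `` {shear (- \<kappa>) (shear \<kappa> z)} = dev b s y"
    using shear_dev[OF shear_oct[OF assms] m c'(1,2), of "- \<kappa>"] by simp
  also have "\<dots> = rel `` {z}" using dev_eq[OF c'(1,2)] c'(3) assms by metis
  finally show ?thesis using class_eq_iff shear_oct assms by metis
qed

lemma shear_vertex:
  assumes "z \<in> oct" "norm z = 1"
  shows "(shear \<kappa> z, z) \<in> rel"
proof -
  note c = coords[OF assms(1)]
  obtain k where k: "k < 8" "z = vtx k" using norm_1_vtx assms by blast
  then have "k = 0 \<or> k = 1 \<or> k = 2 \<or> k = 3 \<or> k = 4 \<or> k = 5 \<or> k = 6 \<or> k = 7" by linarith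
  then have "Im z \<in> {0, sqrt 2 / 2, - sqrt 2 / 2, 1, - 1}"
    unfolding k(2) by (elim disjE; simp only: vtx_values) simp_all
  then have "yco z = lo (cyl z) \<or> yco z = hi (cyl z)"
    using sqrt2 by (auto simp: yco_def lo_def hi_def cyl_def del_def)
  then have "rel `` {shear \<kappa> z} = dev (cyl z) (sco z) (yco z)"
    unfolding shear_def using dev_shear_boundary unfolding dev_def by blast
  also have "\<dots> = rel `` {z}" using dev_eq[OF c(1,2)] c(3) assms by metis
  finally show ?thesis using class_eq_iff shear_oct assms by metis
qed

text \<open>Every twist fixes the class of the vertices, so by \<open>shear_inverse\<close> a point
  sent to a vertex is itself in that class.\<close>

lemma shear_norm:
  assumes "z \<in> oct" "norm z < 1"
  shows "norm (shear \<kappa> z) < 1"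
proof (rule ccontr)
  assume "\<not> ?thesis"
  then have 1: "norm (shear \<kappa> z) = 1" using norm_oct_le[OF shear_oct[OF assms(1)]] by (metis less_eq_real_def)
  have "(shear (- \<kappa>) (shear \<kappa> z), shear \<kappa> z) \<in> rel"
    using shear_vertex[OF shear_oct[OF assms(1)] 1] .
  then have "(shear \<kappa> z, z) \<in> rel" using shear_inverse[OF assms(1)] rel_sym rel_trans by blast
  then show False using norm_rel 1 assms(2) by fastforce
qed

section \<open>Straight paths\<close>

text \<open>The condition of \<open>straight_flow\<close> on an arbitrary set of times; bounded
  intervals serve to compare the image of a segment inside the octagon with the flow.\<close>

definition straight_path :: "real set \<Rightarrow> complex \<Rightarrow> (real \<Rightarrow> complex set) \<Rightarrow> bool" where
  "straight_path I u g \<longleftrightarrow> (\<forall>t\<in>I. g t \<in> octagon_surface 0 1 \<and> g t \<noteq> octagon_singularity 0 1 \<and>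
     (\<exists>e>0. \<exists>y\<in>g t. \<forall>s\<in>I. t \<le> s \<and> s < t + e \<longrightarrow> y + (s - t) *\<^sub>R u \<in> g s) \<and>
     (\<exists>e>0. \<exists>y\<in>g t. \<forall>s\<in>I. t - e < s \<and> s \<le> t \<longrightarrow> y + (s - t) *\<^sub>R u \<in> g s))"

lemma straight_flow_iff:
  "straight_flow 0 1 u x g \<longleftrightarrow> g 0 = rel `` {x} \<and> straight_path {0..} u g"
proof -
  have "(\<forall>s. t \<le> s \<and> s < t + e \<longrightarrow> P s) \<longleftrightarrow> (\<forall>s\<in>{0..}. t \<le> s \<and> s < t + e \<longrightarrow> P s)" if "0 \<le> t" for t e :: real and P
    using that by auto
  then show ?thesis unfolding straight_flow_def straight_path_def
    by (simp add: Ball_def)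
qed

lemma straight_path_forward:
  assumes "straight_path I u g" "t \<in> I"
  obtains e y where "e > 0" "y \<in> g t" "\<And>s. s \<in> I \<Longrightarrow> t \<le> s \<Longrightarrow> s < t + e \<Longrightarrow> y + (s - t) *\<^sub>R u \<in> g s"
proof -
  have "\<exists>e>0. \<exists>y\<in>g t. \<forall>s\<in>I. t \<le> s \<and> s < t + e \<longrightarrow> y + (s - t) *\<^sub>R u \<in> g s"
    using assms unfolding straight_path_def by blast
  then show ?thesis using that by blast
qed

lemma straight_path_backward:
  assumes "straight_path I u g" "t \<in> I"
  obtains e y where "e > 0" "y \<in> g t" "\<And>s. s \<in> I \<Longrightarrow> t - e < s \<Longrightarrow> s \<le> t \<Longrightarrow> y + (s - t) *\<^sub>R u \<in> g s"
proof -
  have "\<exists>e>0. \<exists>y\<in>g t. \<forall>s\<in>I. t - e < s \<and> s \<le> t \<longrightarrow> y + (s - t) *\<^sub>R u \<in> g s"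
    using assms unfolding straight_path_def by blast
  then show ?thesis using that by blast
qed

lemma norm_nonsingular:
  assumes "X \<in> octagon_surface 0 1" "X \<noteq> octagon_singularity 0 1" "y \<in> X"
  shows "norm y < 1"
  using surface_class[OF assms(1,3)] singularity_iff[of y] norm_oct_le[of y] assms(2) by fastforce

text \<open>Two representatives of a nonsingular point are equal or differ by a gluing translation,
  and adding \<open>p\<close> to both preserves the difference. This is where avoiding the
  singularity enters the uniqueness of straight paths.\<close>

lemma rel_translate:
  assumes "y1 \<in> X" "y2 \<in> X" "X \<in> octagon_surface 0 1" "X \<noteq> octagon_singularity 0 1"
    "y1 + p \<in> X1" "y2 + p \<in> X2" "X1 \<in> octagon_surface 0 1" "X2 \<in> octagon_surface 0 1"
  shows "X1 = X2"
proof -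
  note s = surface_class[OF assms(3,1)] surface_class[OF assms(3,2)]
    surface_class[OF assms(7,5)] surface_class[OF assms(8,6)]
  have "(y1, y2) \<in> rel" using s class_eq_iff by metis
  then have "y1 = y2 \<or> y2 - y1 \<in> D" using rel_cases norm_nonsingular[OF assms(3,4,1)] by blast
  then have "(y1 + p, y2 + p) \<in> rel" using s rel_refl rel_D by auto
  then show ?thesis using s class_eq_iff by metis
qed

text \<open>By \<open>rel_translate\<close>, near each time two paths either agree throughout or
  disagree throughout, so the set of agreement is open and closed. Germs on both sides of a time are
  used because the times may lie before or after \<open>t0\<close>.\<close>

lemma straight_path_unique:
  assumes g: "straight_path I u g1" "straight_path I u g2" and I: "connected I" "t0 \<in> I" "g1 t0 = g2 t0" "t \<in> I"
  shows "g1 t = g2 t"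
proof -
  have loc: "\<exists>e>0. \<forall>s\<in>I. \<bar>s - t\<bar> < e \<longrightarrow> (g1 s = g2 s \<longleftrightarrow> g1 t = g2 t)" if t: "t \<in> I" for t
  proof -
    obtain e1 y1 where f1: "e1 > 0" "y1 \<in> g1 t" "\<And>s. s \<in> I \<Longrightarrow> t \<le> s \<Longrightarrow> s < t + e1 \<Longrightarrow> y1 + (s - t) *\<^sub>R u \<in> g1 s"
      using straight_path_forward[OF g(1) t] by blast
    obtain e2 y2 where f2: "e2 > 0" "y2 \<in> g2 t" "\<And>s. s \<in> I \<Longrightarrow> t \<le> s \<Longrightarrow> s < t + e2 \<Longrightarrow> y2 + (s - t) *\<^sub>R u \<in> g2 s"
      using straight_path_forward[OF g(2) t] by blast
    obtain e3 y3 where b1: "e3 > 0" "y3 \<in> g1 t" "\<And>s. s \<in> I \<Longrightarrow> t - e3 < s \<Longrightarrow> s \<le> t \<Longrightarrow> y3 + (s - t) *\<^sub>R u \<in> g1 s"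
      using straight_path_backward[OF g(1) t] by blast
    obtain e4 y4 where b2: "e4 > 0" "y4 \<in> g2 t" "\<And>s. s \<in> I \<Longrightarrow> t - e4 < s \<Longrightarrow> s \<le> t \<Longrightarrow> y4 + (s - t) *\<^sub>R u \<in> g2 s"
      using straight_path_backward[OF g(2) t] by blast
    note f = f1 f2 and b = b1 b2
    have P: "g1 t \<in> octagon_surface 0 1" "g1 t \<noteq> octagon_singularity 0 1" "g2 t \<in> octagon_surface 0 1"
      "g2 t \<noteq> octagon_singularity 0 1" if "t \<in> I" for t
      using g that unfolding straight_path_def by blast+
    have *: "g1 s = g2 s \<longleftrightarrow> g1 t = g2 t"
      if "s \<in> I" "a1 \<in> g1 t" "a2 \<in> g2 t" "a1 + (s - t) *\<^sub>R u \<in> g1 s" "a2 + (s - t) *\<^sub>R u \<in> g2 s" for s a1 a2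
    proof
      assume eq: "g1 s = g2 s"
      show "g1 t = g2 t"
        by (rule rel_translate[of "a1 + (s - t) *\<^sub>R u" "g1 s" "a2 + (s - t) *\<^sub>R u" "- ((s - t) *\<^sub>R u)"])
          (use that eq P t in auto)
    next
      assume eq: "g1 t = g2 t"
      show "g1 s = g2 s"
        by (rule rel_translate[of a1 "g1 t" a2 "(s - t) *\<^sub>R u"]) (use that eq P t in auto)
    qed
    have "g1 s = g2 s \<longleftrightarrow> g1 t = g2 t" if "s \<in> I" "\<bar>s - t\<bar> < min (min e1 e2) (min e3 e4)" for s
    proof (cases "t \<le> s")
      case True
      then show ?thesis using that f by (intro *[of s y1 y2]) auto
    next
      case False
      then show ?thesis using that b by (intro *[of s y3 y4]) auto
    qed
    then show ?thesis using f b by (intro exI[of _ "min (min e1 e2) (min e3 e4)"]) auto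
  qed
  define S where "S = {t \<in> I. g1 t = g2 t}"
  have "openin (top_of_set I) S" "openin (top_of_set I) (I - S)"
  proof -
    have "\<exists>e>0. \<forall>s\<in>I. dist s t < e \<longrightarrow> s \<in> S" if "t \<in> S" for t
      using loc[of t] that unfolding S_def dist_real_def by blast
    then show "openin (top_of_set I) S"
      unfolding openin_euclidean_subtopology_iff by (auto simp: S_def)
    have "\<exists>e>0. \<forall>s\<in>I. dist s t < e \<longrightarrow> s \<in> I - S" if "t \<in> I - S" for t
      using loc[of t] that unfolding S_def dist_real_def by blast
    then show "openin (top_of_set I) (I - S)"
      unfolding openin_euclidean_subtopology_iff by auto
  qed
  then have "S = {} \<or> S = I"
    using I(1) unfolding connected_clopen closedin_def by (auto simp: S_def)
  then show ?thesis using I by (auto simp: S_def)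
qed

section \<open>Affine maps of the surface\<close>

text \<open>
  \<open>G\<close> induces a self-map of the surface with linear part \<open>E\<close>. It need not be continuous on the octagon.
\<close>

definition aff :: "(complex \<Rightarrow> complex) \<Rightarrow> (complex \<Rightarrow> complex) \<Rightarrow> bool" where
  "aff G E \<longleftrightarrow> linear E \<and> (\<forall>z\<in>oct. G z \<in> oct) \<and> (\<forall>z z'. (z, z') \<in> rel \<longrightarrow> (G z, G z') \<in> rel) \<and>
     (\<forall>z\<in>oct. norm z < 1 \<longrightarrow> norm (G z) < 1) \<and>
     (\<forall>z u e. e > 0 \<and> (\<forall>t. 0 \<le> t \<and> t \<le> e \<longrightarrow> z + t *\<^sub>R u \<in> oct) \<longrightarrow>
        (\<exists>e'>0. \<exists>y\<in>rel `` {G z}. \<forall>t. 0 \<le> t \<and> t \<le> e' \<longrightarrow> y + t *\<^sub>R E u \<in> rel `` {G (z + t *\<^sub>R u)}))"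

lemma aff_oct: "aff G E \<Longrightarrow> z \<in> oct \<Longrightarrow> G z \<in> oct"
  and aff_rel: "aff G E \<Longrightarrow> (z, z') \<in> rel \<Longrightarrow> (G z, G z') \<in> rel"
  and aff_norm: "aff G E \<Longrightarrow> z \<in> oct \<Longrightarrow> norm z < 1 \<Longrightarrow> norm (G z) < 1"
  and aff_linear: "aff G E \<Longrightarrow> linear E"
  by (auto simp: aff_def)

lemma aff_germ:
  assumes "aff G E" "e > 0" "\<And>t. 0 \<le> t \<Longrightarrow> t \<le> e \<Longrightarrow> z + t *\<^sub>R u \<in> oct"
  obtains e' y where "e' > 0" "y \<in> rel `` {G z}" "\<And>t. 0 \<le> t \<Longrightarrow> t \<le> e' \<Longrightarrow> y + t *\<^sub>R E u \<in> rel `` {G (z + t *\<^sub>R u)}"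
  using assms unfolding aff_def by (metis (no_types, lifting))

lemma aff_shear: "aff (shear \<kappa>) (shear_lin \<kappa>)"
  unfolding aff_def using linear_shear_lin shear_oct shear_rel shear_norm shear_germ by (auto 0 0)

lemma aff_isometry:
  assumes "linear E" "\<And>z. z \<in> oct \<Longrightarrow> E z \<in> oct" "\<And>d. d \<in> D \<Longrightarrow> E d \<in> D" "\<And>z. norm (E z) = norm z"
  shows "aff E E"
proof -
  have "(E z, E z') \<in> rel" if "(z, z') \<in> rel" for z z'
    using that
  proof (induction rule: rel_induct)
    case refl
    then show ?case using that rel_subset assms(2) rel_refl by blast
  next
    case (step y y')
    then have "(E y, E y') \<in> rel" using assms by (intro rel_D) (auto simp flip: linear_diff)
    then show ?case using step.IH rel_trans by blast
  qed
  moreover have "\<exists>e'>0. \<exists>y\<in>rel `` {E z}. \<forall>t. 0 \<le> t \<and> t \<le> e' \<longrightarrow> y + t *\<^sub>R E u \<in> rel `` {E (z + t *\<^sub>R u)}"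
    if e: "e > 0" "\<forall>t. 0 \<le> t \<and> t \<le> e \<longrightarrow> z + t *\<^sub>R u \<in> oct" for z u e
  proof (intro exI[of _ e] conjI bexI[of _ "E z"] allI impI)
    show "E z \<in> rel `` {E z}" using assms(2)[of z] e(2)[rule_format, of 0] e(1) rel_refl by auto
    fix t assume "0 \<le> t \<and> t \<le> e"
    then have "E (z + t *\<^sub>R u) \<in> oct" using assms(2) e(2) by blast
    moreover have "E (z + t *\<^sub>R u) = E z + t *\<^sub>R E u" using assms(1) by (simp add: linear_add linear_cmul)
    ultimately show "E z + t *\<^sub>R E u \<in> rel `` {E (z + t *\<^sub>R u)}" using rel_refl by auto
  qed (use e in auto)
  ultimately show ?thesis unfolding aff_def using assms by auto
qed

lemma D_vtx: "vtx (k + 5) - vtx k \<in> D"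
proof -
  have p: "vtx k = vtx (k mod 8)" for k
  proof (induction k rule: less_induct)
    case (less k)
    show ?case
    proof (cases "k < 8")
      case False
      then have "vtx k = vtx (k - 8)" using octagon_vertex_add_8[of 0 1 "k - 8"] by simp
      with less[of "k - 8"] False show ?thesis by (simp add: le_mod_geq)
    qed simp
  qed
  have "vtx (k + 5) - vtx k = vtx (k mod 8 + 5) - vtx (k mod 8)"
    using p[of "k + 5"] p[of k] p[of "k mod 8 + 5"] by (simp add: mod_simps)
  then show ?thesis unfolding D_def by auto
qed

lemma rotate_D: "d \<in> D \<Longrightarrow> cis (pi / 4) * d \<in> D"
proof -
  assume "d \<in> D"
  then obtain k where "d = vtx (k + 5) - vtx k" by (auto simp: D_def)
  then have "cis (pi / 4) * d = vtx (Suc k + 5) - vtx (Suc k)"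
    unfolding add_Suc vtx_Suc by (simp add: right_diff_distrib)
  then show ?thesis using D_vtx[of "Suc k"] by simp
qed

lemma linear_mult: "linear (\<lambda>z. c * z)" for c :: complex
  by (intro bounded_linear.linear bounded_linear_mult_right)

lemma aff_rotate: "aff (\<lambda>z. cis (pi / 4) * z) (\<lambda>z. cis (pi / 4) * z)"
  by (rule aff_isometry) (auto simp: linear_mult rotate_oct_iff rotate_D norm_mult)

lemma aff_cnj: "aff cnj cnj"
  by (rule aff_isometry) (auto simp: cnj_oct D_cnj linear_iff)

lemma aff_uminus: "aff uminus uminus"
  by (rule aff_isometry) (auto simp: uminus_oct D_uminus linear_iff)

lemma aff_id: "aff id id"
  by (rule aff_isometry) (auto simp: linear_iff)

lemma aff_comp:
  assumes "aff G E" "aff G' E'"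
  shows "aff (G' \<circ> G) (E' \<circ> E)"
  unfolding aff_def
proof (intro conjI allI impI ballI)
  show "linear (E' \<circ> E)" using assms aff_linear linear_compose by blast
  fix z u :: complex and e :: real
  assume e: "e > 0 \<and> (\<forall>t. 0 \<le> t \<and> t \<le> e \<longrightarrow> z + t *\<^sub>R u \<in> oct)"
  obtain e1 y1 where 1: "e1 > 0" "y1 \<in> rel `` {G z}"
    "\<And>t. 0 \<le> t \<Longrightarrow> t \<le> e1 \<Longrightarrow> y1 + t *\<^sub>R E u \<in> rel `` {G (z + t *\<^sub>R u)}"
    using aff_germ[OF assms(1), of e z u] e by auto
  have "\<And>t. 0 \<le> t \<Longrightarrow> t \<le> e1 \<Longrightarrow> y1 + t *\<^sub>R E u \<in> oct" using 1(3) rel_subset by blast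
  then obtain e2 y2 where 2: "e2 > 0" "y2 \<in> rel `` {G' y1}"
    "\<And>t. 0 \<le> t \<Longrightarrow> t \<le> e2 \<Longrightarrow> y2 + t *\<^sub>R E' (E u) \<in> rel `` {G' (y1 + t *\<^sub>R E u)}"
    using aff_germ[OF assms(2) 1(1)] by blast
  have tr: "rel `` {G' y} \<subseteq> rel `` {G' x}" if "y \<in> rel `` {x}" for x y
    using that aff_rel[OF assms(2), of x y] rel_trans by blast
  show "\<exists>e'>0. \<exists>y\<in>rel `` {(G' \<circ> G) z}. \<forall>t. 0 \<le> t \<and> t \<le> e' \<longrightarrow> y + t *\<^sub>R (E' \<circ> E) u \<in> rel `` {(G' \<circ> G) (z + t *\<^sub>R u)}"
  proof (intro exI[of _ "min e1 e2"] conjI bexI[of _ y2] allI impI)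
    show "y2 \<in> rel `` {(G' \<circ> G) z}" using 2(2) tr[OF 1(2)] by auto
    fix t assume t: "0 \<le> t \<and> t \<le> min e1 e2"
    then show "y2 + t *\<^sub>R (E' \<circ> E) u \<in> rel `` {(G' \<circ> G) (z + t *\<^sub>R u)}"
      using 2(3)[of t] tr[OF 1(3)[of t]] by auto
  qed (use 1 2 in auto)
qed (use assms aff_oct aff_rel aff_norm in auto)

definition lift :: "(complex \<Rightarrow> complex) \<Rightarrow> complex set \<Rightarrow> complex set" where
  "lift G X = rel `` (G ` X)"

lemma lift_class:
  assumes "aff G E" "z \<in> oct"
  shows "lift G (rel `` {z}) = rel `` {G z}"
proof
  show "lift G (rel `` {z}) \<subseteq> rel `` {G z}"
    unfolding lift_def using aff_rel[OF assms(1)] rel_trans by blast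
  show "rel `` {G z} \<subseteq> lift G (rel `` {z})"
    unfolding lift_def using rel_refl[OF assms(2)] by blast
qed

text \<open>Near each time the path is a segment in the octagon starting from some representative,
  and \<open>aff\<close> takes such a germ to a germ of a segment.\<close>

lemma lift_straight_path:
  assumes "aff G E" "straight_path I u g" "is_interval I"
  shows "straight_path I (E u) (\<lambda>t. lift G (g t))"
  unfolding straight_path_def
proof (intro ballI conjI)
  fix t assume t: "t \<in> I"
  have P: "g t \<in> octagon_surface 0 1" "g t \<noteq> octagon_singularity 0 1" if "t \<in> I" for t
    using assms(2) that unfolding straight_path_def by blast+
  have L: "lift G (g t) = rel `` {G y}" "G y \<in> oct" if "t \<in> I" "y \<in> g t" for y t
    using lift_class[OF assms(1)] surface_class[OF P(1) that(2)] that aff_oct[OF assms(1)] by auto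
  obtain y where y: "y \<in> g t" using surface_cases[OF P(1)[OF t]] by metis
  show "lift G (g t) \<in> octagon_surface 0 1" using L[OF t y] class_in_surface by auto
  have "norm (G y) < 1" using aff_norm[OF assms(1)] norm_nonsingular[OF P[OF t] y] surface_class[OF P(1)[OF t] y] by simp
  then show "lift G (g t) \<noteq> octagon_singularity 0 1" using L[OF t y] singularity_iff by fastforce
  \<comment> \<open>The sign \<open>r\<close> treats the forward and the backward germ at
    once.\<close>
  have key: "\<exists>e'>0. \<exists>y\<in>lift G (g t). \<forall>s\<in>I. 0 \<le> r * (s - t) \<and> r * (s - t) < e' \<longrightarrow> y + (s - t) *\<^sub>R E u \<in> lift G (g s)"
    if r: "r = 1 \<or> r = -1" and e: "e > 0" "y \<in> g t" "\<And>s. s \<in> I \<Longrightarrow> 0 \<le> r * (s - t) \<Longrightarrow> r * (s - t) < e \<Longrightarrow> y + (s - t) *\<^sub>R u \<in> g s" for r e y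
  \<comment> \<open>If \<open>t\<close> is the end of \<open>I\<close> on this side, only
    \<open>s = t\<close> is left; otherwise another time of \<open>I\<close> provides the segment
    demanded by \<open>aff_germ\<close>.\<close>
  proof (cases "\<exists>s0\<in>I. r * (s0 - t) > 0")
    case False
    then have "s = t" if "s \<in> I" "0 \<le> r * (s - t)" for s using that r by force
    then have "G y + (s - t) *\<^sub>R E u \<in> lift G (g s)" if "s \<in> I" "0 \<le> r * (s - t)" for s
      using L[OF t e(2)] rel_refl that by fastforce
    then show ?thesis using L[OF t e(2)] rel_refl
      by (intro exI[of _ 1] conjI bexI[of _ "G y"]) auto
  next
    case True
    then obtain s0 where s0: "s0 \<in> I" "r * (s0 - t) > 0" by blast
    define f where "f = min (e / 2) (r * (s0 - t))"
    have f: "f > 0" using e s0 by (auto simp: f_def)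
    have rr: "r * r = 1" using r by auto
    have tI: "t + r * x \<in> I" if "0 \<le> x" "x \<le> f" for x
    proof -
      have "t + r * x \<in> closed_segment t s0"
        using r that by (auto simp: f_def closed_segment_eq_real_ivl)
      then show ?thesis using assms(3) t s0(1) by (meson closed_segment_subset is_interval_convex subset_iff)
    qed
    have "y + x *\<^sub>R (r *\<^sub>R u) \<in> oct" if "0 \<le> x" "x \<le> f" for x
    proof -
      have "r * (t + r * x - t) = x" using rr by (simp flip: mult.assoc)
      moreover have "f < e" using e by (auto simp: f_def)
      ultimately have "0 \<le> r * (t + r * x - t)" "r * (t + r * x - t) < e" using that by linarith+
      from e(3)[OF tI[OF that] this] have "y + (t + r * x - t) *\<^sub>R u \<in> g (t + r * x)" .
      then show ?thesis using surface_class P(1) tI[OF that] by (fastforce simp: mult.commute)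
    qed
    then obtain e' y' where e': "e' > 0" "y' \<in> rel `` {G y}"
      "\<And>x. 0 \<le> x \<Longrightarrow> x \<le> e' \<Longrightarrow> y' + x *\<^sub>R E (r *\<^sub>R u) \<in> rel `` {G (y + x *\<^sub>R (r *\<^sub>R u))}"
      using aff_germ[OF assms(1) f, of y "r *\<^sub>R u"] by blast
    show ?thesis
    proof (intro exI[of _ "min e e'"] conjI bexI[of _ y'] ballI impI)
      show "y' \<in> lift G (g t)" using L[OF t e(2)] e'(2) by simp
      fix s assume s: "s \<in> I" "0 \<le> r * (s - t) \<and> r * (s - t) < min e e'"
      have m: "y' + (r * (s - t)) *\<^sub>R E (r *\<^sub>R u) \<in> rel `` {G (y + (r * (s - t)) *\<^sub>R (r *\<^sub>R u))}"
        using e'(3) s by simp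
      have eqs: "(r * (s - t)) *\<^sub>R (r *\<^sub>R u) = (s - t) *\<^sub>R u" "(r * (s - t)) *\<^sub>R E (r *\<^sub>R u) = (s - t) *\<^sub>R E u"
        using r aff_linear[OF assms(1)] by (auto simp: linear_cmul linear_neg)
      have "y' + (s - t) *\<^sub>R E u \<in> rel `` {G (y + (s - t) *\<^sub>R u)}" using m unfolding eqs .
      then show "y' + (s - t) *\<^sub>R E u \<in> lift G (g s)" using L[OF s(1) e(3)] s by simp
    qed (use e e' in auto)
  qed
  show "\<exists>e>0. \<exists>y\<in>lift G (g t). \<forall>s\<in>I. t \<le> s \<and> s < t + e \<longrightarrow> y + (s - t) *\<^sub>R E u \<in> lift G (g s)"
  proof -
    obtain e y where e: "e > 0" "y \<in> g t" "\<And>s. s \<in> I \<Longrightarrow> t \<le> s \<Longrightarrow> s < t + e \<Longrightarrow> y + (s - t) *\<^sub>R u \<in> g s"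
      using straight_path_forward[OF assms(2) t] by blast
    obtain e' y' where e': "e' > 0" "y' \<in> lift G (g t)"
      "\<And>s. s \<in> I \<Longrightarrow> 0 \<le> 1 * (s - t) \<and> 1 * (s - t) < e' \<Longrightarrow> y' + (s - t) *\<^sub>R E u \<in> lift G (g s)"
      using key[of 1 e y] e by auto
    show ?thesis using e' by (intro exI[of _ e'] conjI bexI[of _ y']) auto
  qed
  show "\<exists>e>0. \<exists>y\<in>lift G (g t). \<forall>s\<in>I. t - e < s \<and> s \<le> t \<longrightarrow> y + (s - t) *\<^sub>R E u \<in> lift G (g s)"
  proof -
    obtain e y where e: "e > 0" "y \<in> g t" "\<And>s. s \<in> I \<Longrightarrow> t - e < s \<Longrightarrow> s \<le> t \<Longrightarrow> y + (s - t) *\<^sub>R u \<in> g s"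
      using straight_path_backward[OF assms(2) t] by blast
    obtain e' y' where e': "e' > 0" "y' \<in> lift G (g t)"
      "\<And>s. s \<in> I \<Longrightarrow> 0 \<le> (-1) * (s - t) \<and> (-1) * (s - t) < e' \<Longrightarrow> y' + (s - t) *\<^sub>R E u \<in> lift G (g s)"
      using key[of "-1" e y] e by auto
    show ?thesis using e' by (intro exI[of _ e'] conjI bexI[of _ y']) auto
  qed
qed

lemma straight_path_segment:
  assumes "\<And>t. t \<in> I \<Longrightarrow> z + t *\<^sub>R u \<in> oct" "\<And>t. t \<in> I \<Longrightarrow> norm (z + t *\<^sub>R u) < 1"
  shows "straight_path I u (\<lambda>t. rel `` {z + t *\<^sub>R u})"
  unfolding straight_path_def
proof (intro ballI conjI)
  fix t assume t: "t \<in> I"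
  show "rel `` {z + t *\<^sub>R u} \<in> octagon_surface 0 1" using class_in_surface assms(1)[OF t] by blast
  show "rel `` {z + t *\<^sub>R u} \<noteq> octagon_singularity 0 1" using singularity_iff assms[OF t] by fastforce
  have "z + t *\<^sub>R u + (s - t) *\<^sub>R u \<in> rel `` {z + s *\<^sub>R u}" if "s \<in> I" for s
    using rel_refl[OF assms(1)[OF that]] by (simp add: algebra_simps)
  then show "\<exists>e>0. \<exists>y\<in>rel `` {z + t *\<^sub>R u}. \<forall>s\<in>I. t \<le> s \<and> s < t + e \<longrightarrow> y + (s - t) *\<^sub>R u \<in> rel `` {z + s *\<^sub>R u}"
    "\<exists>e>0. \<exists>y\<in>rel `` {z + t *\<^sub>R u}. \<forall>s\<in>I. t - e < s \<and> s \<le> t \<longrightarrow> y + (s - t) *\<^sub>R u \<in> rel `` {z + s *\<^sub>R u}"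
    using rel_refl[OF assms(1)[OF t]] by (auto intro!: exI[of _ 1] bexI[of _ "z + t *\<^sub>R u"])
qed

lemma straight_path_subset:
  assumes "straight_path I u g" "J \<subseteq> I"
  shows "straight_path J u g"
  unfolding straight_path_def
proof (intro ballI conjI)
  fix t assume "t \<in> J"
  then have t: "t \<in> I" using assms(2) by blast
  show "g t \<in> octagon_surface 0 1" "g t \<noteq> octagon_singularity 0 1"
    using assms(1) t unfolding straight_path_def by blast+
  obtain e y where "e > 0" "y \<in> g t" "\<And>s. s \<in> I \<Longrightarrow> t \<le> s \<Longrightarrow> s < t + e \<Longrightarrow> y + (s - t) *\<^sub>R u \<in> g s"
    using straight_path_forward[OF assms(1) t] by blast
  then show "\<exists>e>0. \<exists>y\<in>g t. \<forall>s\<in>J. t \<le> s \<and> s < t + e \<longrightarrow> y + (s - t) *\<^sub>R u \<in> g s" using assms(2) by blast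
  obtain e y where "e > 0" "y \<in> g t" "\<And>s. s \<in> I \<Longrightarrow> t - e < s \<Longrightarrow> s \<le> t \<Longrightarrow> y + (s - t) *\<^sub>R u \<in> g s"
    using straight_path_backward[OF assms(1) t] by blast
  then show "\<exists>e>0. \<exists>y\<in>g t. \<forall>s\<in>J. t - e < s \<and> s \<le> t \<longrightarrow> y + (s - t) *\<^sub>R u \<in> g s" using assms(2) by blast
qed

lemma straight_path_cong:
  assumes "straight_path I u g" "\<And>t. t \<in> I \<Longrightarrow> g' t = g t"
  shows "straight_path I u g'"
proof -
  have "straight_path I u g' = straight_path I u g"
    unfolding straight_path_def using assms(2) by (intro ball_cong refl) (simp cong: ball_cong)
  then show ?thesis using assms(1) by simp
qed

lemma straight_path_affine:
  assumes "straight_path I u g" "r > 0"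
  shows "straight_path {t. a + r * t \<in> I} (r *\<^sub>R u) (\<lambda>t. g (a + r * t))"
  unfolding straight_path_def
proof (intro ballI conjI)
  fix t assume "t \<in> {t. a + r * t \<in> I}"
  then have t: "a + r * t \<in> I" by simp
  show "g (a + r * t) \<in> octagon_surface 0 1" "g (a + r * t) \<noteq> octagon_singularity 0 1"
    using assms(1) t unfolding straight_path_def by blast+
  have eq: "(a + r * s - (a + r * t)) *\<^sub>R u = (s - t) *\<^sub>R r *\<^sub>R u" for s by (simp add: algebra_simps)
  obtain e y where e: "e > 0" "y \<in> g (a + r * t)"
    "\<And>s. s \<in> I \<Longrightarrow> a + r * t \<le> s \<Longrightarrow> s < a + r * t + e \<Longrightarrow> y + (s - (a + r * t)) *\<^sub>R u \<in> g s"
    using straight_path_forward[OF assms(1) t] by blast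
  show "\<exists>e>0. \<exists>y\<in>g (a + r * t). \<forall>s\<in>{t. a + r * t \<in> I}. t \<le> s \<and> s < t + e \<longrightarrow> y + (s - t) *\<^sub>R r *\<^sub>R u \<in> g (a + r * s)"
  proof (intro exI[of _ "e / r"] conjI bexI[OF _ e(2)] ballI impI)
    fix s assume s: "s \<in> {t. a + r * t \<in> I}" "t \<le> s \<and> s < t + e / r"
    then have "r * s < r * (t + e / r)" using assms(2) by simp
    then show "y + (s - t) *\<^sub>R r *\<^sub>R u \<in> g (a + r * s)"
      using e(3)[of "a + r * s"] s assms(2) unfolding eq by (simp add: distrib_left)
  qed (use e assms in auto)
  obtain e y where e: "e > 0" "y \<in> g (a + r * t)"
    "\<And>s. s \<in> I \<Longrightarrow> a + r * t - e < s \<Longrightarrow> s \<le> a + r * t \<Longrightarrow> y + (s - (a + r * t)) *\<^sub>R u \<in> g s"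
    using straight_path_backward[OF assms(1) t] by blast
  show "\<exists>e>0. \<exists>y\<in>g (a + r * t). \<forall>s\<in>{t. a + r * t \<in> I}. t - e < s \<and> s \<le> t \<longrightarrow> y + (s - t) *\<^sub>R r *\<^sub>R u \<in> g (a + r * s)"
  proof (intro exI[of _ "e / r"] conjI bexI[OF _ e(2)] ballI impI)
    fix s assume s: "s \<in> {t. a + r * t \<in> I}" "t - e / r < s \<and> s \<le> t"
    then have "r * (t - e / r) < r * s" using assms(2) by simp
    then show "y + (s - t) *\<^sub>R r *\<^sub>R u \<in> g (a + r * s)"
      using e(3)[of "a + r * s"] s assms(2) unfolding eq by (simp add: right_diff_distrib)
  qed (use e assms in auto)
qed

section \<open>The straight-line flow\<close>

text \<open>
  Cylinder coordinates in which a point on a horizontal boundary belongs to the cylinder above it, as needed to follow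
  an upward direction.
\<close>

definition fcyl :: "complex \<Rightarrow> bool" where "fcyl z \<longleftrightarrow> sqrt 2 / 2 \<le> Im z \<or> Im z < - sqrt 2 / 2"
definition fsco :: "complex \<Rightarrow> real" where "fsco z = (if Im z \<ge> 0 then Re z else Re z + lam (fcyl z))"
definition fyco :: "complex \<Rightarrow> real" where "fyco z = (if Im z \<ge> 0 then Im z else Im z + del (fcyl z))"

definition exit_time :: "complex \<Rightarrow> complex \<Rightarrow> real" where
  "exit_time u z = (hi (fcyl z) - fyco z) / Im u"

definition cross :: "complex \<Rightarrow> complex \<Rightarrow> real \<Rightarrow> complex" where
  "cross u z t = nf (fcyl z) (fsco z + t * Re u) (fyco z + t * Im u)"

definition next_point :: "complex \<Rightarrow> complex \<Rightarrow> complex" where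
  "next_point u z = nf (fcyl z) (fsco z + exit_time u z * Re u) (hi (fcyl z))"

text \<open>The successive points at which an upward orbit enters a new cylinder. Between them the
  motion is linear in cover coordinates, so the whole flow is given by formulas.\<close>

primrec zs :: "complex \<Rightarrow> complex \<Rightarrow> nat \<Rightarrow> complex" where
  "zs u x 0 = x"
| "zs u x (Suc n) = next_point u (zs u x n)"

definition ts :: "complex \<Rightarrow> complex \<Rightarrow> nat \<Rightarrow> real" where
  "ts u x n = (\<Sum>i<n. exit_time u (zs u x i))"

definition up_flow :: "complex \<Rightarrow> complex \<Rightarrow> real \<Rightarrow> complex" where
  "up_flow u x t = (let n = (LEAST n. t < ts u x (Suc n)) in cross u (zs u x n) (t - ts u x n))"

text \<open>All vertices lie on the horizontal boundaries, so it is enough to keep the starting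
  point and the crossing points away from them.\<close>

definition up_generic :: "complex \<Rightarrow> complex \<Rightarrow> bool" where
  "up_generic u x \<longleftrightarrow> x \<in> oct \<and> (\<forall>n. norm (zs u x n) < 1)"

lemma hi_lo: "hi b - lo b \<ge> 1 - sqrt 2 / 2" "lo b < hi b"
  using sqrt2 by (auto simp: hi_def lo_def)

lemma fcoords:
  assumes "z \<in> oct"
  shows "lo (fcyl z) \<le> fyco z" "fyco z \<le> hi (fcyl z)" "z = pt (fcyl z) (fsco z) (fyco z) (if Im z \<ge> 0 then 0 else 1)"
  using oct_Im_le[OF assms] sqrt2(2,3)
  by (auto simp: lo_def hi_def fcyl_def fyco_def fsco_def pt_def del_def complex_eq_iff)

lemma fyco_less:
  assumes "z \<in> oct" "norm z < 1"
  shows "fyco z < hi (fcyl z)"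
  using abs_Im_le_cmod[of z] assms(2) sqrt2(2,3)
  by (auto simp: lo_def hi_def fcyl_def fyco_def del_def)

lemma class_fcoords:
  assumes "z \<in> oct"
  shows "rel `` {z} = dev (fcyl z) (fsco z) (fyco z)"
  using dev_eq[OF fcoords(1,2)[OF assms], of "fsco z"] fcoords(3)[OF assms] assms by metis

lemma zs_oct:
  assumes "x \<in> oct"
  shows "zs u x n \<in> oct"
proof (induction n)
  case (Suc n)
  then show ?case using hi_lo(2) by (simp add: next_point_def nf_oct less_imp_le)
qed (use assms in simp)

lemma up_genericD: "up_generic u x \<Longrightarrow> zs u x n \<in> oct" "up_generic u x \<Longrightarrow> norm (zs u x n) < 1"
  by (auto simp: up_generic_def zs_oct)

text \<open>The top of a cylinder is the bottom of the next one in the convention of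
  \<open>fcyl\<close>; height 1 in the octagon, where this fails, is reached only at a vertex. Every
  crossing after the initial one therefore takes a full cylinder height, and the crossing times
  cannot accumulate.\<close>

lemma zs_fyco:
  assumes "up_generic u x"
  shows "fyco (zs u x (Suc n)) = lo (fcyl (zs u x (Suc n)))"
proof -
  let ?z = "zs u x n" and ?w = "zs u x (Suc n)"
  have w: "?w = nf (fcyl ?z) (fsco ?z + exit_time u ?z * Re u) (hi (fcyl ?z))" by (simp add: next_point_def)
  obtain m where "?w = pt (fcyl ?z) (fsco ?z + exit_time u ?z * Re u) (hi (fcyl ?z)) m"
    using nf_cases[of "fcyl ?z" "hi (fcyl ?z)"] hi_lo(2) w by (metis less_imp_le order_refl)
  then have "Im ?w = hi (fcyl ?z) - (if odd m then del (fcyl ?z) else 0)" by (simp only: pt_def complex.sel)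
  moreover have "Im ?w < 1" using up_genericD(2)[OF assms, of "Suc n"] abs_Im_le_cmod[of ?w] by linarith
  ultimately have "Im ?w = sqrt 2 / 2 \<or> Im ?w = 0 \<or> Im ?w = - sqrt 2 / 2"
    by (cases "fcyl ?z"; cases "odd m") (auto simp: hi_def del_def)
  then show ?thesis using sqrt2(2,3) by (auto simp: fyco_def lo_def fcyl_def del_def)
qed

lemma exit_time_pos:
  assumes "up_generic u x" "Im u > 0"
  shows "exit_time u (zs u x n) > 0"
  using fyco_less up_genericD[OF assms(1)] assms(2) by (simp add: exit_time_def)

lemma exit_time_ge:
  assumes "up_generic u x" "Im u > 0"
  shows "exit_time u (zs u x (Suc n)) \<ge> (1 - sqrt 2 / 2) / Im u"
  unfolding exit_time_def zs_fyco[OF assms(1)] using hi_lo(1) assms(2) by (intro divide_right_mono) auto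

lemma ts_0: "ts u x 0 = 0" and ts_Suc: "ts u x (Suc n) = ts u x n + exit_time u (zs u x n)"
  by (simp_all add: ts_def)

lemma ts_strict:
  assumes "up_generic u x" "Im u > 0"
  shows "strict_mono (ts u x)"
  using exit_time_pos[OF assms] by (simp add: strict_mono_Suc_iff ts_Suc)

lemma ts_unbounded:
  assumes "up_generic u x" "Im u > 0"
  shows "\<exists>n. t < ts u x n"
proof -
  define c where "c = (1 - sqrt 2 / 2) / Im u"
  have c: "c > 0" using sqrt2 assms(2) by (simp add: c_def)
  have "real n * c \<le> ts u x (Suc n)" for n
  proof (induction n)
    case 0
    then show ?case using exit_time_pos[OF assms, of 0] by (simp add: ts_Suc ts_0)
  next
    case (Suc n)
    have "ts u x (Suc (Suc n)) = ts u x (Suc n) + exit_time u (zs u x (Suc n))" by (rule ts_Suc)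
    moreover have "real (Suc n) * c = real n * c + c" by (simp add: algebra_simps)
    ultimately show ?case using exit_time_ge[OF assms, of n] Suc unfolding c_def[symmetric] by linarith
  qed
  moreover obtain n where "t < real n * c" using reals_Archimedean3[OF c] by blast
  ultimately show ?thesis by (metis less_le_trans)
qed

lemma up_flow_index:
  assumes "up_generic u x" "Im u > 0" "t \<ge> 0"
  obtains n where "ts u x n \<le> t" "t < ts u x (Suc n)" "up_flow u x t = cross u (zs u x n) (t - ts u x n)"
proof -
  define n where "n = (LEAST n. t < ts u x (Suc n))"
  obtain m where m: "t < ts u x m" using ts_unbounded[OF assms(1,2)] by blast
  then have "m \<noteq> 0" using assms(3) by (metis ts_0 not_less)
  then have ex: "t < ts u x (Suc (m - 1))" using m by simp
  have 1: "t < ts u x (Suc n)" unfolding n_def by (rule LeastI[of "\<lambda>n. t < ts u x (Suc n)", OF ex])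
  have 2: "ts u x n \<le> t"
  proof (cases n)
    case (Suc k)
    then have "\<not> t < ts u x (Suc k)" using not_less_Least[of k "\<lambda>n. t < ts u x (Suc n)"] by (simp add: n_def)
    then show ?thesis using Suc by simp
  qed (use assms ts_0 in simp)
  show ?thesis using that[OF 2 1] by (simp add: up_flow_def n_def Let_def)
qed

lemma level_le:
  assumes "up_generic u x" "Im u > 0" "ts u x n \<le> t" "t \<le> ts u x (Suc n)"
  shows "lo (fcyl (zs u x n)) \<le> fyco (zs u x n) + (t - ts u x n) * Im u"
    "fyco (zs u x n) + (t - ts u x n) * Im u \<le> hi (fcyl (zs u x n))"
proof -
  let ?z = "zs u x n"
  note f = fcoords[OF up_genericD(1)[OF assms(1), of n]]
  show "lo (fcyl ?z) \<le> fyco ?z + (t - ts u x n) * Im u"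
    using f(1) assms by (simp add: add_increasing2)
  have "(t - ts u x n) * Im u \<le> exit_time u ?z * Im u"
    using assms by (intro mult_right_mono) (auto simp: ts_Suc)
  then show "fyco ?z + (t - ts u x n) * Im u \<le> hi (fcyl ?z)"
    using assms(2) by (simp add: exit_time_def)
qed

definition up_path :: "complex \<Rightarrow> complex \<Rightarrow> real \<Rightarrow> complex set" where
  "up_path u x t = rel `` {up_flow u x t}"

text \<open>Valid on a closed interval: at its right end the formulas of two successive crossings
  describe the same class. The backward germ at a crossing time rests on this.\<close>

lemma up_path_dev:
  assumes "up_generic u x" "Im u > 0" "ts u x n \<le> t" "t \<le> ts u x (Suc n)"
  shows "up_path u x t = dev (fcyl (zs u x n)) (fsco (zs u x n) + (t - ts u x n) * Re u) (fyco (zs u x n) + (t - ts u x n) * Im u)"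
proof -
  have "t \<ge> 0" using assms(3) strict_mono_less_eq[OF ts_strict[OF assms(1,2)], of 0 n] by (simp add: ts_0)
  then obtain k where k: "ts u x k \<le> t" "t < ts u x (Suc k)" "up_flow u x t = cross u (zs u x k) (t - ts u x k)"
    using up_flow_index[OF assms(1,2)] by blast
  note sm = strict_mono_less[OF ts_strict[OF assms(1,2)]] strict_mono_less_eq[OF ts_strict[OF assms(1,2)]]
  have "n < Suc k" "k \<le> Suc n" using k assms(3,4) sm by (meson le_less_trans order.trans)+
  then have "k = n \<or> k = Suc n" by linarith
  then show ?thesis
  proof
    assume "k = n"
    then show ?thesis using k(3) by (simp add: up_path_def cross_def dev_def)
  next
    assume kn: "k = Suc n"
    then have t: "t = ts u x (Suc n)" using k assms(4) by simp
    have e: "t - ts u x n = exit_time u (zs u x n)" by (simp add: t ts_Suc)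
    have h: "fyco (zs u x n) + (t - ts u x n) * Im u = hi (fcyl (zs u x n))"
      unfolding e using assms(2) by (simp add: exit_time_def)
    have "up_path u x t = dev (fcyl (zs u x k)) (fsco (zs u x k)) (fyco (zs u x k))"
      unfolding up_path_def k(3) cross_def dev_def using t kn by simp
    also have "\<dots> = rel `` {zs u x k}" using class_fcoords up_genericD(1)[OF assms(1)] by simp
    also have "\<dots> = dev (fcyl (zs u x n)) (fsco (zs u x n) + exit_time u (zs u x n) * Re u) (hi (fcyl (zs u x n)))"
      unfolding kn by (simp add: next_point_def dev_def)
    finally show ?thesis unfolding h unfolding e .
  qed
qed

lemma up_flow_oct:
  assumes "up_generic u x" "Im u > 0" "t \<ge> 0"
  shows "up_flow u x t \<in> oct"
proof -
  obtain n where n: "ts u x n \<le> t" "t < ts u x (Suc n)" "up_flow u x t = cross u (zs u x n) (t - ts u x n)"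
    using up_flow_index[OF assms] by blast
  show ?thesis unfolding n(3) cross_def using level_le[OF assms(1,2) n(1)] n(2) by (intro nf_oct) auto
qed

lemma dev_nonsingular:
  assumes "lo b < y" "y < hi b"
  shows "dev b s y \<noteq> octagon_singularity 0 1"
proof
  assume a: "dev b s y = octagon_singularity 0 1"
  obtain m where m: "nf b s y = pt b s y m" "pt b s y m \<in> oct" using nf_cases[of b y s] assms by auto
  then have "norm (pt b s y m) = 1" using a singularity_iff[OF m(2)] by (simp add: dev_def)
  then obtain k where k: "k < 8" "pt b s y m = vtx k" using norm_1_vtx m(2) by blast
  then have "k = 0 \<or> k = 1 \<or> k = 2 \<or> k = 3 \<or> k = 4 \<or> k = 5 \<or> k = 6 \<or> k = 7" by linarith
  then have "Im (pt b s y m) \<in> {0, sqrt 2 / 2, - sqrt 2 / 2, 1, - 1}"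
    unfolding k(2) by (elim disjE; simp only: vtx_values) simp_all
  then show False using assms sqrt2(2,3)
    by (cases b; cases "odd m") (auto simp: pt_def lo_def hi_def del_def)
qed

lemma straight_path_up_path:
  assumes "up_generic u x" "Im u > 0"
  shows "straight_flow 0 1 u x (up_path u x)"
  unfolding straight_flow_iff straight_path_def
proof (intro conjI ballI)
  show "up_path u x 0 = rel `` {x}"
    using up_path_dev[OF assms, of 0 0] exit_time_pos[OF assms, of 0] class_fcoords[of x] assms(1)
    by (simp add: ts_0 ts_Suc up_generic_def)
  fix t :: real assume "t \<in> {0..}"
  then have t: "t \<ge> 0" by simp
  obtain n where n: "ts u x n \<le> t" "t < ts u x (Suc n)" using up_flow_index[OF assms t] by blast
  define z b where "z = zs u x n" and "b = fcyl z"
  note pd = up_path_dev[OF assms, of n, folded z_def, folded b_def]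
  note ll = level_le[OF assms, of n, folded z_def, folded b_def]
  let ?y = "fyco z + (t - ts u x n) * Im u" and ?s = "fsco z + (t - ts u x n) * Re u"
  have pt: "up_path u x t = dev b ?s ?y" using pd n by simp
  show "up_path u x t \<in> octagon_surface 0 1"
    unfolding up_path_def using class_in_surface up_flow_oct[OF assms t] by blast
  have zn: "z \<in> oct" "norm z < 1" using up_genericD[OF assms(1)] by (auto simp: z_def)
  show "up_path u x t \<noteq> octagon_singularity 0 1"
  proof (cases "t = ts u x n")
    case True
    then show ?thesis using pt class_fcoords[OF zn(1)] singularity_iff[OF zn(1)] zn(2) by (simp add: b_def)
  next
    case False
    have "(t - ts u x n) * Im u > 0" using n False assms(2) by simp
    then have "lo b < ?y" using fcoords(1)[OF zn(1)] by (simp add: b_def)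
    moreover have "(t - ts u x n) * Im u < exit_time u z * Im u"
      using n assms(2) by (intro mult_strict_right_mono) (auto simp: ts_Suc z_def)
    then have "?y < hi b" using assms(2) by (simp add: exit_time_def b_def)
    ultimately show ?thesis unfolding pt by (rule dev_nonsingular)
  qed
  show "\<exists>e>0. \<exists>y\<in>up_path u x t. \<forall>s\<in>{0..}. t \<le> s \<and> s < t + e \<longrightarrow> y + (s - t) *\<^sub>R u \<in> up_path u x s"
  proof -
    define e where "e = ts u x (Suc n) - t"
    have e: "e > 0" using n by (simp add: e_def)
    have lv: "lo b \<le> ?y + r * Im u \<and> ?y + r * Im u \<le> hi b" if "0 \<le> r" "r \<le> e" for r
      using ll[of "t + r"] that n by (auto simp: e_def algebra_simps)
    obtain e' y where e': "e' > 0" "y \<in> dev b ?s ?y"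
      "\<And>r. 0 \<le> r \<and> r \<le> e' \<Longrightarrow> y + r *\<^sub>R u \<in> dev b (?s + r * Re u) (?y + r * Im u)"
      using dev_germ[OF e, of b ?y u ?s] lv by blast
    show ?thesis
    proof (intro exI[of _ "min e e'"] conjI bexI[of _ y] ballI impI)
      fix s assume s: "t \<le> s \<and> s < t + min e e'"
      have "up_path u x s = dev b (?s + (s - t) * Re u) (?y + (s - t) * Im u)"
      proof -
        have "ts u x n \<le> s" "s \<le> ts u x (Suc n)" using s n by (auto simp: e_def)
        from pd[OF this] show ?thesis by (simp add: algebra_simps)
      qed
      moreover have "0 \<le> s - t \<and> s - t \<le> e'" using s min.cobounded2[of e e'] by linarith
      note e'(3)[OF this]
      ultimately show "y + (s - t) *\<^sub>R u \<in> up_path u x s" by simp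
    qed (use e e' pt in auto)
  qed
  show "\<exists>e>0. \<exists>y\<in>up_path u x t. \<forall>s\<in>{0..}. t - e < s \<and> s \<le> t \<longrightarrow> y + (s - t) *\<^sub>R u \<in> up_path u x s"
  proof (cases "t = 0")
    case True
    obtain y where "y \<in> up_path u x 0" using surface_cases \<open>up_path u x t \<in> octagon_surface 0 1\<close> True by metis
    then show ?thesis using True by (intro exI[of _ 1]) auto
  next
    case False
    \<comment> \<open>Backwards in time the cylinder just left is the relevant one, so at a crossing
      time the index is one less than for the forward germ.\<close>
    obtain k where k: "ts u x k < t" "t \<le> ts u x (Suc k)"
    proof (cases "t = ts u x n")
      case True
      with False obtain k where "n = Suc k" by (cases n) (auto simp: ts_0)
      then show ?thesis using that[of k] True strict_monoD[OF ts_strict[OF assms], of k n] by simp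
    qed (use that[of n] n in auto)
    define z b where "z = zs u x k" and "b = fcyl z"
    note pd = up_path_dev[OF assms, of k, folded z_def, folded b_def]
    note ll = level_le[OF assms, of k, folded z_def, folded b_def]
    let ?y = "fyco z + (t - ts u x k) * Im u" and ?s = "fsco z + (t - ts u x k) * Re u"
    define e where "e = t - ts u x k"
    have e: "e > 0" using k by (simp add: e_def)
    have lv: "lo b \<le> ?y + r * Im (- u) \<and> ?y + r * Im (- u) \<le> hi b" if "0 \<le> r" "r \<le> e" for r
      using ll[of "t - r"] that k by (auto simp: e_def algebra_simps)
    obtain e' y where e': "e' > 0" "y \<in> dev b ?s ?y"
      "\<And>r. 0 \<le> r \<and> r \<le> e' \<Longrightarrow> y + r *\<^sub>R (- u) \<in> dev b (?s + r * Re (- u)) (?y + r * Im (- u))"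
      using dev_germ[OF e, of b ?y "- u" ?s] lv by blast
    show ?thesis
    proof (intro exI[of _ "min e e'"] conjI bexI[of _ y] ballI impI)
      fix s assume s: "t - min e e' < s \<and> s \<le> t"
      have "up_path u x s = dev b (?s + (t - s) * Re (- u)) (?y + (t - s) * Im (- u))"
      proof -
        have "ts u x k \<le> s" "s \<le> ts u x (Suc k)" using s k by (auto simp: e_def)
        from pd[OF this] show ?thesis by (simp add: algebra_simps)
      qed
      moreover have "(t - s) *\<^sub>R (- u) = (s - t) *\<^sub>R u" by (simp add: algebra_simps)
      moreover have "0 \<le> t - s \<and> t - s \<le> e'" using s min.cobounded2[of e e'] by linarith
      note e'(3)[OF this]
      ultimately show "y + (s - t) *\<^sub>R u \<in> up_path u x s" by simp
    qed (use e e' pd[of t] k in auto)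
  qed
qed

section \<open>Displacements of the flow\<close>

text \<open>A countable additive group containing the differences between copies of a point, hence
  the deviation of the flow from straight motion in the plane. Countability makes the flow a
  piecewise translation with countably many pieces.\<close>

definition lattice :: "complex set" where
  "lattice = (\<lambda>(i, j, k, l). Complex (of_int i + of_int j * (sqrt 2 / 2)) (of_int k + of_int l * (sqrt 2 / 2)))
     ` (UNIV :: (int \<times> int \<times> int \<times> int) set)"

lemma countable_lattice: "countable lattice"
  unfolding lattice_def by (intro countable_image) simp

lemma lattice_memI: "Re z = of_int i + of_int j * (sqrt 2 / 2) \<Longrightarrow> Im z = of_int k + of_int l * (sqrt 2 / 2) \<Longrightarrow> z \<in> lattice"
  unfolding lattice_def by (rule image_eqI[of _ _ "(i, j, k, l)"]) (auto simp: complex_eq_iff)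

lemma lattice_0: "0 \<in> lattice" by (rule lattice_memI[of _ 0 0 0 0]) auto

lemma lattice_add: "a \<in> lattice \<Longrightarrow> b \<in> lattice \<Longrightarrow> a + b \<in> lattice"
proof -
  assume "a \<in> lattice" "b \<in> lattice"
  then obtain i j k l i' j' k' l' where
    "a = Complex (of_int i + of_int j * (sqrt 2 / 2)) (of_int k + of_int l * (sqrt 2 / 2))"
    "b = Complex (of_int i' + of_int j' * (sqrt 2 / 2)) (of_int k' + of_int l' * (sqrt 2 / 2))"
    unfolding lattice_def by auto
  then show ?thesis by (intro lattice_memI[of _ "i + i'" "j + j'" "k + k'" "l + l'"]) (auto simp: algebra_simps)
qed

lemma pt_diff_lattice: "pt b s y m - pt b s y m' \<in> lattice"
proof (cases b)
  case True
  then show ?thesis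
    by (intro lattice_memI[of _ 0 "m' - m" "of_bool (odd m') - of_bool (odd m)" "of_bool (odd m') - of_bool (odd m)"])
      (auto simp: pt_def lam_def del_def algebra_simps)
next
  case False
  then show ?thesis
    by (intro lattice_memI[of _ "m' - m" "m' - m" 0 "of_bool (odd m') - of_bool (odd m)"])
      (auto simp: pt_def lam_def del_def field_simps)
qed

lemma cross_lattice:
  assumes "z \<in> oct" "lo (fcyl z) \<le> fyco z + t * Im u" "fyco z + t * Im u \<le> hi (fcyl z)"
  shows "cross u z t - (z + t *\<^sub>R u) \<in> lattice"
proof -
  obtain m where m: "cross u z t = pt (fcyl z) (fsco z + t * Re u) (fyco z + t * Im u) m"
    using nf_cases[OF assms(2,3)] unfolding cross_def by metis
  define m0 :: int where "m0 = (if Im z \<ge> 0 then 0 else 1)"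
  have "z + t *\<^sub>R u = pt (fcyl z) (fsco z + t * Re u) (fyco z + t * Im u) m0"
    using fcoords(3)[OF assms(1)] unfolding pt_add m0_def by simp
  then show ?thesis using m pt_diff_lattice by metis
qed

lemma zs_lattice:
  assumes "x \<in> oct" "Im u > 0"
  shows "zs u x n - (x + ts u x n *\<^sub>R u) \<in> lattice"
proof (induction n)
  case 0
  show ?case using lattice_0 by (simp add: ts_0)
next
  case (Suc n)
  let ?z = "zs u x n"
  have z: "?z \<in> oct" using zs_oct assms(1) .
  have h: "fyco ?z + exit_time u ?z * Im u = hi (fcyl ?z)" using assms(2) by (simp add: exit_time_def)
  have "cross u ?z (exit_time u ?z) - (?z + exit_time u ?z *\<^sub>R u) \<in> lattice"
    using z h hi_lo(2) by (intro cross_lattice) (auto simp: less_imp_le)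
  moreover have "cross u ?z (exit_time u ?z) = zs u x (Suc n)" using h by (simp add: cross_def next_point_def)
  ultimately have "(zs u x (Suc n) - (?z + exit_time u ?z *\<^sub>R u)) + (?z - (x + ts u x n *\<^sub>R u)) \<in> lattice"
    using Suc by (metis lattice_add)
  then show ?case by (simp add: ts_Suc algebra_simps)
qed

lemma up_flow_lattice:
  assumes "up_generic u x" "Im u > 0" "t \<ge> 0"
  shows "up_flow u x t - (x + t *\<^sub>R u) \<in> lattice"
proof -
  obtain n where n: "ts u x n \<le> t" "t < ts u x (Suc n)" "up_flow u x t = cross u (zs u x n) (t - ts u x n)"
    using up_flow_index[OF assms] by blast
  have "cross u (zs u x n) (t - ts u x n) - (zs u x n + (t - ts u x n) *\<^sub>R u) \<in> lattice"
    using level_le[OF assms(1,2) n(1)] n(2) up_genericD[OF assms(1)] by (intro cross_lattice) auto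
  moreover have "zs u x n - (x + ts u x n *\<^sub>R u) \<in> lattice"
    using zs_lattice assms by (auto simp: up_generic_def)
  ultimately have "(up_flow u x t - (zs u x n + (t - ts u x n) *\<^sub>R u)) + (zs u x n - (x + ts u x n *\<^sub>R u)) \<in> lattice"
    using n(3) by (metis lattice_add)
  then show ?thesis by (simp add: algebra_simps)
qed

text \<open>A point whose orbit hits a vertex lies on a line with direction \<open>u\<close> through
  a vertex shifted by \<open>lattice\<close>, and there are countably many such lines. The vector
  \<open>\<i> * u\<close> is normal to them.\<close>

lemma negligible_not_up_generic:
  assumes "Im u > 0"
  shows "negligible {x \<in> oct. \<not> up_generic u x}"
proof (rule negligible_subset)
  let ?L = "\<lambda>(k, c). {x. (\<i> * u) \<bullet> x = (\<i> * u) \<bullet> (vtx k - c)}"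
  have "u \<noteq> 0" using assms by auto
  then show "negligible (\<Union> (?L ` ({..<8} \<times> lattice)))"
    by (intro negligible_countable_Union countable_image countable_SIGMA) (auto simp: countable_lattice intro: negligible_hyperplane)
  show "{x \<in> oct. \<not> up_generic u x} \<subseteq> \<Union> (?L ` ({..<8} \<times> lattice))"
  proof
    fix x assume "x \<in> {x \<in> oct. \<not> up_generic u x}"
    then obtain n where x: "x \<in> oct" "\<not> norm (zs u x n) < 1" by (auto simp: up_generic_def)
    have "norm (zs u x n) = 1" using norm_oct_le[OF zs_oct[OF x(1), of u n]] x(2) by linarith
    then obtain k where k: "k < 8" "zs u x n = vtx k" using norm_1_vtx zs_oct[OF x(1)] by blast
    define c where "c = zs u x n - (x + ts u x n *\<^sub>R u)"
    have "c \<in> lattice" using zs_lattice[OF x(1) assms] by (simp add: c_def)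
    moreover have xe: "x = vtx k - c - ts u x n *\<^sub>R u" by (simp add: c_def k)
    have "(\<i> * u) \<bullet> u = 0" by (simp add: inner_complex_def)
    then have "(\<i> * u) \<bullet> x = (\<i> * u) \<bullet> (vtx k - c)" by (subst xe) (simp add: inner_diff_right)
    ultimately show "x \<in> \<Union> (?L ` ({..<8} \<times> lattice))" using k by auto
  qed
qed

section \<open>Measurability\<close>

lemma borel_Complex [measurable]:
  assumes [measurable]: "f \<in> borel_measurable M" "g \<in> borel_measurable M"
  shows "(\<lambda>x. Complex (f x) (g x)) \<in> borel_measurable M"
  unfolding Complex_eq by measurable

lemma nf_alt:
  "nf b s y = (let f = real_of_int \<lfloor>s / (2 * lam b) + 1 / 2\<rfloor> in
     if \<bar>s - 2 * f * lam b\<bar> \<le> wd b y then Complex (s - 2 * f * lam b) y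
     else if s > 2 * f * lam b then Complex (s - (2 * f + 1) * lam b) (y - del b)
     else Complex (s - (2 * f - 1) * lam b) (y - del b))"
  by (simp add: nf_def Let_def pt_def)

lemma borel_nf [measurable]:
  assumes [measurable]: "Measurable.pred M b" "s \<in> borel_measurable M" "y \<in> borel_measurable M"
  shows "(\<lambda>x. nf (b x) (s x) (y x)) \<in> borel_measurable M"
proof -
  define l d w where "l x = lam (b x)" and "d x = del (b x)" and "w x = wd (b x) (y x)" for x
  have [measurable]: "l \<in> borel_measurable M" "d \<in> borel_measurable M" "w \<in> borel_measurable M"
    unfolding l_def[abs_def] d_def[abs_def] w_def[abs_def] lam_def del_def wd_def by measurable
  define f where "f x = real_of_int \<lfloor>s x / (2 * l x) + 1 / 2\<rfloor>" for x
  have [measurable]: "f \<in> borel_measurable M" unfolding f_def[abs_def] by measurable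
  have "(\<lambda>x. nf (b x) (s x) (y x)) = (\<lambda>x. if \<bar>s x - 2 * f x * l x\<bar> \<le> w x then Complex (s x - 2 * f x * l x) (y x)
     else if s x > 2 * f x * l x then Complex (s x - (2 * f x + 1) * l x) (y x - d x)
     else Complex (s x - (2 * f x - 1) * l x) (y x - d x))"
    unfolding nf_alt Let_def f_def l_def d_def w_def ..
  also have "\<dots> \<in> borel_measurable M" by measurable
  finally show ?thesis .
qed

lemma borel_fcyl [measurable]:
  assumes [measurable]: "f \<in> borel_measurable M"
  shows "Measurable.pred M (\<lambda>x. fcyl (f x))" "(\<lambda>x. fsco (f x)) \<in> borel_measurable M"
    "(\<lambda>x. fyco (f x)) \<in> borel_measurable M"
  unfolding fsco_def fyco_def fcyl_def lam_def del_def by measurable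

lemma borel_exit_time [measurable]:
  assumes [measurable]: "f \<in> borel_measurable M" "u \<in> borel_measurable M"
  shows "(\<lambda>x. exit_time (u x) (f x)) \<in> borel_measurable M"
  unfolding exit_time_def hi_def by measurable

lemma borel_cross [measurable]:
  assumes [measurable]: "f \<in> borel_measurable M" "u \<in> borel_measurable M" "t \<in> borel_measurable M"
  shows "(\<lambda>x. cross (u x) (f x) (t x)) \<in> borel_measurable M"
  unfolding cross_def by measurable

lemma borel_zs [measurable]:
  assumes [measurable]: "f \<in> borel_measurable M" "u \<in> borel_measurable M"
  shows "(\<lambda>x. zs (u x) (f x) n) \<in> borel_measurable M"
proof (induction n)
  case (Suc n)
  note [measurable] = Suc
  show ?case unfolding zs.simps next_point_def hi_def by measurable
qed simp

lemma borel_ts [measurable]: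
  assumes [measurable]: "f \<in> borel_measurable M" "u \<in> borel_measurable M"
  shows "(\<lambda>x. ts (u x) (f x) n) \<in> borel_measurable M"
  unfolding ts_def by measurable

lemma borel_up_flow [measurable]:
  assumes [measurable]: "f \<in> borel_measurable M" "u \<in> borel_measurable M" "t \<in> borel_measurable M"
  shows "(\<lambda>x. up_flow (u x) (f x) (t x)) \<in> borel_measurable M"
  unfolding up_flow_def Let_def
  by (rule measurable_compose_countable[where f = "\<lambda>n x. cross (u x) (zs (u x) (f x) n) (t x - ts (u x) (f x) n)"]) measurable

lemma sets_oct [measurable]: "oct \<in> sets borel"
  by (simp add: closed_oct)

lemma pred_up_generic [measurable]:
  assumes [measurable]: "f \<in> borel_measurable M" "u \<in> borel_measurable M"
  shows "Measurable.pred M (\<lambda>x. up_generic (u x) (f x))"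
  unfolding up_generic_def by measurable

section \<open>Arbitrary directions\<close>

text \<open>Downward directions are conjugated to upward ones by the half turn, an automorphism of
  the surface. For horizontal \<open>u\<close> the value is a dummy, and \<open>generic\<close> is
  false.\<close>

definition flow :: "complex \<Rightarrow> complex \<Rightarrow> real \<Rightarrow> complex" where
  "flow u x t = (if Im u > 0 then up_flow u x t else - up_flow (- u) (- x) t)"

definition generic :: "complex \<Rightarrow> complex \<Rightarrow> bool" where
  "generic u x \<longleftrightarrow> (if Im u > 0 then up_generic u x else Im u < 0 \<and> up_generic (- u) (- x))"

lemma borel_flow [measurable]:
  assumes [measurable]: "f \<in> borel_measurable M" "u \<in> borel_measurable M" "t \<in> borel_measurable M"
  shows "(\<lambda>x. flow (u x) (f x) (t x)) \<in> borel_measurable M"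
  unfolding flow_def by measurable

lemma pred_generic [measurable]:
  assumes [measurable]: "f \<in> borel_measurable M" "u \<in> borel_measurable M"
  shows "Measurable.pred M (\<lambda>x. generic (u x) (f x))"
  unfolding generic_def by measurable

lemma generic_oct: "generic u x \<Longrightarrow> x \<in> oct"
  by (auto simp: generic_def up_generic_def uminus_oct_iff split: if_splits)

lemma flow_oct: "generic u x \<Longrightarrow> t \<ge> 0 \<Longrightarrow> flow u x t \<in> oct"
  using up_flow_oct uminus_oct by (auto simp: generic_def flow_def split: if_splits)

lemma lattice_uminus: "a \<in> lattice \<Longrightarrow> - a \<in> lattice"
proof -
  assume "a \<in> lattice"
  then obtain i j k l where
    "a = Complex (of_int i + of_int j * (sqrt 2 / 2)) (of_int k + of_int l * (sqrt 2 / 2))"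
    unfolding lattice_def by auto
  then show ?thesis by (intro lattice_memI[of _ "- i" "- j" "- k" "- l"]) auto
qed

lemma flow_lattice:
  assumes "generic u x" "t \<ge> 0"
  shows "flow u x t - (x + t *\<^sub>R u) \<in> lattice"
proof (cases "Im u > 0")
  case False
  then have "up_flow (- u) (- x) t - (- x + t *\<^sub>R (- u)) \<in> lattice"
    using assms by (intro up_flow_lattice) (auto simp: generic_def)
  moreover have "flow u x t - (x + t *\<^sub>R u) = - (up_flow (- u) (- x) t - (- x + t *\<^sub>R (- u)))"
    using False by (simp add: flow_def algebra_simps)
  ultimately show ?thesis using lattice_uminus by metis
qed (use assms up_flow_lattice in \<open>auto simp: generic_def flow_def\<close>)

lemma straight_flow_flow:
  assumes "generic u x"
  shows "straight_flow 0 1 u x (\<lambda>t. rel `` {flow u x t})"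
proof (cases "Im u > 0")
  case True
  then show ?thesis using straight_path_up_path[of u x] assms by (simp add: generic_def flow_def up_path_def[abs_def])
next
  case False
  then have g: "up_generic (- u) (- x)" "Im (- u) > 0" using assms by (auto simp: generic_def)
  have s: "straight_path {0..} (- u) (up_path (- u) (- x))" "up_path (- u) (- x) 0 = rel `` {- x}"
    using straight_path_up_path[OF g] by (auto simp: straight_flow_iff)
  have "straight_path {0..} u (\<lambda>t. lift uminus (up_path (- u) (- x) t))"
    using lift_straight_path[OF aff_uminus s(1)] by (simp add: is_interval_ci)
  moreover have eq: "rel `` {flow u x t} = lift uminus (up_path (- u) (- x) t)" if "t \<ge> 0" for t
    using lift_class[OF aff_uminus up_flow_oct[OF g that]] False by (simp add: up_path_def flow_def)
  ultimately have "straight_path {0..} u (\<lambda>t. rel `` {flow u x t})"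
    by (rule straight_path_cong) simp
  moreover have "lift uminus (rel `` {- x}) = rel `` {x}"
    using lift_class[OF aff_uminus, of "- x"] generic_oct[OF assms] uminus_oct by simp
  ultimately show ?thesis using eq[of 0] s(2) by (simp add: straight_flow_iff)
qed

lemma flow_unique:
  assumes "generic u x" "straight_flow 0 1 u x g" "t \<ge> 0"
  shows "g t = rel `` {flow u x t}"
  using straight_path_unique[of "{0..}" u g "\<lambda>t. rel `` {flow u x t}" 0 t] assms straight_flow_flow[OF assms(1)]
  by (auto simp: straight_flow_iff)

lemma negligible_not_generic:
  assumes "Im u \<noteq> 0"
  shows "negligible {x \<in> oct. \<not> generic u x}"
proof (cases "Im u > 0")
  case True
  then show ?thesis using negligible_not_up_generic by (simp add: generic_def)
next
  case False
  then have "negligible {x \<in> oct. \<not> up_generic (- u) x}" using negligible_not_up_generic[of "- u"] assms by simp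
  then have "negligible (uminus ` {x \<in> oct. \<not> up_generic (- u) x})"
    by (intro negligible_differentiable_image_negligible derivative_intros) (auto intro: derivative_intros)
  moreover have "{x \<in> oct. \<not> generic u x} \<subseteq> uminus ` {x \<in> oct. \<not> up_generic (- u) x}"
  proof
    fix x assume "x \<in> {x \<in> oct. \<not> generic u x}"
    then show "x \<in> uminus ` {x \<in> oct. \<not> up_generic (- u) x}"
      using False assms by (intro image_eqI[of _ _ "- x"]) (auto simp: generic_def uminus_oct_iff)
  qed
  ultimately show ?thesis using negligible_subset by blast
qed

section \<open>Lebesgue measure in the plane\<close>

lemma lborel_complex: "(lborel :: complex measure) = distr (lborel \<Otimes>\<^sub>M lborel) borel (\<lambda>(x, y). Complex x y)"
proof (rule lborel_eqI)
  fix l u :: complex assume lu: "\<And>b. b \<in> Basis \<Longrightarrow> l \<bullet> b \<le> u \<bullet> b"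
  have le: "Re l \<le> Re u" "Im l \<le> Im u"
    using lu[of 1] lu[of \<i>] by (simp_all add: Basis_complex_def inner_complex_def)
  have [measurable]: "(\<lambda>(x, y). Complex x y) \<in> borel_measurable (lborel \<Otimes>\<^sub>M lborel)"
    by measurable
  have "(\<lambda>(x, y). Complex x y) -` box l u \<inter> space (lborel \<Otimes>\<^sub>M lborel) = {Re l<..<Re u} \<times> {Im l<..<Im u}"
    by (auto simp: space_pair_measure in_box_complex_iff)
  then have "emeasure (distr (lborel \<Otimes>\<^sub>M lborel) borel (\<lambda>(x, y). Complex x y)) (box l u) =
    emeasure lborel {Re l<..<Re u} * emeasure lborel {Im l<..<Im u}"
    by (subst emeasure_distr) (simp_all add: lborel.emeasure_pair_measure_Times)
  also have "\<dots> = ennreal (Re u - Re l) * ennreal (Im u - Im l)" using le by simp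
  also have "\<dots> = (\<Prod>b\<in>Basis. (u - l) \<bullet> b)"
    using le by (simp add: Basis_complex_def inner_complex_def ennreal_mult)
  finally show "emeasure (distr (lborel \<Otimes>\<^sub>M lborel) borel (\<lambda>(x, y). Complex x y)) (box l u) = (\<Prod>b\<in>Basis. (u - l) \<bullet> b)" .
qed simp

lemma emeasure_complex:
  assumes [measurable]: "A \<in> sets borel"
  shows "emeasure lborel A = (\<integral>\<^sup>+x. \<integral>\<^sup>+y. indicator A (Complex x y) \<partial>lborel \<partial>lborel)"
    "emeasure lborel A = (\<integral>\<^sup>+y. \<integral>\<^sup>+x. indicator A (Complex x y) \<partial>lborel \<partial>lborel)"
proof -
  have [measurable]: "(\<lambda>(x, y). Complex x y) \<in> borel_measurable (lborel \<Otimes>\<^sub>M lborel)"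
    by measurable
  have "emeasure lborel A = (\<integral>\<^sup>+z. indicator A z \<partial>lborel)" by simp
  also have "\<dots> = (\<integral>\<^sup>+p. indicator A (case p of (x, y) \<Rightarrow> Complex x y) \<partial>(lborel \<Otimes>\<^sub>M lborel))"
    by (subst lborel_complex) (subst nn_integral_distr, auto)
  finally have *: "emeasure lborel A = (\<integral>\<^sup>+p. indicator A (case p of (x, y) \<Rightarrow> Complex x y) \<partial>(lborel \<Otimes>\<^sub>M lborel))" .
  show "emeasure lborel A = (\<integral>\<^sup>+x. \<integral>\<^sup>+y. indicator A (Complex x y) \<partial>lborel \<partial>lborel)"
    unfolding * by (subst lborel.nn_integral_fst[symmetric]) auto
  show "emeasure lborel A = (\<integral>\<^sup>+y. \<integral>\<^sup>+x. indicator A (Complex x y) \<partial>lborel \<partial>lborel)"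
    unfolding * by (subst lborel_pair.nn_integral_snd[symmetric]) auto
qed

lemma nn_integral_translate:
  fixes c :: real
  assumes "f \<in> borel_measurable borel"
  shows "(\<integral>\<^sup>+x. f (x + c) \<partial>lborel) = (\<integral>\<^sup>+x. f x \<partial>lborel)"
  using nn_integral_real_affine[of f 1 c] assms by (simp add: add.commute)

definition area_preserving :: "(complex \<Rightarrow> complex) \<Rightarrow> bool" where
  "area_preserving T \<longleftrightarrow> T \<in> borel_measurable borel \<and> (\<forall>A\<in>sets borel. emeasure lborel (T -` A) = emeasure lborel A)"

lemma area_preserving_xshear: "area_preserving (\<lambda>z. Complex (Re z + t * Im z) (Im z))"
  unfolding area_preserving_def
proof (intro conjI ballI)
  show [measurable]: "(\<lambda>z. Complex (Re z + t * Im z) (Im z)) \<in> borel_measurable borel" by measurable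
  fix A :: "complex set" assume [measurable]: "A \<in> sets borel"
  let ?T = "\<lambda>z. Complex (Re z + t * Im z) (Im z)"
  have TA: "?T -` A \<in> sets borel" using measurable_sets[of ?T borel borel A] by simp
  have [measurable]: "(\<lambda>x. indicator A (Complex x y)) \<in> borel_measurable borel" for y by measurable
  have "emeasure lborel (?T -` A) = (\<integral>\<^sup>+y. \<integral>\<^sup>+x. indicator A (Complex (x + t * y) y) \<partial>lborel \<partial>lborel)"
    unfolding emeasure_complex(2)[OF TA] by (simp add: indicator_def)
  also have "\<dots> = (\<integral>\<^sup>+y. \<integral>\<^sup>+x. indicator A (Complex x y) \<partial>lborel \<partial>lborel)"
    by (intro nn_integral_cong nn_integral_translate) measurable
  finally show "emeasure lborel (?T -` A) = emeasure lborel A" by (simp only: emeasure_complex(2)[OF \<open>A \<in> sets borel\<close>])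
qed

lemma area_preserving_yshear: "area_preserving (\<lambda>z. Complex (Re z) (Im z + t * Re z))"
  unfolding area_preserving_def
proof (intro conjI ballI)
  show [measurable]: "(\<lambda>z. Complex (Re z) (Im z + t * Re z)) \<in> borel_measurable borel" by measurable
  fix A :: "complex set" assume [measurable]: "A \<in> sets borel"
  let ?T = "\<lambda>z. Complex (Re z) (Im z + t * Re z)"
  have TA: "?T -` A \<in> sets borel" using measurable_sets[of ?T borel borel A] by simp
  have [measurable]: "(\<lambda>y. indicator A (Complex x y)) \<in> borel_measurable borel" for x by measurable
  have "emeasure lborel (?T -` A) = (\<integral>\<^sup>+x. \<integral>\<^sup>+y. indicator A (Complex x (y + t * x)) \<partial>lborel \<partial>lborel)"
    unfolding emeasure_complex(1)[OF TA] by (simp add: indicator_def)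
  also have "\<dots> = (\<integral>\<^sup>+x. \<integral>\<^sup>+y. indicator A (Complex x y) \<partial>lborel \<partial>lborel)"
    by (intro nn_integral_cong nn_integral_translate) measurable
  finally show "emeasure lborel (?T -` A) = emeasure lborel A" by (simp only: emeasure_complex(1)[OF \<open>A \<in> sets borel\<close>])
qed

lemma area_preserving_cnj: "area_preserving cnj"
  unfolding area_preserving_def
proof (intro conjI ballI)
  show "cnj \<in> borel_measurable borel" by (intro borel_measurable_continuous_onI continuous_intros)
  then have m: "cnj \<in> borel_measurable borel" .
  fix A :: "complex set" assume [measurable]: "A \<in> sets borel"
  have TA: "cnj -` A \<in> sets borel" using measurable_sets[OF m, of A] by simp
  have [measurable]: "(\<lambda>y. indicator A (Complex x y)) \<in> borel_measurable borel" for x by measurable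
  have "emeasure lborel (cnj -` A) = (\<integral>\<^sup>+x. \<integral>\<^sup>+y. indicator A (Complex x (- y)) \<partial>lborel \<partial>lborel)"
    unfolding emeasure_complex(1)[OF TA] by (simp add: indicator_def complex_cnj)
  also have "\<dots> = (\<integral>\<^sup>+x. \<integral>\<^sup>+y. indicator A (Complex x y) \<partial>lborel \<partial>lborel)"
  proof (rule nn_integral_cong)
    fix x :: real show "(\<integral>\<^sup>+y. indicator A (Complex x (- y)) \<partial>lborel) = (\<integral>\<^sup>+y. indicator A (Complex x y) \<partial>lborel)"
      using nn_integral_real_affine[of "\<lambda>y. indicator A (Complex x y)" "-1" 0] by simp
  qed
  finally show "emeasure lborel (cnj -` A) = emeasure lborel A" by (simp only: emeasure_complex(1)[OF \<open>A \<in> sets borel\<close>])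
qed

lemma area_preserving_comp:
  assumes "area_preserving S" "area_preserving T"
  shows "area_preserving (S \<circ> T)"
  unfolding area_preserving_def
proof (intro conjI ballI)
  show "S \<circ> T \<in> borel_measurable borel" using assms measurable_comp unfolding area_preserving_def by blast
  fix A :: "complex set" assume A: "A \<in> sets borel"
  have "S -` A \<in> sets borel" using measurable_sets[of S borel borel A] A assms by (simp add: area_preserving_def)
  then show "emeasure lborel ((S \<circ> T) -` A) = emeasure lborel A"
    using assms A by (simp add: area_preserving_def vimage_comp[symmetric])
qed

lemma area_preserving_rotate: "area_preserving (\<lambda>z. cis \<phi> * z)"
proof -
  text \<open>A rotation by less than a half turn is a product of three shears.\<close>
  have *: "area_preserving (\<lambda>z. cis \<phi> * z)" if "cos \<phi> \<noteq> - 1" for \<phi>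
  proof -
    \<comment> \<open>This is \<open>tan (\<phi> / 2)\<close>.\<close>
    define t where "t = sin \<phi> / (1 + cos \<phi>)"
    let ?x = "\<lambda>z. Complex (Re z + (- t) * Im z) (Im z)" and ?y = "\<lambda>z. Complex (Re z) (Im z + sin \<phi> * Re z)"
    have n: "1 + cos \<phi> \<noteq> 0" using that by linarith
    then have t1: "t * (1 + cos \<phi>) = sin \<phi>" by (simp add: t_def)
    have "sin \<phi> * sin \<phi> = (1 - cos \<phi>) * (1 + cos \<phi>)"
      using sin_cos_squared_add[of \<phi>] by (simp add: power2_eq_square algebra_simps)
    then have t2: "t * sin \<phi> = 1 - cos \<phi>" using n by (simp add: t_def)
    have "(\<lambda>z. cis \<phi> * z) = ?x \<circ> ?y \<circ> ?x"
    proof (rule ext)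
      fix z
      have "Im z + sin \<phi> * (Re z + (- t) * Im z) = sin \<phi> * Re z + (1 - t * sin \<phi>) * Im z" by (simp add: algebra_simps)
      then have y: "Im z + sin \<phi> * (Re z + (- t) * Im z) = sin \<phi> * Re z + cos \<phi> * Im z" using t2 by simp
      have "Re z + (- t) * Im z + (- t) * (sin \<phi> * Re z + cos \<phi> * Im z) = (1 - t * sin \<phi>) * Re z - (t * (1 + cos \<phi>)) * Im z"
        by (simp add: algebra_simps)
      then have x: "Re z + (- t) * Im z + (- t) * (sin \<phi> * Re z + cos \<phi> * Im z) = cos \<phi> * Re z - sin \<phi> * Im z"
        unfolding t1 t2 by simp
      show "cis \<phi> * z = (?x \<circ> ?y \<circ> ?x) z"
        unfolding o_def complex.sel y x by (simp add: complex_eq_iff)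
    qed
    moreover have "area_preserving (?x \<circ> ?y \<circ> ?x)"
      by (intro area_preserving_comp area_preserving_xshear area_preserving_yshear)
    ultimately show ?thesis by (simp only:)
  qed
  show ?thesis
  proof (cases "cos \<phi> = - 1")
    case True
    then have "sin \<phi> = 0" using sin_cos_squared_add[of \<phi>] by simp
    then have "cis \<phi> = cis (pi / 2) * cis (pi / 2)" using True by (simp add: complex_eq_iff)
    then have "(\<lambda>z. cis \<phi> * z) = (\<lambda>z. cis (pi / 2) * z) \<circ> (\<lambda>z. cis (pi / 2) * z)" by (auto simp: mult.assoc)
    moreover have "area_preserving (\<lambda>z. cis (pi / 2) * z)" by (rule *) simp
    ultimately show ?thesis using area_preserving_comp by (simp only:)
  qed (rule *)
qed

lemma area_preserving_shear_lin: "area_preserving (shear_lin \<kappa>)"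
  using area_preserving_xshear[of "- (of_int \<kappa> * (2 + 2 * sqrt 2))"]
  by (simp add: shear_lin_def[abs_def])

lemma area_preserving_id: "area_preserving id" "area_preserving (\<lambda>x. x)"
  by (simp_all add: area_preserving_def id_def)

section \<open>Measure-preserving maps of the octagon\<close>

definition oct_preserving :: "(complex \<Rightarrow> complex) \<Rightarrow> bool" where
  "oct_preserving f \<longleftrightarrow> f \<in> borel_measurable borel \<and> (\<forall>z\<in>oct. f z \<in> oct) \<and>
     (\<forall>B\<in>sets borel. emeasure lborel (oct \<inter> f -` B) = emeasure lborel (oct \<inter> B))"

lemma emeasure_translate:
  fixes A :: "complex set"
  assumes "A \<in> sets borel"
  shows "emeasure lborel ((\<lambda>x. x + c) -` A) = emeasure lborel A"
proof -
  have "emeasure lborel A = emeasure (distr lborel borel ((+) c)) A" by (simp add: lborel_distr_plus)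
  also have "\<dots> = emeasure lborel ((+) c -` A)" using assms by (subst emeasure_distr) auto
  also have "(+) c = (\<lambda>x. x + c)" by (auto simp: add.commute)
  finally show ?thesis by simp
qed

lemma emeasure_oct_finite: "emeasure lborel (oct \<inter> B) < \<infinity>"
proof -
  have "emeasure lborel (oct \<inter> B) \<le> emeasure lborel oct" by (intro emeasure_mono) auto
  also have "\<dots> < \<infinity>" by (rule emeasure_compact_finite[OF compact_oct])
  finally show ?thesis .
qed

text \<open>Outside \<open>N\<close> the map is \<open>S\<close> followed by one of countably many
  translations. Each piece keeps its area and injectivity keeps the images of the pieces apart, so a
  preimage has at most the area of the set. The same bound for the complement gives equality,
  because the octagon has finite area.\<close>

lemma oct_preservingI:
  assumes f [measurable]: "f \<in> borel_measurable borel" and oct: "\<And>z. z \<in> oct \<Longrightarrow> f z \<in> oct"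
    and T: "area_preserving T" "\<And>z. T (S z) = z" "\<And>z. S (T z) = z" and S [measurable]: "S \<in> borel_measurable borel"
    and N: "N \<in> null_sets lborel"
    and K: "countable K" "\<And>z. z \<in> oct - N \<Longrightarrow> f z - S z \<in> K"
    and inj: "\<And>x y. x \<in> oct - N \<Longrightarrow> y \<in> oct - N \<Longrightarrow> f x = f y \<Longrightarrow> x = y"
  shows "oct_preserving f"
proof -
  have N' [measurable]: "N \<in> sets borel" using N by auto
  have T' [measurable]: "T \<in> borel_measurable borel" using T by (simp add: area_preserving_def)
  define X where "X = oct - N"
  have X [measurable]: "X \<in> sets borel" by (simp add: X_def)
  define E where "E B c = {x \<in> X. f x - S x = c \<and> f x \<in> B}" for B c
  have E: "E B c \<in> sets borel" if [measurable]: "B \<in> sets borel" for B c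
    unfolding E_def by measurable
  have sub: "emeasure lborel (X \<inter> f -` B) \<le> emeasure lborel (oct \<inter> B)" if B: "B \<in> sets borel" for B
  proof -
    note EB = E[OF B]
    \<comment> \<open>The image of a piece, written as a preimage so that measurability is
      immediate.\<close>
    define P where "P c = (\<lambda>y. y + - c) -` (T -` E B c)" for c
    have TE: "T -` E B c \<in> sets borel" for c using measurable_sets[OF T' EB] by simp
    have P_eq: "P c = f ` E B c" for c
    proof (intro set_eqI iffI)
      fix y assume "y \<in> P c"
      then have *: "T (y - c) \<in> E B c" by (simp add: P_def)
      then have "f (T (y - c)) = y" using T(3)[of "y - c"] by (auto simp: E_def algebra_simps)
      with * show "y \<in> f ` E B c" by force
    next
      fix y assume "y \<in> f ` E B c"
      then obtain x where x: "x \<in> E B c" "y = f x" by blast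
      then have "y - c = S x" by (auto simp: E_def)
      then show "y \<in> P c" using x T(2) by (simp add: P_def)
    qed
    have P: "P c \<in> sets borel" for c
    proof -
      have "(\<lambda>y. y + - c) \<in> borel_measurable borel" by measurable
      from measurable_sets[OF this TE] show ?thesis by (simp add: P_def)
    qed
    have eq: "emeasure lborel (P c) = emeasure lborel (E B c)" for c
      unfolding P_def emeasure_translate[OF TE] using T(1) EB by (simp add: area_preserving_def)
    have "X \<inter> f -` B = (\<Union>c\<in>K. E B c)" using K(2) by (auto simp: E_def X_def)
    then have "emeasure lborel (X \<inter> f -` B) = (\<integral>\<^sup>+c. emeasure lborel (E B c) \<partial>count_space K)"
      using emeasure_UN_countable[OF _ K(1), of "E B" lborel] EB by (auto simp: disjoint_family_on_def E_def)
    also have "\<dots> = (\<integral>\<^sup>+c. emeasure lborel (P c) \<partial>count_space K)" by (simp only: eq)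
    also have "\<dots> = emeasure lborel (\<Union>c\<in>K. P c)"
    proof (rule emeasure_UN_countable[OF _ K(1), symmetric])
      show "disjoint_family_on P K"
        unfolding disjoint_family_on_def P_eq
      proof (intro ballI impI, rule ccontr)
        fix c c' assume "c \<noteq> c'" "f ` E B c \<inter> f ` E B c' \<noteq> {}"
        then obtain x y where xy: "x \<in> E B c" "y \<in> E B c'" "f x = f y" by blast
        then have "x = y" using inj by (auto simp: E_def X_def)
        with xy \<open>c \<noteq> c'\<close> show False by (auto simp: E_def)
      qed
    qed (use P in auto)
    also have "\<dots> \<le> emeasure lborel (oct \<inter> B)"
      unfolding P_eq using oct B by (intro emeasure_mono) (auto simp: E_def X_def)
    finally show ?thesis .
  qed
  have eqX: "emeasure lborel (X \<inter> A) = emeasure lborel (oct \<inter> A)" if [measurable]: "A \<in> sets borel" for A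
  proof -
    have "emeasure lborel (X \<inter> A) = emeasure lborel (oct \<inter> A - N)" unfolding X_def by (intro arg_cong2[where f=emeasure] refl) auto
    also have "\<dots> = emeasure lborel (oct \<inter> A)" using N by (intro emeasure_Diff_null_set) auto
    finally show ?thesis .
  qed
  have fB: "f -` B \<in> sets borel" if "B \<in> sets borel" for B using measurable_sets[OF f that] by simp
  have sub': "emeasure lborel (oct \<inter> f -` B) \<le> emeasure lborel (oct \<inter> B)" if B: "B \<in> sets borel" for B
    using sub[OF B] eqX[OF fB[OF B]] by simp
  have "emeasure lborel (oct \<inter> f -` B) = emeasure lborel (oct \<inter> B)" if B: "B \<in> sets borel" for B
  proof (rule antisym[OF sub'[OF B]])
    have Bc: "- B \<in> sets borel" using B by (metis Compl_eq_Diff_UNIV borel_comp)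
    have sp: "emeasure lborel (oct \<inter> A) + emeasure lborel (oct \<inter> - A) = emeasure lborel oct" if "A \<in> sets borel" for A
    proof -
      have "emeasure lborel oct = emeasure lborel ((oct \<inter> A) \<union> (oct \<inter> - A))" by (intro arg_cong2[where f=emeasure] refl) auto
      also have "\<dots> = emeasure lborel (oct \<inter> A) + emeasure lborel (oct \<inter> - A)"
        using that by (intro plus_emeasure[symmetric]) (auto simp: borel_comp)
      finally show ?thesis by simp
    qed
    have v: "f -` (- B) = - f -` B" by auto
    have "emeasure lborel (oct \<inter> B) + emeasure lborel (oct \<inter> - B) = emeasure lborel (oct \<inter> f -` B) + emeasure lborel (oct \<inter> - f -` B)"
      using sp[OF B] sp[OF fB[OF B]] by simp
    also have "\<dots> \<le> emeasure lborel (oct \<inter> f -` B) + emeasure lborel (oct \<inter> - B)"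
      using sub'[OF Bc] unfolding v by (intro add_left_mono)
    finally show "emeasure lborel (oct \<inter> B) \<le> emeasure lborel (oct \<inter> f -` B)"
      using emeasure_oct_finite[of "- B"] by (metis add.commute ennreal_add_left_cancel_le infinity_ennreal_def less_irrefl)
  qed
  then show ?thesis unfolding oct_preserving_def using f oct by blast
qed

lemma oct_preserving_isometry:
  assumes "area_preserving E" "\<And>z. E z \<in> oct \<longleftrightarrow> z \<in> oct"
  shows "oct_preserving E"
  unfolding oct_preserving_def
proof (intro conjI ballI)
  fix B :: "complex set" assume B: "B \<in> sets borel"
  have "oct \<inter> E -` B = E -` (oct \<inter> B)" using assms(2) by auto
  then show "emeasure lborel (oct \<inter> E -` B) = emeasure lborel (oct \<inter> B)"
    using assms(1) B unfolding area_preserving_def by (metis sets.Int sets_oct)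
qed (use assms in \<open>auto simp: area_preserving_def\<close>)

lemma oct_preserving_comp:
  assumes "oct_preserving f" "oct_preserving g"
  shows "oct_preserving (f \<circ> g)"
  unfolding oct_preserving_def
proof (intro conjI ballI)
  show "f \<circ> g \<in> borel_measurable borel" using assms measurable_comp unfolding oct_preserving_def by blast
  fix B :: "complex set" assume B: "B \<in> sets borel"
  have "f -` B \<in> sets borel" using measurable_sets[of f borel borel B] B assms by (simp add: oct_preserving_def)
  then show "emeasure lborel (oct \<inter> ((f \<circ> g) -` B)) = emeasure lborel (oct \<inter> B)"
    using assms B by (simp add: oct_preserving_def vimage_comp[symmetric])
qed (use assms in \<open>auto simp: oct_preserving_def\<close>)

lemma oct_preserving_rotate: "oct_preserving (\<lambda>z. cis (pi / 4) * z)"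
  by (intro oct_preserving_isometry area_preserving_rotate rotate_oct_iff)

lemma oct_preserving_cnj: "oct_preserving cnj"
  using cnj_oct complex_cnj_cnj by (intro oct_preserving_isometry area_preserving_cnj) metis

lemma null_frontier_oct: "frontier oct \<in> null_sets lborel"
  using negligible_convex_frontier[OF convex_oct] by (simp add: negligible_iff_null_sets null_sets_completion_iff)

lemma oct_minus_frontier: "oct - frontier oct = interior oct"
  using closed_oct interior_subset by (auto simp: frontier_def closure_closed)

text \<open>The offset from the linear part depends only on the cylinder and on the copies before
  and after, so it takes countably many values. Interior points are alone in their classes, so
  \<open>shear_inverse\<close> yields injectivity.\<close>

lemma oct_preserving_shear: "oct_preserving (shear \<kappa>)"
proof (rule oct_preservingI[where T = "shear_lin (- \<kappa>)" and S = "shear_lin \<kappa>" and N = "frontier oct"])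
  show "shear \<kappa> \<in> borel_measurable borel"
    unfolding shear_def[abs_def] sco_def yco_def lo_def lam_def del_def cyl_def by measurable
  define K where "K = range (\<lambda>(b, i, j, l). Complex (of_int i * lam b + of_int \<kappa> * (2 + 2 * sqrt 2) * (lo b - of_int j * del b)) (of_int l * del b))"
  show "countable K" unfolding K_def by (intro countable_image countableI_type)
  fix z assume z: "z \<in> oct - frontier oct"
  define m0 :: int where "m0 = (if Im z \<ge> 0 then 0 else 1)"
  have c: "lo (cyl z) \<le> yco z" "yco z \<le> hi (cyl z)" "z = pt (cyl z) (sco z) (yco z) m0"
    using coords[of z] z by (simp_all add: m0_def)
  define b s y where "b = cyl z" and "s = sco z" and "y = yco z"
  obtain m where m: "shear \<kappa> z = pt b (s - of_int \<kappa> * (2 + 2 * sqrt 2) * (y - lo b)) y m"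
    using nf_cases[OF c(1,2)] unfolding shear_def b_def s_def y_def by metis
  have zc: "z = pt b s y m0" using c(3) by (simp add: b_def s_def y_def)
  have S: "shear_lin \<kappa> z = Complex (s - of_int m0 * lam b - of_int \<kappa> * (2 + 2 * sqrt 2) * (y - (if odd m0 then del b else 0)))
      (y - (if odd m0 then del b else 0))"
    by (simp add: zc pt_def shear_lin_def)
  have "shear \<kappa> z - shear_lin \<kappa> z = (\<lambda>(b, i, j, l). Complex (of_int i * lam b + of_int \<kappa> * (2 + 2 * sqrt 2) * (lo b - of_int j * del b)) (of_int l * del b))
     (b, m0 - m, of_bool (odd m0), of_bool (odd m0) - of_bool (odd m))"
    unfolding m S pt_def minus_complex.code prod.case
    by (cases "even m0"; cases "even m") (simp_all add: algebra_simps del: distrib_left_numeral)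
  then show "shear \<kappa> z - shear_lin \<kappa> z \<in> K" by (simp only: K_def rangeI)
next
  fix x y assume xy: "x \<in> oct - frontier oct" "y \<in> oct - frontier oct" "shear \<kappa> x = shear \<kappa> y"
  then have "(x, y) \<in> rel" using shear_inverse[of x \<kappa>] shear_inverse[of y \<kappa>] rel_sym rel_trans by (metis DiffD1)
  then show "x = y" using rel_interior_eq xy oct_minus_frontier by metis
next
  show "shear_lin \<kappa> \<in> borel_measurable borel"
    using area_preserving_shear_lin by (simp add: area_preserving_def)
qed (auto simp: shear_oct area_preserving_shear_lin null_frontier_oct shear_lin_def)

lemma null_not_generic:
  assumes "Im u \<noteq> 0"
  shows "{x \<in> oct. \<not> generic u x} \<in> null_sets lborel"
proof -
  have "{x \<in> oct. \<not> generic u x} \<in> sets borel" by measurable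
  then show ?thesis using negligible_not_generic[OF assms] by (simp add: negligible_iff_null_sets null_sets_completion_iff)
qed

lemma flow_inj:
  assumes "generic u x" "generic u y" "t \<ge> 0" "(flow u x t, flow u y t) \<in> rel"
  shows "(x, y) \<in> rel"
proof -
  have "rel `` {flow u x t} = rel `` {flow u y t}"
    using assms flow_oct class_eq_iff by metis
  then have "rel `` {flow u x 0} = rel `` {flow u y 0}"
    using straight_path_unique[of "{0..}" u "\<lambda>t. rel `` {flow u x t}" "\<lambda>t. rel `` {flow u y t}" t 0]
      straight_flow_flow assms by (auto simp: straight_flow_iff)
  then have "rel `` {x} = rel `` {y}"
    using straight_flow_flow[OF assms(1)] straight_flow_flow[OF assms(2)] by (simp add: straight_flow_iff)
  then show ?thesis using class_eq_iff generic_oct assms by metis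
qed

text \<open>At a fixed time the flow adds \<open>t *\<^sub>R u\<close> and an element of
  \<open>lattice\<close>, and uniqueness of straight paths makes it injective on generic interior
  points. Filling in the identity elsewhere makes it a map of the whole octagon.\<close>

lemma oct_preserving_flow:
  assumes "Im u \<noteq> 0" "t \<ge> 0"
  shows "oct_preserving (\<lambda>x. if generic u x then flow u x t else x)"
proof (rule oct_preservingI[where T = id and S = id and N = "frontier oct \<union> {x \<in> oct. \<not> generic u x}"])
  show "frontier oct \<union> {x \<in> oct. \<not> generic u x} \<in> null_sets lborel"
    using null_frontier_oct null_not_generic[OF assms(1)] by auto
  show "countable ((\<lambda>c. c + t *\<^sub>R u) ` lattice)" using countable_lattice by simp
  fix x assume x: "x \<in> oct - (frontier oct \<union> {x \<in> oct. \<not> generic u x})"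
  then have "flow u x t - (x + t *\<^sub>R u) \<in> lattice" using flow_lattice assms by auto
  then show "(if generic u x then flow u x t else x) - id x \<in> (\<lambda>c. c + t *\<^sub>R u) ` lattice"
    using x by (intro image_eqI[of _ _ "flow u x t - (x + t *\<^sub>R u)"]) auto
next
  fix x y assume xy: "x \<in> oct - (frontier oct \<union> {x \<in> oct. \<not> generic u x})"
    "y \<in> oct - (frontier oct \<union> {x \<in> oct. \<not> generic u x})"
    "(if generic u x then flow u x t else x) = (if generic u y then flow u y t else y)"
  then have g: "generic u x" "generic u y" "x \<in> oct - frontier oct" by auto
  then have "(x, y) \<in> rel" using flow_inj[OF g(1,2) assms(2)] xy rel_refl flow_oct assms by auto
  then show "x = y" using rel_interior_eq g oct_minus_frontier by metis
qed (use area_preserving_id flow_oct assms in auto)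

section \<open>Renormalisation\<close>

text \<open>Words in three generators, hence a countable family. Generators are composed on the
  right, so that a vector \<open>v\<close> with \<open>E v = u\<close> is replaced by its image
  under the inverse generator.\<close>

inductive autom :: "(complex \<Rightarrow> complex) \<Rightarrow> (complex \<Rightarrow> complex) \<Rightarrow> bool" where
  autom_id: "autom id id"
| autom_shear: "autom G E \<Longrightarrow> autom (G \<circ> shear (- 1)) (E \<circ> shear_lin (- 1))"
| autom_rotate: "autom G E \<Longrightarrow> autom (G \<circ> (\<lambda>z. cis (pi / 4) * z)) (E \<circ> (\<lambda>z. cis (pi / 4) * z))"
| autom_cnj: "autom G E \<Longrightarrow> autom (G \<circ> cnj) (E \<circ> cnj)"

lemma autom_aff: "autom G E \<Longrightarrow> aff G E"
  by (induction rule: autom.induct) (blast intro: aff_id aff_comp aff_shear aff_rotate aff_cnj)+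

lemma oct_preserving_id: "oct_preserving id"
  by (rule oct_preserving_isometry[OF area_preserving_id(1)]) simp

lemma autom_preserving: "autom G E \<Longrightarrow> oct_preserving G"
  by (induction rule: autom.induct)
    (blast intro: oct_preserving_comp oct_preserving_shear oct_preserving_rotate oct_preserving_cnj oct_preserving_id)+

lemma autom_rotations:
  assumes "autom G E"
  shows "\<exists>G'. autom G' (\<lambda>z. E (cis (real j * (pi / 4)) * z))"
proof (induction j)
  case 0
  show ?case using assms by (auto simp: eta_contract_eq)
next
  case (Suc j)
  then obtain G' where "autom G' (\<lambda>z. E (cis (real j * (pi / 4)) * z))" by blast
  moreover have "(\<lambda>z. E (cis (real j * (pi / 4)) * z)) \<circ> (\<lambda>z. cis (pi / 4) * z) = (\<lambda>z. E (cis (real (Suc j) * (pi / 4)) * z))"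
    by (rule ext) (simp add: cis_mult distrib_right add.commute add_divide_distrib flip: mult.assoc)
  ultimately show ?case using autom_rotate by metis
qed

lemma shear_lin_inverse: "shear_lin (- \<kappa>) (shear_lin \<kappa> z) = z"
  by (simp add: shear_lin_def complex_eq_iff algebra_simps)

lemma countable_autom: "countable {E. \<exists>G. autom G E}"
proof -
  define gen :: "nat \<Rightarrow> complex \<Rightarrow> complex" where
    "gen i = (if i = 0 then shear_lin (- 1) else if i = 1 then (\<lambda>z. cis (pi / 4) * z) else cnj)" for i
  define F where "F = (\<lambda>l. foldr (\<lambda>i f. f \<circ> gen i) l id)"
  have "E \<in> range F" if "autom G E" for G E
    using that
  proof (induction rule: autom.induct)
    case autom_id
    have "F [] = id" by (simp add: F_def)
    then show ?case by (metis rangeI)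
  next
    case (autom_shear G E)
    then obtain l where "E = F l" by blast
    then have "F (0 # l) = E \<circ> shear_lin (- 1)" by (simp add: F_def gen_def)
    then show ?case by (metis rangeI)
  next
    case (autom_rotate G E)
    then obtain l where "E = F l" by blast
    then have "F (1 # l) = E \<circ> (\<lambda>z. cis (pi / 4) * z)" by (simp add: F_def gen_def)
    then show ?case by (metis rangeI)
  next
    case (autom_cnj G E)
    then obtain l where "E = F l" by blast
    then have "F (2 # l) = E \<circ> cnj" by (simp add: F_def gen_def)
    then show ?case by (metis rangeI)
  qed
  then have "{E. \<exists>G. autom G E} \<subseteq> range F" by blast
  then show ?thesis by (rule countable_subset) (intro countable_image countableI_type)
qed

text \<open>The determinant of two plane vectors; each generator of \<open>autom\<close> preserves
  it up to sign.\<close>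

definition wedge :: "complex \<Rightarrow> complex \<Rightarrow> real" where
  "wedge a b = Re a * Im b - Im a * Re b"

lemma wedge_rotate: "wedge (cis t * a) (cis t * b) = wedge a b"
proof -
  have "wedge (cis t * a) (cis t * b) = ((cos t)\<^sup>2 + (sin t)\<^sup>2) * wedge a b"
    unfolding wedge_def times_complex.sel cis.sel by algebra
  then show ?thesis by simp
qed

lemma wedge_cnj: "wedge (cnj a) (cnj b) = - wedge a b"
  by (simp add: wedge_def)

lemma wedge_shear: "wedge (shear_lin \<kappa> a) (shear_lin \<kappa> b) = wedge a b"
  by (simp add: wedge_def shear_lin_def algebra_simps)

lemma wedge_polar: "wedge (of_real r * cis s) (of_real r' * cis s') = r * r' * sin (s' - s)"
  by (simp add: wedge_def sin_diff algebra_simps)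

text \<open>The open cone of angles between 0 and \<open>pi / 8\<close>, as
  \<open>cot (pi / 8) = 1 + sqrt 2\<close>: a fundamental domain for the 16 symmetries of the
  octagon.\<close>

definition sector :: "complex \<Rightarrow> bool" where
  "sector v \<longleftrightarrow> 0 < Im v \<and> (1 + sqrt 2) * Im v < Re v"

text \<open>The line spanned by \<open>w\<close> avoids the open sector: the product is positive
  exactly when \<open>w\<close> or \<open>- w\<close> lies in \<open>sector\<close>.\<close>

definition off_sector :: "complex \<Rightarrow> bool" where
  "off_sector w \<longleftrightarrow> Im w * (Re w - (1 + sqrt 2) * Im w) \<le> 0"

section \<open>Trigonometry of the angle pi / 8 and folding of angles\<close>

lemma cos_pi_8: "cos (pi / 8) = (1 + sqrt 2) * sin (pi / 8)" and sin_pi_8: "0 < sin (pi / 8)"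
proof -
  define c s where "c = cos (pi / 8)" and "s = sin (pi / 8)"
  have s: "s > 0" unfolding s_def by (intro sin_gt_zero) auto
  have c: "c > 0" unfolding c_def by (intro cos_gt_zero) auto
  have A: "sin (pi / 4) = 2 * s * c" and B: "cos (pi / 4) = c\<^sup>2 - s\<^sup>2"
    using sin_double[of "pi / 8"] cos_double[of "pi / 8"] by (simp_all add: s_def c_def)
  have "sin (pi / 4) = cos (pi / 4)" by (simp add: sin_45 cos_45)
  then have "2 * s * c = c\<^sup>2 - s\<^sup>2" by (simp only: A B)
  then have "(c - (1 + sqrt 2) * s) * (c + (sqrt 2 - 1) * s) = 0"
    by (simp add: algebra_simps power2_eq_square sqrt2_mult)
  moreover have "c + (sqrt 2 - 1) * s > 0" using c s by (simp add: add_pos_nonneg)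
  ultimately have "c = (1 + sqrt 2) * s" by simp
  then show "cos (pi / 8) = (1 + sqrt 2) * sin (pi / 8)" "0 < sin (pi / 8)" using s by (simp_all add: c_def s_def)
qed

lemma sin_minus_pi_8: "sin (t - pi / 8) = - sin (pi / 8) * (cos t - (1 + sqrt 2) * sin t)"
  and sin_plus_pi_8: "sin (t + pi / 8) = sin (pi / 8) * (cos t + (1 + sqrt 2) * sin t)"
  by (simp_all add: sin_diff sin_add cos_pi_8 algebra_simps)

lemma sin_ge_sin_pi_8:
  assumes "pi / 8 \<le> t" "t \<le> 7 * pi / 8"
  shows "sin (pi / 8) \<le> sin t"
proof (cases "t \<le> pi / 2")
  case True
  then show ?thesis using assms by (intro sin_monotone_2pi_le) auto
next
  case False
  then have "sin (pi / 8) \<le> sin (pi - t)" using assms by (intro sin_monotone_2pi_le) auto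
  then show ?thesis by simp
qed

text \<open>In an even slice of width \<open>pi / 8\<close> a rotation brings the angle into the
  sector; an odd slice needs a reflection as well.\<close>

lemma fold_angle:
  assumes "0 \<le> t"
  obtains k j t' where "k = nat \<lfloor>t / (pi / 8)\<rfloor>" "real k * (pi / 8) \<le> t" "t < (real k + 1) * (pi / 8)" "0 \<le> t'" "t' \<le> pi / 8"
    "(k = 2 * j \<and> t = real j * (pi / 4) + t') \<or> (k + 1 = 2 * j \<and> t = real j * (pi / 4) - t')"
proof -
  define k where "k = nat \<lfloor>t / (pi / 8)\<rfloor>"
  have nn: "0 \<le> t / (pi / 8)" using assms by simp
  have rk: "real k = of_int \<lfloor>t / (pi / 8)\<rfloor>" unfolding k_def using nn by simp
  have "real k \<le> t / (pi / 8)" "t / (pi / 8) < real k + 1" unfolding rk by linarith+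
  then have k: "real k * (pi / 8) \<le> t" "t < (real k + 1) * (pi / 8)" by (simp_all add: field_simps)
  show ?thesis
  proof (cases "even k")
    case True
    then obtain j where "k = 2 * j" by (elim evenE)
    then show ?thesis using k by (intro that[of k "t - real k * (pi / 8)" j] k_def) (auto simp: algebra_simps)
  next
    case False
    then obtain j0 where "k = 2 * j0 + 1" by (elim oddE)
    then show ?thesis using k by (intro that[of k "(real k + 1) * (pi / 8) - t" "j0 + 1"] k_def) (auto simp: algebra_simps)
  qed
qed

section \<open>Shortening a direction by shears and symmetries\<close>

locale renorm =
  fixes u u' :: complex and A :: real
  assumes A: "A > 0"
    and nonexc: "\<And>G E v. autom G E \<Longrightarrow> E v = u \<Longrightarrow> Im v \<noteq> 0 \<and> Re v \<noteq> (1 + sqrt 2) * Im v"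
begin

text \<open>
  \<open>v\<close> and \<open>w\<close> are the direction \<open>u\<close> and an auxiliary vector \<open>u'\<close> pulled back by the same
  automorphism, so the area they span is fixed. The dihedral symmetries fold \<open>v\<close> into the sector of
  angle \<open>pi / 8\<close>, and the shear then shortens it unless it becomes horizontal or lies on the
  boundary of the sector, which is excluded for unexceptional \<open>u\<close>. The off-sector condition on
  \<open>w\<close> persists, and infinitely often the two vectors are uniformly transverse.
\<close>

definition frame :: "complex \<Rightarrow> complex \<Rightarrow> bool" where
  "frame v w \<longleftrightarrow> (\<exists>G E. autom G E \<and> E v = u \<and> E w = u') \<and> \<bar>wedge v w\<bar> = A"

definition state :: "complex \<Rightarrow> complex \<Rightarrow> bool" where
  "state v w \<longleftrightarrow> frame v w \<and> sector v \<and> off_sector w"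

text \<open>The smaller of the lower bounds for the sine of the angle that
  \<open>reach_middle\<close> and \<open>reach_turn\<close> produce.\<close>

definition angle_bound :: real where "angle_bound = min (sin (pi / 8)) (1 / (3 * (2 + sqrt 2)))"

definition transverse :: "complex \<Rightarrow> complex \<Rightarrow> bool" where
  "transverse v w \<longleftrightarrow> angle_bound * norm v * norm w \<le> \<bar>wedge v w\<bar>"

text \<open>A gain by a fixed factor over a vector of length \<open>B\<close>, ending in a uniformly
  transverse pair. Only the end of a run is recorded, since a single shear may gain very
  little.\<close>

definition reach :: "real \<Rightarrow> bool" where
  "reach B \<longleftrightarrow> (\<exists>v w. state v w \<and> (1 + sin (pi / 8)) * (norm v)\<^sup>2 \<le> B\<^sup>2 \<and> transverse v w)"

lemma angle_bound_pos: "angle_bound > 0"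
  using sin_pi_8 by (simp add: angle_bound_def add_pos_pos)

lemma reach_mono: "reach B \<Longrightarrow> 0 \<le> B \<Longrightarrow> B \<le> B' \<Longrightarrow> reach B'"
  unfolding reach_def by (meson order.trans power_mono)

lemma frame_shear:
  assumes "frame v w"
  shows "frame (shear_lin 1 v) (shear_lin 1 w)"
proof -
  obtain G E where "autom G E" "E v = u" "E w = u'" using assms by (auto simp: frame_def)
  then have "autom (G \<circ> shear (- 1)) (E \<circ> shear_lin (- 1))" "(E \<circ> shear_lin (- 1)) (shear_lin 1 v) = u"
    "(E \<circ> shear_lin (- 1)) (shear_lin 1 w) = u'"
    using autom_shear shear_lin_inverse[of 1] by auto
  then show ?thesis using assms unfolding frame_def wedge_shear by blast
qed

lemma frame_rotate:
  assumes "frame (cis (real j * (pi / 4)) * v) (cis (real j * (pi / 4)) * w)"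
  shows "frame v w"
proof -
  obtain G E where "autom G E" "E (cis (real j * (pi / 4)) * v) = u" "E (cis (real j * (pi / 4)) * w) = u'"
    using assms by (auto simp: frame_def)
  then show ?thesis using assms autom_rotations[of G E j] unfolding frame_def wedge_rotate by auto
qed

lemma frame_cnj:
  assumes "frame (cnj v) (cnj w)"
  shows "frame v w"
proof -
  obtain G E where "autom G E" "E (cnj v) = u" "E (cnj w) = u'" using assms by (auto simp: frame_def)
  then have "autom (G \<circ> cnj) (E \<circ> cnj) \<and> (E \<circ> cnj) v = u \<and> (E \<circ> cnj) w = u'" using autom_cnj by simp
  then show ?thesis using assms unfolding frame_def wedge_cnj abs_minus_cancel by blast
qed

text \<open>The angle gives the closed sector, and \<open>nonexc\<close> excludes its two
  sides.\<close>

lemma sector_polar: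
  assumes "frame (of_real r * cis t) w" "r > 0" "0 \<le> t" "t \<le> pi / 8"
  shows "sector (of_real r * cis t)"
proof -
  have "sin t \<ge> 0" using assms by (intro sin_ge_zero) auto
  moreover have "sin (t - pi / 8) \<le> 0" using sin_ge_zero[of "pi / 8 - t"] assms sin_minus[of "pi / 8 - t"] by simp
  then have "cos t - (1 + sqrt 2) * sin t \<ge> 0" unfolding sin_minus_pi_8 using sin_pi_8 by (simp add: zero_le_mult_iff)
  moreover have "r * cos t - (1 + sqrt 2) * (r * sin t) = r * (cos t - (1 + sqrt 2) * sin t)" by (simp add: algebra_simps)
  moreover have "Im (of_real r * cis t) \<noteq> 0 \<and> Re (of_real r * cis t) \<noteq> (1 + sqrt 2) * Im (of_real r * cis t)"
  proof -
    obtain G E where "autom G E" "E (of_real r * cis t) = u" using assms(1) unfolding frame_def by blast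
    then show ?thesis by (rule nonexc)
  qed
  ultimately show ?thesis using assms(2) by (auto simp: sector_def less_le)
qed

lemma off_sector_polar:
  assumes "(pi / 8 \<le> t \<and> t \<le> pi) \<or> (- 7 * pi / 8 \<le> t \<and> t \<le> 0)"
  shows "off_sector (of_real r * cis t)"
proof -
  have "sin t * sin (t - pi / 8) \<ge> 0"
    using assms
  proof
    assume *: "pi / 8 \<le> t \<and> t \<le> pi"
    then show ?thesis by (intro mult_nonneg_nonneg sin_ge_zero) auto
  next
    assume *: "- 7 * pi / 8 \<le> t \<and> t \<le> 0"
    then have "sin (- t) \<ge> 0" "sin (pi / 8 - t) \<ge> 0" by (intro sin_ge_zero; simp)+
    then have "sin (- t) * sin (pi / 8 - t) \<ge> 0" by (intro mult_nonneg_nonneg)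
    moreover have "sin (pi / 8 - t) = - sin (t - pi / 8)" by (metis minus_diff_eq sin_minus)
    ultimately show ?thesis by simp
  qed
  then have "sin (pi / 8) * (sin t * (cos t - (1 + sqrt 2) * sin t)) \<le> 0"
    unfolding sin_minus_pi_8 by (simp add: algebra_simps)
  then have "sin t * (cos t - (1 + sqrt 2) * sin t) \<le> 0" using sin_pi_8 by (simp add: mult_le_0_iff)
  then have "r\<^sup>2 * (sin t * (cos t - (1 + sqrt 2) * sin t)) \<le> 0" by (simp add: mult_nonneg_nonpos)
  then show ?thesis by (simp add: off_sector_def power2_eq_square algebra_simps)
qed

text \<open>The shear takes the sector to the angles between 0 and \<open>7 * pi / 8\<close>, and
  the lines avoiding the sector to those with angles from \<open>7 * pi / 8\<close> to
  \<open>pi\<close>. The last identity shows that \<open>v\<close> becomes shorter, since both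
  factors of the second term are positive.\<close>

lemma sheared:
  assumes "state v w"
  defines "v' \<equiv> shear_lin 1 v" and "w' \<equiv> shear_lin 1 w"
  shows "frame v' w'" "0 < Im v'" "0 < Re v' + (1 + sqrt 2) * Im v'"
    "Im w' * (Re w' + (1 + sqrt 2) * Im w') \<le> 0" "off_sector w'" "norm v' \<le> norm v"
    "(norm v)\<^sup>2 = (norm v')\<^sup>2 + (2 + 2 * sqrt 2) * Im v' * (2 * (Re v' + (1 + sqrt 2) * Im v'))"
proof -
  have s: "sector v" "off_sector w" "frame v w" using assms by (auto simp: state_def)
  show "frame v' w'" unfolding v'_def w'_def by (rule frame_shear[OF s(3)])
  show I: "0 < Im v'" and R: "0 < Re v' + (1 + sqrt 2) * Im v'"
    using s(1) by (auto simp: sector_def v'_def shear_lin_def algebra_simps)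
  show o: "Im w' * (Re w' + (1 + sqrt 2) * Im w') \<le> 0"
    using s(2) by (simp add: off_sector_def w'_def shear_lin_def algebra_simps)
  have "Im w' * (Re w' - (1 + sqrt 2) * Im w') = Im w' * (Re w' + (1 + sqrt 2) * Im w') - (2 + 2 * sqrt 2) * (Im w' * Im w')"
    by (simp add: algebra_simps)
  moreover have "0 \<le> (2 + 2 * sqrt 2) * (Im w' * Im w')" by simp
  ultimately show "off_sector w'" unfolding off_sector_def using o by linarith
  show n: "(norm v)\<^sup>2 = (norm v')\<^sup>2 + (2 + 2 * sqrt 2) * Im v' * (2 * (Re v' + (1 + sqrt 2) * Im v'))"
    unfolding cmod_power2 v'_def shear_lin_def by (simp add: power2_eq_square algebra_simps sqrt2_mult)
  have "0 \<le> (2 + 2 * sqrt 2) * Im v' * (2 * (Re v' + (1 + sqrt 2) * Im v'))"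
    using I R by (intro mult_nonneg_nonneg) auto
  then have "(norm v')\<^sup>2 \<le> (norm v)\<^sup>2" using n by linarith
  then show "norm v' \<le> norm v" by (rule power2_le_imp_le) simp
qed

text \<open>The coefficient \<open>r'\<close> may be negative, so that the line of the sheared
  \<open>w\<close> is represented by an angle in the last eighth of the upper half plane.\<close>

lemma polar_forms:
  assumes "state v w"
  obtains r t r' s where "shear_lin 1 v = of_real r * cis t" "r > 0" "0 < t" "t < 7 * pi / 8"
    "shear_lin 1 w = of_real r' * cis s" "7 * pi / 8 \<le> s" "s \<le> pi" "\<bar>r'\<bar> = norm (shear_lin 1 w)" "r = norm (shear_lin 1 v)"
proof -
  note sh = sheared[OF assms]
  let ?v = "shear_lin 1 v" and ?w = "shear_lin 1 w"
  have arg: "\<exists>t. z = of_real (norm z) * cis t \<and> 0 < t \<and> t < pi" if "Im z > 0" for z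
  proof (intro exI[of _ "Arg z"] conjI)
    show "z = of_real (norm z) * cis (Arg z)" using rcis_cmod_Arg[of z] by (simp add: rcis_def)
    show "0 < Arg z" "Arg z < pi" using that Arg_lt_pi[of z] by blast+
  qed
  obtain t where t: "?v = of_real (norm ?v) * cis t" "0 < t" "t < pi" using arg[OF sh(2)] by blast
  have v0: "norm ?v > 0" using sh(2) by auto
  have tri: "norm z * sin (t + pi / 8) = sin (pi / 8) * (Re z + (1 + sqrt 2) * Im z)"
    if "z = of_real (norm z) * cis t" for z t
  proof -
    have "Re z = norm z * cos t" "Im z = norm z * sin t" using arg_cong[OF that, of Re] arg_cong[OF that, of Im] by simp_all
    then show ?thesis unfolding sin_plus_pi_8 by (simp add: algebra_simps)
  qed
  note tri[OF t(1)]
  then have sp: "sin (t + pi / 8) > 0" using sh(3) sin_pi_8 v0 by (metis mult_pos_pos zero_less_mult_pos)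
  have t7: "t < 7 * pi / 8"
  proof (rule ccontr)
    assume "\<not> ?thesis"
    then have "sin (t + pi / 8) \<le> 0" using t by (intro sin_le_zero) auto
    with sp show False by simp
  qed
  have key: "\<exists>s. z = of_real (norm z) * cis s \<and> 7 * pi / 8 \<le> s \<and> s \<le> pi"
    if z: "Im z > 0" "Im z * (Re z + (1 + sqrt 2) * Im z) \<le> 0" for z
  proof -
    obtain s where s: "z = of_real (norm z) * cis s" "0 < s" "s < pi" using arg[OF z(1)] by blast
    have z0: "norm z > 0" using z by auto
    note tri[OF s(1)]
    moreover have "Re z + (1 + sqrt 2) * Im z \<le> 0" using z by (simp add: mult_le_0_iff)
    then have "sin (pi / 8) * (Re z + (1 + sqrt 2) * Im z) \<le> 0" using sin_pi_8 by (simp add: mult_nonneg_nonpos)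
    ultimately have "norm z * sin (s + pi / 8) \<le> 0" by simp
    then have sp: "sin (s + pi / 8) \<le> 0" using z0 by (simp add: mult_le_0_iff)
    have "7 * pi / 8 \<le> s"
    proof (rule ccontr)
      assume "\<not> ?thesis"
      then have "0 < sin (s + pi / 8)" using s by (intro sin_gt_zero) auto
      with sp show False by simp
    qed
    then show ?thesis using s by (intro exI[of _ s]) auto
  qed
  have "\<exists>r' s. ?w = of_real r' * cis s \<and> 7 * pi / 8 \<le> s \<and> s \<le> pi \<and> \<bar>r'\<bar> = norm ?w"
  proof (cases "Im ?w" "0 :: real" rule: linorder_cases)
    case equal
    then show ?thesis by (intro exI[of _ "- Re ?w"] exI[of _ pi]) (auto simp: complex_eq_iff cmod_eq_Re)
  next
    case greater
    then show ?thesis using key[of ?w] sh(4) by (metis abs_norm_cancel)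
  next
    case less
    then obtain s where "- ?w = of_real (norm ?w) * cis s" "7 * pi / 8 \<le> s" "s \<le> pi"
      using key[of "- ?w"] sh(4) by (auto simp: algebra_simps)
    then show ?thesis by (intro exI[of _ "- norm ?w"] exI[of _ s]) (auto simp: minus_equation_iff[of ?w])
  qed
  then show ?thesis using that[of "norm ?v" t] t t7 v0 by blast
qed

text \<open>Folding \<open>t\<close> into the sector turns by at most three times
  \<open>pi / 4\<close>. The angle \<open>s\<close> is turned along with it and afterwards is still
  at least \<open>pi / 8\<close>, or is nonpositive when a reflection was used, so its line avoids
  the sector.\<close>

lemma fold_state:
  assumes "frame (of_real r * cis t) (of_real r' * cis s)" "r > 0" "0 < t" "t < 7 * pi / 8" "7 * pi / 8 \<le> s" "s \<le> pi"
  shows "\<exists>v w. state v w \<and> norm v = \<bar>r\<bar> \<and> norm w = \<bar>r'\<bar> \<and> \<bar>wedge v w\<bar> = \<bar>wedge (of_real r * cis t) (of_real r' * cis s)\<bar>"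
proof -
  obtain k j t' where k: "k = nat \<lfloor>t / (pi / 8)\<rfloor>" "real k * (pi / 8) \<le> t" "t < (real k + 1) * (pi / 8)" "0 \<le> t'" "t' \<le> pi / 8"
    "(k = 2 * j \<and> t = real j * (pi / 4) + t') \<or> (k + 1 = 2 * j \<and> t = real j * (pi / 4) - t')"
    by (rule fold_angle[OF less_imp_le[OF assms(3)]])
  have "real k * (pi / 8) < 7 * (pi / 8)" using k(2) assms(4) by linarith
  then have "real k < 7" by (rule mult_right_less_imp_less) simp
  then have k7: "k \<le> 6" by linarith
  from k(6) show ?thesis
  proof
    assume e: "k = 2 * j \<and> t = real j * (pi / 4) + t'"
    define s' where "s' = s - real j * (pi / 4)"
    have j3: "j \<le> 3" using e k7 by linarith
    have eq: "of_real r * cis t = cis (real j * (pi / 4)) * (of_real r * cis t')"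
      "of_real r' * cis s = cis (real j * (pi / 4)) * (of_real r' * cis s')"
      using e by (simp_all add: s'_def cis_mult algebra_simps flip: mult.assoc)
    have fr: "frame (of_real r * cis t') (of_real r' * cis s')"
      using assms(1) frame_rotate unfolding eq by blast
    have "real j * (pi / 4) \<le> 3 * (pi / 4)" using j3 by (intro mult_right_mono) auto
    moreover have "0 \<le> real j * (pi / 4)" by simp
    ultimately have "pi / 8 \<le> s'" "s' \<le> pi" using assms(5,6) unfolding s'_def by linarith+
    then have "state (of_real r * cis t') (of_real r' * cis s')"
      unfolding state_def using fr sector_polar[OF fr assms(2) k(4,5)] off_sector_polar by blast
    then show ?thesis unfolding eq wedge_rotate
      by (intro exI[of _ "of_real r * cis t'"] exI[of _ "of_real r' * cis s'"]) (simp add: norm_mult)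
  next
    assume e: "k + 1 = 2 * j \<and> t = real j * (pi / 4) - t'"
    define s' where "s' = real j * (pi / 4) - s"
    have j3: "1 \<le> j" "j \<le> 3" using e k7 by linarith+
    have eq: "of_real r * cis t = cis (real j * (pi / 4)) * cnj (of_real r * cis t')"
      "of_real r' * cis s = cis (real j * (pi / 4)) * cnj (of_real r' * cis s')"
    proof -
      have te: "t = real j * (pi / 4) - t'" and se: "s = real j * (pi / 4) - s'" using e by (auto simp: s'_def)
      show "of_real r * cis t = cis (real j * (pi / 4)) * cnj (of_real r * cis t')"
        unfolding te by (simp add: cis_cnj cis_mult mult.left_commute)
      show "of_real r' * cis s = cis (real j * (pi / 4)) * cnj (of_real r' * cis s')"
        unfolding se by (simp add: cis_cnj cis_mult mult.left_commute)
    qed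
    have fr: "frame (of_real r * cis t') (of_real r' * cis s')"
      using assms(1) frame_rotate frame_cnj unfolding eq by blast
    have "real j * (pi / 4) \<le> 3 * (pi / 4)" "1 * (pi / 4) \<le> real j * (pi / 4)" using j3 by (intro mult_right_mono; simp)+
    then have "- 7 * pi / 8 \<le> s'" "s' \<le> 0" using assms(5,6) unfolding s'_def by linarith+
    then have "state (of_real r * cis t') (of_real r' * cis s')"
      unfolding state_def using fr sector_polar[OF fr assms(2) k(4,5)] off_sector_polar by blast
    then show ?thesis unfolding eq wedge_rotate wedge_cnj
      by (intro exI[of _ "of_real r * cis t'"] exI[of _ "of_real r' * cis s'"]) (simp add: norm_mult)
  qed
qed

lemma sector_iff_polar:
  assumes "r > 0" "0 < t" "t < pi"
  shows "sector (of_real r * cis t) \<longleftrightarrow> t < pi / 8"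
proof -
  have "sin t > 0" using assms by (intro sin_gt_zero) auto
  then have "sector (of_real r * cis t) \<longleftrightarrow> r * ((1 + sqrt 2) * sin t) < r * cos t"
    using assms by (simp add: sector_def algebra_simps)
  also have "\<dots> \<longleftrightarrow> sin (t - pi / 8) < 0" unfolding sin_minus_pi_8 using assms sin_pi_8
    by (simp add: zero_less_mult_iff)
  also have "\<dots> \<longleftrightarrow> t < pi / 8"
    using assms sin_gt_zero[of "pi / 8 - t"] sin_ge_zero[of "t - pi / 8"] sin_minus[of "pi / 8 - t"] by (simp; linarith)
  finally show ?thesis .
qed

text \<open>The angle \<open>t\<close> stays \<open>pi / 8\<close> away from 0 and from the range of
  \<open>s\<close>. Hence the angle between the vectors is bounded below, and the length identity of
  \<open>sheared\<close> gains a fixed factor.\<close>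

lemma reach_middle:
  assumes "state v w" "shear_lin 1 v = of_real r * cis t" "r > 0" "pi / 8 \<le> t" "t \<le> 6 * pi / 8"
  shows "reach (norm v)"
proof -
  obtain r1 t1 r' s where p: "shear_lin 1 v = of_real r1 * cis t1" "r1 > 0" "0 < t1" "t1 < 7 * pi / 8"
    "shear_lin 1 w = of_real r' * cis s" "7 * pi / 8 \<le> s" "s \<le> pi" "\<bar>r'\<bar> = norm (shear_lin 1 w)" "r1 = norm (shear_lin 1 v)"
    using polar_forms[OF assms(1)] by blast
  note sh = sheared[OF assms(1)]
  have t: "0 < t" "t < 7 * pi / 8" using assms(4,5) pi_gt_zero by linarith+
  have fr: "frame (of_real r * cis t) (of_real r' * cis s)" using sh(1) unfolding assms(2) p(5) .
  obtain v1 w1 where v1: "state v1 w1" "norm v1 = \<bar>r\<bar>" "norm w1 = \<bar>r'\<bar>"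
    "\<bar>wedge v1 w1\<bar> = \<bar>wedge (of_real r * cis t) (of_real r' * cis s)\<bar>"
    using fold_state[OF fr assms(3) t p(6,7)] by blast
  have "norm v1 = r" using v1(2) assms(3) by simp
  note 1 = v1(1) this v1(3,4)
  have "pi / 8 \<le> s - t" "s - t \<le> 7 * pi / 8" using assms(4,5) p(6,7) by linarith+
  then have "sin (pi / 8) \<le> sin (s - t)" by (rule sin_ge_sin_pi_8)
  then have "sin (pi / 8) * r * \<bar>r'\<bar> \<le> \<bar>r * r' * sin (s - t)\<bar>"
    using assms(3) sin_pi_8 by (simp add: abs_mult mult.commute mult.left_commute mult_left_mono)
  moreover have "angle_bound * (r * \<bar>r'\<bar>) \<le> sin (pi / 8) * (r * \<bar>r'\<bar>)"
    using assms(3) by (intro mult_right_mono) (auto simp: angle_bound_def)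
  ultimately have g: "transverse v1 w1" unfolding transverse_def 1 wedge_polar by (simp add: mult.assoc)
  \<comment> \<open>Both factors of the shortening term are bounded below by multiples of
    \<open>r\<close>.\<close>
  have "r * sin (pi / 8) \<le> r * sin t" using assms(3,4) t by (intro mult_left_mono sin_ge_sin_pi_8) auto
  then have y: "r * sin (pi / 8) \<le> Im (shear_lin 1 v)" unfolding assms(2) by simp
  have "sin (pi / 8) * r \<le> sin (t + pi / 8) * r" using assms(3-5) by (intro mult_right_mono sin_ge_sin_pi_8) auto
  also have "\<dots> = sin (pi / 8) * (Re (shear_lin 1 v) + (1 + sqrt 2) * Im (shear_lin 1 v))"
    unfolding assms(2) sin_plus_pi_8 by (simp add: algebra_simps)
  finally have x: "r \<le> Re (shear_lin 1 v) + (1 + sqrt 2) * Im (shear_lin 1 v)" using sin_pi_8 by simp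
  have "1 * (r * sin (pi / 8)) * (2 * r) \<le> (2 + 2 * sqrt 2) * Im (shear_lin 1 v) * (2 * (Re (shear_lin 1 v) + (1 + sqrt 2) * Im (shear_lin 1 v)))"
    using x y assms(3) sin_pi_8 sh(2) by (intro mult_mono) (auto intro: mult_nonneg_nonneg)
  moreover have "(norm (shear_lin 1 v))\<^sup>2 = r\<^sup>2" unfolding assms(2) by (simp add: norm_mult)
  ultimately have "r\<^sup>2 + 2 * (sin (pi / 8) * r\<^sup>2) \<le> (norm v)\<^sup>2" using sh(7) by (simp add: power2_eq_square algebra_simps)
  moreover have "0 \<le> sin (pi / 8) * r\<^sup>2" using sin_pi_8 by simp
  ultimately have "(1 + sin (pi / 8)) * (norm v1)\<^sup>2 \<le> (norm v)\<^sup>2" unfolding 1 by (simp add: algebra_simps)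
  then show ?thesis unfolding reach_def using 1(1) g by blast
qed

text \<open>The second shear turns \<open>v\<close> far to the left, where it may come close to the
  range of \<open>w\<close>. But \<open>w\<close> has been sheared twice too and is flatter: with
  \<open>h = 1 + sqrt 2\<close>, its slope is at most \<open>1 / (3 * h)\<close> in absolute value,
  while that of \<open>v\<close> is at least \<open>1 / h\<close>. The first shear already halves
  the squared length.\<close>

lemma reach_turn:
  assumes "state v w" "sector (shear_lin 1 v)" "Re (shear_lin 1 (shear_lin 1 v)) \<le> - Im (shear_lin 1 v)"
  shows "reach (norm v)"
proof -
  note sh = sheared[OF assms(1)]
  define v1 w1 v2 w2 where d: "v1 = shear_lin 1 v" "w1 = shear_lin 1 w" "v2 = shear_lin 1 v1" "w2 = shear_lin 1 w1"
  have st: "state v1 w1" using sh assms(2) by (simp add: state_def d)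
  note sh1 = sheared[OF st, folded d(3,4)]
  obtain r t r' s where p: "v2 = of_real r * cis t" "r > 0" "0 < t" "t < 7 * pi / 8"
    "w2 = of_real r' * cis s" "7 * pi / 8 \<le> s" "s \<le> pi" "\<bar>r'\<bar> = norm w2" "r = norm v2"
    using polar_forms[OF st, folded d(3,4)] by blast
  obtain v3 w3 where 3: "state v3 w3" "norm v3 = norm v2" "norm w3 = norm w2" "\<bar>wedge v3 w3\<bar> = \<bar>wedge v2 w2\<bar>"
  proof -
    have "frame (of_real r * cis t) (of_real r' * cis s)" using sh1(1) unfolding p(1,5) .
    from fold_state[OF this p(2-4,6,7)] obtain v3 w3 where "state v3 w3" "norm v3 = \<bar>r\<bar>" "norm w3 = \<bar>r'\<bar>"
      "\<bar>wedge v3 w3\<bar> = \<bar>wedge v2 w2\<bar>" unfolding p(1)[symmetric] p(5)[symmetric] by blast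
    moreover from this have "norm v3 = norm v2" "norm w3 = norm w2" using p(2,8,9) by simp_all
    ultimately show ?thesis by (intro that)
  qed
  define h where "h = 1 + sqrt 2"
  have h: "h > 2" using sqrt2 by (simp add: h_def)
  have I: "Im v1 > 0" "Im v2 = Im v1" "Im w2 = Im w1" using sh(2) by (auto simp: d shear_lin_def)
  have R: "Re v2 = Re v1 - 2 * h * Im v1" "Re w2 = Re w1 - 2 * h * Im w1" by (simp_all add: d(3,4) h_def shear_lin_def algebra_simps)
  have p1: "- h * Im v1 < Re v2" "Re v2 \<le> - Im v1" using sh1(3) assms(3) I by (simp_all add: d h_def algebra_simps)
  have "Im w1 * (Re w1 + h * Im w1) \<le> 0" using sh(4) by (simp add: d h_def)
  then have "Im w2 * (Re w2 + 3 * h * Im w2) \<le> 0" unfolding R I by (simp add: algebra_simps)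
  then have w2: "3 * h * \<bar>Im w2\<bar> \<le> \<bar>Re w2\<bar>"
  proof -
    assume *: "Im w2 * (Re w2 + 3 * h * Im w2) \<le> 0"
    have "3 * h * (Im w2 * Im w2) \<le> - (Im w2 * Re w2)" using * by (simp add: algebra_simps)
    also have "\<dots> \<le> \<bar>Im w2\<bar> * \<bar>Re w2\<bar>" by (metis abs_ge_self abs_minus_cancel abs_mult)
    finally have "\<bar>Im w2\<bar> * (3 * h * \<bar>Im w2\<bar>) \<le> \<bar>Im w2\<bar> * \<bar>Re w2\<bar>" by (simp add: abs_mult_self_eq algebra_simps)
    then show ?thesis by (cases "Im w2 = 0") (auto simp: mult_le_cancel_left)
  qed
  have nv: "norm v2 \<le> (1 + h) * Im v1" using cmod_le[of v2] p1 I h by (simp add: algebra_simps)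
  have "2 * \<bar>Im w2\<bar> \<le> 3 * h * \<bar>Im w2\<bar>" using h by (intro mult_right_mono) auto
  then have nw: "norm w2 \<le> 3 / 2 * \<bar>Re w2\<bar>" using cmod_le[of w2] w2 by simp
  have "\<bar>Re v2 * Im w2\<bar> \<le> h * Im v1 * \<bar>Im w2\<bar>"
    unfolding abs_mult using p1 I h by (intro mult_right_mono) (auto simp: abs_le_iff intro: order.trans[of _ 0])
  moreover have "Im v1 * (3 * h * \<bar>Im w2\<bar>) \<le> Im v1 * \<bar>Re w2\<bar>" using w2 I by (intro mult_left_mono) auto
  moreover have "\<bar>Im v2 * Re w2\<bar> = Im v1 * \<bar>Re w2\<bar>" using I by (simp add: abs_mult)
  moreover have "Im v1 * (3 * h * \<bar>Im w2\<bar>) = 3 * (h * Im v1 * \<bar>Im w2\<bar>)" by simp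
  ultimately have we: "2 / 3 * (Im v1 * \<bar>Re w2\<bar>) \<le> \<bar>wedge v2 w2\<bar>"
    unfolding wedge_def by linarith
  have "norm v2 * norm w2 \<le> (1 + h) * Im v1 * (3 / 2 * \<bar>Re w2\<bar>)"
    using nv nw I h by (intro mult_mono) auto
  then have "norm v2 * norm w2 / (3 * (1 + h)) \<le> (1 + h) * Im v1 * (3 / 2 * \<bar>Re w2\<bar>) / (3 * (1 + h))"
    using h by (intro divide_right_mono) auto
  also have "\<dots> \<le> 2 / 3 * (Im v1 * \<bar>Re w2\<bar>)"
    using h I by (simp add: field_simps)
  finally have "norm v2 * norm w2 / (3 * (1 + h)) \<le> \<bar>wedge v2 w2\<bar>" using we by (rule order.trans)
  then have "1 / (3 * (1 + h)) * (norm v2 * norm w2) \<le> \<bar>wedge v2 w2\<bar>" by (simp only: times_divide_eq_left mult_1)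
  moreover have "angle_bound * (norm v2 * norm w2) \<le> 1 / (3 * (1 + h)) * (norm v2 * norm w2)"
    by (intro mult_right_mono) (auto simp: angle_bound_def h_def)
  ultimately have g: "transverse v3 w3" unfolding transverse_def 3 by (simp add: mult.assoc)
  \<comment> \<open>The turn limits how flat \<open>v1\<close> can be, so the shortening term of the
    first shear is at least \<open>(norm v1)\<^sup>2\<close>.\<close>
  have x1: "Re v1 \<le> (2 * h - 1) * Im v1" using p1 R by (simp add: algebra_simps)
  have sec: "h * Im v1 < Re v1" using assms(2) by (simp add: sector_def d h_def)
  have "0 < h * Im v1" using h I by (intro mult_pos_pos) auto
  then have R0: "0 \<le> Re v1" using sec by linarith
  have n1: "(norm v)\<^sup>2 = (norm v1)\<^sup>2 + 2 * h * Im v1 * (2 * (Re v1 + h * Im v1))"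
    using sh(7) by (simp add: d h_def algebra_simps)
  have "(norm v1)\<^sup>2 \<le> ((2 * h - 1) * Im v1)\<^sup>2 + (Im v1)\<^sup>2"
    unfolding cmod_power2 using x1 R0 by (intro add_mono[OF power_mono order.refl])
  also have "\<dots> \<le> 2 * h * Im v1 * (2 * (h * Im v1 + h * Im v1))"
  proof -
    have "(2 * h - 1)\<^sup>2 + 1 \<le> 8 * h * h"
    proof -
      have "(2 * h - 1)\<^sup>2 + 1 = 4 * (h * h) - 4 * h + 2" "8 * h * h = 8 * (h * h)" by (simp_all add: power2_eq_square algebra_simps)
      moreover have "0 \<le> h * h" by simp
      ultimately show ?thesis using h by linarith
    qed
    then have "((2 * h - 1)\<^sup>2 + 1) * (Im v1)\<^sup>2 \<le> 8 * h * h * (Im v1)\<^sup>2" by (intro mult_right_mono) auto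
    then show ?thesis by (simp add: power2_eq_square algebra_simps)
  qed
  also have "\<dots> \<le> 2 * h * Im v1 * (2 * (Re v1 + h * Im v1))"
    using sec I h by (intro mult_left_mono) auto
  finally have "2 * (norm v1)\<^sup>2 \<le> (norm v)\<^sup>2" using n1 by simp
  moreover have "(1 + sin (pi / 8)) * (norm v3)\<^sup>2 \<le> 2 * (norm v1)\<^sup>2"
    unfolding 3 using sh1(6) by (intro mult_mono power_mono) auto
  ultimately show ?thesis unfolding reach_def using 3(1) g by (meson order.trans)
qed

text \<open>The run near the horizontal: each shear lowers the ratio of \<open>Re v\<close> to
  \<open>Im v\<close> by \<open>2 + 2 * sqrt 2\<close>, so after finitely many the vector leaves the
  sector, either into the middle range or by turning past it.\<close>

lemma reach_zero:
  assumes "state v w" "sector (shear_lin 1 v)" "Re v < real n * (2 + 2 * sqrt 2) * Im v"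
  shows "reach (norm v)"
  using assms
proof (induction n arbitrary: v w)
  case 0
  then show ?case by (auto simp: state_def sector_def) (smt (verit) mult_nonneg_nonneg real_sqrt_ge_zero)
next
  case (Suc n)
  note sh = sheared[OF Suc.prems(1)]
  let ?v1 = "shear_lin 1 v" and ?w1 = "shear_lin 1 w"
  have st: "state ?v1 ?w1" using sh Suc.prems(2) by (simp add: state_def)
  obtain r t r' s where p: "shear_lin 1 ?v1 = of_real r * cis t" "r > 0" "0 < t" "t < 7 * pi / 8"
    using polar_forms[OF st] by metis
  have "reach (norm ?v1) \<or> reach (norm v)"
  proof -
    consider "t < pi / 8" | "pi / 8 \<le> t" "t \<le> 6 * pi / 8" | "6 * pi / 8 < t" by linarith
    then show ?thesis
    proof cases
      case 1
      have "t < pi" using 1 pi_gt_zero by linarith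
      then have "sector (shear_lin 1 ?v1)" unfolding p(1) using sector_iff_polar[OF p(2,3)] 1 by blast
      moreover have "Re ?v1 < real n * (2 + 2 * sqrt 2) * Im ?v1"
        using Suc.prems(3) by (simp add: shear_lin_def algebra_simps)
      ultimately show ?thesis using Suc.IH[OF st] by blast
    next
      case 2
      then show ?thesis using reach_middle[OF st p(1,2)] by blast
    next
      case 3
      have "sin (t + pi / 4) \<le> 0" using 3 p by (intro sin_le_zero) auto
      moreover have "sin (t + pi / 4) = sqrt 2 / 2 * (cos t + sin t)" by (simp add: sin_add sin_45 cos_45 algebra_simps)
      ultimately have "cos t + sin t \<le> 0" using sqrt2(2) by (simp add: mult_le_0_iff)
      then have "r * (cos t + sin t) \<le> 0" using p by (simp add: mult_nonneg_nonpos)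
      then have "Re (shear_lin 1 ?v1) \<le> - Im (shear_lin 1 ?v1)" unfolding p(1) by (simp add: algebra_simps)
      moreover have "Im (shear_lin 1 ?v1) = Im ?v1" by (simp add: shear_lin_def)
      ultimately show ?thesis using reach_turn[OF Suc.prems(1,2)] by simp
    qed
  qed
  then show ?case using reach_mono[of "norm ?v1"] sh(6) by auto
qed

text \<open>The run near the angle \<open>pi / 8\<close>: a shear followed by the rotation through
  \<open>- 3 * pi / 4\<close> is parabolic and fixes that direction. The component of
  \<open>v\<close> orthogonal to it is preserved, and the component along it drops by a fixed
  multiple of the orthogonal one, so the run ends.\<close>

lemma reach_state_aux:
  assumes "state v w" "Re v * cos (pi / 8) + Im v * sin (pi / 8) < real n * ((2 + 2 * sqrt 2) * (Re v * sin (pi / 8) - Im v * cos (pi / 8)))"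
  shows "reach (norm v)"
  using assms
proof (induction n arbitrary: v w)
  case 0
  have "cos (pi / 8) > 0" using cos_pi_8 sin_pi_8 by (simp add: add_pos_pos)
  moreover have "Im v > 0" "(1 + sqrt 2) * Im v < Re v" using 0(1) by (auto simp: state_def sector_def)
  moreover have "0 < (1 + sqrt 2) * Im v" using calculation(2) by (intro mult_pos_pos add_pos_pos) auto
  then have "Re v > 0" using calculation(3) by linarith
  ultimately have "Re v * cos (pi / 8) + Im v * sin (pi / 8) > 0" using sin_pi_8 by (intro add_pos_pos mult_pos_pos)
  with 0 show ?case by simp
next
  case (Suc n)
  note sh = sheared[OF Suc.prems(1)]
  let ?v1 = "shear_lin 1 v" and ?w1 = "shear_lin 1 w"
  obtain r t r' s where p: "?v1 = of_real r * cis t" "r > 0" "0 < t" "t < 7 * pi / 8"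
    "?w1 = of_real r' * cis s" "7 * pi / 8 \<le> s" "s \<le> pi" "\<bar>r'\<bar> = norm ?w1" "r = norm ?v1"
    using polar_forms[OF Suc.prems(1)] by blast
  consider "t < pi / 8" | "pi / 8 \<le> t" "t \<le> 6 * pi / 8" | "6 * pi / 8 < t" by linarith
  then show ?case
  proof cases
    case 1
    have "t < pi" using 1 pi_gt_zero by linarith
    then have sec: "sector ?v1" unfolding p(1) using sector_iff_polar[OF p(2,3)] 1 by blast
    have "Im v > 0" using Suc.prems(1) by (auto simp: state_def sector_def)
    then have pos: "(2 + 2 * sqrt 2) * Im v > 0" by (simp add: add_pos_pos)
    obtain m where "Re v < real m * ((2 + 2 * sqrt 2) * Im v)" using reals_Archimedean3[OF pos] by blast
    then show ?thesis using reach_zero[OF Suc.prems(1) sec, of m] by (simp add: mult.assoc)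
  next
    case 2
    then show ?thesis using reach_middle[OF Suc.prems(1) p(1,2)] by blast
  next
    case 3
    define t' s' where "t' = t - 6 * pi / 8" and "s' = s - 6 * pi / 8"
    have eq: "?v1 = cis (real 3 * (pi / 4)) * (of_real r * cis t')" "?w1 = cis (real 3 * (pi / 4)) * (of_real r' * cis s')"
      unfolding p(1,5) t'_def s'_def by (simp_all add: cis_mult mult.left_commute)
    have fr: "frame (of_real r * cis t') (of_real r' * cis s')"
      using sh(1) frame_rotate[of 3] unfolding eq by blast
    have "state (of_real r * cis t') (of_real r' * cis s')"
    proof -
      have "0 \<le> t'" "t' \<le> pi / 8" "pi / 8 \<le> s'" "s' \<le> pi"
        using 3 p(4,6,7) pi_gt_zero unfolding t'_def s'_def by linarith+
      then show ?thesis unfolding state_def using fr sector_polar[OF fr p(2)] off_sector_polar[of s'] by blast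
    qed
    note IH = Suc.IH[OF this]
    have vn: "of_real r * cis t' = cis (- (3 * pi / 4)) * ?v1"
      unfolding eq by (simp add: cis_mult flip: mult.assoc)
    have c34: "cos (3 * pi / 4) = - (sqrt 2 / 2)" "sin (3 * pi / 4) = sqrt 2 / 2"
    proof -
      have "3 * pi / 4 = pi - pi / 4" by simp
      then show "cos (3 * pi / 4) = - (sqrt 2 / 2)" "sin (3 * pi / 4) = sqrt 2 / 2"
        by (simp_all only: cos_pi_minus sin_pi_minus cos_45 sin_45)
    qed
    \<comment> \<open>With \<open>h = sqrt 2 / 2\<close> everything becomes polynomial in
      \<open>h\<close> and \<open>S\<close> subject to \<open>2 * h * h = 1\<close>.\<close>
    define S where "S = sin (pi / 8)"
    define h where "h = sqrt 2 / 2"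
    have hh: "2 * h * h = 1" "sqrt 2 = 2 * h" using sqrt2(1) by (simp_all add: h_def)
    have RI: "Re (of_real r * cis t') = h * (Im v - (Re v - (2 + 4 * h) * Im v))"
      "Im (of_real r * cis t') = - h * (Im v + (Re v - (2 + 4 * h) * Im v))"
    proof -
      have c: "cis (- (3 * pi / 4)) = Complex (- h) (- h)" using c34 by (simp add: complex_eq_iff h_def)
      have "of_real r * cis t' = Complex (- h) (- h) * Complex (Re v - (2 + 4 * h) * Im v) (Im v)"
        unfolding vn c by (simp add: shear_lin_def hh(2))
      then show "Re (of_real r * cis t') = h * (Im v - (Re v - (2 + 4 * h) * Im v))"
        "Im (of_real r * cis t') = - h * (Im v + (Re v - (2 + 4 * h) * Im v))"
        by (simp_all add: algebra_simps)
    qed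
    have C: "cos (pi / 8) = (1 + 2 * h) * S" using cos_pi_8 hh(2) by (simp add: S_def)
    let ?x = "Re (of_real r * cis t')" and ?y = "Im (of_real r * cis t')"
    have H: "?x * S - ?y * cos (pi / 8) = Re v * S - Im v * cos (pi / 8)"
      unfolding RI C S_def[symmetric] using hh(1) by algebra
    have Gd: "?x * cos (pi / 8) + ?y * S = Re v * cos (pi / 8) + Im v * S - (2 + 2 * sqrt 2) * (Re v * S - Im v * cos (pi / 8))"
      unfolding RI C hh(2) using hh(1) by algebra
    have "?x * cos (pi / 8) + ?y * sin (pi / 8) < real n * ((2 + 2 * sqrt 2) * (?x * sin (pi / 8) - ?y * cos (pi / 8)))"
      using Suc.prems(2) unfolding S_def[symmetric] H Gd by (simp add: algebra_simps)
    then have "reach (norm (of_real r * cis t'))" by (rule IH)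
    moreover have "norm (of_real r * cis t') = norm ?v1" using p(2) unfolding p(1) by (simp add: norm_mult)
    ultimately show ?thesis using reach_mono sh(6) by (metis norm_ge_zero)
  qed
qed

lemma reach_state:
  assumes "state v w"
  shows "reach (norm v)"
proof -
  have "Re v * sin (pi / 8) - Im v * cos (pi / 8) = sin (pi / 8) * (Re v - (1 + sqrt 2) * Im v)"
    by (simp add: cos_pi_8 algebra_simps)
  also have "\<dots> > 0" using assms sin_pi_8 by (auto simp: state_def sector_def)
  finally have "(2 + 2 * sqrt 2) * (Re v * sin (pi / 8) - Im v * cos (pi / 8)) > 0" by (simp add: add_pos_pos)
  then show ?thesis using reals_Archimedean3 reach_state_aux[OF assms] by blast
qed

text \<open>Each application of \<open>reach_state\<close> divides the squared length by at least
  \<open>1 + sin (pi / 8)\<close>.\<close>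

lemma arbitrarily_short:
  assumes "state v w" "e > 0"
  shows "\<exists>v' w'. state v' w' \<and> transverse v' w' \<and> norm v' \<le> e"
proof -
  define q where "q = 1 + sin (pi / 8)"
  have q: "q > 1" using sin_pi_8 by (simp add: q_def)
  have "\<exists>v' w'. state v' w' \<and> transverse v' w' \<and> q ^ Suc n * (norm v')\<^sup>2 \<le> (norm v)\<^sup>2" for n
  proof (induction n)
    case 0
    then show ?case using reach_state[OF assms(1)] by (auto simp: reach_def q_def)
  next
    case (Suc n)
    then obtain v' w' where 1: "state v' w'" "q ^ Suc n * (norm v')\<^sup>2 \<le> (norm v)\<^sup>2" by blast
    then obtain v2 w2 where 2: "state v2 w2" "q * (norm v2)\<^sup>2 \<le> (norm v')\<^sup>2" "transverse v2 w2"
      using reach_state[OF 1(1)] by (auto simp: reach_def q_def)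
    have "q ^ Suc n * (q * (norm v2)\<^sup>2) \<le> q ^ Suc n * (norm v')\<^sup>2" using 2(2) q by (intro mult_left_mono) auto
    then show ?case using 1 2 by (intro exI[of _ v2] exI[of _ w2]) (auto simp: algebra_simps)
  qed
  moreover obtain n where n: "(norm v)\<^sup>2 / e\<^sup>2 < q ^ n" using real_arch_pow[OF q] by blast
  ultimately obtain v' w' where *: "state v' w'" "transverse v' w'" "q ^ Suc n * (norm v')\<^sup>2 \<le> (norm v)\<^sup>2" by blast
  have "q ^ n * (norm v')\<^sup>2 \<le> q ^ Suc n * (norm v')\<^sup>2" using q by (intro mult_right_mono) auto
  also note *(3)
  also have "(norm v)\<^sup>2 \<le> q ^ n * e\<^sup>2" using n assms(2) by (simp add: field_simps)
  finally have "(norm v')\<^sup>2 \<le> e\<^sup>2" using q by (simp add: mult_le_cancel_left)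
  then have "norm v' \<le> e" using assms(2) by (auto intro: power2_le_imp_le)
  then show ?thesis using * by blast
qed

end

text \<open>Directions that some automorphism pulls back to the line of a side of the sector. The
  identity contributes the horizontal ones, so \<open>Im u \<noteq> 0\<close> off this set.\<close>

definition exceptional :: "complex set" where
  "exceptional = (\<Union>E\<in>{E. \<exists>G. autom G E}. E ` ({v. Im v = 0} \<union> {v. Re v = (1 + sqrt 2) * Im v}))"

lemma negligible_exceptional: "negligible exceptional"
proof -
  have neg: "negligible ({v. Im v = 0} \<union> {v. Re v = (1 + sqrt 2) * Im v})"
  proof (rule negligible_Un)
    show "negligible {v. Im v = 0}" using negligible_hyperplane[of \<i> 0] by (simp add: inner_complex_def)
    show "negligible {v. Re v = (1 + sqrt 2) * Im v}"
      using negligible_hyperplane[of "Complex 1 (- (1 + sqrt 2))" 0]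
      by (auto simp: inner_complex_def complex_eq_iff algebra_simps)
  qed
  have "negligible (E ` ({v. Im v = 0} \<union> {v. Re v = (1 + sqrt 2) * Im v}))" if "autom G E" for G E
    using aff_linear[OF autom_aff[OF that]]
    by (intro negligible_differentiable_image_negligible[OF _ neg] linear_imp_differentiable_on) auto
  then show ?thesis unfolding exceptional_def
    by (intro negligible_countable_Union countable_image countable_autom) auto
qed

text \<open>When \<open>v\<close> becomes short, the fixed area \<open>A\<close> makes
  \<open>w\<close> long, while its image \<open>E w = E0 \<i>\<close> does not change; the
  normalised vector \<open>q\<close> is therefore contracted. Transversality provides the constant
  \<open>c\<close>.\<close>

lemma renormalisation:
  assumes "u \<notin> exceptional"
  shows "\<exists>c>0. \<forall>e>0. \<exists>G E p q r. aff G E \<and> oct_preserving G \<and> norm p = 1 \<and> norm q = 1 \<and> c \<le> \<bar>wedge p q\<bar> \<and>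
    r > 0 \<and> E p = r *\<^sub>R u \<and> norm (E q) \<le> e"
proof -
  have nonexc: "Im v \<noteq> 0 \<and> Re v \<noteq> (1 + sqrt 2) * Im v" if "autom G E" "E v = u" for G E v
    using assms that unfolding exceptional_def by blast
  have u0: "norm u > 0" using nonexc[OF autom_id, of u] by auto
  have up: "u = of_real (norm u) * cis (Arg2pi u)" by (metis Arg2pi_eq cis_conv_exp mult.commute)
  obtain k j t' where k: "0 \<le> t'" "t' \<le> pi / 8"
    "(k = 2 * j \<and> Arg2pi u = real j * (pi / 4) + t') \<or> (k + 1 = 2 * j \<and> Arg2pi u = real j * (pi / 4) - t')"
    by (rule fold_angle[OF Arg2pi_ge_0[of u]])
  let ?v = "of_real (norm u) * cis t'"
  obtain G0 E0 where E0: "autom G0 E0" "E0 ?v = u"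
  proof -
    obtain G1 where G1: "autom G1 (\<lambda>z. cis (real j * (pi / 4)) * z)" using autom_rotations[OF autom_id, of j] by auto
    from k(3) show ?thesis
    proof
      assume e: "k = 2 * j \<and> Arg2pi u = real j * (pi / 4) + t'"
      have "cis (real j * (pi / 4)) * ?v = u" by (subst (2) up) (simp add: e cis_mult mult.left_commute)
      then show ?thesis using that[OF G1] by simp
    next
      assume e: "k + 1 = 2 * j \<and> Arg2pi u = real j * (pi / 4) - t'"
      have "cis (real j * (pi / 4)) * cnj ?v = u" by (subst (2) up) (simp add: e cis_mult cis_cnj mult.left_commute)
      then show ?thesis using that[OF autom_cnj[OF G1]] by simp
    qed
  qed
  \<comment> \<open>The vector \<open>\<i>\<close> serves as the auxiliary one: it avoids the sector
    and is independent of \<open>?v\<close>.\<close>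
  define A where "A = \<bar>wedge ?v \<i>\<bar>"
  have "- (pi / 2) < t'" "t' < pi / 2" using k(1,2) pi_gt_zero by linarith+
  then have "cos t' > 0" by (rule cos_gt_zero_pi)
  then have A: "A > 0" using u0 by (simp add: A_def wedge_def)
  interpret renorm u "E0 \<i>" A by standard (use A nonexc in blast)+
  have fr: "frame ?v \<i>" unfolding frame_def using E0 by (auto simp: A_def)
  have st: "state ?v \<i>" unfolding state_def using fr sector_polar[OF fr u0 k(1,2)] sqrt2(2) by (simp add: off_sector_def)
  show ?thesis
  proof (intro exI[of _ angle_bound] conjI allI impI angle_bound_pos)
    fix e :: real assume e: "e > 0"
    \<comment> \<open>Chosen so that \<open>norm v \<le> f\<close>, which forces
      \<open>norm w \<ge> A / f\<close>, gives
      \<open>norm (E0 \<i>) / norm w \<le> e\<close>.\<close>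
    define f where "f = e * A / (norm (E0 \<i>) + 1)"
    have f: "f > 0" using e A by (simp add: f_def add_nonneg_pos)
    obtain v w where vw: "state v w" "transverse v w" "norm v \<le> f" using arbitrarily_short[OF st f] by blast
    obtain G E where GE: "autom G E" "E v = u" "E w = E0 \<i>" and wA: "\<bar>wedge v w\<bar> = A"
      using vw(1) by (auto simp: state_def frame_def)
    have v0: "norm v > 0" "norm w > 0" using wA A by (auto simp: wedge_def)
    have lin: "linear E" using aff_linear autom_aff GE(1) by blast
    show "\<exists>G E p q r. aff G E \<and> oct_preserving G \<and> norm p = 1 \<and> norm q = 1 \<and> angle_bound \<le> \<bar>wedge p q\<bar> \<and>
      r > 0 \<and> E p = r *\<^sub>R u \<and> norm (E q) \<le> e"
    proof (rule exI[of _ G], rule exI[of _ E], rule exI[of _ "(1 / norm v) *\<^sub>R v"],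
        rule exI[of _ "(1 / norm w) *\<^sub>R w"], rule exI[of _ "1 / norm v"], intro conjI)
      show "aff G E" "oct_preserving G" using GE autom_aff autom_preserving by auto
      show "norm ((1 / norm v) *\<^sub>R v) = 1" "norm ((1 / norm w) *\<^sub>R w) = 1" using v0 by auto
      show "E ((1 / norm v) *\<^sub>R v) = (1 / norm v) *\<^sub>R u" using lin GE by (simp add: linear_cmul)
      have we: "wedge ((1 / norm v) *\<^sub>R v) ((1 / norm w) *\<^sub>R w) = wedge v w / (norm v * norm w)"
        by (simp add: wedge_def diff_divide_distrib mult.commute)
      show "angle_bound \<le> \<bar>wedge ((1 / norm v) *\<^sub>R v) ((1 / norm w) *\<^sub>R w)\<bar>"
        unfolding we using vw(2) v0 by (simp add: transverse_def abs_mult field_simps)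
      have "A \<le> norm v * norm w"
      proof -
        have "wedge v w = Im (cnj v * w)" by (simp add: wedge_def algebra_simps)
        then show ?thesis using abs_Im_le_cmod[of "cnj v * w"] wA by (simp add: norm_mult)
      qed
      also have "\<dots> \<le> f * norm w" using vw(3) v0 by (intro mult_right_mono) auto
      finally have "A \<le> f * norm w" .
      then have "A * (norm (E0 \<i>) + 1) \<le> e * A * norm w"
      proof -
        assume "A \<le> f * norm w"
        moreover have "f * norm w = e * A * norm w / (norm (E0 \<i>) + 1)" by (simp add: f_def)
        moreover have "norm (E0 \<i>) + 1 > 0" by (simp add: add_nonneg_pos)
        ultimately show ?thesis by (simp add: pos_le_divide_eq)
      qed
      then have "norm (E0 \<i>) + 1 \<le> e * norm w" using A by (simp add: mult.commute mult.left_commute)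
      then show "norm (E ((1 / norm w) *\<^sub>R w)) \<le> e" using lin GE v0 by (simp add: linear_cmul field_simps)
    qed (use v0 in simp)
  qed
qed

section \<open>Ergodicity\<close>

text \<open>By regularity \<open>B\<close> lies between a compact and an open set of nearly the same
  measure; shifts shorter than the distance from the compact set to the complement of the open one
  move few points out of \<open>B\<close>.\<close>

lemma translation_continuity:
  fixes B :: "complex set"
  assumes B [measurable]: "B \<in> sets borel" and bd: "bounded B" and e: "e > 0"
  shows "\<exists>d>0. \<forall>v. norm v < d \<longrightarrow> emeasure lborel {x \<in> B. x + v \<notin> B} \<le> ennreal e"
proof -
  obtain U where U: "open U" "B \<subseteq> U" "emeasure lborel (U - B) < ennreal (e / 2)"
    using outer_regular_lborel[OF B, of "e / 2"] e by auto
  have Bc: "- B \<in> sets borel" using B by (metis Compl_eq_Diff_UNIV borel_comp)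
  obtain V where V: "open V" "- B \<subseteq> V" "emeasure lborel (V - - B) < ennreal (e / 2)"
    using outer_regular_lborel[OF Bc, of "e / 2"] e by auto
  define C where "C = - V"
  have "closed C" "C \<subseteq> B" using V by (auto simp: C_def)
  then have C: "C \<subseteq> B" "compact C" using bd bounded_subset compact_eq_bounded_closed by blast+
  have BC: "B - C = V - - B" by (auto simp: C_def)
  have "\<exists>d>0. \<forall>x\<in>C. \<forall>y\<in>- U. d \<le> dist x y"
    using separate_compact_closed[OF C(2), of "- U"] U C by auto
  then obtain d where d: "d > 0" "\<And>x y. x \<in> C \<Longrightarrow> y \<notin> U \<Longrightarrow> d \<le> dist x y" by blast
  have [measurable]: "C \<in> sets borel" "U \<in> sets borel" using C U by (auto simp: borel_compact)
  show ?thesis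
  proof (intro exI[of _ d] conjI allI impI d(1))
    fix v :: complex assume v: "norm v < d"
    have sub: "{x \<in> B. x + v \<notin> B} \<subseteq> (B - C) \<union> (\<lambda>x. x + v) -` (U - B)"
    proof
      fix x assume x: "x \<in> {x \<in> B. x + v \<notin> B}"
      show "x \<in> (B - C) \<union> (\<lambda>x. x + v) -` (U - B)"
      proof (cases "x \<in> C")
        case True
        then have "x + v \<in> U" using d(2)[of x "x + v"] v by (force simp: dist_norm)
        then show ?thesis using x by auto
      qed (use x in auto)
    qed
    have m: "(\<lambda>x. x + v) -` (U - B) \<in> sets borel"
    proof -
      have "(\<lambda>x. x + v) \<in> borel_measurable borel" by measurable
      from measurable_sets[OF this, of "U - B"] show ?thesis by simp
    qed
    have "emeasure lborel {x \<in> B. x + v \<notin> B} \<le> emeasure lborel ((B - C) \<union> (\<lambda>x. x + v) -` (U - B))"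
      using m by (intro emeasure_mono sub) auto
    also have "\<dots> \<le> emeasure lborel (B - C) + emeasure lborel ((\<lambda>x. x + v) -` (U - B))"
      using m by (intro emeasure_subadditive) auto
    also have "\<dots> \<le> ennreal (e / 2) + ennreal (e / 2)"
      using U(3) V(3) unfolding BC by (intro add_mono) (simp_all add: emeasure_translate)
    also have "\<dots> = ennreal e" using e by (simp flip: ennreal_plus)
    finally show "emeasure lborel {x \<in> B. x + v \<notin> B} \<le> ennreal e" .
  qed
qed

text \<open>Fubini with the substitution of \<open>y + w\<close> for the second variable. It bounds
  a product of measures once every translation carries only few points from one set to the
  other.\<close>

lemma emeasure_product_translates:
  fixes B1 B2 :: "complex set"
  assumes [measurable]: "B1 \<in> sets borel" "B2 \<in> sets borel"
  shows "emeasure lborel B1 * emeasure lborel B2 = (\<integral>\<^sup>+w. emeasure lborel {y \<in> B1. y + w \<in> B2} \<partial>lborel)"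
proof -
  have "(\<integral>\<^sup>+w. emeasure lborel {y \<in> B1. y + w \<in> B2} \<partial>lborel) = (\<integral>\<^sup>+w. \<integral>\<^sup>+y. indicator B1 y * indicator B2 (y + w) \<partial>lborel \<partial>lborel)"
  proof (rule nn_integral_cong)
    fix w :: complex
    have m: "{y \<in> B1. y + w \<in> B2} \<in> sets lborel" by measurable
    have "emeasure lborel {y \<in> B1. y + w \<in> B2} = (\<integral>\<^sup>+y. indicator {y \<in> B1. y + w \<in> B2} y \<partial>lborel)"
      using m by simp
    also have "\<dots> = (\<integral>\<^sup>+y. indicator B1 y * indicator B2 (y + w) \<partial>lborel)"
      by (intro nn_integral_cong) (auto simp: indicator_def)
    finally show "emeasure lborel {y \<in> B1. y + w \<in> B2} = (\<integral>\<^sup>+y. indicator B1 y * indicator B2 (y + w) \<partial>lborel)" .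
  qed
  also have "\<dots> = (\<integral>\<^sup>+y. \<integral>\<^sup>+w. indicator B1 y * indicator B2 (y + w) \<partial>lborel \<partial>lborel)"
    by (rule lborel_pair.Fubini') measurable
  also have "\<dots> = (\<integral>\<^sup>+y. indicator B1 y * emeasure lborel B2 \<partial>lborel)"
  proof (rule nn_integral_cong)
    fix y :: complex
    have m: "(\<lambda>w. w + y) -` B2 \<in> sets borel"
    proof -
      have "(\<lambda>w. w + y) \<in> borel_measurable borel" by measurable
      from measurable_sets[OF this, of B2] show ?thesis by simp
    qed
    have "(\<integral>\<^sup>+w. indicator B1 y * indicator B2 (y + w) \<partial>lborel) = indicator B1 y * (\<integral>\<^sup>+w. indicator B2 (y + w) \<partial>lborel)"
      by (rule nn_integral_cmult) measurable
    also have "(\<integral>\<^sup>+w. indicator B2 (y + w) \<partial>lborel) = (\<integral>\<^sup>+w. indicator ((\<lambda>w. w + y) -` B2) w \<partial>lborel)"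
      by (intro nn_integral_cong) (auto simp: indicator_def add.commute)
    also have "\<dots> = emeasure lborel B2" using m emeasure_translate[of B2 y] by simp
    finally show "(\<integral>\<^sup>+w. indicator B1 y * indicator B2 (y + w) \<partial>lborel) = indicator B1 y * emeasure lborel B2" .
  qed
  also have "\<dots> = emeasure lborel B1 * emeasure lborel B2" by (simp add: nn_integral_multc)
  finally show ?thesis ..
qed

text \<open>For \<open>s > 1\<close> this is a scaled octagon inside the interior: it leaves room
  for small translations and is still convex.\<close>

definition shrink :: "real \<Rightarrow> complex set" where
  "shrink s = {z. s *\<^sub>R z \<in> oct}"

lemma sets_shrink [measurable]: "shrink s \<in> sets borel"
  unfolding shrink_def by measurable

lemma convex_shrink: "convex (shrink s)"
proof (rule convexI)
  fix x y :: complex and a b :: real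
  assume *: "x \<in> shrink s" "y \<in> shrink s" "0 \<le> a" "0 \<le> b" "a + b = 1"
  have "a *\<^sub>R (s *\<^sub>R x) + b *\<^sub>R (s *\<^sub>R y) \<in> oct"
    using * by (intro convexD[OF convex_oct]) (auto simp: shrink_def)
  then show "a *\<^sub>R x + b *\<^sub>R y \<in> shrink s" by (simp add: shrink_def algebra_simps)
qed

lemma zero_interior_oct: "\<exists>r>0. ball 0 r \<subseteq> oct"
proof (intro exI[of _ "1/2"] conjI subsetI)
  fix z :: complex assume "z \<in> ball 0 (1/2)"
  then have *: "\<bar>Re z\<bar> \<le> 1/2" "\<bar>Im z\<bar> \<le> 1/2" using abs_Re_le_cmod[of z] abs_Im_le_cmod[of z] by auto
  have "(sqrt 2 - 1) * \<bar>Im z\<bar> \<le> 1 * (1/2)" "(sqrt 2 - 1) * \<bar>Re z\<bar> \<le> 1 * (1/2)" using * sqrt2 by (intro mult_mono; simp)+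
  then show "z \<in> oct" unfolding oct_iff using * by linarith
qed simp

lemma ball_shrink:
  assumes "s > 1"
  obtains r where "r > 0" "\<And>z. z \<in> shrink s \<Longrightarrow> ball z r \<subseteq> interior oct"
proof -
  obtain r0 where r0: "r0 > 0" "ball 0 r0 \<subseteq> oct" using zero_interior_oct by blast
  define k where "k = 1 - 1 / s"
  have k: "k > 0" using assms by (simp add: k_def)
  have "ball z (k * r0) \<subseteq> interior oct" if "z \<in> shrink s" for z
  proof (rule interior_maximal)
    show "ball z (k * r0) \<subseteq> oct"
    proof
      fix y assume "y \<in> ball z (k * r0)"
      then have "norm (y - z) < r0 * k" by (simp add: dist_norm norm_minus_commute mult.commute)
      then have "norm ((1 / k) *\<^sub>R (y - z)) < r0" using k unfolding norm_scaleR by (simp add: pos_divide_less_eq)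
      then have "(1 / k) *\<^sub>R (y - z) \<in> oct" using r0 by (auto simp: subset_iff)
      then have "(1 / s) *\<^sub>R (s *\<^sub>R z) + k *\<^sub>R ((1 / k) *\<^sub>R (y - z)) \<in> oct"
        using that k assms by (intro convexD[OF convex_oct]) (auto simp: shrink_def k_def)
      then show "y \<in> oct" using k assms by simp
    qed
  qed simp
  then show ?thesis using that[of "k * r0"] k r0 by simp
qed

lemma shrink_subset: "s > 1 \<Longrightarrow> shrink s \<subseteq> interior oct"
  using ball_shrink[of s] by (metis centre_in_ball subset_iff)

lemma emeasure_shrink:
  assumes "e > 0"
  obtains s where "s > 1" "emeasure lborel (oct - shrink s) < ennreal e"
proof -
  define K where "K n = shrink (1 + 1 / (real n + 1))" for n
  have 1: "1 + 1 / (real n + 1) > 1" for n by simp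
  have "interior oct \<subseteq> (\<Union>n. K n)"
  proof
    fix z assume z: "z \<in> interior oct"
    have "(\<lambda>n. (1 + 1 / (real n + 1)) *\<^sub>R z) \<longlonglongrightarrow> (1 + 0) *\<^sub>R z"
      by (intro tendsto_intros) real_asymp
    then have "eventually (\<lambda>n. (1 + 1 / (real n + 1)) *\<^sub>R z \<in> interior oct) sequentially"
      using z by (intro topological_tendstoD) auto
    then obtain n where "(1 + 1 / (real n + 1)) *\<^sub>R z \<in> interior oct" by (auto simp: eventually_sequentially)
    then have "z \<in> K n" using interior_subset by (auto simp: K_def shrink_def)
    then show "z \<in> (\<Union>n. K n)" by blast
  qed
  then have "(\<Inter>n. oct - K n) \<subseteq> frontier oct" using oct_minus_frontier by blast
  then have z0: "emeasure lborel (\<Inter>n. oct - K n) = 0"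
    using null_frontier_oct null_sets_subset[of "frontier oct" lborel "\<Inter>n. oct - K n"] by (auto simp: K_def)
  have "decseq (\<lambda>n. oct - K n)"
  proof (rule decseq_SucI)
    fix n show "oct - K (Suc n) \<subseteq> oct - K n"
    proof (rule Diff_mono[OF order.refl], rule subsetI)
      fix z assume z: "z \<in> K n"
      define a where "a = (1 + 1 / (real (Suc n) + 1)) / (1 + 1 / (real n + 1))"
      have "1 + 1 / (real (Suc n) + 1) \<le> 1 + 1 / (real n + 1)" by (intro add_left_mono divide_left_mono) auto
      moreover have "0 < 1 + 1 / (real n + 1)" by (intro add_pos_pos) auto
      ultimately have a: "0 \<le> a" "a \<le> 1" unfolding a_def by (simp_all only: divide_le_eq_1_pos) (simp add: add_nonneg_nonneg)
      have "0 \<in> oct" using zero_interior_oct by (metis centre_in_ball subset_iff)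
      then have "a *\<^sub>R ((1 + 1 / (real n + 1)) *\<^sub>R z) + (1 - a) *\<^sub>R 0 \<in> oct"
        using z a by (intro convexD[OF convex_oct]) (auto simp: K_def shrink_def)
      moreover have "a * (1 + 1 / (real n + 1)) = 1 + 1 / (real (Suc n) + 1)"
      proof -
        have "1 + 1 / (real n + 1) \<noteq> 0" using 1[of n] by linarith
        then show ?thesis unfolding a_def by (rule nonzero_eq_divide_eq[THEN iffD1, OF _ refl])
      qed
      ultimately show "z \<in> K (Suc n)" by (simp add: K_def shrink_def)
    qed
  qed
  then have "(\<lambda>n. emeasure lborel (oct - K n)) \<longlonglongrightarrow> emeasure lborel (\<Inter>n. oct - K n)"
    using emeasure_oct_finite[of "- K _"] by (intro Lim_emeasure_decseq) (auto simp: K_def Diff_eq less_top)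
  then have "eventually (\<lambda>n. emeasure lborel (oct - K n) < ennreal e) sequentially"
    using assms unfolding z0 by (intro order_tendstoD) auto
  then obtain n where "emeasure lborel (oct - K n) < ennreal e" by (auto simp: eventually_sequentially)
  then show ?thesis using that[OF 1[of n]] by (simp add: K_def)
qed

text \<open>Phrased with \<open>rel\<close> because a position on the surface is only a class; both
  points have to be generic so that both orbits exist.\<close>

definition flow_invariant :: "complex \<Rightarrow> complex set \<Rightarrow> bool" where
  "flow_invariant u A \<longleftrightarrow> (\<forall>x x' t. generic u x \<longrightarrow> generic u x' \<longrightarrow> 0 \<le> t \<longrightarrow> (flow u x t, x') \<in> rel \<longrightarrow> (x \<in> A \<longleftrightarrow> x' \<in> A))"

text \<open>The image under \<open>G\<close> of the segment from \<open>y\<close> to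
  \<open>y + a *\<^sub>R p\<close> is a straight path whose velocity is a multiple of
  \<open>u\<close>. By uniqueness it is the flow, run for time \<open>a * r\<close>; negative
  \<open>a\<close> exchanges the end points.\<close>

lemma invariant_segment:
  assumes inv: "flow_invariant u A" and G: "aff G E" "E p = r *\<^sub>R u" "r > 0"
    and y: "y \<in> interior oct" "y + a *\<^sub>R p \<in> interior oct" "generic u (G y)" "generic u (G (y + a *\<^sub>R p))"
  shows "G y \<in> A \<longleftrightarrow> G (y + a *\<^sub>R p) \<in> A"
proof -
  have pos: "G y \<in> A \<longleftrightarrow> G (y + a *\<^sub>R p) \<in> A"
    if a: "a > 0" and y: "y \<in> interior oct" "y + a *\<^sub>R p \<in> interior oct" "generic u (G y)" "generic u (G (y + a *\<^sub>R p))" for a y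
  proof -
    have seg: "y + t *\<^sub>R (a *\<^sub>R p) \<in> interior oct" if "t \<in> {0..1}" for t
    proof -
      have "(1 - t) *\<^sub>R y + t *\<^sub>R (y + a *\<^sub>R p) \<in> interior oct"
        using that y by (intro convexD[OF convex_interior[OF convex_oct]]) auto
      then show ?thesis by (simp add: algebra_simps)
    qed
    have "straight_path {0..1} (a *\<^sub>R p) (\<lambda>t. rel `` {y + t *\<^sub>R (a *\<^sub>R p)})"
      using seg interior_subset interior_norm_less by (intro straight_path_segment) blast+
    from lift_straight_path[OF G(1) this]
    have s1: "straight_path {0..1} (E (a *\<^sub>R p)) (\<lambda>t. lift G (rel `` {y + t *\<^sub>R (a *\<^sub>R p)}))" by (simp add: is_interval_cc)
    have L: "lift G (rel `` {y + t *\<^sub>R (a *\<^sub>R p)}) = rel `` {G (y + t *\<^sub>R (a *\<^sub>R p))}" if "t \<in> {0..1}" for t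
      using lift_class[OF G(1)] seg[OF that] interior_subset by blast
    have Ea: "E (a *\<^sub>R p) = (a * r) *\<^sub>R u" using aff_linear[OF G(1)] G(2) by (simp add: linear_cmul)
    have "straight_path {0..} u (\<lambda>t. rel `` {flow u (G y) t})" "rel `` {flow u (G y) 0} = rel `` {G y}"
      using straight_flow_flow[OF y(3)] by (auto simp: straight_flow_iff)
    then have "straight_path {0..1} ((a * r) *\<^sub>R u) (\<lambda>t. rel `` {flow u (G y) (0 + (a * r) * t)})"
      using straight_path_affine[of "{0..}" u _ "a * r" 0] a G(3)
      by (rule_tac straight_path_subset) auto
    then have "lift G (rel `` {y + 1 *\<^sub>R (a *\<^sub>R p)}) = rel `` {flow u (G y) (0 + (a * r) * 1)}"
      using straight_path_unique[OF s1[unfolded Ea], of "\<lambda>t. rel `` {flow u (G y) (0 + (a * r) * t)}" 0 1]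
        L[of 0] \<open>rel `` {flow u (G y) 0} = rel `` {G y}\<close> by simp
    then have "rel `` {flow u (G y) (a * r)} = rel `` {G (y + a *\<^sub>R p)}" using L[of 1] by simp
    moreover have "0 \<le> a * r" using a G(3) by simp
    ultimately have "(flow u (G y) (a * r), G (y + a *\<^sub>R p)) \<in> rel"
      using class_eq_iff flow_oct generic_oct y(3,4) by metis
    then show ?thesis using inv y(3,4) \<open>0 \<le> a * r\<close> unfolding flow_invariant_def by blast
  qed
  consider "a > 0" | "a = 0" | "a < 0" by linarith
  then show ?thesis
  proof cases
    case 1 then show ?thesis using pos y by blast
  next
    case 3 then show ?thesis using pos[of "- a" "y + a *\<^sub>R p"] y by simp
  qed simp
qed

text \<open>The segment from \<open>G y\<close> to \<open>G y + E b\<close> stays in the octagon, so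
  by uniqueness it is the image path, and its interior end point has no other
  representative.\<close>

lemma aff_segment:
  assumes G: "aff G E" and y: "y \<in> interior oct" "y + b \<in> interior oct" "G y \<in> interior oct" "G y + E b \<in> interior oct"
  shows "G (y + b) = G y + E b"
proof -
  have seg: "z + t *\<^sub>R d \<in> interior oct" if "z \<in> interior oct" "z + d \<in> interior oct" "t \<in> {0..1}" for z d t
  proof -
    have "(1 - t) *\<^sub>R z + t *\<^sub>R (z + d) \<in> interior oct"
      using that by (intro convexD[OF convex_interior[OF convex_oct]]) auto
    then show ?thesis by (simp add: algebra_simps)
  qed
  have path: "straight_path {0..1} d (\<lambda>t. rel `` {z + t *\<^sub>R d})" if "z \<in> interior oct" "z + d \<in> interior oct" for z d
    using seg[OF that] interior_subset interior_norm_less by (intro straight_path_segment) blast+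
  from lift_straight_path[OF G path[OF y(1,2)]]
  have s1: "straight_path {0..1} (E b) (\<lambda>t. lift G (rel `` {y + t *\<^sub>R b}))" by (simp add: is_interval_cc)
  have L: "lift G (rel `` {y + t *\<^sub>R b}) = rel `` {G (y + t *\<^sub>R b)}" if "t \<in> {0..1}" for t
    using lift_class[OF G] seg[OF y(1,2) that] interior_subset by blast
  have "lift G (rel `` {y + 1 *\<^sub>R b}) = rel `` {G y + 1 *\<^sub>R E b}"
    using straight_path_unique[OF s1 path[OF y(3,4)], of 0 1] L[of 0] by simp
  then have "rel `` {G (y + b)} = rel `` {G y + E b}" using L[of 1] by simp
  then have "(G y + E b, G (y + b)) \<in> rel"
    using class_eq_iff aff_oct[OF G] y interior_subset by (metis subsetD)
  then show ?thesis using rel_interior_eq y(4) by blast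
qed

lemma wedge_decomposition:
  assumes "wedge p q \<noteq> 0"
  shows "w = (wedge w q / wedge p q) *\<^sub>R p + (wedge p w / wedge p q) *\<^sub>R q"
proof -
  have "wedge p q *\<^sub>R w = wedge w q *\<^sub>R p + wedge p w *\<^sub>R q"
    by (simp add: wedge_def complex_eq_iff algebra_simps)
  then have "(1 / wedge p q) *\<^sub>R (wedge p q *\<^sub>R w) = (1 / wedge p q) *\<^sub>R (wedge w q *\<^sub>R p + wedge p w *\<^sub>R q)" by simp
  then show ?thesis using assms by (simp add: scaleR_add_right divide_inverse mult.commute)
qed

lemma abs_wedge_le: "\<bar>wedge a b\<bar> \<le> norm a * norm b"
proof -
  have "wedge a b = Im (cnj a * b)" by (simp add: wedge_def algebra_simps)
  then show ?thesis using abs_Im_le_cmod[of "cnj a * b"] by (simp add: norm_mult)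
qed

text \<open>
  Moving by \<open>a *\<^sub>R p\<close> before \<open>G\<close> is flowing along \<open>u\<close> after \<open>G\<close>, which does not change membership in
  \<open>A\<close>; moving by \<open>b *\<^sub>R q\<close> becomes a translation by the tiny vector \<open>b *\<^sub>R E q\<close>.
\<close>

lemma almost_invariant_step:
  assumes A [measurable]: "A \<in> sets borel" "A \<subseteq> oct" and inv: "flow_invariant u A" and u: "Im u \<noteq> 0"
    and G: "aff G E" "oct_preserving G" "E p = r *\<^sub>R u" "r > 0" "norm p = 1" "norm q = 1" "c \<le> \<bar>wedge p q\<bar>" "c > 0"
    and d: "\<And>z. z \<in> K \<Longrightarrow> ball z d \<subseteq> interior oct" and K [measurable]: "K \<in> sets borel" and w: "norm w < c * d"
    and small: "\<And>v. norm v \<le> d * norm (E q) \<Longrightarrow> emeasure lborel {x \<in> A. x + v \<notin> A} \<le> \<theta>"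
      "\<And>v. norm v \<le> d * norm (E q) \<Longrightarrow> emeasure lborel {x \<in> interior oct. x + v \<notin> interior oct} \<le> \<theta>"
  shows "emeasure lborel {y \<in> K. G y \<in> A \<and> y + w \<in> K \<and> G (y + w) \<notin> A} \<le> 2 * \<theta>"
proof -
  have Gm [measurable]: "G \<in> borel_measurable borel" using G(2) by (simp add: oct_preserving_def)
  \<comment> \<open>Cramer's rule; the lower bound on \<open>\<bar>wedge p q\<bar>\<close> makes
    both coefficients smaller than \<open>d\<close>.\<close>
  define a b where "a = wedge w q / wedge p q" and "b = wedge p w / wedge p q"
  have wpq: "\<bar>wedge p q\<bar> > 0" "wedge p q \<noteq> 0" using G(7,8) by auto
  have wab: "w = a *\<^sub>R p + b *\<^sub>R q" unfolding a_def b_def by (rule wedge_decomposition[OF wpq(2)])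
  have bd: "\<bar>x / wedge p q\<bar> < d" if "\<bar>x\<bar> \<le> norm w" for x
  proof -
    have "d > 0" using w G(8) by (metis less_le_trans norm_ge_zero not_less zero_less_mult_pos le_less_trans)
    have "\<bar>x\<bar> < c * d" using that w by simp
    also have "\<dots> \<le> \<bar>wedge p q\<bar> * d" using G(7) \<open>d > 0\<close> by (intro mult_right_mono) auto
    finally show ?thesis using wpq by (simp add: abs_divide field_simps)
  qed
  have ab: "\<bar>a\<bar> < d" "\<bar>b\<bar> < d"
    unfolding a_def b_def using abs_wedge_le[of w q] abs_wedge_le[of p w] G(5,6) by (intro bd; simp)+
  define v where "v = b *\<^sub>R E q"
  have v: "norm v \<le> d * norm (E q)" using ab(2) by (simp add: v_def mult_right_mono)
  have Eb: "E (b *\<^sub>R q) = v" using aff_linear[OF G(1)] by (simp add: v_def linear_cmul)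
  \<comment> \<open>Points with a nongeneric image: a null set, because \<open>G\<close> preserves
    area.\<close>
  define N where "N = oct \<inter> G -` {x \<in> oct. \<not> generic u x}"
  have [measurable]: "interior oct \<in> sets borel" "frontier oct \<in> sets borel" by auto
  \<comment> \<open>Unwanted positions after \<open>G\<close>: the shift by \<open>v\<close> leaves
    \<open>A\<close> or the interior, or the position is on the frontier.\<close>
  define Z where "Z = {x \<in> A. x + v \<notin> A} \<union> {x \<in> interior oct. x + v \<notin> interior oct} \<union> frontier oct"
  have Zm [measurable]: "Z \<in> sets borel"
    unfolding Z_def by measurable
  have null: "{x \<in> oct. \<not> generic u x} \<in> null_sets lborel" by (rule null_not_generic[OF u])
  have nm: "{x \<in> oct. \<not> generic u x} \<in> sets borel" by measurable
  have N0: "N \<in> null_sets lborel"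
  proof -
    have "emeasure lborel N = emeasure lborel (oct \<inter> {x \<in> oct. \<not> generic u x})"
      unfolding N_def using G(2) nm unfolding oct_preserving_def by blast
    also have "oct \<inter> {x \<in> oct. \<not> generic u x} = {x \<in> oct. \<not> generic u x}" by auto
    also have "emeasure lborel {x \<in> oct. \<not> generic u x} = 0" by (rule null_setsD1[OF null])
    finally have "emeasure lborel N = 0" .
    moreover have "N \<in> sets borel" unfolding N_def using measurable_sets[OF Gm nm] by auto
    ultimately show ?thesis by auto
  qed
  let ?T = "\<lambda>y. y + a *\<^sub>R p"
  have Tm: "?T -` B \<in> sets borel" if "B \<in> sets borel" for B
  proof -
    have "?T \<in> borel_measurable borel" by measurable
    from measurable_sets[OF this that] show ?thesis by simp
  qed
  have sub: "{y \<in> K. G y \<in> A \<and> y + w \<in> K \<and> G (y + w) \<notin> A} \<subseteq> N \<union> ?T -` N \<union> ?T -` (oct \<inter> G -` Z)"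
  proof (rule subsetI, rule ccontr)
    fix y assume y: "y \<in> {y \<in> K. G y \<in> A \<and> y + w \<in> K \<and> G (y + w) \<notin> A}"
      and ny: "y \<notin> N \<union> ?T -` N \<union> ?T -` (oct \<inter> G -` Z)"
    have dpos: "d > 0" using ab by linarith
    have yi: "y \<in> interior oct" "y + w \<in> interior oct" using d[of y] d[of "y + w"] y dpos by auto
    have y1: "y + a *\<^sub>R p \<in> interior oct" using d[of y] y ab(1) G(5) by (auto simp: subset_iff dist_norm)
    have gen: "generic u (G y)" "generic u (G (y + a *\<^sub>R p))"
      using ny yi y1 interior_subset aff_oct[OF G(1)] by (auto simp: N_def)
    have x: "G (y + a *\<^sub>R p) \<in> A" using invariant_segment[OF inv G(1,3,4) yi(1) y1 gen] y by blast
    have xZ: "G (y + a *\<^sub>R p) \<notin> Z" using ny y1 interior_subset by auto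
    then have x1: "G (y + a *\<^sub>R p) \<in> interior oct" using x A(2) oct_minus_frontier by (auto simp: Z_def)
    then have x2: "G (y + a *\<^sub>R p) + E (b *\<^sub>R q) \<in> interior oct" "G (y + a *\<^sub>R p) + E (b *\<^sub>R q) \<in> A"
      using xZ x unfolding Eb by (auto simp: Z_def)
    have yw: "y + w = y + a *\<^sub>R p + b *\<^sub>R q" by (simp add: wab add.assoc)
    have "G (y + w) = G (y + a *\<^sub>R p) + E (b *\<^sub>R q)"
      unfolding yw by (rule aff_segment[OF G(1) y1 _ x1 x2(1)]) (use yi yw in simp)
    then show False using x2(2) y by simp
  qed
  have GZ: "oct \<inter> G -` Z \<in> sets borel" using measurable_sets[OF Gm Zm] by auto
  have Nb: "N \<in> sets borel" using N0 by auto
  have "emeasure lborel {y \<in> K. G y \<in> A \<and> y + w \<in> K \<and> G (y + w) \<notin> A} \<le> emeasure lborel (N \<union> ?T -` N \<union> ?T -` (oct \<inter> G -` Z))"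
    using Nb Tm[OF Nb] Tm[OF GZ] by (intro emeasure_mono sub) auto
  also have "\<dots> \<le> emeasure lborel N + emeasure lborel (?T -` N) + emeasure lborel (?T -` (oct \<inter> G -` Z))"
    using Nb Tm[OF Nb] Tm[OF GZ] by (intro order.trans[OF emeasure_subadditive] add_mono emeasure_subadditive order.refl) auto
  also have "\<dots> = emeasure lborel (oct \<inter> G -` Z)"
    unfolding emeasure_translate[OF Nb] emeasure_translate[OF GZ] null_setsD1[OF N0] by simp
  also have "\<dots> = emeasure lborel (oct \<inter> Z)" using G(2) Zm by (simp add: oct_preserving_def)
  also have "\<dots> \<le> emeasure lborel Z" by (intro emeasure_mono) auto
  also have "\<dots> \<le> emeasure lborel {x \<in> A. x + v \<notin> A} + emeasure lborel {x \<in> interior oct. x + v \<notin> interior oct} + emeasure lborel (frontier oct)"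
    unfolding Z_def by (intro order.trans[OF emeasure_subadditive] add_mono emeasure_subadditive order.refl) measurable
  also have "\<dots> \<le> \<theta> + \<theta> + 0" using small(1)[OF v] small(2)[OF v] null_frontier_oct by (intro add_mono) auto
  finally show ?thesis by (simp add: mult_2)
qed

text \<open>A translation by \<open>w\<close> that leaves \<open>P\<close> leaves it in one of
  \<open>n\<close> equal steps; convexity of \<open>K\<close> keeps the intermediate points in
  \<open>K\<close>, where the estimate for one step applies.\<close>

lemma almost_invariant_chain:
  fixes P :: "complex set"
  assumes K [measurable]: "K \<in> sets borel" and conv: "convex K" and P [measurable]: "P \<in> sets borel" and n: "n > 0"
    and step: "emeasure lborel {y \<in> K. y \<in> P \<and> y + (1 / real n) *\<^sub>R w \<in> K \<and> y + (1 / real n) *\<^sub>R w \<notin> P} \<le> \<theta>"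
  shows "emeasure lborel {y \<in> K \<inter> P. y + w \<in> K - P} \<le> of_nat n * \<theta>"
proof -
  let ?v = "(1 / real n) *\<^sub>R w"
  define S where "S = {y \<in> K. y \<in> P \<and> y + ?v \<in> K \<and> y + ?v \<notin> P}"
  have Sm: "S \<in> sets borel" unfolding S_def by measurable
  have Tm: "(\<lambda>y. y + x) -` S \<in> sets borel" for x
  proof -
    have "(\<lambda>y. y + x) \<in> borel_measurable borel" by measurable
    from measurable_sets[OF this Sm] show ?thesis by simp
  qed
  have sub: "{y \<in> K \<inter> P. y + w \<in> K - P} \<subseteq> (\<Union>i<n. (\<lambda>y. y + real i *\<^sub>R ?v) -` S)"
  proof
    fix y assume y: "y \<in> {y \<in> K \<inter> P. y + w \<in> K - P}"
    have inK: "y + real i *\<^sub>R ?v \<in> K" if "i \<le> n" for i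
    proof -
      have "(1 - real i / real n) *\<^sub>R y + (real i / real n) *\<^sub>R (y + w) \<in> K"
        using y that n by (intro convexD[OF conv]) auto
      then show ?thesis by (simp add: algebra_simps)
    qed
    have "\<exists>i<n. y + real i *\<^sub>R ?v \<in> P \<and> y + real (Suc i) *\<^sub>R ?v \<notin> P"
    proof (rule ccontr)
      assume *: "\<not> ?thesis"
      have "y + real i *\<^sub>R ?v \<in> P" if "i \<le> n" for i
        using that
      proof (induction i)
        case (Suc i) then show ?case using * by auto
      qed (use y in auto)
      from this[of n] y n show False by simp
    qed
    then obtain i where i: "i < n" "y + real i *\<^sub>R ?v \<in> P" "y + real (Suc i) *\<^sub>R ?v \<notin> P" by blast
    have "real (Suc i) *\<^sub>R ?v = real i *\<^sub>R ?v + ?v" unfolding of_nat_Suc scaleR_add_left by (simp only: scaleR_one add.commute)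
    then have e: "y + real (Suc i) *\<^sub>R ?v = y + real i *\<^sub>R ?v + ?v" by (simp only: add.assoc)
    have "y + real i *\<^sub>R ?v + ?v \<in> K" "y + real i *\<^sub>R ?v + ?v \<notin> P"
      using i inK[of "Suc i"] unfolding e by auto
    moreover have "y + real i *\<^sub>R ?v \<in> K" using i(1) by (intro inK) simp
    ultimately have "y + real i *\<^sub>R ?v \<in> S" using i(2) unfolding S_def by blast
    then show "y \<in> (\<Union>i<n. (\<lambda>y. y + real i *\<^sub>R ?v) -` S)" using i by auto
  qed
  have "emeasure lborel {y \<in> K \<inter> P. y + w \<in> K - P} \<le> emeasure lborel (\<Union>i<n. (\<lambda>y. y + real i *\<^sub>R ?v) -` S)"
    using Tm by (intro emeasure_mono sub) auto
  also have "\<dots> \<le> (\<Sum>i<n. emeasure lborel ((\<lambda>y. y + real i *\<^sub>R ?v) -` S))"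
    using Tm by (intro emeasure_subadditive_finite) auto
  also have "\<dots> = of_nat n * emeasure lborel S" by (simp add: emeasure_translate[OF Sm])
  also have "\<dots> \<le> of_nat n * \<theta>" using step by (intro mult_left_mono) (auto simp: S_def)
  finally show ?thesis .
qed

theorem ergodic:
  assumes u: "u \<notin> exceptional" and A [measurable]: "A \<in> sets borel" "A \<subseteq> oct" and inv: "flow_invariant u A"
  shows "emeasure lborel A = 0 \<or> emeasure lborel (oct - A) = 0"
proof (rule ccontr)
  assume "\<not> ?thesis"
  then have pos: "emeasure lborel A > 0" "emeasure lborel (oct - A) > 0" by (auto simp: zero_less_iff_neq_zero)
  have Imu: "Im u \<noteq> 0" using u autom_id unfolding exceptional_def by force
  have fin: "emeasure lborel A < \<infinity>" "emeasure lborel (interior oct) < \<infinity>" "emeasure lborel (oct - A) < \<infinity>"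
    using emeasure_oct_finite[of A] emeasure_oct_finite[of "interior oct"] emeasure_oct_finite[of "- A"] A(2) interior_subset[of oct]
    by (auto simp: Int_absorb1 Diff_eq)
  obtain m where m: "m > 0" "ennreal m < emeasure lborel A" "ennreal m < emeasure lborel (oct - A)"
  proof -
    obtain m1 where m1: "0 < m1" "m1 < min (emeasure lborel A) (emeasure lborel (oct - A))" using pos dense[of 0 "min (emeasure lborel A) (emeasure lborel (oct - A))"] by auto
    then have "m1 < top" using fin by (auto simp: less_top[symmetric])
    then obtain r where "m1 = ennreal r" "0 \<le> r" by (cases m1) auto
    then show ?thesis using that[of r] m1 by (auto simp: ennreal_less_zero_iff)
  qed
  obtain s where s: "s > 1" "emeasure lborel (oct - shrink s) < ennreal (m / 2)" using emeasure_shrink[of "m / 2"] m by auto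
  define K where "K = shrink s"
  have K [measurable]: "K \<in> sets borel" by (simp add: K_def)
  have Koct: "K \<subseteq> oct" using shrink_subset[OF s(1)] interior_subset by (auto simp: K_def)
  obtain d where d: "d > 0" "\<And>z. z \<in> K \<Longrightarrow> ball z d \<subseteq> interior oct" using ball_shrink[OF s(1)] unfolding K_def by metis
  obtain c where c: "c > 0" "\<And>e. e > 0 \<Longrightarrow> \<exists>G E p q r. aff G E \<and> oct_preserving G \<and> norm p = 1 \<and> norm q = 1 \<and> c \<le> \<bar>wedge p q\<bar> \<and>
    r > 0 \<and> E p = r *\<^sub>R u \<and> norm (E q) \<le> e" using renormalisation[OF u] by blast
  \<comment> \<open>The number of steps depends only on \<open>c\<close> and \<open>d\<close>; the
    automorphism is chosen later, after \<open>\<theta>\<close> has been fixed in terms of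
    \<open>n\<close>.\<close>
  obtain n :: nat where n: "2 / (c * d) < real n" using reals_Archimedean2 by blast
  have n0: "n > 0" using n c d by (metis divide_pos_pos gr0I less_asym mult_pos_pos of_nat_0 zero_less_numeral)
  define B where "B = measure lborel (cball (0 :: complex) 2)"
  have B: "emeasure lborel (cball (0 :: complex) 2) = ennreal B"
    unfolding B_def by (intro emeasure_eq_ennreal_measure) (use emeasure_compact_finite[of "cball (0 :: complex) 2"] in auto)
  \<comment> \<open>Two points of the octagon differ by at most 2, so the bound
    \<open>2 * n * \<theta>\<close> is integrated over a disc of area \<open>B\<close>; this choice
    makes the result at most half of \<open>(m / 2)\<^sup>2\<close>.\<close>
  define \<theta> where "\<theta> = (m / 2)\<^sup>2 / (4 * (real n * (B + 1)))"
  have B0: "B \<ge> 0" by (simp add: B_def)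
  have \<theta>: "\<theta> > 0" using m n0 B0 by (simp add: \<theta>_def)
  obtain d1 where d1: "d1 > 0" "\<And>v. norm v < d1 \<Longrightarrow> emeasure lborel {x \<in> A. x + v \<notin> A} \<le> ennreal \<theta>"
    using translation_continuity[OF A(1) bounded_subset[OF bounded_oct A(2)] \<theta>] by blast
  obtain d2 where d2: "d2 > 0" "\<And>v. norm v < d2 \<Longrightarrow> emeasure lborel {x \<in> interior oct. x + v \<notin> interior oct} \<le> ennreal \<theta>"
    using translation_continuity[OF _ bounded_subset[OF bounded_oct interior_subset] \<theta>] by auto
  define e where "e = min d1 d2 / (2 * d)"
  have e: "e > 0" using d d1 d2 by (simp add: e_def)
  obtain G E p q r where G: "aff G E" "oct_preserving G" "norm p = 1" "norm q = 1" "c \<le> \<bar>wedge p q\<bar>" "r > 0" "E p = r *\<^sub>R u" "norm (E q) \<le> e"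
    using c(2)[OF e] by blast
  have Gm [measurable]: "G \<in> borel_measurable borel" using G(2) by (simp add: oct_preserving_def)
  define P where "P = G -` A"
  have P [measurable]: "P \<in> sets borel" using measurable_sets[OF Gm A(1)] by (simp add: P_def)
  have sm: "norm v < min d1 d2" if "norm v \<le> d * norm (E q)" for v :: complex
  proof -
    have "d * norm (E q) \<le> d * e" using G(8) d by (intro mult_left_mono) auto
    also have "\<dots> = min d1 d2 / 2" using d by (simp add: e_def)
    finally show ?thesis using that d1 d2 by linarith
  qed
  have chain: "emeasure lborel {y \<in> K \<inter> P. y + w \<in> K - P} \<le> of_nat n * (2 * ennreal \<theta>)" if w: "norm w \<le> 2" for w
  proof (rule almost_invariant_chain[OF K _ P n0])
    show "convex K" by (simp add: K_def convex_shrink)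
    have "norm ((1 / real n) *\<^sub>R w) < c * d"
    proof -
      have "norm ((1 / real n) *\<^sub>R w) \<le> 2 / real n" using w n0 by (simp add: divide_right_mono)
      also have "\<dots> < c * d" using n n0 c d by (simp add: field_simps)
      finally show ?thesis .
    qed
    from almost_invariant_step[OF A inv Imu G(1,2,7,6,3,4,5) c(1) d(2) K this, of "ennreal \<theta>"] d1 d2 sm
    show "emeasure lborel {y \<in> K. y \<in> P \<and> y + (1 / real n) *\<^sub>R w \<in> K \<and> y + (1 / real n) *\<^sub>R w \<notin> P} \<le> 2 * ennreal \<theta>"
      by (simp add: P_def)
  qed
  have "emeasure lborel (K \<inter> P) * emeasure lborel (K - P) = (\<integral>\<^sup>+w. emeasure lborel {y \<in> K \<inter> P. y + w \<in> K - P} \<partial>lborel)"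
    by (rule emeasure_product_translates) measurable
  also have "\<dots> \<le> (\<integral>\<^sup>+w. of_nat n * (2 * ennreal \<theta>) * indicator (cball 0 2) (w :: complex) \<partial>lborel)"
  proof (intro nn_integral_mono)
    fix w :: complex
    show "emeasure lborel {y \<in> K \<inter> P. y + w \<in> K - P} \<le> of_nat n * (2 * ennreal \<theta>) * indicator (cball 0 2) w"
    proof (cases "norm w \<le> 2")
      case True then show ?thesis using chain by simp
    next
      case False
      have "{y \<in> K \<inter> P. y + w \<in> K - P} = {}"
      proof (rule ccontr)
        assume "{y \<in> K \<inter> P. y + w \<in> K - P} \<noteq> {}"
        then obtain y where "y \<in> oct" "y + w \<in> oct" using Koct by blast
        then have "norm w \<le> 1 + 1" using norm_triangle_ineq4[of "y + w" y] norm_oct_le[of y] norm_oct_le[of "y + w"] by simp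
        with False show False by simp
      qed
      then show ?thesis by (metis emeasure_empty zero_le)
    qed
  qed
  also have "\<dots> = of_nat n * (2 * ennreal \<theta>) * ennreal B"
    by (subst nn_integral_cmult_indicator) (auto simp: B)
  also have "\<dots> = ennreal (real n * (2 * \<theta>) * B)"
    using \<theta> B0 by (simp add: ennreal_mult ennreal_of_nat_eq_real_of_nat)
  also have "\<dots> < ennreal ((m / 2) * (m / 2))"
  proof (rule ennreal_lessI)
    have "real n * (2 * \<theta>) * B \<le> real n * (2 * \<theta>) * (B + 1)" using \<theta> by (intro mult_left_mono) auto
    also have "\<dots> = 2 * ((real n * (B + 1)) * \<theta>)" by (simp only: mult_ac)
    also have "\<dots> = (m / 2)\<^sup>2 / 2"
    proof -
      have "real n * (B + 1) > 0" using n0 B0 by (intro mult_pos_pos) auto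
      moreover have "X * ((m / 2)\<^sup>2 / (4 * X)) = (m / 2)\<^sup>2 / 4" if "X > 0" for X :: real using that by simp
      ultimately have "(real n * (B + 1)) * \<theta> = (m / 2)\<^sup>2 / 4" unfolding \<theta>_def by blast
      then show ?thesis by simp
    qed
    also have "\<dots> < (m / 2) * (m / 2)" using m by (simp add: power2_eq_square)
    finally show "real n * (2 * \<theta>) * B < m / 2 * (m / 2)" .
  qed (use m in simp)
  finally have less: "emeasure lborel (K \<inter> P) * emeasure lborel (K - P) < ennreal ((m / 2) * (m / 2))" .
  \<comment> \<open>\<open>K\<close> misses less than \<open>m / 2\<close> of the octagon, so a set
    of measure above \<open>m\<close> keeps at least \<open>m / 2\<close> inside
    \<open>K\<close>.\<close>
  have big: "ennreal (m / 2) \<le> emeasure lborel (K \<inter> X)" if X [measurable]: "X \<in> sets borel" and "ennreal m < emeasure lborel (oct \<inter> X)" for X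
  proof -
    have "ennreal (m / 2) + ennreal (m / 2) = ennreal m" using m by (simp flip: ennreal_plus)
    also have "\<dots> \<le> emeasure lborel (oct \<inter> X)" using that by simp
    also have "\<dots> \<le> emeasure lborel ((K \<inter> X) \<union> (oct - K))" by (intro emeasure_mono) auto
    also have "\<dots> \<le> emeasure lborel (K \<inter> X) + emeasure lborel (oct - K)" by (intro emeasure_subadditive) auto
    also have "\<dots> \<le> emeasure lborel (K \<inter> X) + ennreal (m / 2)" using s by (intro add_left_mono) (simp add: K_def)
    finally show ?thesis by (simp add: add.commute ennreal_add_left_cancel_le)
  qed
  have "emeasure lborel (oct \<inter> P) = emeasure lborel A"
    using G(2) A unfolding oct_preserving_def P_def by (metis Int_absorb1)
  then have 1: "ennreal (m / 2) \<le> emeasure lborel (K \<inter> P)" using big[OF P] m by simp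
  have Ac: "- A \<in> sets borel" and Pc: "- P \<in> sets borel" using A(1) P by (metis Compl_eq_Diff_UNIV borel_comp)+
  have "emeasure lborel (oct \<inter> - P) = emeasure lborel (oct \<inter> - A)"
    using G(2) Ac unfolding oct_preserving_def P_def by (metis vimage_Compl)
  then have 2: "ennreal (m / 2) \<le> emeasure lborel (K - P)" using big[OF Pc] m by (simp add: Diff_eq)
  have "ennreal ((m / 2) * (m / 2)) = ennreal (m / 2) * ennreal (m / 2)" using m by (intro ennreal_mult) auto
  also have "\<dots> \<le> emeasure lborel (K \<inter> P) * emeasure lborel (K - P)" using 1 2 by (intro mult_mono) auto
  finally show False using less by simp
qed

section \<open>An ergodic inequality\<close>

text \<open>Greedy covering of the first \<open>L\<close> steps: at a good point skip a whole block,
  at a point of \<open>B\<close> advance by one and charge \<open>c\<close>; at most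
  \<open>N\<close> steps at the end stay uncovered.\<close>

lemma ergodic_count:
  fixes f :: "'a \<Rightarrow> real"
  assumes T: "\<And>x. x \<in> X \<Longrightarrow> T x \<in> X" and f: "\<And>x. x \<in> X \<Longrightarrow> 0 \<le> f x" and c: "0 \<le> c"
    and good: "\<And>x. x \<in> X \<Longrightarrow> x \<notin> B \<Longrightarrow> \<exists>n\<ge>1. n \<le> N \<and> real n * c \<le> (\<Sum>i<n. f ((T ^^ i) x))"
  shows "x \<in> X \<Longrightarrow> (real L - real N) * c \<le> (\<Sum>i<L. f ((T ^^ i) x) + c * indicator B ((T ^^ i) x))"
proof (induction L arbitrary: x rule: less_induct)
  case (less L)
  have Ti: "(T ^^ i) x \<in> X" if "x \<in> X" for i x using that T by (induction i) auto
  have nn: "0 \<le> (\<Sum>i<k. f ((T ^^ i) x) + c * indicator B ((T ^^ i) x))" if "x \<in> X" for k x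
    using f c Ti[OF that] by (intro sum_nonneg add_nonneg_nonneg) auto
  have split: "(\<Sum>i<L. g ((T ^^ i) x)) = (\<Sum>i<n. g ((T ^^ i) x)) + (\<Sum>i<L - n. g ((T ^^ i) ((T ^^ n) x)))"
    if "n \<le> L" for n and g :: "'a \<Rightarrow> real"
  proof -
    have "(\<Sum>i<L. g ((T ^^ i) x)) = (\<Sum>i<n + (L - n). g ((T ^^ i) x))" using that by simp
    also have "\<dots> = (\<Sum>i<n. g ((T ^^ i) x)) + (\<Sum>i<L - n. g ((T ^^ (i + n)) x))"
    proof -
      have "(\<Sum>i<n + m. h i) = (\<Sum>i<n. h i) + (\<Sum>i<m. h (i + n))" for m and h :: "nat \<Rightarrow> real"
        by (induction m) (simp_all add: add.commute)
      then show ?thesis .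
    qed
    finally show ?thesis by (simp add: funpow_add)
  qed
  show ?case
  proof (cases "L \<le> N")
    case True
    then have "(real L - real N) * c \<le> 0" using c by (simp add: mult_nonpos_nonneg)
    then show ?thesis using nn[OF less.prems, of L] by linarith
  next
    case False
    show ?thesis
    proof (cases "x \<in> B")
      case True
      have "(real (L - 1) - real N) * c \<le> (\<Sum>i<L - 1. f ((T ^^ i) (T x)) + c * indicator B ((T ^^ i) (T x)))"
        using less.IH[of "L - 1" "T x"] False T less.prems by simp
      moreover have "c \<le> f x + c * indicator B x" using True f less.prems by simp
      moreover have "real (L - 1) = real L - 1" using False by simp
      ultimately show ?thesis
        using split[of 1 "\<lambda>x. f x + c * indicator B x"] False by (simp add: algebra_simps)
    next
      case nB: False
      obtain n where n: "n \<ge> 1" "n \<le> N" "real n * c \<le> (\<Sum>i<n. f ((T ^^ i) x))" using good less.prems nB by blast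
      have "(real (L - n) - real N) * c \<le> (\<Sum>i<L - n. f ((T ^^ i) ((T ^^ n) x)) + c * indicator B ((T ^^ i) ((T ^^ n) x)))"
        using less.IH[of "L - n" "(T ^^ n) x"] False n Ti less.prems by simp
      moreover have "(\<Sum>i<n. f ((T ^^ i) x)) \<le> (\<Sum>i<n. f ((T ^^ i) x) + c * indicator B ((T ^^ i) x))"
        using c by (intro sum_mono) auto
      moreover have "real (L - n) = real L - real n" using n False by simp
      ultimately show ?thesis
        using split[of n "\<lambda>x. f x + c * indicator B x"] False n by (simp add: algebra_simps)
    qed
  qed
qed

text \<open>
  This replaces the pointwise ergodic theorem: the orbit is covered by blocks whose averages are nearly \<open>c\<close>, and
  block lengths are bounded off a set of small measure.
\<close>

lemma integral_le_of_averages: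
  fixes f :: "'a \<Rightarrow> real"
  assumes fin: "finite_measure M" and T [measurable]: "T \<in> measurable M M" and pres: "distr M M T = M"
    and f [measurable]: "f \<in> borel_measurable M" and fb: "\<And>x. 0 \<le> f x" "\<And>x. f x \<le> 1"
    and av: "\<And>e. e > 0 \<Longrightarrow> AE x in M. \<exists>n\<ge>1. real n * (c - e) \<le> (\<Sum>i<n. f ((T ^^ i) x))"
  shows "c * measure M (space M) \<le> (\<integral>x. f x \<partial>M)"
proof -
  interpret finite_measure M by fact
  let ?m = "measure M (space M)"
  have Tn [measurable]: "(T ^^ i) \<in> measurable M M" for i by (rule measurable_compose_n) simp
  have int: "integrable M g" if "g \<in> borel_measurable M" "\<And>x. \<bar>g x\<bar> \<le> K" for g :: "'a \<Rightarrow> real" and K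
    using that by (intro integrable_const_bound[of _ K]) auto
  have Ti: "(\<integral>x. g ((T ^^ i) x) \<partial>M) = (\<integral>x. g x \<partial>M)" if [measurable]: "g \<in> borel_measurable M" for g :: "'a \<Rightarrow> real" and i
  proof (induction i)
    case (Suc i)
    have "(\<integral>x. g ((T ^^ Suc i) x) \<partial>M) = (\<integral>x. g ((T ^^ i) x) \<partial>distr M M T)"
      by (subst integral_distr) (simp_all add: funpow_swap1)
    then show ?case using Suc pres by simp
  qed simp
  have I0: "0 \<le> (\<integral>x. f x \<partial>M)" using fb by simp
  have main: "(c - e) * ?m \<le> (\<integral>x. f x \<partial>M) + (c - e) * e" if e: "e > 0" "c - e \<ge> 0" for e
  proof -
    define d where "d = c - e"
    \<comment> \<open>Points with a block of length at most \<open>N\<close>. They exhaust almost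
      all of the space, so the complement is small for large \<open>N\<close>.\<close>
    define A where "A N = {x \<in> space M. \<exists>n\<in>{1..N}. real n * d \<le> (\<Sum>i<n. f ((T ^^ i) x))}" for N
    have A [measurable]: "A N \<in> sets M" for N unfolding A_def by measurable
    have "incseq A" by (auto simp: incseq_def A_def)
    moreover have "(\<lambda>N. measure M (A N)) \<longlonglongrightarrow> measure M (\<Union>N. A N)"
      by (intro finite_Lim_measure_incseq) (use \<open>incseq A\<close> in auto)
    moreover have "measure M (\<Union>N. A N) = ?m"
    proof (rule finite_measure_eq_AE)
      show "AE x in M. (x \<in> (\<Union>N. A N)) = (x \<in> space M)"
        using av[OF e(1)] AE_space
      proof eventually_elim
        case (elim x)
        then obtain n where "n \<ge> 1" "real n * (c - e) \<le> (\<Sum>i<n. f ((T ^^ i) x))" by blast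
        then have "x \<in> A n" using elim by (auto simp: A_def d_def)
        then show ?case using elim by blast
      qed
    qed auto
    ultimately have "eventually (\<lambda>N. ?m - e < measure M (A N)) sequentially"
      using e by (auto intro: order_tendstoD)
    then obtain N where N: "?m - e < measure M (A N)" by (auto simp: eventually_sequentially)
    define B where "B = space M - A N"
    have [measurable]: "B \<in> sets M" by (simp add: B_def)
    have mB: "measure M B < e" using N by (simp add: B_def finite_measure_compl)
    have L: "(real L - real N) * d * ?m \<le> real L * ((\<integral>x. f x \<partial>M) + d * measure M B)" for L
    proof -
      have "(real L - real N) * d * ?m = (\<integral>x. (real L - real N) * d \<partial>M)" by simp
      also have "\<dots> \<le> (\<integral>x. (\<Sum>i<L. f ((T ^^ i) x) + d * indicator B ((T ^^ i) x)) \<partial>M)"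
      proof (rule integral_mono)
        show "integrable M (\<lambda>x. \<Sum>i<L. f ((T ^^ i) x) + d * indicator B ((T ^^ i) x))"
          using fb by (intro Bochner_Integration.integrable_sum Bochner_Integration.integrable_add integrable_mult_right)
            (auto intro!: int[of _ 1] simp: indicator_def)
        fix x assume "x \<in> space M"
        then show "(real L - real N) * d \<le> (\<Sum>i<L. f ((T ^^ i) x) + d * indicator B ((T ^^ i) x))"
          using measurable_space[OF T] fb e by (intro ergodic_count[where X = "space M"]) (auto simp: B_def A_def d_def)
      qed auto
      also have "\<dots> = (\<Sum>i<L. (\<integral>x. f ((T ^^ i) x) \<partial>M) + d * (\<integral>x. indicator B ((T ^^ i) x) \<partial>M))"
      proof -
        have i1: "integrable M (\<lambda>x. f ((T ^^ i) x))" for i using fb by (intro int[of _ 1]) auto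
        have i2: "integrable M (\<lambda>x. indicator B ((T ^^ i) x) :: real)" for i by (intro int[of _ 1]) (auto simp: indicator_def)
        show ?thesis
          by (subst Bochner_Integration.integral_sum) (auto simp: i1 i2 intro!: sum.cong)
      qed
      also have "\<dots> = real L * ((\<integral>x. f x \<partial>M) + d * measure M B)"
        by (subst Ti, simp, subst Ti, simp) (simp add: Int_absorb1 sets.sets_into_space)
      finally show ?thesis .
    qed
    \<comment> \<open>Division by \<open>L\<close> removes the uncovered end of the orbit.\<close>
    have "(\<lambda>L. (1 - real N / real L) * d * ?m) \<longlonglongrightarrow> (1 - 0) * d * ?m"
      by (intro tendsto_intros)
    moreover have "eventually (\<lambda>L. (1 - real N / real L) * d * ?m \<le> (\<integral>x. f x \<partial>M) + d * measure M B) sequentially"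
      using eventually_gt_at_top[of 0]
    proof eventually_elim
      case (elim L)
      have "real L * ((1 - real N / real L) * d * ?m) = (real L - real N) * d * ?m" using elim by (simp add: field_simps)
      then show ?case using L[of L] elim by (metis mult_le_cancel_left_pos of_nat_0_less_iff)
    qed
    ultimately have "d * ?m \<le> (\<integral>x. f x \<partial>M) + d * measure M B"
      by (intro tendsto_upperbound[where F = sequentially]) auto
    also have "d * measure M B \<le> d * e" using mB e by (intro mult_left_mono) (auto simp: d_def)
    finally show ?thesis by (simp add: d_def)
  qed
  show ?thesis
  proof (cases "c > 0")
    case False
    then show ?thesis using I0 by (smt (verit) measure_nonneg mult_nonneg_nonneg mult_minus_left)
  next
    case True
    have 1: "((\<lambda>e. (c - e) * ?m) \<longlongrightarrow> (c - 0) * ?m) (at_right 0)" by (intro tendsto_intros)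
    have 2: "((\<lambda>e. (\<integral>x. f x \<partial>M) + (c - e) * e) \<longlongrightarrow> (\<integral>x. f x \<partial>M) + (c - 0) * 0) (at_right 0)" by (intro tendsto_intros)
    have 3: "eventually (\<lambda>e. (c - e) * ?m \<le> (\<integral>x. f x \<partial>M) + (c - e) * e) (at_right 0)"
      unfolding eventually_at_right_field using True main by (intro exI[of _ c]) auto
    show ?thesis using tendsto_le[OF trivial_limit_at_right_real 2 1 3] by simp
  qed
qed

section \<open>Averages of weakly correlated functions\<close>

lemma integral_interval_bound:
  fixes f :: "real \<Rightarrow> real"
  assumes [measurable]: "f \<in> borel_measurable borel" and "\<And>t. \<bar>f t\<bar> \<le> 1" "a \<le> b"
  shows "set_integrable lborel {a..b} f" "\<bar>LINT t:{a..b}|lborel. f t\<bar> \<le> b - a"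
proof -
  show i: "set_integrable lborel {a..b} f"
    unfolding set_integrable_def
  proof (rule Bochner_Integration.integrable_bound)
    show "integrable lborel (\<lambda>t. indicator {a..b} t :: real)" using emeasure_lborel_Icc[OF assms(3)] by (intro integrable_real_indicator) auto
    show "AE t in lborel. norm (indicator {a..b} t *\<^sub>R f t) \<le> norm (indicator {a..b} t :: real)"
      using assms(2) by (auto simp: indicator_def)
  qed measurable
  have "\<bar>LINT t:{a..b}|lborel. f t\<bar> \<le> (LINT t:{a..b}|lborel. \<bar>f t\<bar>)"
    using set_integral_norm_bound[OF i] by simp
  also have "\<dots> \<le> (LINT t:{a..b}|lborel. 1)"
    using i assms by (intro set_integral_mono set_integrable_abs) (auto simp: set_integrable_def)
  also have "\<dots> = b - a" using assms(3) by (simp add: set_lebesgue_integral_def)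
  finally show "\<bar>LINT t:{a..b}|lborel. f t\<bar> \<le> b - a" .
qed

text \<open>Consecutive fourth powers have ratio tending to 1 and the integrand is bounded, so the
  averages change little in between.\<close>

lemma averages_tendsto_of_powers:
  fixes f :: "real \<Rightarrow> real"
  assumes [measurable]: "f \<in> borel_measurable borel" and fb: "\<And>t. \<bar>f t\<bar> \<le> 1"
    and lim: "(\<lambda>n. (LINT t:{0..real n ^ 4}|lborel. f t) / real n ^ 4) \<longlonglongrightarrow> 0"
  shows "((\<lambda>T. (LINT t:{0..T}|lborel. f t) / T) \<longlongrightarrow> 0) at_top"
proof -
  define I where "I T = (LINT t:{0..T}|lborel. f t)" for T
  define k where "k T = nat \<lfloor>root 4 T\<rfloor>" for T :: real
  have k: "filterlim k at_top at_top" unfolding k_def by real_asymp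
  have "(\<lambda>n. \<bar>I (real n ^ 4) / real n ^ 4\<bar> + (real (n + 1) ^ 4 - real n ^ 4) / real n ^ 4) \<longlonglongrightarrow> \<bar>0\<bar> + 0"
    using lim unfolding I_def by (intro tendsto_add tendsto_rabs) (assumption, real_asymp)
  then have lim': "((\<lambda>T. \<bar>I (real (k T) ^ 4) / real (k T) ^ 4\<bar> + (real (k T + 1) ^ 4 - real (k T) ^ 4) / real (k T) ^ 4) \<longlongrightarrow> 0) at_top"
    using filterlim_compose[OF _ k] by simp
  show ?thesis
  proof (rule Lim_null_comparison[OF _ lim'])
    show "\<forall>\<^sub>F T in at_top. norm ((LINT t:{0..T}|lborel. f t) / T) \<le> \<bar>I (real (k T) ^ 4) / real (k T) ^ 4\<bar> + (real (k T + 1) ^ 4 - real (k T) ^ 4) / real (k T) ^ 4"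
      using eventually_ge_at_top[of 1]
    proof eventually_elim
      case (elim T)
      define n where "n = k T"
      have r: "root 4 T \<ge> 1" using elim by simp
      then have n1: "n \<ge> 1" by (simp add: n_def k_def le_nat_iff)
      have nr: "real n \<le> root 4 T" "root 4 T < real (n + 1)" using r by (simp_all add: n_def k_def, linarith+)
      have rT: "root 4 T ^ 4 = T" using elim by simp
      have nT: "real n ^ 4 \<le> T" "T \<le> real (n + 1) ^ 4"
        using power_mono[OF nr(1), of 4] power_mono[of "root 4 T" "real (n + 1)" 4] nr rT r by auto
      have n0: "0 \<le> real n ^ 4" by simp
      have "{0..T} = {0..real n ^ 4} \<union> {real n ^ 4<..T}" using nT(1) n0 by (auto intro: order.trans[OF n0 less_imp_le] simp del: zero_le_power)
      then have "I T = I (real n ^ 4) + (LINT t:{real n ^ 4<..T}|lborel. f t)"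
        unfolding I_def using integral_interval_bound(1)[OF assms(1,2), of 0 T] elim nT
        by (auto intro!: set_integral_Un intro: set_integrable_subset)
      moreover have "(LINT t:{real n ^ 4<..T}|lborel. f t) = (LINT t:{real n ^ 4..T}|lborel. f t)"
        unfolding set_lebesgue_integral_def
        by (rule integral_cong_AE) (use AE_lborel_singleton[of "real n ^ 4"] in \<open>auto simp: indicator_def elim!: eventually_mono\<close>)
      ultimately have "\<bar>I T\<bar> \<le> \<bar>I (real n ^ 4)\<bar> + (T - real n ^ 4)"
        using integral_interval_bound(2)[OF assms(1,2) nT(1)] by linarith
      also have "\<dots> \<le> \<bar>I (real n ^ 4)\<bar> + (real (n + 1) ^ 4 - real n ^ 4)" using nT by simp
      finally have *: "\<bar>I T\<bar> \<le> \<bar>I (real n ^ 4)\<bar> + (real (n + 1) ^ 4 - real n ^ 4)" .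
      have "\<bar>I T\<bar> / T \<le> \<bar>I T\<bar> / real n ^ 4"
        using nT n1 elim by (intro divide_left_mono) auto
      also have "\<dots> \<le> (\<bar>I (real n ^ 4)\<bar> + (real (n + 1) ^ 4 - real n ^ 4)) / real n ^ 4"
        using * by (intro divide_right_mono) auto
      finally show ?case using elim by (simp add: n_def I_def add_divide_distrib abs_divide)
    qed
  qed
qed

text \<open>In the second moment of the integral, pairs of times within \<open>sqrt T\<close>
  contribute \<open>O(T * sqrt T)\<close> trivially, the others by the correlation bound. The
  averages have second moment \<open>O(1 / sqrt T)\<close>, which is summable along
  \<open>T = n ^ 4\<close>, so they tend to 0 along this sequence almost everywhere.\<close>

lemma averages_tendsto_0:
  fixes Y :: "real \<Rightarrow> 'a \<Rightarrow> real"
  assumes "finite_measure P" and Y [measurable]: "case_prod Y \<in> borel_measurable (borel \<Otimes>\<^sub>M P)"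
    and Yb: "\<And>t x. \<bar>Y t x\<bar> \<le> 1"
    and cor: "\<And>t t'. t \<noteq> t' \<Longrightarrow> \<bar>\<integral>x. Y t x * Y t' x \<partial>P\<bar> \<le> K / \<bar>t - t'\<bar>" and K: "K \<ge> 0"
  shows "AE x in P. ((\<lambda>T. (LINT t:{0..T}|lborel. Y t x) / T) \<longlongrightarrow> 0) at_top"
proof -
  interpret P: finite_measure P by fact
  define m where "m = measure P (space P)"
  define I where "I T x = (LINT t:{0..T}|lborel. Y t x)" for T x
  have Yx [measurable]: "(\<lambda>t. Y t x) \<in> borel_measurable borel" if "x \<in> space P" for x
    using measurable_compose[OF measurable_Pair2'[OF that] Y] by simp
  have Yt [measurable]: "Y t \<in> borel_measurable P" for t
    using measurable_compose[OF measurable_Pair1' Y, of t] by simp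
  have I_meas [measurable]: "I T \<in> borel_measurable P" for T
    unfolding I_def[abs_def] set_lebesgue_integral_def by measurable
  have second: "(\<integral>x. (I T x)\<^sup>2 \<partial>P) \<le> (2 * m + K) * T * sqrt T" if T: "T > 0" for T
  proof -
    define M where "M = restrict_space lborel {0..T}"
    have Ms: "space M = {0..T}" "emeasure M (space M) = ennreal T"
      using T by (auto simp: M_def space_restrict_space emeasure_restrict_space)
    have fM: "finite_measure M" by (rule finite_measureI) (simp only: Ms(2), simp)
    interpret M: finite_measure M by fact
    have mM: "measure M (space M) = T" using Ms(2) T by (simp add: measure_def)
    interpret MP: pair_sigma_finite M P ..
    interpret PM: finite_measure "M \<Otimes>\<^sub>M P" using fM P.finite_measure_axioms by (intro finite_measure_pair_measure)
    have Y': "case_prod Y \<in> borel_measurable (M \<Otimes>\<^sub>M P)"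
    proof -
      have "(\<lambda>p. (fst p, snd p)) \<in> measurable (M \<Otimes>\<^sub>M P) (borel \<Otimes>\<^sub>M P)"
        by (intro measurable_Pair measurable_snd measurable_compose[OF measurable_fst])
          (simp add: M_def measurable_restrict_space1)
      then show ?thesis using measurable_compose[OF _ Y] by simp
    qed
    note [measurable] = Y'
    have I_eq: "I T x = (\<integral>t. Y t x \<partial>M)" for x
      unfolding I_def M_def set_lebesgue_integral_def by (subst integral_restrict_space) auto
    have Yx' [measurable]: "(\<lambda>t. Y t x) \<in> borel_measurable M" if "x \<in> space P" for x
      using Yx[OF that] by (simp add: M_def measurable_restrict_space1)
    have Ib: "\<bar>I T x\<bar> \<le> T" if "x \<in> space P" for x
      unfolding I_def using integral_interval_bound(2)[OF Yx[OF that] Yb, of 0 T] T by simp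
    have "(\<integral>x. (I T x)\<^sup>2 \<partial>P) = (\<integral>x. (\<integral>t. Y t x * I T x \<partial>M) \<partial>P)"
      by (intro Bochner_Integration.integral_cong refl) (simp add: I_eq power2_eq_square)
    also have "\<dots> = (\<integral>t. (\<integral>x. Y t x * I T x \<partial>P) \<partial>M)"
    proof (rule MP.Fubini_integral)
      have "\<bar>Y t x * I T x\<bar> \<le> T" if "x \<in> space P" for t x
        using mult_mono[OF Yb[of t x] Ib[OF that]] T by (simp add: abs_mult)
      then show "integrable (M \<Otimes>\<^sub>M P) (\<lambda>(t, x). Y t x * I T x)"
        by (intro PM.integrable_const_bound[of _ T]) (auto simp: space_pair_measure split_beta)
    qed
    also have "\<dots> = (\<integral>t. (\<integral>t'. (\<integral>x. Y t x * Y t' x \<partial>P) \<partial>M) \<partial>M)"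
    proof (intro Bochner_Integration.integral_cong refl)
      fix t assume "t \<in> space M"
      have "(\<integral>x. Y t x * I T x \<partial>P) = (\<integral>x. (\<integral>t'. Y t x * Y t' x \<partial>M) \<partial>P)"
        by (simp add: I_eq)
      also have "\<dots> = (\<integral>t'. (\<integral>x. Y t x * Y t' x \<partial>P) \<partial>M)"
      proof (rule MP.Fubini_integral)
        have "\<bar>Y t x * Y t' x\<bar> \<le> 1" for t' x
          using mult_mono[OF Yb[of t x] Yb[of t' x]] by (simp add: abs_mult)
        then show "integrable (M \<Otimes>\<^sub>M P) (\<lambda>(t', x). Y t x * Y t' x)"
          by (intro PM.integrable_const_bound[of _ 1]) (auto simp: split_beta)
      qed
      finally show "(\<integral>x. Y t x * I T x \<partial>P) = (\<integral>t'. (\<integral>x. Y t x * Y t' x \<partial>P) \<partial>M)" .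
    qed
    also have "\<dots> \<le> (\<integral>t. 2 * sqrt T * m + K * sqrt T \<partial>M)"
    proof (rule integral_mono_AE')
      show "integrable M (\<lambda>t. 2 * sqrt T * m + K * sqrt T)" by simp
      have "(\<integral>t'. (\<integral>x. Y t x * Y t' x \<partial>P) \<partial>M) \<le> 2 * sqrt T * m + K * sqrt T" for t
      proof -
        have b: "(\<integral>x. Y t x * Y t' x \<partial>P) \<le> m * indicator {t - sqrt T..t + sqrt T} t' + K / sqrt T" for t'
        proof (cases "\<bar>t - t'\<bar> \<le> sqrt T")
          case True
          have "(\<integral>x. Y t x * Y t' x \<partial>P) \<le> (\<integral>x. 1 \<partial>P)"
          proof (rule integral_mono_AE')
            have "\<bar>Y t x * Y t' x\<bar> \<le> 1" for x
              using mult_mono[OF Yb[of t x] Yb[of t' x]] by (simp add: abs_mult)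
            then show "AE x in P. Y t x * Y t' x \<le> 1" by (auto simp: abs_le_iff)
          qed auto
          moreover have "indicator {t - sqrt T..t + sqrt T} t' = (1::real)" using True by (auto simp: indicator_def)
          moreover have "0 \<le> K / sqrt T" using K T by simp
          ultimately show ?thesis by (simp add: m_def)
        next
          case False
          then have "(\<integral>x. Y t x * Y t' x \<partial>P) \<le> K / \<bar>t - t'\<bar>" using cor[of t t'] T by force
          also have "\<dots> \<le> K / sqrt T"
          proof (rule divide_left_mono)
            have "0 < sqrt T" using T by simp
            then show "0 < \<bar>t - t'\<bar> * sqrt T" using False by (intro mult_pos_pos) linarith+
          qed (use False K in auto)
          finally show ?thesis by (auto simp: m_def intro: add_increasing)
        qed
        have i1: "integrable M (\<lambda>t'. indicator {t - sqrt T..t + sqrt T} t' :: real)"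
          by (rule M.integrable_const_bound[of _ 1]) (auto simp: indicator_def M_def intro!: measurable_restrict_space1)
        then have iM: "integrable M (\<lambda>t'. m * indicator {t - sqrt T..t + sqrt T} t' + K / sqrt T)" by simp
        have "(\<integral>t'. (\<integral>x. Y t x * Y t' x \<partial>P) \<partial>M) \<le> (\<integral>t'. m * indicator {t - sqrt T..t + sqrt T} t' + K / sqrt T \<partial>M)"
          using iM by (intro integral_mono_AE') (use b K T in \<open>auto simp: m_def\<close>)
        also have "\<dots> = m * (\<integral>t'. indicator {t - sqrt T..t + sqrt T} t' \<partial>M) + K / sqrt T * T"
          using mM i1 by (subst Bochner_Integration.integral_add) auto
        also have "(\<integral>t'. indicator {t - sqrt T..t + sqrt T} t' \<partial>M) \<le> 2 * sqrt T"
        proof -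
          have "(\<integral>t'. indicator {t - sqrt T..t + sqrt T} t' \<partial>M) = (\<integral>t'. (indicator {0..T} t' :: real) * indicator {t - sqrt T..t + sqrt T} t' \<partial>lborel)"
            using integral_restrict_space[of "{0..T}" lborel "indicator {t - sqrt T..t + sqrt T} :: real \<Rightarrow> real"]
            unfolding M_def by (simp only: real_scaleR_def) simp?
          also have "\<dots> \<le> (\<integral>t'. indicator {t - sqrt T..t + sqrt T} t' \<partial>lborel)"
          proof (rule integral_mono_AE')
            show "integrable lborel (\<lambda>t'. indicator {t - sqrt T..t + sqrt T} t' :: real)"
              by (intro integrable_real_indicator) (auto simp: emeasure_lborel_Icc_eq)
          qed (auto simp: indicator_def)
          also have "\<dots> = 2 * sqrt T" using T by simp
          finally show ?thesis .
        qed
        then have "m * (\<integral>t'. indicator {t - sqrt T..t + sqrt T} t' \<partial>M) + K / sqrt T * T \<le> m * (2 * sqrt T) + K / sqrt T * T"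
          by (intro add_mono mult_left_mono order.refl) (auto simp: m_def)
        also have "K / sqrt T * T = K * sqrt T" using T by (simp add: field_simps)
        finally show ?thesis by (simp add: mult.commute)
      qed
      then show "AE t in M. (\<integral>t'. (\<integral>x. Y t x * Y t' x \<partial>P) \<partial>M) \<le> 2 * sqrt T * m + K * sqrt T" by simp
      show "AE t in M. 0 \<le> 2 * sqrt T * m + K * sqrt T" using K T by (simp add: m_def)
    qed
    also have "\<dots> = (2 * m + K) * T * sqrt T" by (simp add: mM algebra_simps)
    finally show ?thesis .
  qed
  define a where "a n x = (I (real (Suc n) ^ 4) x / real (Suc n) ^ 4)\<^sup>2" for n x
  have a_int: "(\<integral>\<^sup>+x. ennreal (a n x) \<partial>P) \<le> ennreal ((2 * m + K) * (1 / real (Suc n) ^ 2))" for n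
  proof -
    let ?T = "real (Suc n) ^ 4"
    have Ib: "\<bar>I ?T x\<bar> \<le> ?T" if "x \<in> space P" for x
      unfolding I_def using integral_interval_bound(2)[OF Yx[OF that] Yb, of 0 ?T] by simp
    have int: "integrable P (\<lambda>x. (I ?T x)\<^sup>2)"
    proof (rule P.integrable_const_bound[of _ "?T\<^sup>2"])
      show "AE x in P. norm ((I ?T x)\<^sup>2) \<le> ?T\<^sup>2"
        using Ib by (intro AE_I2) (metis abs_ge_zero norm_power power2_abs power_mono real_norm_def)
    qed simp
    have "(\<integral>\<^sup>+x. ennreal (a n x) \<partial>P) = ennreal (\<integral>x. a n x \<partial>P)"
      using int by (intro nn_integral_eq_integral) (auto simp: a_def power_divide)
    also have "(\<integral>x. a n x \<partial>P) = (\<integral>x. (I ?T x)\<^sup>2 \<partial>P) / ?T\<^sup>2"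
      by (simp add: a_def power_divide)
    also have "\<dots> \<le> (2 * m + K) * ?T * sqrt ?T / ?T\<^sup>2"
      using second[of ?T] by (intro divide_right_mono) auto
    also have "sqrt ?T = real (Suc n) ^ 2"
      by (intro real_sqrt_unique) (simp_all flip: power_mult)
    also have "(2 * m + K) * ?T * real (Suc n) ^ 2 / ?T\<^sup>2 = (2 * m + K) * (1 / real (Suc n) ^ 2)"
      by (simp add: field_simps flip: power_add power_mult del: of_nat_Suc)
    finally show ?thesis by (simp add: ennreal_leI)
  qed
  have [measurable]: "a n \<in> borel_measurable P" for n unfolding a_def[abs_def] by measurable
  have "(\<integral>\<^sup>+x. (\<Sum>n. ennreal (a n x)) \<partial>P) = (\<Sum>n. \<integral>\<^sup>+x. ennreal (a n x) \<partial>P)"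
    by (intro nn_integral_suminf) measurable
  also have "\<dots> \<le> (\<Sum>n. ennreal ((2 * m + K) * (1 / real (Suc n) ^ 2)))"
    using a_int by (intro suminf_le) auto
  also have "\<dots> < \<infinity>"
  proof -
    have "summable (\<lambda>n. (2 * m + K) * (1 / real (Suc n) ^ 2))"
    proof (rule summable_mult)
      have "summable (\<lambda>n. inverse (real (Suc n) ^ 2))"
        using inverse_power_summable[of 2, where 'a=real] by (subst summable_Suc_iff[of "\<lambda>n. inverse (real n ^ 2)"]) simp
      then show "summable (\<lambda>n. 1 / real (Suc n) ^ 2)" by (simp add: inverse_eq_divide del: of_nat_Suc)
    qed
    then show ?thesis using K by (subst suminf_ennreal_eq[OF _ summable_sums]) (auto simp: m_def)
  qed
  finally have "AE x in P. (\<Sum>n. ennreal (a n x)) \<noteq> \<infinity>"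
    by (intro nn_integral_PInf_AE) auto
  then show ?thesis
    using AE_space
  proof eventually_elim
    case (elim x)
    have "summable (\<lambda>n. a n x)"
      using elim by (intro summable_suminf_not_top) (auto simp: a_def)
    then have "(\<lambda>n. a n x) \<longlonglongrightarrow> 0" by (rule summable_LIMSEQ_zero)
    then have "(\<lambda>n. sqrt (a n x)) \<longlonglongrightarrow> sqrt 0" by (intro tendsto_real_sqrt)
    then have "(\<lambda>n. \<bar>I (real (Suc n) ^ 4) x / real (Suc n) ^ 4\<bar>) \<longlonglongrightarrow> 0" by (simp add: a_def)
    then have "(\<lambda>n. I (real (Suc n) ^ 4) x / real (Suc n) ^ 4) \<longlonglongrightarrow> 0" by (rule tendsto_rabs_zero_cancel)
    then have "(\<lambda>n. I (real n ^ 4) x / real n ^ 4) \<longlonglongrightarrow> 0"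
      by (rule LIMSEQ_imp_Suc[rotated])
    then show ?case using averages_tendsto_of_powers[OF Yx[OF elim(2)] Yb] unfolding I_def by simp
  qed
qed

section \<open>Equidistribution on the octagon surface\<close>

abbreviation octm :: "complex measure" where "octm \<equiv> restrict_space lborel oct"

lemma sets_oct_lborel: "oct \<inter> space lborel \<in> sets lborel"
  using sets_oct by simp

lemma emeasure_octm: "A \<in> sets borel \<Longrightarrow> A \<subseteq> oct \<Longrightarrow> emeasure octm A = emeasure lborel A"
  by (rule emeasure_restrict_space) (use sets_oct in auto)

lemma finite_measure_octm: "finite_measure octm"
  by (rule finite_measureI)
    (use emeasure_oct_finite[of UNIV] in \<open>simp add: space_restrict_space emeasure_restrict_space sets_oct less_top\<close>)

lemma measurable_octm: "f \<in> measurable borel M \<Longrightarrow> f \<in> measurable octm M"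
  by (intro measurable_restrict_space1) (simp cong: measurable_cong_sets)

lemma measurable_octm_oct:
  assumes "f \<in> borel_measurable borel" "\<And>z. z \<in> oct \<Longrightarrow> f z \<in> oct"
  shows "f \<in> measurable octm octm"
  by (intro measurable_restrict_space2 measurable_octm)
    (use assms in \<open>auto simp: space_restrict_space cong: measurable_cong_sets\<close>)

lemma distr_octm:
  assumes "oct_preserving f"
  shows "distr octm octm f = octm"
proof (rule measure_eqI)
  have f: "f \<in> borel_measurable borel" "\<And>z. z \<in> oct \<Longrightarrow> f z \<in> oct" using assms by (auto simp: oct_preserving_def)
  have m: "f \<in> measurable octm octm" by (rule measurable_octm_oct) (fact f)+
  fix A assume "A \<in> sets (distr octm octm f)"
  then have A: "A \<in> sets octm" by simp
  then have A': "A \<in> sets borel" "A \<subseteq> oct"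
    using sets_oct by (auto simp: sets_restrict_space)
  have v: "f -` A \<inter> space octm = oct \<inter> f -` A" by (auto simp: space_restrict_space)
  have "emeasure (distr octm octm f) A = emeasure octm (oct \<inter> f -` A)"
    by (subst emeasure_distr[OF m A]) (simp only: v)
  also have "\<dots> = emeasure lborel (oct \<inter> f -` A)"
    using measurable_sets[OF f(1) A'(1)] sets_oct by (intro emeasure_octm) auto
  also have "\<dots> = emeasure lborel (oct \<inter> A)" using assms A' by (simp add: oct_preserving_def)
  also have "oct \<inter> A = A" using A' by auto
  finally show "emeasure (distr octm octm f) A = emeasure octm A" using emeasure_octm A' by simp
qed simp

text \<open>The semigroup law up to representatives: the shifted path of \<open>x\<close> and the
  path of \<open>x'\<close> start in the same class, so uniqueness applies.\<close>

lemma flow_shift: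
  assumes "generic u x" "generic u x'" "t \<ge> 0" "s \<ge> 0" "(flow u x t, x') \<in> rel"
  shows "(flow u x (t + s), flow u x' s) \<in> rel"
proof -
  have p: "straight_path {0..} u (\<lambda>t. rel `` {flow u x t})" "straight_path {0..} u (\<lambda>t. rel `` {flow u x' t})"
    "rel `` {flow u x' 0} = rel `` {x'}"
    using straight_flow_flow assms(1,2) by (auto simp: straight_flow_iff)
  have "straight_path {r. t + 1 * r \<in> {0..}} (1 *\<^sub>R u) (\<lambda>r. rel `` {flow u x (t + 1 * r)})"
    by (rule straight_path_affine[OF p(1)]) simp
  then have q: "straight_path {0..} u (\<lambda>r. rel `` {flow u x (t + r)})"
    using assms(3) by (rule_tac straight_path_subset) auto
  have "rel `` {flow u x (t + 0)} = rel `` {flow u x' 0}"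
    unfolding p(3) add_0_right
    by (subst class_eq_iff) (use assms flow_oct generic_oct in auto)
  then have "rel `` {flow u x (t + s)} = rel `` {flow u x' s}"
    using straight_path_unique[OF q p(2), of 0 s] assms by simp
  then show ?thesis using class_eq_iff flow_oct assms by (metis add_nonneg_nonneg)
qed

lemma borel_flow_time [measurable]: "flow u x \<in> borel_measurable borel"
  using borel_flow[of "\<lambda>_. x" borel "\<lambda>_. u" "\<lambda>t. t"] by simp

lemma AE_generic:
  assumes "Im u \<noteq> 0"
  shows "AE x in octm. generic u x"
  unfolding AE_restrict_space_iff[OF sets_oct_lborel]
proof (rule AE_I'[OF null_not_generic[OF assms]])
  show "{x \<in> space lborel. \<not> (x \<in> oct \<longrightarrow> generic u x)} \<subseteq> {x \<in> oct. \<not> generic u x}" by auto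
qed

lemma AE_octm_compose:
  assumes "oct_preserving f" "AE x in octm. P x"
  shows "AE x in octm. P (f x)"
proof -
  have f: "f \<in> borel_measurable borel" "\<And>z. z \<in> oct \<Longrightarrow> f z \<in> oct" using assms(1) by (auto simp: oct_preserving_def)
  have "AE x in distr octm octm f. P x" using assms(2) by (simp only: distr_octm[OF assms(1)])
  then show ?thesis by (rule AE_distrD[rotated]) (rule measurable_octm_oct, (fact f)+)
qed

lemma set_integral_shift:
  fixes f :: "real \<Rightarrow> real"
  shows "(LINT t:{a..b}|lborel. f (t + c)) = (LINT t:{a + c..b + c}|lborel. f t)"
proof -
  have "(LINT t:{a + c..b + c}|lborel. f t) = (\<integral>t. indicator {a + c..b + c} (c + 1 * t) *\<^sub>R f (c + 1 * t) \<partial>lborel)"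
    unfolding set_lebesgue_integral_def using lborel_integral_real_affine[of 1 "\<lambda>t. indicator {a + c..b + c} t *\<^sub>R f t" c] by simp
  also have "\<dots> = (LINT t:{a..b}|lborel. f (t + c))"
    unfolding set_lebesgue_integral_def by (intro Bochner_Integration.integral_cong refl) (auto simp: indicator_def add.commute)
  finally show ?thesis by simp
qed

lemma set_integral_split:
  fixes f :: "real \<Rightarrow> real"
  assumes f: "f \<in> borel_measurable borel" "\<And>t. \<bar>f t\<bar> \<le> 1" and "a \<le> b" "b \<le> c"
  shows "(LINT t:{a..c}|lborel. f t) = (LINT t:{a..b}|lborel. f t) + (LINT t:{b..c}|lborel. f t)"
proof -
  have "{a..c} = {a..b} \<union> {b<..c}" using assms by auto
  then have "(LINT t:{a..c}|lborel. f t) = (LINT t:{a..b}|lborel. f t) + (LINT t:{b<..c}|lborel. f t)"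
    using integral_interval_bound(1)[OF f, of a c] assms(3,4)
    by (auto intro!: set_integral_Un intro: set_integrable_subset)
  moreover have "(LINT t:{b<..c}|lborel. f t) = (LINT t:{b..c}|lborel. f t)"
    unfolding set_lebesgue_integral_def
    by (rule integral_cong_AE) (use f(1) AE_lborel_singleton[of b] in \<open>auto simp: indicator_def elim!: eventually_mono\<close>)
  ultimately show ?thesis by simp
qed

text \<open>Rounding \<open>T\<close> down changes the integral by at most 1.\<close>

lemma average_real_of_nat:
  fixes f :: "real \<Rightarrow> real"
  assumes f: "f \<in> borel_measurable borel" "\<And>t. \<bar>f t\<bar> \<le> 1"
  shows "((\<lambda>T. (LINT t:{0..T}|lborel. f t) / T) \<longlongrightarrow> L) at_top \<longleftrightarrow> (\<lambda>n. (LINT t:{0..real n}|lborel. f t) / real n) \<longlonglongrightarrow> L"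
proof
  assume "((\<lambda>T. (LINT t:{0..T}|lborel. f t) / T) \<longlongrightarrow> L) at_top"
  then show "(\<lambda>n. (LINT t:{0..real n}|lborel. f t) / real n) \<longlonglongrightarrow> L"
    using filterlim_compose filterlim_real_sequentially by blast
next
  assume lim: "(\<lambda>n. (LINT t:{0..real n}|lborel. f t) / real n) \<longlonglongrightarrow> L"
  define I where "I T = (LINT t:{0..T}|lborel. f t)" for T
  define k where "k T = nat \<lfloor>T\<rfloor>" for T :: real
  have k: "filterlim k at_top at_top" unfolding k_def by real_asymp
  have 1: "((\<lambda>T. I (real (k T)) / real (k T) * (real (k T) / T)) \<longlongrightarrow> L * 1) at_top"
  proof (rule tendsto_mult)
    show "((\<lambda>T. I (real (k T)) / real (k T)) \<longlongrightarrow> L) at_top"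
      using filterlim_compose[OF lim k] unfolding I_def .
    show "((\<lambda>T. real (k T) / T) \<longlongrightarrow> 1) at_top" unfolding k_def by real_asymp
  qed
  have 2: "((\<lambda>T. I T / T - I (real (k T)) / real (k T) * (real (k T) / T)) \<longlongrightarrow> 0) at_top"
  proof (rule Lim_null_comparison)
    show "((\<lambda>T::real. 1 / T) \<longlongrightarrow> 0) at_top" by real_asymp
    show "\<forall>\<^sub>F T in at_top. norm (I T / T - I (real (k T)) / real (k T) * (real (k T) / T)) \<le> 1 / T"
      using eventually_ge_at_top[of 1]
    proof eventually_elim
      case (elim T)
      have kT: "real (k T) \<ge> 1" "real (k T) \<le> T" "T \<le> real (k T) + 1" using elim by (auto simp: k_def le_nat_iff)
      have "I T = I (real (k T)) + (LINT t:{real (k T)..T}|lborel. f t)"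
        unfolding I_def using kT by (intro set_integral_split[OF f]) auto
      then have "\<bar>I T - I (real (k T))\<bar> \<le> 1" using integral_interval_bound(2)[OF f kT(2)] kT by simp
      moreover have "I T / T - I (real (k T)) / real (k T) * (real (k T) / T) = (I T - I (real (k T))) / T"
        using kT by (simp add: field_simps)
      ultimately show ?case using elim by (simp add: divide_right_mono)
    qed
  qed
  from tendsto_add[OF 1 2] show "((\<lambda>T. (LINT t:{0..T}|lborel. f t) / T) \<longlongrightarrow> L) at_top"
    by (simp add: I_def)
qed

text \<open>A function on the surface with values in the unit interval, so that \<open>1 - f\<close>
  is again one.\<close>

locale observable =
  fixes f :: "complex \<Rightarrow> real"
  assumes f_meas [measurable]: "f \<in> borel_measurable borel" and f_nonneg: "\<And>z. 0 \<le> f z" and f_le: "\<And>z. f z \<le> 1"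
    and f_rel: "\<And>z z'. (z, z') \<in> rel \<Longrightarrow> f z = f z'"
begin

definition orbit_integral :: "complex \<Rightarrow> complex \<Rightarrow> real \<Rightarrow> real" where
  "orbit_integral u x T = (LINT t:{0..T}|lborel. f (flow u x t))"

lemma f_flow: "(\<lambda>t. f (flow u x t)) \<in> borel_measurable borel" "\<bar>f (flow u x t)\<bar> \<le> 1"
  using f_nonneg f_le by auto

lemma borel_orbit_integral [measurable]: "(\<lambda>x. orbit_integral u x T) \<in> borel_measurable borel"
  unfolding orbit_integral_def set_lebesgue_integral_def by measurable

text \<open>The generic points whose averages over integer times have limsup at least
  \<open>c\<close>, written with countable quantifiers for measurability.\<close>

definition upper_set :: "complex \<Rightarrow> real \<Rightarrow> complex set" where
  "upper_set u c = {x \<in> oct. generic u x \<and> (\<forall>k N. \<exists>n\<ge>N. n \<ge> 1 \<and> c - 1 / (real k + 1) \<le> orbit_integral u x (real n) / real n)}"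

lemma sets_upper_set [measurable]: "upper_set u c \<in> sets borel"
  unfolding upper_set_def by measurable

lemma orbit_integral_shift:
  assumes "generic u x" "generic u x'" "t \<ge> 0" "(flow u x t, x') \<in> rel" "T \<ge> 0"
  shows "\<bar>orbit_integral u x' T - orbit_integral u x T\<bar> \<le> 2 * t"
proof -
  let ?g = "\<lambda>s. f (flow u x s)"
  have "orbit_integral u x' T = (LINT s:{0..T}|lborel. ?g (s + t))"
    unfolding orbit_integral_def
  proof (rule set_lebesgue_integral_cong)
    show "\<forall>s. s \<in> {0..T} \<longrightarrow> f (flow u x' s) = ?g (s + t)"
      using f_rel[OF flow_shift[OF assms(1,2,3) _ assms(4)]] by (auto simp: add.commute)
  qed simp
  also have "\<dots> = (LINT s:{t..T + t}|lborel. ?g s)" by (rule set_integral_shift[where a = 0 and b = T and c = t and f = ?g, simplified])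
  finally have 1: "orbit_integral u x' T = (LINT s:{t..T + t}|lborel. ?g s)" .
  have 2: "(LINT s:{0..T + t}|lborel. ?g s) = (LINT s:{0..t}|lborel. ?g s) + (LINT s:{t..T + t}|lborel. ?g s)"
    using assms by (intro set_integral_split[OF f_flow]) auto
  have 3: "(LINT s:{0..T + t}|lborel. ?g s) = (LINT s:{0..T}|lborel. ?g s) + (LINT s:{T..T + t}|lborel. ?g s)"
    using assms by (intro set_integral_split[OF f_flow]) auto
  have "\<bar>LINT s:{0..t}|lborel. ?g s\<bar> \<le> t - 0" "\<bar>LINT s:{T..T + t}|lborel. ?g s\<bar> \<le> T + t - T"
    using assms by (intro integral_interval_bound[OF f_flow]; simp)+
  then show ?thesis using 1 2 3 unfolding orbit_integral_def by linarith
qed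

lemma flow_invariant_upper_set: "flow_invariant u (upper_set u c)"
  unfolding flow_invariant_def
proof (intro allI impI)
  fix x x' t assume a: "generic u x" "generic u x'" "0 \<le> t" "(flow u x t, x') \<in> rel"
  have *: "y' \<in> upper_set u c" if "y \<in> upper_set u c" "generic u y'"
    "\<And>T. T \<ge> 0 \<Longrightarrow> \<bar>orbit_integral u y' T - orbit_integral u y T\<bar> \<le> 2 * t" for y y'
    unfolding upper_set_def mem_Collect_eq
  proof (intro conjI allI)
    show "y' \<in> oct" "generic u y'" using that(2) generic_oct by auto
    fix k N :: nat
    \<comment> \<open>The gap between consecutive tolerances absorbs the bounded change of the
      integral, divided by a large \<open>n\<close>.\<close>
    define d where "d = 1 / (real k + 1) - 1 / (real (k + 1) + 1)"
    have d: "d > 0" by (simp add: d_def divide_strict_left_mono)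
    obtain N' :: nat where N': "2 * t / d < real N'" using reals_Archimedean2 by blast
    from that(1)[unfolded upper_set_def mem_Collect_eq, THEN conjunct2, THEN conjunct2, rule_format, where ?k = "k + 1" and ?N = "max N N'"]
    obtain n where n: "n \<ge> max N N'" "n \<ge> 1" "c - 1 / (real (k + 1) + 1) \<le> orbit_integral u y (real n) / real n"
      by (elim exE conjE)
    have "real N' \<le> real n" using n(1) by simp
    then have "2 * t / d \<le> real n" using N' by linarith
    then have "2 * t / real n \<le> d" using n(2) d by (simp add: field_simps)
    moreover have "orbit_integral u y (real n) / real n - 2 * t / real n \<le> orbit_integral u y' (real n) / real n"
      using that(3)[of "real n"] n(2) by (simp add: divide_right_mono flip: diff_divide_distrib)
    ultimately have "c - 1 / (real k + 1) \<le> orbit_integral u y' (real n) / real n"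
      using n(3) unfolding d_def by linarith
    then show "\<exists>n\<ge>N. 1 \<le> n \<and> c - 1 / (real k + 1) \<le> orbit_integral u y' (real n) / real n" using n by auto
  qed
  have "\<bar>orbit_integral u x T - orbit_integral u x' T\<bar> \<le> 2 * t" if "T \<ge> 0" for T
    using orbit_integral_shift[OF a that] by linarith
  then show "x \<in> upper_set u c \<longleftrightarrow> x' \<in> upper_set u c"
    using *[of x x'] *[of x' x] orbit_integral_shift[OF a] a by blast
qed

definition mean :: real where "mean = (\<integral>x. f x \<partial>octm) / measure octm oct"

lemma measure_octm_pos: "measure octm oct > 0"
proof -
  have "emeasure octm oct = emeasure lborel oct" using sets_oct by (intro emeasure_octm) auto
  moreover have "emeasure lborel oct > 0"
  proof -
    obtain r where r: "r > 0" "ball 0 r \<subseteq> oct" using zero_interior_oct by blast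
    have "0 < measure lebesgue (ball (0 :: complex) r)" using r(1) by simp
    then have "emeasure lborel (ball (0 :: complex) r) \<noteq> 0" by (auto simp: measure_def)
    moreover have "emeasure lborel (ball (0 :: complex) r) \<le> emeasure lborel oct" by (rule emeasure_mono) (use r sets_oct in auto)
    ultimately show ?thesis by (metis le_zero_eq not_gr_zero)
  qed
  moreover have "emeasure octm oct < \<infinity>"
    using finite_measure.emeasure_finite[OF finite_measure_octm, of oct] by (simp add: less_top)
  ultimately show ?thesis by (simp add: measure_def enn2real_positive_iff)
qed

lemma integral_f_flow:
  assumes "Im u \<noteq> 0" "t \<ge> 0"
  shows "(\<integral>x. f (flow u x t) \<partial>octm) = (\<integral>x. f x \<partial>octm)"
proof -
  let ?T = "\<lambda>x. if generic u x then flow u x t else x"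
  have T: "oct_preserving ?T" by (rule oct_preserving_flow[OF assms])
  have Tm: "?T \<in> measurable octm octm" using T by (intro measurable_octm_oct) (auto simp: oct_preserving_def)
  have fm: "f \<in> borel_measurable octm" by (rule measurable_octm) measurable
  have m1: "(\<lambda>x. f (flow u x t)) \<in> borel_measurable octm" by (rule measurable_octm) measurable
  have m2: "(\<lambda>x. f (?T x)) \<in> borel_measurable octm" by (rule measurable_octm) measurable
  have "(\<integral>x. f (flow u x t) \<partial>octm) = (\<integral>x. f (?T x) \<partial>octm)"
    by (rule integral_cong_AE[OF m1 m2]) (use AE_generic[OF assms(1)] in eventually_elim, simp)
  also have "\<dots> = (\<integral>x. f x \<partial>distr octm octm ?T)" by (rule integral_distr[OF Tm fm, symmetric])
  also have "\<dots> = (\<integral>x. f x \<partial>octm)" by (simp only: distr_octm[OF T])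
  finally show ?thesis .
qed

text \<open>Applied to the time-one map, \<open>integral_le_of_averages\<close> bounds
  \<open>c\<close> by the mean of the unit orbit integral, which equals the mean of \<open>f\<close>
  because the flow preserves area.\<close>

lemma upper_set_full:
  assumes u: "Im u \<noteq> 0" and full: "emeasure lborel (oct - upper_set u c) = 0"
  shows "c \<le> mean"
proof -
  interpret fm: finite_measure octm by (rule finite_measure_octm)
  let ?T = "\<lambda>x. if generic u x then flow u x 1 else x"
  have T: "oct_preserving ?T" using oct_preserving_flow[OF u, of 1] by simp
  have Tm: "?T \<in> measurable octm octm" using T by (intro measurable_octm_oct) (auto simp: oct_preserving_def)
  define f1 where "f1 x = orbit_integral u x 1" for x
  have f1m: "f1 \<in> borel_measurable octm" unfolding f1_def by (rule measurable_octm) measurable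
  have f1b: "0 \<le> f1 x" "f1 x \<le> 1" for x
  proof -
    show "0 \<le> f1 x" unfolding f1_def orbit_integral_def set_lebesgue_integral_def
      using f_nonneg by (intro Bochner_Integration.integral_nonneg) auto
    show "f1 x \<le> 1" using integral_interval_bound(2)[OF f_flow, of 0 1 u x] by (simp add: f1_def orbit_integral_def)
  qed
  have Ti: "oct_preserving (?T ^^ i)" for i
  proof (induction i)
    case 0 then show ?case using oct_preserving_id by (simp add: id_def)
  next
    case (Suc i)
    show ?case unfolding funpow.simps by (rule oct_preserving_comp[OF T Suc])
  qed
  \<comment> \<open>Almost every point stays generic under all iterates, so the completed time-one
    map really follows the flow.\<close>
  have gen: "AE x in octm. \<forall>i. generic u ((?T ^^ i) x)"
    unfolding AE_all_countable using AE_octm_compose[OF Ti AE_generic[OF u]] by blast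
  have sum: "(\<Sum>i<n. f1 ((?T ^^ i) x)) = orbit_integral u x (real n)" if g: "\<forall>i. generic u ((?T ^^ i) x)" for x n
  proof -
    have gx: "generic u x" using g[rule_format, of 0] by simp
    have r: "(flow u x (real i), (?T ^^ i) x) \<in> rel" for i
    proof (induction i)
      case 0
      have "rel `` {flow u x 0} = rel `` {x}" using straight_flow_flow[OF gx] by (simp add: straight_flow_iff)
      then show ?case using class_eq_iff flow_oct[OF gx, of 0] generic_oct[OF gx] by simp
    next
      case (Suc i)
      have "(flow u x (real i + 1), flow u ((?T ^^ i) x) 1) \<in> rel" using g Suc by (intro flow_shift[OF gx]) auto
      moreover have "(?T ^^ Suc i) x = flow u ((?T ^^ i) x) 1" using g by simp
      ultimately show ?case by (simp add: add.commute)
    qed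
    show ?thesis
    proof (induction n)
      case 0
      show ?case by (auto simp: orbit_integral_def set_lebesgue_integral_def AE_lborel_singleton[of 0] indicator_def
          intro!: integral_eq_zero_AE elim!: eventually_mono intro: eventually_mono[OF AE_lborel_singleton[of 0]])
    next
      case (Suc n)
      let ?g = "\<lambda>s. f (flow u x s)"
      have "f1 ((?T ^^ n) x) = (LINT s:{0..1}|lborel. ?g (s + real n))"
        unfolding f1_def orbit_integral_def
      proof (rule set_lebesgue_integral_cong)
        show "\<forall>s. s \<in> {0..1} \<longrightarrow> f (flow u ((?T ^^ n) x) s) = ?g (s + real n)"
          using f_rel[OF flow_shift[OF gx g[rule_format, of n] _ _ r]] by (auto simp: add.commute)
      qed simp
      also have "\<dots> = (LINT s:{real n..real (Suc n)}|lborel. ?g s)" using set_integral_shift[of 0 1 ?g "real n"] by (simp add: add.commute)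
      finally show ?case using Suc set_integral_split[OF f_flow, of 0 "real n" "real (Suc n)" u x]
        by (simp add: orbit_integral_def)
    qed
  qed
  have full': "AE x in octm. x \<in> upper_set u c"
    unfolding AE_restrict_space_iff[OF sets_oct_lborel]
  proof (rule AE_I'[of "oct - upper_set u c"])
    show "oct - upper_set u c \<in> null_sets lborel" using full sets_oct by (intro null_setsI) auto
  qed auto
  have "c * measure octm (space octm) \<le> (\<integral>x. f1 x \<partial>octm)"
  proof (rule integral_le_of_averages[OF finite_measure_octm Tm distr_octm[OF T] f1m f1b])
    fix e :: real assume e: "e > 0"
    obtain k :: nat where k: "1 / e < real k + 1" using reals_Archimedean2[of "1 / e"] by (metis add_increasing2 less_add_one less_trans zero_le_one)
    then have k: "1 / (real k + 1) \<le> e" using e by (simp add: field_simps)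
    show "AE x in octm. \<exists>n\<ge>1. real n * (c - e) \<le> (\<Sum>i<n. f1 ((?T ^^ i) x))"
      using gen full'
    proof eventually_elim
      case (elim x)
      then obtain n where n: "n \<ge> 1" "c - 1 / (real k + 1) \<le> orbit_integral u x (real n) / real n"
        unfolding upper_set_def mem_Collect_eq by (elim conjE) (drule spec[of _ k], drule spec[of _ 0], elim exE conjE, rule that)
      then have "c - e \<le> orbit_integral u x (real n) / real n" using k by linarith
      then have "real n * (c - e) \<le> orbit_integral u x (real n)" using n(1) by (simp add: field_simps)
      then show ?case using sum[OF elim(1)] n(1) by auto
    qed
  qed
  also have "(\<integral>x. f1 x \<partial>octm) = (\<integral>x. (LINT t:{0..1}|lborel. f (flow u x t)) \<partial>octm)"
    by (simp add: f1_def orbit_integral_def)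
  also have "\<dots> = (\<integral>x. (\<integral>t. f (flow u x t) \<partial>restrict_space lborel {0..1}) \<partial>octm)"
    unfolding set_lebesgue_integral_def by (subst integral_restrict_space) auto
  also have "\<dots> = (\<integral>t. (\<integral>x. f (flow u x t) \<partial>octm) \<partial>restrict_space lborel {0..1})"
  proof -
    have ft: "finite_measure (restrict_space lborel {0..1::real})"
      by (rule finite_measureI) (simp add: space_restrict_space emeasure_restrict_space)
    interpret ft: finite_measure "restrict_space lborel {0..1::real}" by fact
    interpret P: pair_sigma_finite "restrict_space lborel {0..1::real}" octm ..
    interpret PF: finite_measure "restrict_space lborel {0..1::real} \<Otimes>\<^sub>M octm"
      by (rule finite_measure_pair_measure[OF finite_measure_octm ft])
    have "(\<lambda>p. (fst p, snd p)) \<in> measurable (restrict_space lborel {0..1::real} \<Otimes>\<^sub>M octm) (borel \<Otimes>\<^sub>M borel)"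
      by (intro measurable_Pair measurable_compose[OF measurable_fst] measurable_compose[OF measurable_snd])
        (auto intro!: measurable_octm measurable_restrict_space1)
    moreover have "(\<lambda>p. f (flow u (snd p) (fst p))) \<in> borel_measurable (borel \<Otimes>\<^sub>M borel)" by measurable
    ultimately have "(\<lambda>p. f (flow u (snd p) (fst p))) \<in> borel_measurable (restrict_space lborel {0..1::real} \<Otimes>\<^sub>M octm)"
      using measurable_compose by fastforce
    then have "integrable (restrict_space lborel {0..1::real} \<Otimes>\<^sub>M octm) (\<lambda>(t, x). f (flow u x t))"
      using f_flow(2) by (intro PF.integrable_const_bound[of _ 1]) (auto simp: split_beta)
    then show ?thesis by (rule P.Fubini_integral[of "\<lambda>t x. f (flow u x t)"])
  qed
  also have "\<dots> = (\<integral>t. (\<integral>x. f x \<partial>octm) \<partial>restrict_space lborel {0..1::real})"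
    by (rule Bochner_Integration.integral_cong[OF refl]) (rule integral_f_flow[OF u], simp add: space_restrict_space)
  also have "\<dots> = (\<integral>x. f x \<partial>octm)" by (simp add: measure_restrict_space space_restrict_space)
  finally show ?thesis
    using measure_octm_pos by (simp add: mean_def space_restrict_space field_simps)
qed

lemma upper_set_null:
  assumes "u \<notin> exceptional" "mean < c"
  shows "emeasure lborel (upper_set u c) = 0"
proof -
  have "Im u \<noteq> 0" using assms(1) autom_id unfolding exceptional_def by force
  moreover have "emeasure lborel (upper_set u c) = 0 \<or> emeasure lborel (oct - upper_set u c) = 0"
    by (rule ergodic[OF assms(1) sets_upper_set _ flow_invariant_upper_set]) (auto simp: upper_set_def)
  ultimately show ?thesis using upper_set_full[of u c] assms(2) by force
qed

lemma AE_upper: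
  assumes u: "u \<notin> exceptional"
  shows "AE x in octm. generic u x \<and> (\<forall>e>0. \<forall>\<^sub>F n in sequentially. orbit_integral u x (real n) / real n \<le> mean + e)"
proof -
  have Imu: "Im u \<noteq> 0" using u autom_id unfolding exceptional_def by force
  have "AE x in octm. x \<notin> upper_set u (mean + 1 / (real k + 1))" for k :: nat
    unfolding AE_restrict_space_iff[OF sets_oct_lborel]
    by (rule AE_I'[of "upper_set u (mean + 1 / (real k + 1))"])
      (use upper_set_null[OF u, of "mean + 1 / (real k + 1)"] in \<open>auto simp: null_sets_def\<close>)
  then have "AE x in octm. \<forall>k::nat. x \<notin> upper_set u (mean + 1 / (real k + 1))"
    by (simp add: AE_all_countable)
  then show ?thesis using AE_generic[OF Imu]
  proof eventually_elim
    case (elim x)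
    show ?case
    proof (intro conjI allI impI elim(2))
      fix e :: real assume e: "e > 0"
      obtain k :: nat where k: "1 / e < real k + 1" using reals_Archimedean2[of "1 / e"] by (metis add_increasing2 less_add_one less_trans zero_le_one)
      then have k: "1 / (real k + 1) \<le> e" using e by (simp add: field_simps)
      have "x \<notin> upper_set u (mean + 1 / (real k + 1))" using elim(1) by blast
      then have "\<not> (\<forall>j N. \<exists>n\<ge>N. n \<ge> 1 \<and> mean + 1 / (real k + 1) - 1 / (real j + 1) \<le> orbit_integral u x (real n) / real n)"
        using elim(2) generic_oct[OF elim(2)] by (simp only: upper_set_def mem_Collect_eq simp_thms)
      then obtain j N where "\<not> (\<exists>n\<ge>N. n \<ge> 1 \<and> mean + 1 / (real k + 1) - 1 / (real j + 1) \<le> orbit_integral u x (real n) / real n)"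
        unfolding not_all by (elim exE)
      then have N: "\<And>n. n \<ge> N \<Longrightarrow> n \<ge> 1 \<Longrightarrow> orbit_integral u x (real n) / real n < mean + 1 / (real k + 1) - 1 / (real j + 1)"
        by (meson not_le)
      have "orbit_integral u x (real n) / real n \<le> mean + e" if "n \<ge> max N 1" for n
      proof -
        have "orbit_integral u x (real n) / real n < mean + 1 / (real k + 1) - 1 / (real j + 1)" using N that by simp
        moreover have "0 < 1 / (real j + 1)" by simp
        ultimately show ?thesis using k by linarith
      qed
      then show "\<forall>\<^sub>F n in sequentially. orbit_integral u x (real n) / real n \<le> mean + e"
        by (rule eventually_sequentiallyI)
    qed
  qed
qed

end

text \<open>Ergodicity was turned into upper bounds for the averages; the lower bound is the upper
  bound for \<open>1 - indicator Q\<close>. As \<open>Q\<close> lies in the interior, its indicator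
  is constant on classes.\<close>

theorem AE_average:
  assumes u: "u \<notin> exceptional" and Q [measurable]: "Q \<in> sets borel" "Q \<subseteq> interior oct"
  shows "AE x in octm. generic u x \<and>
    ((\<lambda>T. (LINT t:{0..T}|lborel. indicator Q (flow u x t)) / T) \<longlongrightarrow> measure lborel Q / measure lborel oct) at_top"
proof -
  have rel: "indicator Q z = (indicator Q z' :: real)" if "(z, z') \<in> rel" for z z'
  proof -
    have "z \<in> Q \<longleftrightarrow> z' \<in> Q"
      using that rel_interior_eq[OF that] rel_interior_eq[OF rel_sym[OF that]] Q(2) by blast
    then show ?thesis by (simp add: indicator_def)
  qed
  interpret o1: observable "indicator Q"
  proof
    show "indicator Q z = (indicator Q z' :: real)" if "(z, z') \<in> rel" for z z' using rel[OF that] .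
  qed (auto simp: indicator_def)
  interpret o2: observable "\<lambda>z. 1 - indicator Q z"
  proof
    show "1 - indicator Q z = (1 - indicator Q z' :: real)" if "(z, z') \<in> rel" for z z' using rel[OF that] by simp
  qed (auto simp: indicator_def)
  interpret fm: finite_measure octm by (rule finite_measure_octm)
  have Qo: "Q \<subseteq> oct" using Q(2) interior_subset by blast
  have Qs: "Q \<in> sets octm" using Qo sets_oct by (simp add: sets_restrict_space_iff)
  have mQ: "measure octm Q = measure lborel Q" "measure octm oct = measure lborel oct"
    using emeasure_octm[of Q] emeasure_octm[of oct] Qo sets_oct Q(1) by (auto simp: measure_def)
  have so: "space octm = oct" by (simp add: space_restrict_space)
  have m1: "o1.mean = measure lborel Q / measure lborel oct"
    using Qs Qo by (simp add: o1.mean_def mQ so Int_absorb2)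
  have m2: "o2.mean = 1 - measure lborel Q / measure lborel oct"
  proof -
    have "(\<integral>x. 1 - indicator Q x \<partial>octm) = measure octm oct - measure octm Q"
      using Qs Qo by (subst Bochner_Integration.integral_diff) (auto simp: so Int_absorb2 less_top[symmetric])
    then show ?thesis using o1.measure_octm_pos by (simp add: o2.mean_def mQ diff_divide_distrib)
  qed
  show ?thesis using o1.AE_upper[OF u] o2.AE_upper[OF u]
  proof eventually_elim
    case (elim x)
    let ?I = "\<lambda>n. (LINT t:{0..real n}|lborel. indicator Q (flow u x t)) / real n"
    have b: "(\<lambda>t. indicator Q (flow u x t) :: real) \<in> borel_measurable borel" "\<bar>indicator Q (flow u x t) :: real\<bar> \<le> 1" for t
      by (auto simp: indicator_def)
    have I2: "o2.orbit_integral u x (real n) / real n = 1 - ?I n" if "n \<ge> 1" for n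
    proof -
      have "o2.orbit_integral u x (real n) = (LINT t:{0..real n}|lborel. 1) - (LINT t:{0..real n}|lborel. indicator Q (flow u x t))"
        unfolding o2.orbit_integral_def
        by (intro set_integral_diff integral_interval_bound(1)[OF b]) (auto intro!: integral_interval_bound(1))
      then show ?thesis using that by (simp add: set_lebesgue_integral_def diff_divide_distrib)
    qed
    have "?I \<longlonglongrightarrow> measure lborel Q / measure lborel oct"
    proof (rule LIMSEQ_I)
      fix r :: real assume r: "r > 0"
      have "\<forall>\<^sub>F n in sequentially. ?I n \<le> measure lborel Q / measure lborel oct + r / 2"
        using elim(1) r unfolding o1.orbit_integral_def m1 by auto
      moreover have "\<forall>\<^sub>F n in sequentially. o2.orbit_integral u x (real n) / real n \<le> o2.mean + r / 2"
        using elim(2) r by auto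
      then have "\<forall>\<^sub>F n in sequentially. 1 - ?I n \<le> 1 - measure lborel Q / measure lborel oct + r / 2"
        using eventually_ge_at_top[of 1] by eventually_elim (use I2 m2 in simp)
      ultimately have "\<forall>\<^sub>F n in sequentially. norm (?I n - measure lborel Q / measure lborel oct) < r"
        by eventually_elim (unfold real_norm_def, use r in linarith)
      then show "\<exists>no. \<forall>n\<ge>no. norm (?I n - measure lborel Q / measure lborel oct) < r"
        by (simp add: eventually_sequentially)
    qed
    then show ?case using elim average_real_of_nat[OF b] by blast
  qed
qed

section \<open>The vertical coordinate\<close>

definition zmod :: "real \<Rightarrow> real \<Rightarrow> real" where
  "zmod L z = z - L * of_int \<lfloor>z / L\<rfloor>"

lemma borel_zmod [measurable]:
  assumes [measurable]: "f \<in> borel_measurable M"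
  shows "(\<lambda>x. zmod L (f x)) \<in> borel_measurable M"
  unfolding zmod_def by measurable

lemma zmod_range:
  assumes "L > 0"
  shows "0 \<le> zmod L z" "zmod L z < L"
proof -
  show "0 \<le> zmod L z" "zmod L z < L" using floor_divide_lower[OF assms, of z] floor_divide_upper[OF assms, of z] by (simp_all add: zmod_def algebra_simps)
qed

lemma zmod_eq:
  assumes "0 \<le> z" "z < L"
  shows "zmod L z = z"
proof -
  have "\<lfloor>z / L\<rfloor> = 0" using assms by (simp add: floor_eq_iff)
  then show ?thesis by (simp add: zmod_def)
qed

lemma zmod_periodic: "L > 0 \<Longrightarrow> zmod L (z + L) = zmod L z"
  by (simp add: zmod_def add_divide_distrib algebra_simps)

lemma finite_measure_Icc: "finite_measure (restrict_space lborel {a..b::real})"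
  by (rule finite_measureI) (simp add: space_restrict_space emeasure_restrict_space emeasure_lborel_Icc_eq)

locale periodic =
  fixes L :: real and g :: "real \<Rightarrow> real"
  assumes L: "L > 0" and g_meas [measurable]: "g \<in> borel_measurable borel"
    and g_bound: "\<And>z. \<bar>g z\<bar> \<le> 1" and g_add: "\<And>z. g (z + L) = g z"
begin

lemma split: "a \<le> b \<Longrightarrow> b \<le> c \<Longrightarrow> (LINT t:{a..c}|lborel. g t) = (LINT t:{a..b}|lborel. g t) + (LINT t:{b..c}|lborel. g t)"
  by (rule set_integral_split[OF g_meas g_bound])

lemma add_period: "(LINT t:{a + L..b + L}|lborel. g t) = (LINT t:{a..b}|lborel. g t)"
  using set_integral_shift[of a b g L] by (simp add: g_add)

lemma add_periods: "(LINT t:{a + of_int n * L..b + of_int n * L}|lborel. g t) = (LINT t:{a..b}|lborel. g t)"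
proof (induction n rule: int_induct[where k = 0])
  case (step1 i)
  then show ?case using add_period[of "a + of_int i * L" "b + of_int i * L"] by (simp add: algebra_simps)
next
  case (step2 i)
  then show ?case using add_period[of "a + of_int (i - 1) * L" "b + of_int (i - 1) * L"] by (simp add: algebra_simps)
qed simp

lemma integral_period: "(LINT t:{a..a + L}|lborel. g t) = (LINT t:{0..L}|lborel. g t)"
proof -
  define b where "b = of_int \<lfloor>a / L\<rfloor> * L"
  have b: "b \<le> a" "a \<le> b + L"
    using floor_divide_lower[OF L, of a] floor_divide_upper[OF L, of a] by (simp_all add: b_def algebra_simps)
  have "(LINT t:{a..a + L}|lborel. g t) = (LINT t:{a..b + L}|lborel. g t) + (LINT t:{b + L..a + L}|lborel. g t)"
    using b by (intro split) auto
  also have "\<dots> = (LINT t:{b..a}|lborel. g t) + (LINT t:{a..b + L}|lborel. g t)"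
    by (simp add: add_period)
  also have "\<dots> = (LINT t:{b..b + L}|lborel. g t)" using b by (intro split[symmetric]) auto
  also have "\<dots> = (LINT t:{0..L}|lborel. g t)"
    using add_periods[of 0 "\<lfloor>a / L\<rfloor>" L] by (simp add: b_def add.commute)
  finally show ?thesis .
qed

lemma integral_period_shift: "(LINT t:{0..L}|lborel. g (t + a)) = (LINT t:{0..L}|lborel. g t)"
  using set_integral_shift[of 0 L g a] integral_period[of a] by (simp add: add.commute)

text \<open>Whole periods contribute nothing, and the rest is at most one period long.\<close>

lemma integral_bound:
  assumes "(LINT t:{0..L}|lborel. g t) = 0" "a \<le> b"
  shows "\<bar>LINT t:{a..b}|lborel. g t\<bar> \<le> L"
proof -
  have n: "(LINT t:{a..a + real n * L}|lborel. g t) = 0" for n :: nat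
  proof (induction n)
    case 0
    show ?case using integral_interval_bound(2)[OF g_meas g_bound, of a a] by simp
  next
    case (Suc n)
    have e: "a + real (Suc n) * L = a + real n * L + L" by (simp add: algebra_simps)
    show ?case unfolding e
      using split[of a "a + real n * L" "a + real n * L + L"] Suc integral_period[of "a + real n * L"] assms(1) L
      by simp
  qed
  define n where "n = nat \<lfloor>(b - a) / L\<rfloor>"
  have "real n \<le> (b - a) / L" "(b - a) / L < real n + 1"
    using assms(2) L by (simp_all add: n_def)
  then have nb: "a + real n * L \<le> b" "b \<le> a + real n * L + L"
    using L by (simp_all add: pos_le_divide_eq pos_divide_less_eq algebra_simps)
  have "(LINT t:{a..b}|lborel. g t) = (LINT t:{a + real n * L..b}|lborel. g t)"
    using split[of a "a + real n * L" b] n[of n] nb L by simp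
  then show ?thesis using integral_interval_bound(2)[OF g_meas g_bound nb(1)] nb(2) by linarith
qed

lemma integral_bound_affine:
  assumes "(LINT t:{0..L}|lborel. g t) = 0" "a \<le> b" "r \<noteq> 0"
  shows "\<bar>LINT s:{a..b}|lborel. g (z + r * s)\<bar> \<le> L / \<bar>r\<bar>"
proof -
  have "(LINT t:{min (z + r * a) (z + r * b)..max (z + r * a) (z + r * b)}|lborel. g t) =
    \<bar>r\<bar> *\<^sub>R (\<integral>s. indicator {min (z + r * a) (z + r * b)..max (z + r * a) (z + r * b)} (z + r * s) *\<^sub>R g (z + r * s) \<partial>lborel)"
    unfolding set_lebesgue_integral_def using assms(3) by (rule lborel_integral_real_affine)
  also have "(\<integral>s. indicator {min (z + r * a) (z + r * b)..max (z + r * a) (z + r * b)} (z + r * s) *\<^sub>R g (z + r * s) \<partial>lborel)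
    = (LINT s:{a..b}|lborel. g (z + r * s))"
    unfolding set_lebesgue_integral_def
  proof (rule Bochner_Integration.integral_cong[OF refl])
    fix s
    have "(z + r * s \<in> {min (z + r * a) (z + r * b)..max (z + r * a) (z + r * b)}) = (s \<in> {a..b})"
      using assms(2,3) by (cases "r > 0") (auto simp: min_def max_def mult_le_cancel_left)
    then show "indicator {min (z + r * a) (z + r * b)..max (z + r * a) (z + r * b)} (z + r * s) *\<^sub>R g (z + r * s) = indicator {a..b} s *\<^sub>R g (z + r * s)"
      by (simp only: indicator_def)
  qed
  finally have "\<bar>r\<bar> * \<bar>LINT s:{a..b}|lborel. g (z + r * s)\<bar> \<le> L"
    using integral_bound[OF assms(1), of "min (z + r * a) (z + r * b)" "max (z + r * a) (z + r * b)"] by (simp add: abs_mult)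
  then show ?thesis using assms(3) by (simp add: field_simps)
qed

abbreviation Z :: "real measure" where "Z \<equiv> restrict_space lborel {0..L}"
abbreviation S :: "real \<Rightarrow> real measure" where "S R \<equiv> restrict_space lborel {-R..R}"

text \<open>Periodicity allows \<open>z\<close> to be shifted by \<open>s * t\<close>, which leaves
  \<open>g z * g (z + (t' - t) * s)\<close>. For fixed \<open>z\<close> the second factor oscillates
  in \<open>s\<close> with mean zero, so its integral over any interval is at most
  \<open>L / \<bar>t - t'\<bar>\<close>, whatever \<open>R\<close> is.\<close>

lemma correlation:
  assumes zero: "(LINT t:{0..L}|lborel. g t) = 0" and "R \<ge> 0" "t \<noteq> t'"
  shows "\<bar>\<integral>p. g (snd p + fst p * t) * g (snd p + fst p * t') \<partial>(S R \<Otimes>\<^sub>M Z)\<bar> \<le> L\<^sup>2 / \<bar>t - t'\<bar>"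
proof -
  note fin = finite_measure_Icc
  interpret S: finite_measure "S R" by (rule fin)
  interpret Z: finite_measure Z by (rule fin)
  interpret SZ: finite_measure "S R \<Otimes>\<^sub>M Z" by (rule finite_measure_pair_measure[OF fin fin])
  interpret P: pair_sigma_finite "S R" Z ..
  have gg: "\<bar>g y * g y'\<bar> \<le> 1" for y y'
    using mult_mono[OF g_bound[of y] g_bound[of y']] by (simp add: abs_mult)
  have mS: "f \<in> borel_measurable borel \<Longrightarrow> f \<in> borel_measurable (restrict_space lborel A)" for f :: "real \<Rightarrow> real" and A
    by (intro measurable_restrict_space1) simp
  have [measurable]: "fst \<in> borel_measurable (S R \<Otimes>\<^sub>M Z)" "snd \<in> borel_measurable (S R \<Otimes>\<^sub>M Z)"
    by (rule measurable_compose[OF measurable_fst] measurable_compose[OF measurable_snd], rule mS, simp)+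
  have int: "integrable (S R \<Otimes>\<^sub>M Z) (\<lambda>p. g (f p) * g (h p))" if [measurable]: "f \<in> borel_measurable (S R \<Otimes>\<^sub>M Z)" "h \<in> borel_measurable (S R \<Otimes>\<^sub>M Z)" for f h
  proof (rule SZ.integrable_const_bound)
    show "AE p in S R \<Otimes>\<^sub>M Z. norm (g (f p) * g (h p)) \<le> 1" using gg by (intro AE_I2) simp
  qed measurable
  let ?r = "t' - t"
  have "(\<integral>p. g (snd p + fst p * t) * g (snd p + fst p * t') \<partial>(S R \<Otimes>\<^sub>M Z)) = (\<integral>s. \<integral>z. g (z + s * t) * g (z + s * t') \<partial>Z \<partial>S R)"
    using P.integral_fst'[OF int[of "\<lambda>p. snd p + fst p * t" "\<lambda>p. snd p + fst p * t'"]] by simp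
  also have "\<dots> = (\<integral>s. \<integral>z. g z * g (z + ?r * s) \<partial>Z \<partial>S R)"
  proof (rule Bochner_Integration.integral_cong[OF refl])
    fix s
    interpret q: periodic L "\<lambda>z. g z * g (z + ?r * s)"
    proof
      show "g (z + L) * g (z + L + ?r * s) = g z * g (z + ?r * s)" for z
        using g_add[of z] g_add[of "z + ?r * s"] by (simp add: algebra_simps)
    qed (use L gg in auto)
    have e: "z + s * t + ?r * s = z + s * t'" for z by (simp add: algebra_simps)
    have r: "(\<integral>z. f z \<partial>Z) = (LINT z:{0..L}|lborel. f z)" for f :: "real \<Rightarrow> real"
      unfolding set_lebesgue_integral_def by (rule integral_restrict_space) simp
    show "(\<integral>z. g (z + s * t) * g (z + s * t') \<partial>Z) = (\<integral>z. g z * g (z + ?r * s) \<partial>Z)"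
      unfolding r using q.integral_period_shift[of "s * t"] by (simp only: e)
  qed
  also have "\<dots> = (\<integral>z. \<integral>s. g z * g (z + ?r * s) \<partial>S R \<partial>Z)"
  proof -
    have "integrable (S R \<Otimes>\<^sub>M Z) (\<lambda>(s, z). g z * g (z + ?r * s))" using int[of snd "\<lambda>p. snd p + ?r * fst p"] unfolding split_beta' by simp
    then show ?thesis by (rule P.Fubini_integral[symmetric])
  qed
  also have "\<dots> = (\<integral>z. g z * (\<integral>s. g (z + ?r * s) \<partial>S R) \<partial>Z)" by simp
  also have "\<bar>\<dots>\<bar> \<le> (\<integral>z. L / \<bar>?r\<bar> \<partial>Z)"
  proof -
    have b: "\<bar>g z * (\<integral>s. g (z + ?r * s) \<partial>S R)\<bar> \<le> L / \<bar>?r\<bar>" for z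
    proof -
      have "(\<integral>s. g (z + ?r * s) \<partial>S R) = (LINT s:{-R..R}|lborel. g (z + ?r * s))"
        unfolding set_lebesgue_integral_def by (rule integral_restrict_space) simp
      then have "\<bar>\<integral>s. g (z + ?r * s) \<partial>S R\<bar> \<le> L / \<bar>?r\<bar>"
        using integral_bound_affine[OF zero, of "-R" R ?r z] assms(2,3) by simp
      then show ?thesis using mult_mono[OF g_bound[of z], of "\<bar>\<integral>s. g (z + ?r * s) \<partial>S R\<bar>" "L / \<bar>?r\<bar>"] by (simp add: abs_mult)
    qed
    have m: "(\<lambda>z. g z * (\<integral>s. g (z + ?r * s) \<partial>S R)) \<in> borel_measurable Z"
    proof -
      have "(\<lambda>p. g (snd p + ?r * fst p)) \<in> borel_measurable (S R \<Otimes>\<^sub>M Z)" by measurable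
      then have "(\<lambda>p. g (fst p + ?r * snd p)) \<in> borel_measurable (Z \<Otimes>\<^sub>M S R)"
        using measurable_pair_swap[of "\<lambda>p. g (snd p + ?r * fst p)" "S R" Z borel] by (simp add: split_beta)
      then have "(\<lambda>z. \<integral>s. g (z + ?r * s) \<partial>S R) \<in> borel_measurable Z"
        by (intro S.borel_measurable_lebesgue_integral) (simp add: split_beta)
      then show ?thesis by (intro borel_measurable_times mS[OF g_meas])
    qed
    have "integrable Z (\<lambda>z. g z * (\<integral>s. g (z + ?r * s) \<partial>S R))"
      by (rule Z.integrable_const_bound[of _ "L / \<bar>?r\<bar>"]) (use b m in auto)
    then have "\<bar>\<integral>z. g z * (\<integral>s. g (z + ?r * s) \<partial>S R) \<partial>Z\<bar> \<le> (\<integral>z. \<bar>g z * (\<integral>s. g (z + ?r * s) \<partial>S R)\<bar> \<partial>Z)"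
      using integral_norm_bound[of Z "\<lambda>z. g z * (\<integral>s. g (z + ?r * s) \<partial>S R)"] by simp
    also have "\<dots> \<le> (\<integral>z. L / \<bar>?r\<bar> \<partial>Z)"
      by (rule integral_mono) (use b m in \<open>auto intro!: Z.integrable_const_bound[of _ "L / \<bar>?r\<bar>"]\<close>)
    finally show ?thesis .
  qed
  also have "\<dots> = L\<^sup>2 / \<bar>t - t'\<bar>"
    using L by (simp add: space_restrict_space measure_restrict_space power2_eq_square abs_minus_commute)
  finally show ?thesis .
qed

text \<open>The weight depends on time alone, so it comes out of the correlation integral as a
  factor of modulus at most 1.\<close>

lemma AE_weighted_average:
  assumes zero: "(LINT t:{0..L}|lborel. g t) = 0" and "R \<ge> 0"
    and h [measurable]: "h \<in> borel_measurable borel" and hb: "\<And>t. \<bar>h t\<bar> \<le> 1"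
  shows "AE p in S R \<Otimes>\<^sub>M Z. ((\<lambda>T. (LINT t:{0..T}|lborel. h t * g (snd p + fst p * t)) / T) \<longlongrightarrow> 0) at_top"
proof (rule averages_tendsto_0)
  note fin = finite_measure_Icc
  show "finite_measure (S R \<Otimes>\<^sub>M Z)" by (rule finite_measure_pair_measure[OF fin fin])
  have mS: "f \<in> borel_measurable borel \<Longrightarrow> f \<in> borel_measurable (restrict_space lborel A)" for f :: "real \<Rightarrow> real" and A
    by (intro measurable_restrict_space1) simp
  have [measurable]: "fst \<in> borel_measurable (S R \<Otimes>\<^sub>M Z)" "snd \<in> borel_measurable (S R \<Otimes>\<^sub>M Z)"
    by (rule measurable_compose[OF measurable_fst] measurable_compose[OF measurable_snd], rule mS, simp)+
  show "(\<lambda>(t, p). h t * g (snd p + fst p * t)) \<in> borel_measurable (borel \<Otimes>\<^sub>M (S R \<Otimes>\<^sub>M Z))" by measurable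
  show "\<bar>h t * g (snd p + fst p * t)\<bar> \<le> 1" for t p
    using mult_mono[OF hb[of t] g_bound[of "snd p + fst p * t"]] by (simp add: abs_mult)
  show "L\<^sup>2 \<ge> 0" by simp
  fix t t' :: real assume t: "t \<noteq> t'"
  have "(\<integral>p. (h t * g (snd p + fst p * t)) * (h t' * g (snd p + fst p * t')) \<partial>(S R \<Otimes>\<^sub>M Z))
    = (\<integral>p. (h t * h t') * (g (snd p + fst p * t) * g (snd p + fst p * t')) \<partial>(S R \<Otimes>\<^sub>M Z))"
    by (simp add: mult.assoc mult.left_commute)
  also have "\<dots> = (h t * h t') * (\<integral>p. g (snd p + fst p * t) * g (snd p + fst p * t') \<partial>(S R \<Otimes>\<^sub>M Z))"
    by simp
  also have "\<bar>\<dots>\<bar> \<le> 1 * (L\<^sup>2 / \<bar>t - t'\<bar>)"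
  proof -
    have "\<bar>h t * h t'\<bar> \<le> 1" using mult_mono[OF hb[of t] hb[of t']] by (simp add: abs_mult)
    then show ?thesis unfolding abs_mult[of "h t * h t'"] using correlation[OF zero assms(2) t] by (intro mult_mono) auto
  qed
  finally show "\<bar>\<integral>p. (h t * g (snd p + fst p * t)) * (h t' * g (snd p + fst p * t')) \<partial>(S R \<Otimes>\<^sub>M Z)\<bar> \<le> L\<^sup>2 / \<bar>t - t'\<bar>" by simp
qed

end

text \<open>Subtracting the mean \<open>b\<close> from the indicator leaves a mean zero periodic
  function, whose weighted averages vanish; the rest is \<open>b\<close> times the average of
  \<open>h\<close>. Slopes are exhausted by bounded intervals, on which the measure is
  finite.\<close>

lemma AE_vertical_average:
  assumes L: "L > 0" and J [measurable]: "J \<in> sets borel" "J \<subseteq> {0..<L}"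
    and h [measurable]: "h \<in> borel_measurable borel" and hb: "\<And>t. \<bar>h t\<bar> \<le> 1"
    and lim: "((\<lambda>T. (LINT t:{0..T}|lborel. h t) / T) \<longlongrightarrow> a) at_top"
  shows "AE s in lborel. AE z in lborel. z \<in> {0..L} \<longrightarrow>
    ((\<lambda>T. (LINT t:{0..T}|lborel. h t * indicator J (zmod L (z + s * t))) / T) \<longlongrightarrow> a * (measure lborel J / L)) at_top"
proof -
  define b where "b = measure lborel J / L"
  have "measure lborel J \<le> measure lborel {0..L}"
    using L J(2) by (intro measure_mono_fmeasurable) (auto simp: fmeasurable_def)
  then have b: "0 \<le> b" "b \<le> 1" using L by (auto simp: b_def)
  interpret periodic L "\<lambda>z. indicator J (zmod L z) - b"
    by standard (use L b zmod_periodic in \<open>auto simp: indicator_def\<close>)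
  have "(LINT z:{0..L}|lborel. indicator J (zmod L z) - b) = (LINT z:{0..L}|lborel. indicator J z - b)"
    unfolding set_lebesgue_integral_def
  proof (rule integral_cong_AE)
    show "AE z in lborel. indicator {0..L} z *\<^sub>R (indicator J (zmod L z) - b) = indicator {0..L} z *\<^sub>R (indicator J z - b)"
      using AE_lborel_singleton[of L] by eventually_elim (auto simp: indicator_def zmod_eq)
  qed measurable
  also have "\<dots> = (LINT z:{0..L}|lborel. indicator J z) - (LINT z:{0..L}|lborel. b)"
    by (rule set_integral_diff; rule integral_interval_bound(1)) (use L b in \<open>auto simp: indicator_def\<close>)
  also have "(LINT z:{0..L}|lborel. indicator J z) = (\<integral>z. indicator J z \<partial>lborel :: real)"
    unfolding set_lebesgue_integral_def using J(2)
    by (intro Bochner_Integration.integral_cong) (auto simp: indicator_def)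
  also have "\<dots> - (LINT z:{0..L}|lborel. b) = 0"
    using L by (simp add: set_lebesgue_integral_def b_def)
  finally have zero: "(LINT z:{0..L}|lborel. indicator J (zmod L z) - b) = 0" .
  let ?P = "\<lambda>s z. ((\<lambda>T. (LINT t:{0..T}|lborel. h t * indicator J (zmod L (z + s * t))) / T) \<longlongrightarrow> a * b) at_top"
  have *: "AE p in S R \<Otimes>\<^sub>M Z. ?P (fst p) (snd p)" if R: "R \<ge> 0" for R
    using AE_weighted_average[OF zero R h hb]
  proof eventually_elim
    case (elim p)
    have i: "(LINT t:{0..T}|lborel. h t * indicator J (zmod L (snd p + fst p * t))) / T =
      (LINT t:{0..T}|lborel. h t * (indicator J (zmod L (snd p + fst p * t)) - b)) / T + (LINT t:{0..T}|lborel. h t) / T * b" if "T > 0" for T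
    proof -
      have h1: "set_integrable lborel {0..T} h" using that by (intro integral_interval_bound(1)[OF h hb]) auto
      have h2: "set_integrable lborel {0..T} (\<lambda>t. h t * (indicator J (zmod L (snd p + fst p * t)) - b))"
      proof (rule integral_interval_bound(1))
        show "\<bar>h t * (indicator J (zmod L (snd p + fst p * t)) - b)\<bar> \<le> 1" for t
          using mult_mono[OF hb[of t] g_bound[of "snd p + fst p * t"]] by (simp add: abs_mult)
      qed (use that in auto)
      have "(LINT t:{0..T}|lborel. h t * indicator J (zmod L (snd p + fst p * t))) =
        (LINT t:{0..T}|lborel. h t * (indicator J (zmod L (snd p + fst p * t)) - b) + b * h t)"
        by (simp add: algebra_simps)
      also have "\<dots> = (LINT t:{0..T}|lborel. h t * (indicator J (zmod L (snd p + fst p * t)) - b)) + (LINT t:{0..T}|lborel. b * h t)"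
        by (rule set_integral_add(2)[OF h2]) (use h1 in simp)
      finally show ?thesis by (simp add: add_divide_distrib)
    qed
    have "((\<lambda>T. (LINT t:{0..T}|lborel. h t * (indicator J (zmod L (snd p + fst p * t)) - b)) / T + (LINT t:{0..T}|lborel. h t) / T * b) \<longlongrightarrow> 0 + a * b) at_top"
      using elim lim by (intro tendsto_intros)
    then show ?case
      by (subst tendsto_cong[OF eventually_mono[OF eventually_gt_at_top[of 0] i]]) simp_all
  qed
  have "AE s in lborel. s \<in> {- real n..real n} \<longrightarrow> (AE z in lborel. z \<in> {0..L} \<longrightarrow> ?P s z)" for n :: nat
  proof -
    interpret S: finite_measure "S (real n)" by (rule finite_measure_Icc)
    interpret Z: finite_measure Z by (rule finite_measure_Icc)
    interpret P: pair_sigma_finite "S (real n)" Z ..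
    have "AE s in S (real n). AE z in Z. ?P s z" using P.AE_pair[OF *[of "real n"]] by simp
    then show ?thesis by (simp add: AE_restrict_space_iff)
  qed
  then have "AE s in lborel. \<forall>n::nat. s \<in> {- real n..real n} \<longrightarrow> (AE z in lborel. z \<in> {0..L} \<longrightarrow> ?P s z)"
    unfolding AE_all_countable by (rule allI)
  then have "AE s in lborel. AE z in lborel. z \<in> {0..L} \<longrightarrow> ?P s z"
  proof eventually_elim
    case (elim s)
    obtain n :: nat where "\<bar>s\<bar> \<le> real n" using real_arch_simple by blast
    then show ?case using elim[rule_format, of n] by (simp add: abs_le_iff)
  qed
  then show ?thesis by (simp only: b_def)
qed

section \<open>Typical initial conditions\<close>

text \<open>Half-open dyadic cubes are nested and each point lies in just one per level.
  \<open>cell\<close> cuts them down to the open prism, whose points are the only representatives of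
  their classes.\<close>

definition cell_index :: "nat \<Rightarrow> complex \<times> real \<Rightarrow> int \<times> int \<times> int" where
  "cell_index k p = (\<lfloor>2 ^ k * Re (fst p)\<rfloor>, \<lfloor>2 ^ k * Im (fst p)\<rfloor>, \<lfloor>2 ^ k * snd p\<rfloor>)"

definition cell :: "real \<Rightarrow> nat \<Rightarrow> int \<times> int \<times> int \<Rightarrow> (complex \<times> real) set" where
  "cell L k i = {p \<in> interior oct \<times> {0<..<L}. cell_index k p = i}"

lemma cell_Times:
  "cell L k (a, b, l) = {x \<in> interior oct. \<lfloor>2 ^ k * Re x\<rfloor> = a \<and> \<lfloor>2 ^ k * Im x\<rfloor> = b} \<times> {z \<in> {0<..<L}. \<lfloor>2 ^ k * z\<rfloor> = l}"
  by (auto simp: cell_def cell_index_def)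

lemma sets_cell_factors [measurable]:
  "{x \<in> interior oct. \<lfloor>2 ^ k * Re x\<rfloor> = a \<and> \<lfloor>2 ^ k * Im x\<rfloor> = b} \<in> sets borel"
  "{z \<in> {0<..<L :: real}. \<lfloor>2 ^ k * z\<rfloor> = l} \<in> sets borel"
  by measurable

lemma sets_cell [measurable]: "cell L k i \<in> sets borel"
proof (cases i)
  case (fields a b l)
  show ?thesis unfolding fields cell_Times
    using pair_measureI[OF sets_cell_factors(1)[of k a b] sets_cell_factors(2)[of L k l]] unfolding borel_prod .
qed

lemma measure_lborel_Times:
  fixes A :: "complex set" and B :: "real set"
  assumes "A \<in> sets borel" "B \<in> sets borel"
  shows "measure lborel (A \<times> B) = measure lborel A * measure lborel B"
proof -
  have "emeasure lborel (A \<times> B) = emeasure lborel A * emeasure lborel B"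
    unfolding lborel_prod[symmetric] using assms by (intro lborel.emeasure_pair_measure_Times) auto
  then show ?thesis by (simp add: measure_def enn2real_mult)
qed

definition trajectory :: "real \<Rightarrow> complex \<times> real \<Rightarrow> complex \<times> real \<Rightarrow> real \<Rightarrow> complex \<times> real" where
  "trajectory L v p t = (flow (fst v) (fst p) t, zmod L (snd p + snd v * t))"

text \<open>Countably many limits along integer times, so that the condition is measurable;
  equidistribution is deduced from it for each single orbit.\<close>

definition good :: "real \<Rightarrow> complex \<times> real \<Rightarrow> complex \<times> real \<Rightarrow> bool" where
  "good L v p \<longleftrightarrow> generic (fst v) (fst p) \<and>
     (\<forall>k i. (\<lambda>n. (LINT t:{0..real n}|lborel. indicator (cell L k i) (trajectory L v p t)) / real n)
        \<longlonglongrightarrow> measure lborel (cell L k i) / measure lborel (oct \<times> {0..L}))"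

lemma borel_fst_snd:
  assumes "(v :: 'a \<Rightarrow> complex \<times> real) \<in> borel_measurable M"
  shows "(\<lambda>x. fst (v x)) \<in> borel_measurable M" "(\<lambda>x. snd (v x)) \<in> borel_measurable M"
  by (intro measurable_compose[OF assms] borel_measurable_continuous_onI continuous_intros)+

lemma borel_trajectory [measurable]:
  assumes [measurable]: "v \<in> borel_measurable M" "p \<in> borel_measurable M" "t \<in> borel_measurable M"
  shows "(\<lambda>x. trajectory L (v x) (p x) (t x)) \<in> borel_measurable M"
proof -
  note [measurable] = borel_fst_snd[OF assms(1)] borel_fst_snd[OF assms(2)]
  show ?thesis unfolding trajectory_def borel_prod[symmetric] by measurable
qed

lemma pred_good [measurable]:
  assumes [measurable]: "v \<in> borel_measurable M" "p \<in> borel_measurable M"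
  shows "Measurable.pred M (\<lambda>x. good L (v x) (p x))"
proof -
  note [measurable] = borel_fst_snd(1)[OF assms(1)] borel_fst_snd(1)[OF assms(2)]
  have [measurable]: "(\<lambda>x. (LINT t:{0..real n}|lborel. indicator (cell L k i) (trajectory L (v x) (p x) t) :: real)) \<in> borel_measurable M" for n k i
    unfolding set_lebesgue_integral_def by measurable
  show ?thesis unfolding good_def by measurable
qed

text \<open>For fixed \<open>u\<close> and \<open>x\<close> the planar orbit is fixed and its visits
  to a planar cell serve as the weight \<open>h\<close>. The null set of slopes and heights may
  depend on \<open>x\<close>, while countably many cells share one.\<close>

lemma AE_good_iterated:
  assumes L: "L > 0" and u: "u \<notin> exceptional"
  shows "AE x in lborel. x \<in> oct \<longrightarrow> (AE s in lborel. AE z in lborel. z \<in> {0..L} \<longrightarrow> good L (u, s) (x, z))"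
proof -
  define Q where "Q k a b = {x \<in> interior oct. \<lfloor>2 ^ k * Re x\<rfloor> = a \<and> \<lfloor>2 ^ k * Im x\<rfloor> = b}" for k :: nat and a b :: int
  define J where "J k l = {z \<in> {0<..<L}. \<lfloor>2 ^ k * z\<rfloor> = l}" for k :: nat and l :: int
  have m [measurable]: "Q k a b \<in> sets borel" "J k l \<in> sets borel" for k a b l unfolding Q_def J_def by measurable
  have c: "cell L k (a, b, l) = Q k a b \<times> J k l" for k a b l by (simp only: cell_Times Q_def J_def)
  have sub: "Q k a b \<subseteq> interior oct" "J k l \<subseteq> {0..<L}" for k a b l by (auto simp: Q_def J_def)
  have "AE x in octm. \<forall>k a b. generic u x \<and>
    ((\<lambda>T. (LINT t:{0..T}|lborel. indicator (Q k a b) (flow u x t)) / T) \<longlongrightarrow> measure lborel (Q k a b) / measure lborel oct) at_top"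
    unfolding AE_all_countable by (intro allI AE_average[OF u m(1) sub(1)])
  then have "AE x in lborel. x \<in> oct \<longrightarrow> (\<forall>k a b. generic u x \<and>
    ((\<lambda>T. (LINT t:{0..T}|lborel. indicator (Q k a b) (flow u x t)) / T) \<longlongrightarrow> measure lborel (Q k a b) / measure lborel oct) at_top)"
    by (subst (asm) AE_restrict_space_iff[OF sets_oct_lborel])
  then show ?thesis
  proof eventually_elim
    case (elim x)
    show ?case
    proof
      assume "x \<in> oct"
      then have x: "generic u x" "((\<lambda>T. (LINT t:{0..T}|lborel. indicator (Q k a b) (flow u x t)) / T) \<longlongrightarrow> measure lborel (Q k a b) / measure lborel oct) at_top" for k a b
        using elim by blast+
      have "AE s in lborel. AE z in lborel. z \<in> {0..L} \<longrightarrow>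
        ((\<lambda>T. (LINT t:{0..T}|lborel. indicator (Q k a b) (flow u x t) * indicator (J k l) (zmod L (z + s * t))) / T) \<longlongrightarrow>
          measure lborel (Q k a b) / measure lborel oct * (measure lborel (J k l) / L)) at_top" for k a b l
        by (rule AE_vertical_average[OF L m(2) sub(2) _ _ x(2)]) (auto simp: indicator_def)
      then have "AE s in lborel. \<forall>k a b l. AE z in lborel. z \<in> {0..L} \<longrightarrow>
        ((\<lambda>T. (LINT t:{0..T}|lborel. indicator (Q k a b) (flow u x t) * indicator (J k l) (zmod L (z + s * t))) / T) \<longlongrightarrow>
          measure lborel (Q k a b) / measure lborel oct * (measure lborel (J k l) / L)) at_top"
        unfolding AE_all_countable by (intro allI)
      then have "AE s in lborel. AE z in lborel. \<forall>k a b l. z \<in> {0..L} \<longrightarrow>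
        ((\<lambda>T. (LINT t:{0..T}|lborel. indicator (Q k a b) (flow u x t) * indicator (J k l) (zmod L (z + s * t))) / T) \<longlongrightarrow>
          measure lborel (Q k a b) / measure lborel oct * (measure lborel (J k l) / L)) at_top"
        by (rule eventually_mono) (unfold AE_all_countable, assumption)
      then show "AE s in lborel. AE z in lborel. z \<in> {0..L} \<longrightarrow> good L (u, s) (x, z)"
      proof eventually_elim
        case (elim s)
        then show ?case
        proof eventually_elim
          case (elim z)
          show ?case
          proof
            assume "z \<in> {0..L}"
        then have lim: "((\<lambda>T. (LINT t:{0..T}|lborel. indicator (Q k a b) (flow u x t) * indicator (J k l) (zmod L (z + s * t))) / T) \<longlongrightarrow>
          measure lborel (Q k a b) / measure lborel oct * (measure lborel (J k l) / L)) at_top" for k a b l using elim by blast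
        have "(\<lambda>n. (LINT t:{0..real n}|lborel. indicator (cell L k i) (trajectory L (u, s) (x, z) t)) / real n)
          \<longlonglongrightarrow> measure lborel (cell L k i) / measure lborel (oct \<times> {0..L})" for k i
        proof (cases i)
          case (fields a b l)
          have ml: "measure lborel (cell L k i) / measure lborel (oct \<times> {0..L}) = measure lborel (Q k a b) / measure lborel oct * (measure lborel (J k l) / L)"
            unfolding fields c using L sets_oct by (simp add: measure_lborel_Times)
          have ind: "indicator (cell L k i) (trajectory L (u, s) (x, z) t) = (indicator (Q k a b) (flow u x t) * indicator (J k l) (zmod L (z + s * t)) :: real)" for t
            unfolding fields c trajectory_def by (simp add: indicator_times)
          show ?thesis unfolding ml ind by (rule filterlim_compose[OF lim filterlim_real_sequentially])
        qed
        then show "good L (u, s) (x, z)" unfolding good_def using x(1) by simp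
        qed
        qed
      qed
    qed
  qed
qed

text \<open>Fubini moves \<open>x\<close> behind \<open>s\<close>, so that the direction
  \<open>(u, s)\<close> is quantified before the starting point \<open>(x, z)\<close>.\<close>

lemma AE_good:
  assumes L: "L > 0" and u: "u \<notin> exceptional"
  shows "AE s in lborel. AE p in lborel. p \<in> oct \<times> {0..L} \<longrightarrow> good L (u, s) p"
proof -
  note [measurable] = sets_oct
  let ?Q = "\<lambda>x s z. x \<in> oct \<longrightarrow> z \<in> {0..L} \<longrightarrow> good L (u, s) (x, z)"
  interpret xs: pair_sigma_finite "lborel :: complex measure" "lborel \<Otimes>\<^sub>M lborel :: (real \<times> real) measure"
    by (simp add: lborel_prod pair_sigma_finite_def sigma_finite_lborel)
  have "AE x in lborel. AE s in lborel. AE z in lborel. ?Q x s z"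
    using AE_good_iterated[OF L u] by eventually_elim auto
  then have "AE x in lborel. AE p in lborel \<Otimes>\<^sub>M lborel. ?Q x (fst p) (snd p)"
  proof eventually_elim
    case (elim x)
    have "{p \<in> space (lborel \<Otimes>\<^sub>M lborel). ?Q x (fst p) (snd p)} \<in> sets (lborel \<Otimes>\<^sub>M lborel)" by measurable
    from lborel_pair.AE_pair_measure[OF this] elim show ?case by simp
  qed
  then have "AE p in lborel \<Otimes>\<^sub>M lborel. AE x in lborel. ?Q x (fst p) (snd p)"
    by (subst (asm) xs.AE_commute) measurable
  then have "AE s in lborel. AE z in lborel. AE x in lborel. ?Q x s z"
    by (drule_tac lborel_pair.AE_pair) simp
  then show ?thesis
  proof eventually_elim
    case (elim s)
    then have 1: "AE x in lborel. AE z in lborel. ?Q x s z" by (subst lborel_pair.AE_commute) measurable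
    have "{p \<in> space (lborel \<Otimes>\<^sub>M lborel). ?Q (fst p) s (snd p)} \<in> sets (lborel \<Otimes>\<^sub>M lborel)" by measurable
    from lborel_pair.AE_pair_measure[OF this] 1 have "AE p in lborel \<Otimes>\<^sub>M lborel. ?Q (fst p) s (snd p)" by simp
    then show ?case unfolding lborel_prod by eventually_elim auto
  qed
qed

section \<open>Invariance under positive scaling of the direction\<close>

lemma scale_exit:
  assumes "r > 0"
  shows "exit_time (of_real r * u) z = exit_time u z / r" "next_point (of_real r * u) z = next_point u z"
    "zs (of_real r * u) x n = zs u x n" "ts (of_real r * u) x n = ts u x n / r"
    "cross (of_real r * u) z (t / r) = cross u z t"
proof -
  show e: "exit_time (of_real r * u) z = exit_time u z / r" for z by (simp add: exit_time_def mult.commute)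
  show n: "next_point (of_real r * u) z = next_point u z" for z using assms by (simp add: next_point_def e)
  show z: "zs (of_real r * u) x n = zs u x n" for n by (induction n) (simp_all add: n)
  show "ts (of_real r * u) x n = ts u x n / r" by (simp add: ts_def z e sum_divide_distrib)
  show "cross (of_real r * u) z (t / r) = cross u z t" using assms by (simp add: cross_def)
qed

lemma scale_up:
  assumes "r > 0"
  shows "up_generic (of_real r * u) x \<longleftrightarrow> up_generic u x" "up_flow (of_real r * u) x t = up_flow u x (r * t)"
proof -
  show "up_generic (of_real r * u) x \<longleftrightarrow> up_generic u x" by (simp add: up_generic_def scale_exit[OF assms])
  have "t < ts u x n / r \<longleftrightarrow> r * t < ts u x n" for n using assms by (simp add: pos_less_divide_eq mult.commute)
  moreover have "t - ts u x n / r = (r * t - ts u x n) / r" for n using assms by (simp add: field_simps)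
  ultimately show "up_flow (of_real r * u) x t = up_flow u x (r * t)"
    unfolding up_flow_def scale_exit[OF assms] by (simp only: scale_exit(5)[OF assms])
qed

lemma scale_flow:
  assumes "r > 0"
  shows "generic (of_real r * u) x \<longleftrightarrow> generic u x" "flow (of_real r * u) x t = flow u x (r * t)"
proof -
  have m: "- (of_real r * u) = of_real r * (- u)" by simp
  show "generic (of_real r * u) x \<longleftrightarrow> generic u x" "flow (of_real r * u) x t = flow u x (r * t)"
    unfolding generic_def flow_def m scale_up[OF assms]
    using assms by (auto simp: zero_less_mult_iff mult_less_0_iff)
qed

lemma average_scale:
  fixes f :: "real \<Rightarrow> real"
  assumes f: "f \<in> borel_measurable borel" "\<And>t. \<bar>f t\<bar> \<le> 1" and r: "r > 0"
    and lim: "(\<lambda>n. (LINT t:{0..real n}|lborel. f t) / real n) \<longlonglongrightarrow> a"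
  shows "(\<lambda>n. (LINT t:{0..real n}|lborel. f (r * t)) / real n) \<longlonglongrightarrow> a"
proof -
  have s: "(LINT t:{0..T}|lborel. f (r * t)) / T = (LINT t:{0..r * T}|lborel. f t) / (r * T)" for T
  proof -
    have "(LINT t:{0..r * T}|lborel. f t) = \<bar>r\<bar> *\<^sub>R (\<integral>t. indicator {0..r * T} (0 + r * t) *\<^sub>R f (0 + r * t) \<partial>lborel)"
      unfolding set_lebesgue_integral_def using r by (intro lborel_integral_real_affine) simp
    also have "(\<integral>t. indicator {0..r * T} (0 + r * t) *\<^sub>R f (0 + r * t) \<partial>lborel) = (LINT t:{0..T}|lborel. f (r * t))"
      unfolding set_lebesgue_integral_def using r
      by (intro Bochner_Integration.integral_cong refl) (auto simp: indicator_def zero_le_mult_iff)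
    finally show ?thesis using r by simp
  qed
  have "((\<lambda>T. (LINT t:{0..T}|lborel. f t) / T) \<longlongrightarrow> a) at_top" using average_real_of_nat[OF f] lim by blast
  moreover have "filterlim (\<lambda>n. r * real n) at_top sequentially"
    using filterlim_real_sequentially r by (intro filterlim_tendsto_pos_mult_at_top[OF tendsto_const])
  ultimately have "(\<lambda>n. (LINT t:{0..r * real n}|lborel. f t) / (r * real n)) \<longlonglongrightarrow> a"
    by (rule filterlim_compose)
  then show ?thesis by (simp only: s)
qed

lemma good_scale:
  assumes r: "r > 0" and g: "good L v p"
  shows "good L (of_real r * fst v, r * snd v) p"
proof -
  have [measurable]: "(\<lambda>t. trajectory L v p t) \<in> borel_measurable borel" by measurable
  have "trajectory L (of_real r * fst v, r * snd v) p t = trajectory L v p (r * t)" for t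
    unfolding trajectory_def fst_conv snd_conv scale_flow[OF r] by (simp add: mult_ac)
  moreover have "(\<lambda>n. (LINT t:{0..real n}|lborel. indicator (cell L k i) (trajectory L v p (r * t))) / real n)
        \<longlonglongrightarrow> measure lborel (cell L k i) / measure lborel (oct \<times> {0..L})" for k i
  proof (rule average_scale[OF _ _ r])
    show "(\<lambda>n. (LINT t:{0..real n}|lborel. indicator (cell L k i) (trajectory L v p t)) / real n)
        \<longlonglongrightarrow> measure lborel (cell L k i) / measure lborel (oct \<times> {0..L})"
      using g unfolding good_def by blast
  qed (auto simp: indicator_def)
  ultimately show ?thesis using g by (simp add: good_def scale_flow[OF r])
qed

section \<open>From cells to Jordan measurable sets\<close>

lemma floor_half_power: "\<lfloor>2 ^ k * x\<rfloor> = \<lfloor>2 ^ Suc k * x\<rfloor> div (2 :: int)" for x :: real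
proof -
  have "\<lfloor>(2 ^ Suc k * x) / real_of_int 2\<rfloor> = \<lfloor>2 ^ Suc k * x\<rfloor> div 2" by (rule floor_divide_real_eq_div) simp
  then show ?thesis by simp
qed

lemma cell_index_Suc: "cell_index (Suc k) p = cell_index (Suc k) q \<Longrightarrow> cell_index k p = cell_index k q"
  unfolding cell_index_def floor_half_power[of k] by (simp del: power_Suc)

lemma dist_cell_index:
  assumes "cell_index k p = cell_index k q"
  shows "dist p q \<le> 3 / 2 ^ k"
proof -
  have *: "\<bar>x - y\<bar> \<le> 1 / 2 ^ k" if "\<lfloor>2 ^ k * x\<rfloor> = \<lfloor>2 ^ k * y\<rfloor>" for x y :: real
  proof -
    have "\<bar>2 ^ k * x - 2 ^ k * y\<bar> \<le> 1" using that by linarith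
    then have "2 ^ k * \<bar>x - y\<bar> \<le> 1" by (simp add: abs_mult flip: right_diff_distrib)
    then show ?thesis by (simp add: field_simps)
  qed
  have "dist p q \<le> norm (fst p - fst q) + \<bar>snd p - snd q\<bar>"
    using norm_Pair_le[of "fst p - fst q" "snd p - snd q"] by (simp add: dist_norm minus_prod_def)
  moreover have "norm (fst p - fst q) \<le> \<bar>Re (fst p) - Re (fst q)\<bar> + \<bar>Im (fst p) - Im (fst q)\<bar>"
    using cmod_le[of "fst p - fst q"] by simp
  moreover have "\<bar>Re (fst p) - Re (fst q)\<bar> \<le> 1 / 2 ^ k" "\<bar>Im (fst p) - Im (fst q)\<bar> \<le> 1 / 2 ^ k" "\<bar>snd p - snd q\<bar> \<le> 1 / 2 ^ k"
    using assms by (auto intro!: * simp: cell_index_def)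
  ultimately have "dist p q \<le> 3 * (1 / 2 ^ k)" by linarith
  then show ?thesis by simp
qed

definition prism_interior :: "real \<Rightarrow> (complex \<times> real) set" where
  "prism_interior L = interior oct \<times> {0<..<L}"

text \<open>The union of the grid cubes of level \<open>k\<close> that are contained in
  \<open>U\<close>, without naming the cubes.\<close>

definition inner_cells :: "nat \<Rightarrow> (complex \<times> real) set \<Rightarrow> (complex \<times> real) set" where
  "inner_cells k U = {p. \<forall>q. cell_index k q = cell_index k p \<longrightarrow> q \<in> U}"

lemma inner_cells_subset: "inner_cells k U \<subseteq> U"
  by (auto simp: inner_cells_def)

lemma incseq_inner_cells: "incseq (\<lambda>k. inner_cells k U)"
  by (rule incseq_SucI) (auto simp: inner_cells_def dest: cell_index_Suc)

lemma UN_inner_cells: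
  assumes "open U"
  shows "(\<Union>k. inner_cells k U) = U"
proof
  show "U \<subseteq> (\<Union>k. inner_cells k U)"
  proof
    fix p assume "p \<in> U"
    then obtain e where e: "e > 0" "ball p e \<subseteq> U" using assms openE by blast
    obtain k :: nat where k: "(1 / 2) ^ k < e / 3" using real_arch_pow_inv[of "e / 3" "1 / 2"] e(1) by auto
    have "q \<in> U" if "cell_index k q = cell_index k p" for q
    proof -
      have "dist p q \<le> 3 * (1 / 2) ^ k" using dist_cell_index[OF that[symmetric]] by (simp add: power_one_over)
      then show ?thesis using k e(2) by (intro subsetD[OF e(2)]) simp
    qed
    then show "p \<in> (\<Union>k. inner_cells k U)" by (auto simp: inner_cells_def)
  qed
qed (use inner_cells_subset in auto)

text \<open>Boundedness of the prism leaves finitely many indices, and a cube contained in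
  \<open>U\<close> lies in the open prism and so agrees with its cell.\<close>

lemma inner_cells_decomposition:
  assumes "U \<subseteq> prism_interior L"
  shows "finite (cell_index k ` inner_cells k U)" "inner_cells k U = (\<Union>i\<in>cell_index k ` inner_cells k U. cell L k i)"
proof -
  have "cell_index k p \<in> {- (2 ^ k)..2 ^ k} \<times> {- (2 ^ k)..2 ^ k} \<times> {0..\<lfloor>2 ^ k * L\<rfloor>}" if "p \<in> inner_cells k U" for p
  proof -
    have p: "fst p \<in> oct" "0 < snd p" "snd p < L"
    proof -
      have "p \<in> interior oct \<times> {0<..<L}" using that inner_cells_subset[of k U] assms unfolding prism_interior_def by blast
      then show "fst p \<in> oct" "0 < snd p" "snd p < L" using interior_subset[of oct] by auto
    qed
    have n: "\<bar>Re (fst p)\<bar> \<le> 1" "\<bar>Im (fst p)\<bar> \<le> 1"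
      using norm_oct_le[OF p(1)] abs_Re_le_cmod[of "fst p"] abs_Im_le_cmod[of "fst p"] by linarith+
    have *: "\<lfloor>2 ^ k * x\<rfloor> \<in> {- (2 ^ k)..2 ^ k}" if "\<bar>x\<bar> \<le> 1" for x :: real
    proof -
      have "2 ^ k * \<bar>x\<bar> \<le> 2 ^ k * 1" using that by (intro mult_left_mono) auto
      then have "\<bar>2 ^ k * x\<bar> \<le> of_int (2 ^ k)" by (simp add: abs_mult)
      then have "of_int (- (2 ^ k)) \<le> 2 ^ k * x" "2 ^ k * x < of_int (2 ^ k) + 1" by (simp_all del: of_int_power add: abs_le_iff)
      then show ?thesis unfolding atLeastAtMost_iff le_floor_iff floor_le_iff by blast
    qed
    have "\<lfloor>2 ^ k * snd p\<rfloor> \<in> {0..\<lfloor>2 ^ k * L\<rfloor>}" using p by (auto intro!: floor_mono)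
    then show ?thesis using *[OF n(1)] *[OF n(2)] by (simp add: cell_index_def)
  qed
  then show "finite (cell_index k ` inner_cells k U)"
    by (intro finite_subset[OF image_subsetI]) (assumption, simp)
  show "inner_cells k U = (\<Union>i\<in>cell_index k ` inner_cells k U. cell L k i)"
  proof (intro equalityI subsetI)
    fix p assume p: "p \<in> inner_cells k U"
    then have "p \<in> prism_interior L" using inner_cells_subset assms by blast
    then have "p \<in> cell L k (cell_index k p)" by (simp add: cell_def prism_interior_def)
    then show "p \<in> (\<Union>i\<in>cell_index k ` inner_cells k U. cell L k i)" using p by blast
  next
    fix p assume "p \<in> (\<Union>i\<in>cell_index k ` inner_cells k U. cell L k i)"
    then obtain q where q: "q \<in> inner_cells k U" "p \<in> cell L k (cell_index k q)" by (elim UN_E imageE) (rule that, assumption, hypsubst, assumption)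
    then have "cell_index k p = cell_index k q" unfolding cell_def mem_Collect_eq by (elim conjE)
    then show "p \<in> inner_cells k U" using q(1) unfolding inner_cells_def mem_Collect_eq by (simp only: simp_thms)
  qed
qed

lemma sets_octagon_prism: "oct \<times> {0..L :: real} \<in> sets borel"
  by (intro borel_closed closed_Times closed_oct) auto

lemma measure_prism_interior:
  assumes "L > 0"
  shows "measure lborel (prism_interior L) = measure lborel (oct \<times> {0..L})" "measure lborel (oct \<times> {0..L}) > 0"
    "emeasure lborel (oct \<times> {0..L}) < \<infinity>"
proof -
  have "measure lborel (interior oct) = measure lborel oct"
    using emeasure_Diff_null_set[OF null_frontier_oct, of oct] sets_oct by (simp add: measure_def oct_minus_frontier)
  then show "measure lborel (prism_interior L) = measure lborel (oct \<times> {0..L})"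
    using assms sets_oct by (simp add: prism_interior_def measure_lborel_Times)
  interpret observable "\<lambda>_. 0" by standard auto
  have "measure lborel oct > 0" using measure_octm_pos emeasure_octm[of oct] sets_oct by (simp add: measure_def)
  then show "measure lborel (oct \<times> {0..L}) > 0" using assms sets_oct by (simp add: measure_lborel_Times)
  show "emeasure lborel (oct \<times> {0..L}) < \<infinity>"
    using compact_oct by (intro emeasure_bounded_finite bounded_Times compact_imp_bounded) auto
qed

text \<open>Finitely many cells inside \<open>U\<close> nearly fill it, and \<open>good\<close>
  gives the limiting frequency of each. Since \<open>U\<close> may have a large boundary, only a
  lower bound results.\<close>

lemma average_open_set:
  assumes L: "L > 0" and g: "good L v p" and U: "open U" "U \<subseteq> prism_interior L" and e: "e > 0"
  shows "\<forall>\<^sub>F T in at_top. measure lborel U / measure lborel (oct \<times> {0..L}) - e \<le> (LINT t:{0..T}|lborel. indicator U (trajectory L v p t)) / T"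
proof -
  define m where "m = measure lborel (oct \<times> {0..L})"
  have m: "m > 0" using measure_prism_interior[OF L] by (simp add: m_def)
  define F where "F k = cell_index k ` inner_cells k U" for k
  note F = inner_cells_decomposition[OF U(2), folded F_def]
  have sU: "U \<in> sets borel" using U(1) by simp
  have fU: "emeasure lborel A < \<infinity>" if "A \<subseteq> U" for A
  proof -
    have "A \<subseteq> oct \<times> {0..L}" using that U(2) interior_subset[of oct] by (force simp: prism_interior_def)
    then have "emeasure lborel A \<le> emeasure lborel (oct \<times> {0..L})" by (intro emeasure_mono) (simp_all add: sets_octagon_prism)
    then show ?thesis using measure_prism_interior(3)[OF L] by (rule le_less_trans)
  qed
  have si: "inner_cells k U \<in> sets borel" for k
    by (subst F(2)) (use F(1) in \<open>intro sets.finite_UN\<close>, auto)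
  have "(\<lambda>k. measure lborel (inner_cells k U)) \<longlonglongrightarrow> measure lborel U"
    using Lim_measure_incseq[of "\<lambda>k. inner_cells k U" lborel, OF _ incseq_inner_cells] si fU[of U] UN_inner_cells[OF U(1)] by (simp add: image_subset_iff less_top)
  then have "(\<lambda>k. measure lborel (inner_cells k U) / m) \<longlonglongrightarrow> measure lborel U / m" by (intro tendsto_divide tendsto_const) (use m in auto)
  then have "\<forall>\<^sub>F k in sequentially. measure lborel U / m - e / 2 < measure lborel (inner_cells k U) / m"
    using e by (intro order_tendstoD) auto
  then obtain k where k: "measure lborel U / m - e / 2 < measure lborel (inner_cells k U) / m"
    by (auto simp: eventually_sequentially)
  have b: "(\<lambda>t. indicator A (trajectory L v p t) :: real) \<in> borel_measurable borel" "\<bar>indicator A (trajectory L v p t) :: real\<bar> \<le> 1" if "A \<in> sets borel" for A t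
    using that by (auto simp: indicator_def)
  have cell: "((\<lambda>T. (LINT t:{0..T}|lborel. indicator (cell L k i) (trajectory L v p t)) / T) \<longlongrightarrow> measure lborel (cell L k i) / m) at_top" for i
    unfolding average_real_of_nat[OF b[OF sets_cell]] m_def using g unfolding good_def by blast
  have disj: "disjoint_family_on (cell L k) (F k)" by (auto simp: disjoint_family_on_def cell_def)
  have ind: "indicator (inner_cells k U) q = (\<Sum>i\<in>F k. indicator (cell L k i) q :: real)" for q
    by (subst F(2)) (rule indicator_UN_disjoint[OF F(1) disj])
  have sub: "cell L k i \<subseteq> U" if "i \<in> F k" for i
    using F(2)[of k] that inner_cells_subset[of k U] by blast
  have "measure lborel (inner_cells k U) = (\<Sum>i\<in>F k. measure lborel (cell L k i))"
    by (subst F(2)) (rule measure_finite_Union, use F(1) disj fU[OF sub] in \<open>auto simp: less_top\<close>)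
  moreover have "((\<lambda>T. \<Sum>i\<in>F k. (LINT t:{0..T}|lborel. indicator (cell L k i) (trajectory L v p t)) / T) \<longlongrightarrow> (\<Sum>i\<in>F k. measure lborel (cell L k i) / m)) at_top"
    by (intro tendsto_sum cell)
  ultimately have "((\<lambda>T. \<Sum>i\<in>F k. (LINT t:{0..T}|lborel. indicator (cell L k i) (trajectory L v p t)) / T) \<longlongrightarrow> measure lborel (inner_cells k U) / m) at_top"
    by (simp add: sum_divide_distrib)
  then have "\<forall>\<^sub>F T in at_top. measure lborel U / m - e < (\<Sum>i\<in>F k. (LINT t:{0..T}|lborel. indicator (cell L k i) (trajectory L v p t)) / T)"
    using k e by (intro order_tendstoD) auto
  then show ?thesis using eventually_gt_at_top[of 0]
  proof eventually_elim
    case (elim T)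
    have "(\<Sum>i\<in>F k. (LINT t:{0..T}|lborel. indicator (cell L k i) (trajectory L v p t))) = (LINT t:{0..T}|lborel. indicator (inner_cells k U) (trajectory L v p t) :: real)"
      unfolding ind set_lebesgue_integral_def scaleR_sum_right
      using integral_interval_bound(1)[OF b[OF sets_cell] less_imp_le[OF elim(2)]]
      by (intro Bochner_Integration.integral_sum[symmetric]) (simp add: set_integrable_def)
    also have "\<dots> \<le> (LINT t:{0..T}|lborel. indicator U (trajectory L v p t))"
    proof (rule set_integral_mono)
      show "indicator (inner_cells k U) (trajectory L v p t) \<le> (indicator U (trajectory L v p t) :: real)" for t
        using inner_cells_subset[of k U] by (auto simp: indicator_def)
    qed (use integral_interval_bound(1)[OF b[OF si]] integral_interval_bound(1)[OF b[OF sU]] elim(2) in auto)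
    finally have "(\<Sum>i\<in>F k. (LINT t:{0..T}|lborel. indicator (cell L k i) (trajectory L v p t)) / T) \<le> (LINT t:{0..T}|lborel. indicator U (trajectory L v p t)) / T"
      using elim(2) by (simp add: divide_right_mono flip: sum_divide_distrib)
    then show ?case using elim(1) unfolding m_def by linarith
  qed
qed

text \<open>The lower bound for open sets is applied to the interior of \<open>R\<close> and to the
  part of the open prism outside its closure; the second use is an upper bound for \<open>R\<close>.
  The outer measure of the visiting times is squeezed between measures of Borel sets.\<close>

theorem good_uniformly_distributed:
  assumes L: "L > 0" and g: "good L v p" and R: "R \<subseteq> oct \<times> {0..L}" "negligible (frontier R)"
  shows "((\<lambda>T. 1 / T * enn2real (outer_measure_of lebesgue {t \<in> {0..T}. trajectory L v p t \<in> R})) \<longlongrightarrow>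
    measure lborel (interior R) / measure lborel (oct \<times> {0..L})) at_top"
proof (rule tendstoI)
  fix e :: real assume e: "e > 0"
  define m where "m = measure lborel (oct \<times> {0..L})"
  define U where "U = interior R"
  define U' where "U' = prism_interior L - closure R"
  have U: "open U" "U \<subseteq> prism_interior L"
    using interior_mono[OF R(1)] by (auto simp: U_def interior_Times prism_interior_def)
  have oV: "open (prism_interior L)" by (simp add: prism_interior_def open_Times)
  then have U': "open U'" "U' \<subseteq> prism_interior L" by (auto simp: U'_def)
  have m: "m > 0" "m = measure lborel (prism_interior L)" using measure_prism_interior[OF L] by (simp_all add: m_def)
  have fV: "emeasure lborel (prism_interior L) < \<infinity>"
  proof -
    have "prism_interior L \<subseteq> oct \<times> {0..L}" using interior_subset[of oct] by (auto simp: prism_interior_def)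
    then have "emeasure lborel (prism_interior L) \<le> emeasure lborel (oct \<times> {0..L})" by (intro emeasure_mono) (simp_all add: sets_octagon_prism)
    then show ?thesis using measure_prism_interior(3)[OF L] by (rule le_less_trans)
  qed
  \<comment> \<open>The frontier of \<open>R\<close> is null, so the two open sets fill the
    prism.\<close>
  have mm: "m \<le> measure lborel U + measure lborel U'"
  proof -
    have fr: "frontier R \<in> null_sets lborel" using R(2) by (simp add: negligible_iff_null_sets null_sets_completion_iff)
    have fin: "emeasure lborel U \<noteq> \<infinity>" "emeasure lborel U' \<noteq> \<infinity>"
      using emeasure_mono[OF U(2), of lborel] emeasure_mono[OF U'(2), of lborel] fV oV by (auto simp: top_unique)
    have "emeasure lborel (prism_interior L) \<le> emeasure lborel ((U \<union> U') \<union> frontier R)"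
      using U U' by (intro emeasure_mono) (auto simp: U_def U'_def frontier_def)
    also have "\<dots> = emeasure lborel (U \<union> U')" using U U' by (intro emeasure_Un_null_set fr) auto
    also have "\<dots> \<le> emeasure lborel U + emeasure lborel U'" using U U' by (intro emeasure_subadditive) auto
    finally show ?thesis unfolding m(2) measure_def using fin
      by (subst enn2real_plus[symmetric]) (auto intro!: enn2real_mono simp: less_top)
  qed
  have "\<forall>\<^sub>F T in at_top. measure lborel U / m - e / 2 \<le> (LINT t:{0..T}|lborel. indicator U (trajectory L v p t)) / T"
    "\<forall>\<^sub>F T in at_top. measure lborel U' / m - e / 2 \<le> (LINT t:{0..T}|lborel. indicator U' (trajectory L v p t)) / T"
    using average_open_set[OF L g U, of "e / 2"] average_open_set[OF L g U', of "e / 2"] e by (simp_all add: m_def)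
  then show "\<forall>\<^sub>F T in at_top. dist (1 / T * enn2real (outer_measure_of lebesgue {t \<in> {0..T}. trajectory L v p t \<in> R}))
    (measure lborel (interior R) / measure lborel (oct \<times> {0..L})) < e"
    using eventually_gt_at_top[of 0]
  proof eventually_elim
    case (elim T)
    define A where "A W = {t \<in> {0..T}. trajectory L v p t \<in> W}" for W
    have sA: "A W \<in> sets borel" if [measurable]: "W \<in> sets borel" for W unfolding A_def by measurable
    have eA: "emeasure lebesgue (A W) = ennreal (LINT t:{0..T}|lborel. indicator W (trajectory L v p t))" if "W \<in> sets borel" for W
    proof -
      have "emeasure lborel (A W) \<le> emeasure lborel {0..T}" by (rule emeasure_mono) (auto simp: A_def)
      then have "emeasure lborel (A W) \<noteq> \<infinity>" using elim(3) by (auto simp: top_unique)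
      then have "emeasure lborel (A W) = ennreal (measure lborel (A W))" by (simp add: emeasure_eq_ennreal_measure)
      also have "measure lborel (A W) = (LINT t:{0..T}|lborel. indicator W (trajectory L v p t))"
      proof -
        have "(LINT t:{0..T}|lborel. indicator W (trajectory L v p t)) = (\<integral>t. indicator (A W) t \<partial>lborel)"
          unfolding set_lebesgue_integral_def by (intro Bochner_Integration.integral_cong) (auto simp: A_def indicator_def)
        also have "\<dots> = measure lborel (A W)" by simp
        finally show ?thesis by (rule sym)
      qed
      finally show ?thesis using sA[OF that] by simp
    qed
    define I :: "(complex \<times> real) set \<Rightarrow> real" where "I W = (LINT t:{0..T}|lborel. indicator W (trajectory L v p t))" for W
    have I0: "I W \<ge> 0" for W unfolding I_def set_lebesgue_integral_def by (intro Bochner_Integration.integral_nonneg) (simp add: indicator_def)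
    let ?O = "outer_measure_of lebesgue (A R)"
    have sb: "U \<in> sets borel" "U' \<in> sets borel" using U U' by auto
    have "outer_measure_of lebesgue (A U) \<le> ?O" by (rule outer_measure_of_mono) (use interior_subset[of R] in \<open>auto simp: A_def U_def\<close>)
    then have lo: "ennreal (I U) \<le> ?O" using sA[OF sb(1)] eA[OF sb(1)] by (simp add: I_def)
    have "?O \<le> outer_measure_of lebesgue ({0..T} - A U')" by (rule outer_measure_of_mono) (use closure_subset[of R] in \<open>auto simp: A_def U'_def\<close>)
    also have "\<dots> = emeasure lebesgue ({0..T} - A U')" using sA[OF sb(2)] by (intro outer_measure_of_eq) auto
    also have "\<dots> = emeasure lebesgue {0..T} - emeasure lebesgue (A U')"
    proof (rule emeasure_Diff)
      show "emeasure lebesgue (A U') \<noteq> \<infinity>" unfolding eA[OF sb(2)] by simp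
      show "{0..T} \<in> sets lebesgue" "A U' \<in> sets lebesgue" using sA[OF sb(2)] by simp_all
      show "A U' \<subseteq> {0..T}" unfolding A_def by blast
    qed
    also have "\<dots> = ennreal (T - I U')" using elim(3) eA[OF sb(2)] I0 by (simp add: I_def ennreal_minus)
    finally have hi: "?O \<le> ennreal (T - I U')" .
    have fin: "?O < \<infinity>" using hi by (rule le_less_trans) simp
    have TI: "T - I U' \<ge> 0"
    proof -
      have "I U' \<le> T - 0" unfolding I_def
      proof (rule order_trans[OF abs_ge_self integral_interval_bound(2)])
        show "(\<lambda>t. indicator U' (trajectory L v p t) :: real) \<in> borel_measurable borel" using sb(2) by measurable
      qed (use elim(3) in \<open>simp_all add: indicator_def\<close>)
      then show ?thesis by simp
    qed
    have "I U \<le> enn2real ?O" using enn2real_mono[OF lo] fin I0 by simp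
    then have 1: "I U / T \<le> enn2real ?O / T" using elim(3) by (intro divide_right_mono) auto
    have "enn2real ?O \<le> T - I U'" using enn2real_mono[OF hi] TI by simp
    then have "enn2real ?O / T \<le> (T - I U') / T" using elim(3) by (intro divide_right_mono) auto
    then have 2: "enn2real ?O / T \<le> 1 - I U' / T" using elim(3) by (simp add: diff_divide_distrib)
    have "1 \<le> (measure lborel U + measure lborel U') / m" using mm m(1) by simp
    then have "1 - measure lborel U' / m \<le> measure lborel U / m" by (simp add: add_divide_distrib)
    then have "\<bar>enn2real ?O / T - measure lborel U / m\<bar> < e"
      using 1 2 elim(1,2) e unfolding I_def by linarith
    then show ?case by (simp add: dist_real_def A_def U_def m_def)
  qed
qed

section \<open>Arbitrary regular octagons\<close>

locale similarity =
  fixes c w :: complex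
  assumes w: "w \<noteq> 0"
begin

definition sim :: "complex \<Rightarrow> complex" where "sim x = c + w * x"
definition unsim :: "complex \<Rightarrow> complex" where "unsim y = (y - c) / w"

lemma unsim_sim [simp]: "unsim (sim x) = x" and sim_unsim [simp]: "sim (unsim x) = x"
  using w by (simp_all add: sim_def unsim_def)

lemma inj_sim: "inj sim"
  by (rule injI) (metis unsim_sim)

lemma sim_eq_iff [simp]: "sim x = sim y \<longleftrightarrow> x = y"
  using inj_sim by (rule inj_eq)

lemma image_sim: "sim ` X = unsim -` X"
  by (force simp: image_iff)

lemma sim_vimage_image [simp]: "sim -` (sim ` X) = X" "sim ` (sim -` X) = X"
  using inj_vimage_image_eq[OF inj_sim] surj_image_vimage_eq[OF surjI[of sim unsim]] by simp_all

lemma sim_scaleR: "sim (x + r *\<^sub>R u) = sim x + r *\<^sub>R (w * u)"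
  by (simp add: sim_def algebra_simps)

lemma octagon_vertex_sim: "octagon_vertex c w k = sim (vtx k)"
  by (simp add: octagon_vertex_def sim_def)

lemma convex_hull_sim:
  "convex hull (sim ` X) = sim ` (convex hull X)"
proof -
  have l: "linear (\<lambda>x. w * x)" by (rule linear_times)
  have "sim ` X = (+) c ` ((\<lambda>x. w * x) ` X)" for X by (force simp: sim_def image_iff)
  then show ?thesis by (simp only: convex_hull_translation convex_hull_linear_image[OF l])
qed

lemma octagon_sim: "octagon c w = sim ` oct"
  unfolding octagon_def convex_hull_sim[symmetric] image_image octagon_vertex_sim ..

lemma octagon_edge_sim: "octagon_edge c w k = sim ` octagon_edge 0 1 k"
  unfolding octagon_edge_def segment_convex_hull convex_hull_sim[symmetric] octagon_vertex_sim by simp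

lemma glue_sim: "(sim x, sim y) \<in> octagon_glue c w \<longleftrightarrow> (x, y) \<in> octagon_glue 0 1"
proof -
  have "sim y = sim x + (sim a - sim b) \<longleftrightarrow> y = x + (a - b)" for a b
  proof -
    have "sim x + (sim a - sim b) = sim (x + (a - b))" by (simp add: sim_def algebra_simps)
    then show ?thesis by simp
  qed
  then show ?thesis unfolding octagon_glue_def octagon_edge_sim octagon_vertex_sim by (auto simp: inj_image_mem_iff[OF inj_sim])
qed

lemma rel_sim: "(sim x, sim y) \<in> octagon_rel c w \<longleftrightarrow> (x, y) \<in> rel"
proof -
  have "(sim a, sim b) \<in> (octagon_glue c w)\<^sup>*" if "(a, b) \<in> (octagon_glue 0 1)\<^sup>*" for a b
    using that by induction (auto simp: glue_sim intro: rtrancl_into_rtrancl)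
  moreover have "(unsim a, unsim b) \<in> (octagon_glue 0 1)\<^sup>*" if "(a, b) \<in> (octagon_glue c w)\<^sup>*" for a b
    using that
  proof induction
    case (step y z)
    then have "(unsim y, unsim z) \<in> octagon_glue 0 1" using glue_sim[of "unsim y" "unsim z"] by simp
    then show ?case using step.IH by (rule rtrancl_into_rtrancl[rotated])
  qed simp
  from this[of "sim x" "sim y"] have "(sim x, sim y) \<in> (octagon_glue c w)\<^sup>* \<Longrightarrow> (x, y) \<in> (octagon_glue 0 1)\<^sup>*" by simp
  ultimately show ?thesis by (auto simp: octagon_rel_def octagon_sim inj_image_mem_iff[OF inj_sim])
qed

lemma class_sim: "octagon_rel c w `` {sim x} = sim ` (rel `` {x})"
proof (rule set_eqI)
  fix y show "y \<in> octagon_rel c w `` {sim x} \<longleftrightarrow> y \<in> sim ` (rel `` {x})"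
    using rel_sim[of x "unsim y"] by (simp add: image_sim)
qed

lemma sim_image_eq_iff: "sim ` X = sim ` Y \<longleftrightarrow> X = Y"
  using inj_sim by (rule inj_image_eq_iff)

lemma surface_sim: "sim ` X \<in> octagon_surface c w \<longleftrightarrow> X \<in> octagon_surface 0 1"
proof -
  have "sim ` X \<in> octagon_surface c w \<longleftrightarrow> (\<exists>x\<in>oct. sim ` X = octagon_rel c w `` {sim x})"
    unfolding octagon_surface_def quotient_def octagon_sim by blast
  also have "\<dots> \<longleftrightarrow> X \<in> octagon_surface 0 1"
    unfolding class_sim sim_image_eq_iff octagon_surface_def quotient_def by blast
  finally show ?thesis .
qed

lemma singularity_sim: "sim ` X = octagon_singularity c w \<longleftrightarrow> X = octagon_singularity 0 1"
  unfolding octagon_singularity_def octagon_vertex_sim class_sim sim_image_eq_iff ..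

lemma straight_flow_sim:
  "straight_flow c w (w * u) (sim x) (\<lambda>t. sim ` g t) \<longleftrightarrow> straight_flow 0 1 u x g"
  unfolding straight_flow_def surface_sim singularity_sim class_sim sim_image_eq_iff bex_simps sim_scaleR[symmetric]
    inj_image_mem_iff[OF inj_sim] ..

text \<open>By the polar form of \<open>w\<close> the similarity is a rotation followed by a
  homothety, which scales area by \<open>(norm w)\<^sup>2\<close>.\<close>

lemma emeasure_sim:
  assumes A: "A \<in> sets borel"
  shows "emeasure lborel A = ennreal ((norm w)\<^sup>2) * emeasure lborel (sim -` A)"
proof -
  define r where "r = norm w"
  have r: "r > 0" using w by (simp add: r_def)
  define \<phi> where "\<phi> = Arg w"
  have wr: "w = of_real r * cis \<phi>" using rcis_cmod_Arg[of w] by (simp add: r_def \<phi>_def rcis_def)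
  define B where "B = (\<lambda>x. c + r *\<^sub>R x) -` A"
  have m: "(\<lambda>x. c + r *\<^sub>R x) \<in> borel_measurable borel" by measurable
  have B: "B \<in> sets borel" using measurable_sets[OF m A] by (simp add: B_def)
  have "emeasure lborel A = emeasure (density (distr lborel borel (\<lambda>x. c + r *\<^sub>R x)) (\<lambda>_. ennreal (\<bar>r\<bar> ^ DIM(complex)))) A"
    using lborel_affine[of r c] r by simp
  also have "\<dots> = ennreal (r\<^sup>2) * emeasure lborel B"
    using A m by (simp add: emeasure_density_const emeasure_distr B_def power2_eq_square)
  also have "emeasure lborel B = emeasure lborel ((\<lambda>z. cis \<phi> * z) -` B)"
    using area_preserving_rotate[of \<phi>] B by (simp add: area_preserving_def)
  also have "(\<lambda>z. cis \<phi> * z) -` B = sim -` A"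
  proof -
    have "w * z = r *\<^sub>R (cis \<phi> * z)" for z by (subst wr) (simp add: scaleR_conv_of_real mult.assoc)
    then show ?thesis by (auto simp: B_def sim_def)
  qed
  finally show ?thesis by (simp only: r_def)
qed

lemma borel_sim [measurable]: "sim \<in> borel_measurable borel" "unsim \<in> borel_measurable borel"
  unfolding sim_def[abs_def] unsim_def[abs_def] by measurable

definition psim :: "complex \<times> real \<Rightarrow> complex \<times> real" where "psim p = (sim (fst p), snd p)"
definition punsim :: "complex \<times> real \<Rightarrow> complex \<times> real" where "punsim p = (unsim (fst p), snd p)"

lemma punsim_psim [simp]: "punsim (psim x) = x" and psim_punsim [simp]: "psim (punsim x) = x"
  by (simp_all add: psim_def punsim_def)

lemma continuous_psim: "continuous_on UNIV psim" "continuous_on UNIV punsim"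
  unfolding psim_def[abs_def] punsim_def[abs_def] sim_def unsim_def by (intro continuous_intros; use w in simp)+

lemma borel_psim [measurable]: "psim \<in> borel_measurable borel" "punsim \<in> borel_measurable borel"
  using continuous_psim by (auto intro: borel_measurable_continuous_onI)

lemma emeasure_psim:
  assumes B: "B \<in> sets borel"
  shows "emeasure lborel B = ennreal ((norm w)\<^sup>2) * emeasure lborel (psim -` B)"
proof -
  have B': "B \<in> sets (lborel \<Otimes>\<^sub>M lborel)" unfolding lborel_prod using B by simp
  have pB: "psim -` B \<in> sets borel" using measurable_sets[OF borel_psim(1) B] by simp
  then have pB': "psim -` B \<in> sets (lborel \<Otimes>\<^sub>M lborel)" unfolding lborel_prod by simp
  have s: "(\<lambda>x. (x, y)) -` B \<in> sets borel" for y
    using measurable_sets[OF _ B, of "\<lambda>x. (x, y)" borel] by (auto intro!: borel_measurable_continuous_onI continuous_intros)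
  have "emeasure lborel B = (\<integral>\<^sup>+y. emeasure lborel ((\<lambda>x. (x, y)) -` B) \<partial>lborel)"
    unfolding lborel_prod[symmetric] by (rule lborel_pair.emeasure_pair_measure_alt2[OF B'])
  also have "\<dots> = (\<integral>\<^sup>+y. ennreal ((norm w)\<^sup>2) * emeasure lborel ((\<lambda>x. (x, y)) -` (psim -` B)) \<partial>lborel)"
  proof (rule nn_integral_cong)
    fix y
    have "sim -` ((\<lambda>x. (x, y)) -` B) = (\<lambda>x. (x, y)) -` (psim -` B)" by (auto simp: psim_def)
    then show "emeasure lborel ((\<lambda>x. (x, y)) -` B) = ennreal ((norm w)\<^sup>2) * emeasure lborel ((\<lambda>x. (x, y)) -` (psim -` B))"
      using emeasure_sim[OF s[of y]] by simp
  qed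
  also have "\<dots> = ennreal ((norm w)\<^sup>2) * (\<integral>\<^sup>+y. emeasure lborel ((\<lambda>x. (x, y)) -` (psim -` B)) \<partial>lborel)"
    by (rule nn_integral_cmult) (use lborel_pair.measurable_emeasure_Pair2[OF pB'] in simp)
  also have "(\<integral>\<^sup>+y. emeasure lborel ((\<lambda>x. (x, y)) -` (psim -` B)) \<partial>lborel) = emeasure lborel (psim -` B)"
    unfolding lborel_prod[symmetric] by (rule lborel_pair.emeasure_pair_measure_alt2[OF pB', symmetric])
  finally show ?thesis .
qed

lemma measure_psim:
  assumes "B \<in> sets borel"
  shows "measure lborel B = (norm w)\<^sup>2 * measure lborel (psim -` B)"
  using emeasure_psim[OF assms] by (simp add: measure_def enn2real_mult)

lemma open_psim_vimage: "open S \<Longrightarrow> open (psim -` S)" "open S \<Longrightarrow> open (punsim -` S)"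
  using continuous_psim by (auto simp: continuous_on_open_vimage)

lemma interior_psim: "interior (psim -` S) = psim -` interior S"
proof
  show "psim -` interior S \<subseteq> interior (psim -` S)"
    by (rule interior_maximal) (use interior_subset in \<open>auto intro: open_psim_vimage\<close>)
  have "punsim -` interior (psim -` S) \<subseteq> interior S"
  proof (rule interior_maximal)
    show "punsim -` interior (psim -` S) \<subseteq> S"
    proof
      fix p assume "p \<in> punsim -` interior (psim -` S)"
      then have "punsim p \<in> psim -` S" using interior_subset[of "psim -` S"] by auto
      then show "p \<in> S" by simp
    qed
  qed (auto intro: open_psim_vimage)
  then show "interior (psim -` S) \<subseteq> psim -` interior S"
  proof (intro subsetI vimageI2)
    fix p assume a: "punsim -` interior (psim -` S) \<subseteq> interior S" and "p \<in> interior (psim -` S)"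
    then have "psim p \<in> punsim -` interior (psim -` S)" by simp
    then show "psim p \<in> interior S" using a by (rule subsetD[rotated])
  qed
qed

lemma frontier_psim: "frontier (psim -` S) = psim -` frontier S"
  using interior_psim[of S] interior_psim[of "- S"]
  by (auto simp: frontier_def closure_interior vimage_Compl[symmetric])

lemma prism_psim: "psim -` octagon_prism c w z0 = oct \<times> {0..2 * z0}"
  by (auto simp: octagon_prism_def psim_def octagon_sim inj_image_mem_iff[OF inj_sim])

text \<open>Pulls \<open>good\<close> back to the given octagon. Only the planar part of the
  direction is divided by \<open>w\<close>, so time runs equally fast on both octagons.\<close>

definition typical :: "real \<Rightarrow> complex \<times> real \<Rightarrow> complex \<times> real \<Rightarrow> bool" where
  "typical z0 v p \<longleftrightarrow> good (2 * z0) (fst v / w, snd v) (punsim p)"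

lemma circle_class_zmod:
  assumes "z0 > 0"
  shows "circle_class z0 (zmod (2 * z0) z) = circle_class z0 z"
proof -
  define k where "k = \<lfloor>z / (2 * z0)\<rfloor>"
  have z: "zmod (2 * z0) z = z - 2 * z0 * of_int k" by (simp add: zmod_def k_def)
  have "(\<exists>n::int. s = zmod (2 * z0) z + 2 * z0 * of_int n) \<longleftrightarrow> (\<exists>n::int. s = z + 2 * z0 * of_int n)" for s
  proof
    assume "\<exists>n::int. s = zmod (2 * z0) z + 2 * z0 * of_int n"
    then obtain n :: int where "s = zmod (2 * z0) z + 2 * z0 * of_int n" ..
    then show "\<exists>n::int. s = z + 2 * z0 * of_int n" by (intro exI[of _ "n - k"]) (simp only: z of_int_diff, simp add: algebra_simps)
  next
    assume "\<exists>n::int. s = z + 2 * z0 * of_int n"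
    then obtain n :: int where "s = z + 2 * z0 * of_int n" ..
    then show "\<exists>n::int. s = zmod (2 * z0) z + 2 * z0 * of_int n" by (intro exI[of _ "n + k"]) (simp only: z of_int_add, simp add: algebra_simps)
  qed
  then show ?thesis unfolding circle_class_def by blast
qed

lemma straight_flow_typical:
  assumes "typical z0 v p"
  shows "straight_flow c w (fst v) (fst p) (\<lambda>t. sim ` (rel `` {flow (fst v / w) (unsim (fst p)) t}))"
    "straight_flow c w (fst v) (fst p) g \<Longrightarrow> t \<ge> 0 \<Longrightarrow> g t = sim ` (rel `` {flow (fst v / w) (unsim (fst p)) t})"
proof -
  have g: "generic (fst v / w) (unsim (fst p))" using assms by (simp add: typical_def good_def punsim_def)
  have v: "w * (fst v / w) = fst v" using w by simp
  show "straight_flow c w (fst v) (fst p) (\<lambda>t. sim ` (rel `` {flow (fst v / w) (unsim (fst p)) t}))"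
    using straight_flow_sim[of "fst v / w" "unsim (fst p)" "\<lambda>t. rel `` {flow (fst v / w) (unsim (fst p)) t}"] straight_flow_flow[OF g] v
    by simp
  assume "straight_flow c w (fst v) (fst p) g" "t \<ge> 0"
  then have "straight_flow 0 1 (fst v / w) (unsim (fst p)) (\<lambda>t. sim -` g t)"
    using straight_flow_sim[of "fst v / w" "unsim (fst p)" "\<lambda>t. sim -` g t"] by (simp only: v sim_vimage_image sim_unsim)
  from flow_unique[OF g this \<open>t \<ge> 0\<close>] have "sim ` (sim -` g t) = sim ` (rel `` {flow (fst v / w) (unsim (fst p)) t})" by (rule arg_cong)
  then show "g t = sim ` (rel `` {flow (fst v / w) (unsim (fst p)) t})" by (simp only: sim_vimage_image)
qed

lemma typical_geodesic_exists:
  assumes "typical z0 v p"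
  shows "\<exists>L. half_infinite_geodesic c w z0 p v L"
  unfolding half_infinite_geodesic_def
  by (rule exI, rule exI, rule conjI, rule straight_flow_typical(1)[OF assms], intro allI impI, rule refl)

lemma typical_geodesic:
  assumes z0: "z0 > 0" and "typical z0 v p" "half_infinite_geodesic c w z0 p v L" "t \<ge> 0"
  shows "L t = prism_proj c w z0 (psim (trajectory (2 * z0) (fst v / w, snd v) (punsim p) t))"
proof -
  obtain g where g: "straight_flow c w (fst v) (fst p) g" "L t = (g t, circle_class z0 (snd p + snd v * t))"
    using assms(3,4) unfolding half_infinite_geodesic_def by blast
  show ?thesis unfolding g(2) straight_flow_typical(2)[OF assms(2) g(1) assms(4)] using z0
    by (simp add: prism_proj_def psim_def punsim_def trajectory_def class_sim circle_class_zmod)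
qed

lemma typical_uniformly_distributed:
  assumes z0: "z0 > 0" and t: "typical z0 v p" and L: "half_infinite_geodesic c w z0 p v L"
  shows "uniformly_distributed c w z0 L"
  unfolding uniformly_distributed_def
proof (intro allI impI)
  fix A assume "manifold_jordan_measurable c w z0 A"
  then have A: "bounded (prism_reps c w z0 A)" "negligible (frontier (prism_reps c w z0 A))"
    by (auto simp: manifold_jordan_measurable_def jordan_measurable_def)
  define R where "R = prism_reps c w z0 A"
  let ?L = "2 * z0"
  have L0: "?L > 0" using z0 by simp
  have RP: "R \<subseteq> octagon_prism c w z0" by (auto simp: R_def prism_reps_def)
  have sub: "psim -` R \<subseteq> oct \<times> {0..?L}" using RP prism_psim[of z0] by blast
  have fr: "frontier R \<in> null_sets lborel" using A(2) by (simp add: R_def negligible_iff_null_sets null_sets_completion_iff)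
  have "emeasure lborel (psim -` frontier R) = 0"
    using emeasure_psim[of "frontier R"] fr w by (simp add: null_sets_def)
  then have "psim -` frontier R \<in> null_sets lborel"
    using measurable_sets[OF borel_psim(1), of "frontier R"] by (simp add: null_sets_def)
  then have fr': "negligible (frontier (psim -` R))"
    by (simp add: frontier_psim negligible_iff_null_sets null_sets_completionI)
  have g: "good ?L (fst v / w, snd v) (punsim p)" using t by (simp add: typical_def)
  have gen: "generic (fst v / w) (fst (punsim p))" using g by (simp add: good_def)
  have lim: "((\<lambda>T. 1 / T * enn2real (outer_measure_of lebesgue {t \<in> {0..T}. trajectory ?L (fst v / w, snd v) (punsim p) t \<in> psim -` R})) \<longlongrightarrow>
    measure lborel (interior (psim -` R)) / measure lborel (oct \<times> {0..?L})) at_top"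
    by (rule good_uniformly_distributed[OF L0 g sub fr'])
  have visits: "L t \<in> A \<longleftrightarrow> trajectory ?L (fst v / w, snd v) (punsim p) t \<in> psim -` R" if "t \<ge> 0" for t
  proof -
    have "trajectory ?L (fst v / w, snd v) (punsim p) t \<in> psim -` octagon_prism c w z0"
      unfolding prism_psim using flow_oct[OF gen that] zmod_range[OF L0] by (simp add: trajectory_def less_imp_le)
    then show ?thesis unfolding typical_geodesic[OF z0 t L that] by (simp add: R_def prism_reps_def)
  qed
  have bor: "octagon_prism c w z0 \<in> sets borel"
    using measurable_sets[OF borel_psim(2) sets_octagon_prism[of ?L]] prism_psim[of z0, symmetric]
    by (simp add: vimage_comp comp_def)
  have vP: "manifold_vol c w z0 (octagon_manifold c w z0) = (norm w)\<^sup>2 * measure lborel (oct \<times> {0..?L})"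
    unfolding manifold_vol_def prism_reps_manifold using measure_psim[OF bor] bor by (simp add: prism_psim)
  have vR: "manifold_vol c w z0 A = (norm w)\<^sup>2 * measure lborel (interior (psim -` R))"
  proof -
    \<comment> \<open>\<open>R\<close> need not be Borel; it differs from its interior by a part of
      the null frontier.\<close>
    have "measure lebesgue R = measure lebesgue (interior R)"
    proof (rule measure_negligible_symdiff)
      show "interior R \<in> lmeasurable"
        using A(1) interior_subset[of R] by (intro lmeasurable_open) (auto simp: R_def intro: bounded_subset)
      have "interior R - R \<union> (R - interior R) \<subseteq> frontier R"
        using interior_subset closure_subset by (auto simp: frontier_def)
      then show "negligible (interior R - R \<union> (R - interior R))" using A(2) negligible_subset by (auto simp: R_def)
    qed
    then show ?thesis unfolding manifold_vol_def R_def[symmetric] interior_psim using measure_psim[of "interior R"] by simp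
  qed
  have ratio: "manifold_vol c w z0 A / manifold_vol c w z0 (octagon_manifold c w z0) =
    measure lborel (interior (psim -` R)) / measure lborel (oct \<times> {0..?L})"
    unfolding vP vR using w by simp
  have "{t \<in> {0..T}. L t \<in> A} = {t \<in> {0..T}. trajectory ?L (fst v / w, snd v) (punsim p) t \<in> psim -` R}" for T
    using visits by auto
  then show "((\<lambda>T. 1 / T * enn2real (outer_measure_of lebesgue {t \<in> {0..T}. L t \<in> A})) \<longlongrightarrow>
    manifold_vol c w z0 A / manifold_vol c w z0 (octagon_manifold c w z0)) at_top"
    using lim unfolding ratio by simp
qed

end

section \<open>Almost every direction and starting point\<close>

lemma space_sphere_measure: "space (sphere_measure :: (complex \<times> real) measure) = sphere 0 1"
  and sets_sphere_measure: "sets (sphere_measure :: (complex \<times> real) measure) = sets (restrict_space borel (sphere 0 1))"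
  by (simp_all add: sphere_measure_def space_scale_measure space_restrict_space)

lemma finite_measure_sphere: "finite_measure (sphere_measure :: (complex \<times> real) measure)"
proof (rule finite_measureI)
  have "emeasure lborel {x \<in> ball 0 1 - {0} :: (complex \<times> real) set. sgn x \<in> sphere 0 1} \<le> emeasure lborel (ball 0 1 :: (complex \<times> real) set)"
    by (rule emeasure_mono) auto
  also have "\<dots> < \<infinity>" by (rule emeasure_bounded_finite) simp
  finally show "emeasure sphere_measure (space (sphere_measure :: (complex \<times> real) measure)) \<noteq> \<infinity>"
    unfolding space_sphere_measure by (subst emeasure_sphere_measure) (auto simp: ennreal_mult_eq_top_iff)
qed

text \<open>Surface measure is defined through volumes of cones, and by scaling invariance the cone
  over the bad unit vectors consists of bad vectors, a null set.\<close>

lemma AE_sphere_measure: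
  fixes P :: "complex \<times> real \<Rightarrow> bool"
  assumes [measurable]: "Measurable.pred borel P" and P: "AE v in lborel. P v"
    and scale: "\<And>r v. r > 0 \<Longrightarrow> P v \<Longrightarrow> P (r *\<^sub>R v)"
  shows "AE v in sphere_measure. P v"
proof (rule AE_I)
  let ?N = "{v \<in> sphere 0 1. \<not> P v}"
  show "{v \<in> space sphere_measure. \<not> P v} \<subseteq> ?N" by (simp add: space_sphere_measure)
  have N: "?N \<in> sets borel" by measurable
  then show "?N \<in> sets sphere_measure" by (simp add: sets_sphere_measure sets_restrict_space_iff subset_iff)
  have "emeasure lborel {x \<in> ball 0 1 - {0}. sgn x \<in> ?N} \<le> emeasure lborel {x. \<not> P x}"
  proof (rule emeasure_mono)
    show "{x \<in> ball 0 1 - {0}. sgn x \<in> ?N} \<subseteq> {x. \<not> P x}"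
    proof safe
      fix x assume "x \<noteq> 0" "P x" "\<not> P (sgn x)"
      then show False using scale[of "inverse (norm x)" x] by (simp add: sgn_div_norm)
    qed
  qed measurable
  also have "\<dots> = 0" using P by (subst (asm) AE_iff_measurable[OF _ refl]) auto
  finally have "emeasure lborel {x \<in> ball 0 1 - {0}. sgn x \<in> ?N} = 0" by simp
  then show "emeasure sphere_measure ?N = 0" by (subst emeasure_sphere_measure[OF N]) auto
qed

text \<open>The condition says that a section of the bad set has measure zero, and measures of
  sections depend measurably on the parameter.\<close>

lemma pred_AE:
  fixes Q :: "('a \<times> 'b :: euclidean_space) set"
  assumes "Q \<in> sets (M \<Otimes>\<^sub>M lborel)"
  shows "Measurable.pred M (\<lambda>x. AE y in lborel. (x, y) \<notin> Q)"
proof -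
  have m: "(\<lambda>x. emeasure lborel (Pair x -` Q)) \<in> borel_measurable M" by (rule lborel.measurable_emeasure_Pair[OF assms])
  have "(AE y in lborel. (x, y) \<notin> Q) \<longleftrightarrow> emeasure lborel (Pair x -` Q) = 0" if "x \<in> space M" for x
    using sets_Pair1[OF assms, of x] by (subst AE_iff_measurable[OF _ refl]) (auto simp: vimage_def)
  then show ?thesis using m by (subst measurable_cong) auto
qed

context similarity
begin

lemma sets_octagon_prism_general: "octagon_prism c w z0 \<in> sets borel"
  using measurable_sets[OF borel_psim(2) sets_octagon_prism[of "2 * z0"]] prism_psim[of z0, symmetric]
  by (simp add: vimage_comp comp_def)

lemma pred_typical [measurable]:
  assumes [measurable]: "v \<in> borel_measurable M" "p \<in> borel_measurable M"
  shows "Measurable.pred M (\<lambda>x. typical z0 (v x) (p x))"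
proof -
  note [measurable] = borel_fst_snd[OF assms(1)]
  show ?thesis unfolding typical_def by measurable
qed

lemma pred_AE_typical: "Measurable.pred borel (\<lambda>v. AE p in lborel. p \<in> octagon_prism c w z0 \<longrightarrow> typical z0 v p)"
proof -
  let ?M = "borel \<Otimes>\<^sub>M lborel :: ((complex \<times> real) \<times> (complex \<times> real)) measure"
  note [measurable] = sets_octagon_prism_general
  have [measurable]: "fst \<in> borel_measurable ?M" "snd \<in> borel_measurable ?M"
    using measurable_fst[of borel lborel] measurable_snd[of borel lborel] by simp_all
  have "{x \<in> space ?M. \<not> (snd x \<in> octagon_prism c w z0 \<longrightarrow> typical z0 (fst x) (snd x))} \<in> sets ?M"
    by measurable
  from pred_AE[OF this] show ?thesis by (simp add: space_pair_measure)
qed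

lemma typical_scale: "r > 0 \<Longrightarrow> typical z0 v p \<Longrightarrow> typical z0 (r *\<^sub>R v) p"
  using good_scale[of r "2 * z0" "(fst v / w, snd v)" "punsim p"] by (simp add: typical_def scaleR_conv_of_real)

lemma AE_typical_lborel:
  assumes z0: "z0 > 0"
  shows "AE v in lborel. AE p in lborel. p \<in> octagon_prism c w z0 \<longrightarrow> typical z0 v p"
proof -
  note [measurable] = sets_octagon_prism_general
  \<comment> \<open>Division by \<open>w\<close> inverts a similarity with centre 0, so the preimage
    of a null set is null.\<close>
  have E: "AE u in lborel. u / w \<notin> exceptional"
  proof -
    obtain N where N: "N \<in> null_sets lborel" "exceptional \<subseteq> N"
      using negligible_exceptional by (auto simp: negligible_iff_null_sets null_sets_completion_iff2)
    interpret s: similarity 0 w by standard (rule w)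
    have v: "s.unsim -` N = {u. u / w \<in> N}" by (auto simp: s.unsim_def)
    have m: "s.unsim -` N \<in> sets borel" using measurable_sets[OF s.borel_sim(2), of N] N(1) by auto
    have "s.sim -` (s.unsim -` N) = N" by auto
    then have "emeasure lborel (s.unsim -` N) = 0" using s.emeasure_sim[OF m] N(1) by (simp add: null_sets_def)
    then have "s.unsim -` N \<in> null_sets lborel" using m by (simp add: null_sets_def)
    then show ?thesis by (rule AE_I') (use N(2) in \<open>auto simp: v\<close>)
  qed
  have "AE u in lborel. AE s in lborel. AE p in lborel. p \<in> octagon_prism c w z0 \<longrightarrow> typical z0 (u, s) p"
    using E
  proof eventually_elim
    case (elim u)
    have "AE s in lborel. AE p in lborel. p \<in> oct \<times> {0..2 * z0} \<longrightarrow> good (2 * z0) (u / w, s) p"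
      using z0 by (intro AE_good[OF _ elim]) simp
    then show ?case
    proof eventually_elim
      case (elim s)
      \<comment> \<open>Since \<open>psim\<close> scales volume by a constant, it is enough that the
        preimage of the bad set is null.\<close>
      have "AE p in lborel. psim p \<in> octagon_prism c w z0 \<longrightarrow> typical z0 (u, s) (psim p)"
        using elim by eventually_elim (use prism_psim[of z0] in \<open>auto simp: typical_def\<close>)
      then have "emeasure lborel (psim -` {p. \<not> (p \<in> octagon_prism c w z0 \<longrightarrow> typical z0 (u, s) p)}) = 0"
        by (subst (asm) AE_iff_measurable[OF _ refl]) (auto simp: vimage_def)
      then have "emeasure lborel {p. \<not> (p \<in> octagon_prism c w z0 \<longrightarrow> typical z0 (u, s) p)} = 0"
        by (subst emeasure_psim) auto
      then show ?case by (subst AE_iff_measurable[OF _ refl]) auto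
    qed
  qed
  moreover have "{v \<in> space (lborel \<Otimes>\<^sub>M lborel). AE p in lborel. p \<in> octagon_prism c w z0 \<longrightarrow> typical z0 v p} \<in> sets (lborel \<Otimes>\<^sub>M lborel)"
    using pred_AE_typical[of z0] unfolding lborel_prod by (simp add: pred_def)
  ultimately have "AE v in lborel \<Otimes>\<^sub>M lborel. AE p in lborel. p \<in> octagon_prism c w z0 \<longrightarrow> typical z0 v p"
    by (intro lborel_pair.AE_pair_measure) simp_all
  then show ?thesis unfolding lborel_prod .
qed

end

theorem theorem2:
  fixes c w :: complex and z0 :: real
  assumes "w \<noteq> 0" and "z0 > 0"
  shows "AE (v, S) in (sphere_measure :: (complex \<times> real) measure) \<Otimes>\<^sub>M
                      restrict_space lborel (octagon_prism c w z0).
           (\<exists>L. half_infinite_geodesic c w z0 S v L) \<and>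
           (\<forall>L. half_infinite_geodesic c w z0 S v L \<longrightarrow> uniformly_distributed c w z0 L)"
proof -
  interpret similarity c w by standard (rule assms(1))
  let ?P = "restrict_space lborel (octagon_prism c w z0)"
  have sP: "octagon_prism c w z0 \<inter> space lborel \<in> sets lborel" using sets_octagon_prism_general by simp
  have "AE v in sphere_measure. AE p in lborel. p \<in> octagon_prism c w z0 \<longrightarrow> typical z0 v p"
  proof (rule AE_sphere_measure[OF _ AE_typical_lborel[OF assms(2)]])
    show "AE p in lborel. p \<in> octagon_prism c w z0 \<longrightarrow> typical z0 (r *\<^sub>R v) p"
      if "r > 0" "AE p in lborel. p \<in> octagon_prism c w z0 \<longrightarrow> typical z0 v p" for r v
      using that(2) by eventually_elim (simp add: typical_scale[OF that(1)])
  qed (rule pred_AE_typical)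
  then have it: "AE v in sphere_measure. AE p in ?P. typical z0 v p"
    unfolding AE_restrict_space_iff[OF sP] .
  interpret M1: finite_measure "sphere_measure :: (complex \<times> real) measure" by (rule finite_measure_sphere)
  interpret M2: sigma_finite_measure ?P
    using sets_octagon_prism_general by (intro sigma_finite_measure_restrict_space sigma_finite_lborel) simp
  interpret P: pair_sigma_finite "sphere_measure :: (complex \<times> real) measure" ?P ..
  have i1: "(\<lambda>x. x) \<in> borel_measurable (sphere_measure :: (complex \<times> real) measure)"
    by (subst measurable_cong_sets[OF sets_sphere_measure refl]) (intro measurable_restrict_space1, simp)
  have i2: "(\<lambda>x. x) \<in> borel_measurable ?P" by (intro measurable_restrict_space1) simp
  let ?M = "(sphere_measure :: (complex \<times> real) measure) \<Otimes>\<^sub>M ?P"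
  have [measurable]: "fst \<in> borel_measurable ?M" by (rule measurable_compose[OF measurable_fst i1])
  have [measurable]: "snd \<in> borel_measurable ?M" by (rule measurable_compose[OF measurable_snd i2])
  have "{x \<in> space ?M. typical z0 (fst x) (snd x)} \<in> sets ?M"
    by measurable
  \<comment> \<open>Measurability of \<open>typical\<close> turns the iterated statement into one
    about pairs; geodesics enter only afterwards, point by point.\<close>
  from P.AE_pair_measure[OF this] it have "AE x in ?M. typical z0 (fst x) (snd x)" by simp
  then show ?thesis
  proof eventually_elim
    case (elim x)
    then show ?case
      using typical_geodesic_exists[OF elim] typical_uniformly_distributed[OF assms(2) elim]
      by (simp add: case_prod_beta)
  qed
qed

end
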